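(* Let $d\ge1$ be an integer, $\delta>0$ and $\varepsilon>0$. There exists a constant $C_{d,\delta,\varepsilon}>0$, depending only on $d,\delta,\varepsilon$, such that $$\|f(x)g(-i\nabla)\|_{\mathcal{L}^{2,\infty}}^*\le C_{d,\delta,\varepsilon}\,\big\|(\ln\mathbf h)^{\frac12}(\ln\ln\mathbf h)^{\frac12+\varepsilon}f\big\|_{L^2}\ \sup_{\substack{2<p\le2+\delta\\ \frac1p+\frac1{p'}=1}}\ \inf_{\substack{g_p,\,g_{p'}\\ g^2=g_pg_{p'}}}\sqrt{\|g_p\|_{L^{p,\infty}}^*\,\|g_{p'}\|_{\ell^{p',\infty}(L^2)}^*}$$ for all measurable functions $f:\mathbb{R}^d\to\mathbb{C}$ and $g:\mathbb{R}^d\to\mathbb{R}$ such that the right-hand side is finite. For each $p$, the infimum is over all pairs of measurable functions $g_p\in L^{p,\infty}(\mathbb{R}^d)$ and $g_{p'}\in\ell^{p',\infty}(L^2)$ with $g^2=g_pg_{p'}$.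
   Context: $L^2=L^2(\mathbb{R}^d)$. The operator $\mathbf h:=c_d(-\Delta+x^2)$ is the harmonic oscillator on $L^2(\mathbb{R}^d)$ with $c_d:=e^e/d$, so that $\mathbf h\ge e^e$; functions of $\mathbf h$ are defined by the spectral functional calculus, and the norm involving $f$ is finite when $f\in L^2$ lies in the domain of $(\ln\mathbf h)^{\frac12}(\ln\ln\mathbf h)^{\frac12+\varepsilon}$. The Fourier transform is $\mathcal{F}(\varphi)(\xi)=(2\pi)^{-d/2}\int_{\mathbb{R}^d} e^{-ix\cdot\xi}\varphi(x)\,\mathrm{d}x$; $g(-i\nabla)$ is the Fourier multiplier $\varphi\mapsto\mathcal{F}^{-1}(g\,\mathcal{F}\varphi)$, and $f(x)$ denotes multiplication by $f$. The bound includes the assertion that $f(x)g(-i\nabla)$ (extends to) a compact operator on $L^2$. Quasinorms: for a compact operator $A$ on $L^2$, $\|A\|^*_{\mathcal{L}^{2,\infty}}:=\sup_{j\ge0}(j+1)^{1/2}\sqrt{\lambda_j(A^*A)}$, where $(\lambda_j(A^*A))_{j\ge0}$ are the eigenvalues of $A^*A$ in decreasing order, with multiplicity. For $1\le p<\infty$ and measurable $\varphi$ on $\mathbb{R}^d$, $\|\varphi\|^*_{L^{p,\infty}}:=\sup_{t>0}t\,\lambda(\{|\varphi|>t\})^{1/p}$, with $\lambda$ the Lebesgue measure. For a family $u=(u_{\mathbf m})_{\mathbf m\in\mathbb{Z}^d}$ of complex numbers, $\|u\|^*_{\ell^{q,\infty}}:=\sup_{j\ge0}(j+1)^{1/q}u_j^*$,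 where $(u_j^* )_{j\ge0}$ is the sequence of the $|u_{\mathbf m}|$ sorted in decreasing order. With $\chi_{\mathbf m}$ the characteristic function of the unit hypercube of $\mathbb{R}^d$ centered at $\mathbf m\in\mathbb{Z}^d$, $\|\varphi\|^*_{\ell^{q,\infty}(L^2)}:=\big\|(\|\chi_{\mathbf m}\varphi\|_{L^2})_{\mathbf m}\big\|^*_{\ell^{q,\infty}}$. The spaces $L^{p,\infty}$ and $\ell^{q,\infty}(L^2)$ consist of the measurable functions for which the corresponding quasinorm is finite. *)

theory Defs
  imports "HOL-Analysis.Analysis"
begin

text \<open>Elements of \<open>L\<^sup>2\<close> are represented by functions, and equality almost everywhere is
  handled explicitly. The dimension is \<open>d = CARD('n)\<close>.\<close>

type_synonym 'n fn = "(real ^ 'n) \<Rightarrow> complex"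

text \<open>Powers of extended nonnegative reals, used for exponents \<open>a > 0\<close> only.\<close>

definition ennpowr :: "ennreal \<Rightarrow> real \<Rightarrow> ennreal" where
  "ennpowr x a = (if x = top then top else ennreal (enn2real x powr a))"

section \<open>The Hilbert space and its operators\<close>

definition L2norm :: "'n::finite fn \<Rightarrow> ennreal" where
  "L2norm \<phi> = ennpowr (\<integral>\<^sup>+ x. ennreal ((cmod (\<phi> x))\<^sup>2) \<partial>lebesgue) (1/2)"

definition L2 :: "'n::finite fn set" where
  "L2 = {\<phi> \<in> borel_measurable lebesgue. L2norm \<phi> < top}"

definition ae_eq :: "'n::finite fn \<Rightarrow> 'n fn \<Rightarrow> bool" where
  "ae_eq \<phi> \<psi> \<longleftrightarrow> (AE x in lebesgue. \<phi> x = \<psi> x)"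

definition L2inner :: "'n::finite fn \<Rightarrow> 'n fn \<Rightarrow> complex" where
  "L2inner \<phi> \<psi> = (LINT x|lebesgue. cnj (\<phi> x) * \<psi> x)"

text \<open>Operators, possibly unbounded, are given by their graphs, which contain all representatives
  of their elements. Since \<open>O\<close> is the composition of relations, \<open>S O T\<close> is the operator that
  applies \<open>S\<close> first, and \<open>Domain T\<close> is the domain.\<close>

type_synonym 'n op = "('n fn \<times> 'n fn) set"

definition L2_operator :: "'n::finite op \<Rightarrow> bool" where
  "L2_operator T \<longleftrightarrow>
     T \<noteq> {} \<and> T \<subseteq> L2 \<times> L2 \<and>
     (\<forall>\<phi> \<phi>' \<psi> \<psi>' a. (\<phi>, \<phi>') \<in> T \<longrightarrow> (\<psi>, \<psi>') \<in> T \<longrightarrow>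
        ((\<lambda>x. a * \<phi> x + \<psi> x), (\<lambda>x. a * \<phi>' x + \<psi>' x)) \<in> T) \<and>
     (\<forall>\<phi> \<phi>' \<psi> \<psi>'. (\<phi>, \<phi>') \<in> T \<longrightarrow> (\<psi>, \<psi>') \<in> T \<longrightarrow> ae_eq \<phi> \<psi> \<longrightarrow> ae_eq \<phi>' \<psi>') \<and>
     (\<forall>\<phi> \<phi>'. \<forall>\<psi>\<in>L2. \<forall>\<psi>'\<in>L2. (\<phi>, \<phi>') \<in> T \<longrightarrow> ae_eq \<phi> \<psi> \<longrightarrow> ae_eq \<phi>' \<psi>' \<longrightarrow> (\<psi>, \<psi>') \<in> T)"

definition L2_adjoint :: "'n::finite op \<Rightarrow> 'n op" where
  "L2_adjoint T = {(\<psi>, \<eta>). \<psi> \<in> L2 \<and> \<eta> \<in> L2 \<and>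
     (\<forall>(\<phi>, \<phi>') \<in> T. L2inner \<phi>' \<psi> = L2inner \<phi> \<eta>)}"

definition compact_operator :: "'n::finite op \<Rightarrow> bool" where
  "compact_operator T \<longleftrightarrow> L2_operator T \<and> Domain T = L2 \<and>
     (\<forall>\<phi> \<psi> M. (\<forall>n::nat. (\<phi> n, \<psi> n) \<in> T \<and> L2norm (\<phi> n) \<le> ennreal M) \<longrightarrow>
        (\<exists>r \<eta>. strict_mono r \<and> \<eta> \<in> L2 \<and>
           (\<lambda>n. L2norm (\<lambda>x. \<psi> (r n) x - \<eta> x)) \<longlonglongrightarrow> 0))"

text \<open>As \<open>S\<close> is densely defined, it has at most one bounded extension \<open>T\<close> to all of \<open>L\<^sup>2\<close>.\<close>

definition extends_densely_defined :: "'n::finite op \<Rightarrow> 'n op \<Rightarrow> bool" where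
  "extends_densely_defined T S \<longleftrightarrow> S \<subseteq> T \<and>
     (\<forall>\<phi>\<in>L2. \<forall>e>0. \<exists>\<psi>\<in>Domain S. L2norm (\<lambda>x. \<phi> x - \<psi> x) < ennreal e)"

text \<open>\<open>l\<close> lists the eigenvalues of a compact positive operator \<open>T\<close> in decreasing order, repeated
  according to multiplicity, with orthonormal eigenvectors \<open>e\<close>. Eigenvectors that are not
  spanned by \<open>e\<close> belong to the eigenvalue \<open>0\<close>; this occurs for example when there are infinitely
  many positive eigenvalues and a nontrivial kernel, and is then invisible in \<open>l\<close>.\<close>

definition decreasing_eigenvalues :: "'n::finite op \<Rightarrow> (nat \<Rightarrow> real) \<Rightarrow> bool" where
  "decreasing_eigenvalues T l \<longleftrightarrow> decseq l \<and>
     (\<exists>e. (\<forall>j. (e j, (\<lambda>x. of_real (l j) * e j x)) \<in> T) \<and>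
          (\<forall>j k. L2inner (e j) (e k) = (if j = k then 1 else 0)) \<and>
          (\<forall>\<phi>\<in>L2. (\<forall>j. L2inner (e j) \<phi> = 0) \<longrightarrow> (\<phi>, (\<lambda>x. 0)) \<in> T))"

text \<open>For compact \<open>A\<close> the sequence \<open>l\<close> exists and is unique, so the infimum is over one
  element. Note that \<open>A O L2_adjoint A\<close> is the product \<open>A\<^sup>* A\<close>.\<close>

definition weak_schatten2_norm :: "'n::finite op \<Rightarrow> ennreal" where
  "weak_schatten2_norm A = (INF l\<in>{l. decreasing_eigenvalues (A O L2_adjoint A) l}.
     SUP j. ennreal (sqrt (real j + 1) * sqrt (l j)))"

section \<open>Weak Lebesgue quasinorms\<close>

definition weak_Lp_norm :: "real \<Rightarrow> 'n::finite fn \<Rightarrow> ennreal" where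
  "weak_Lp_norm p \<phi> =
     (SUP t\<in>{0<..}. ennreal t * ennpowr (emeasure lebesgue {x. cmod (\<phi> x) > t}) (1/p))"

definition weak_Lp :: "real \<Rightarrow> 'n::finite fn set" where
  "weak_Lp p = {\<phi> \<in> borel_measurable lebesgue. weak_Lp_norm p \<phi> < top}"

definition decreasing_rearrangement :: "('i \<Rightarrow> ennreal) \<Rightarrow> (nat \<Rightarrow> ennreal) \<Rightarrow> bool" where
  "decreasing_rearrangement u s \<longleftrightarrow> decseq s \<and>
     (\<exists>\<sigma>. inj \<sigma> \<and> (\<forall>j. s j = u (\<sigma> j)) \<and> (\<forall>m. m \<notin> range \<sigma> \<longrightarrow> (\<forall>j. u m \<le> s j)))"

text \<open>A family (over an infinite index set) that tends to \<open>0\<close> can be sorted, with a unique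
  result. For all other families the value below is \<open>\<infinity>\<close>.\<close>

definition weak_lq_norm :: "real \<Rightarrow> ('i \<Rightarrow> ennreal) \<Rightarrow> ennreal" where
  "weak_lq_norm q u = (INF s\<in>{s. decreasing_rearrangement u s}.
     SUP j. ennreal ((real j + 1) powr (1/q)) * s j)"

definition unit_cube :: "int ^ 'n \<Rightarrow> (real ^ 'n::finite) set" where
  "unit_cube m = {x. \<forall>i. \<bar>x $ i - of_int (m $ i)\<bar> \<le> 1/2}"

definition weak_lq_L2_norm :: "real \<Rightarrow> 'n::finite fn \<Rightarrow> ennreal" where
  "weak_lq_L2_norm q \<phi> =
     weak_lq_norm q (\<lambda>m :: int ^ 'n. L2norm (\<lambda>x. indicator (unit_cube m) x * \<phi> x))"

definition weak_lq_L2 :: "real \<Rightarrow> 'n::finite fn set" where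
  "weak_lq_L2 q = {\<phi> \<in> borel_measurable lebesgue. weak_lq_L2_norm q \<phi> < top}"

section \<open>Multiplication operators and Fourier multipliers\<close>

definition mult_op :: "'n::finite fn \<Rightarrow> 'n op" where
  "mult_op m = {(\<phi>, \<psi>). \<phi> \<in> L2 \<and> \<psi> \<in> L2 \<and> ae_eq \<psi> (\<lambda>x. m x * \<phi> x)}"

definition fourier_integral :: "'n::finite fn \<Rightarrow> 'n fn" where
  "fourier_integral \<phi> \<xi> = of_real ((2 * pi) powr (- real CARD('n) / 2)) *
     (LINT x|lebesgue. exp (- \<i> * of_real (x \<bullet> \<xi>)) * \<phi> x)"

text \<open>The unitary Fourier transform of \<open>L\<^sup>2\<close>, as the limit of truncated Fourier integrals.\<close>

definition fourier_op :: "'n::finite op" where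
  "fourier_op = {(\<phi>, \<psi>). \<phi> \<in> L2 \<and> \<psi> \<in> L2 \<and>
     ((\<lambda>R::real. L2norm (\<lambda>\<xi>. fourier_integral (\<lambda>x. indicator (ball 0 R) x * \<phi> x) \<xi> - \<psi> \<xi>))
        \<longlongrightarrow> 0) at_top}"

definition fourier_multiplier :: "'n::finite fn \<Rightarrow> 'n op" where
  "fourier_multiplier g = fourier_op O mult_op g O fourier_op\<inverse>"

section \<open>The harmonic oscillator and its functional calculus\<close>

definition partial_derivative :: "'n::finite \<Rightarrow> 'n fn \<Rightarrow> 'n fn" where
  "partial_derivative i \<phi> x = frechet_derivative \<phi> (at x) (axis i 1)"

definition schwartz :: "'n::finite fn set" where
  "schwartz = {\<phi>. \<forall>is. (\<forall>x. foldr partial_derivative is \<phi> differentiable (at x)) \<and>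
     (\<forall>k. bounded (range (\<lambda>x. norm x ^ k *\<^sub>R foldr partial_derivative is \<phi> x)))}"

definition laplacian :: "'n::finite fn \<Rightarrow> 'n fn" where
  "laplacian \<phi> x = (\<Sum>i\<in>UNIV. partial_derivative i (partial_derivative i \<phi>) x)"

definition oscillator_on_schwartz :: "'n::finite op" where
  "oscillator_on_schwartz = {(\<phi>, \<psi>). \<phi> \<in> schwartz \<and>
     \<psi> = (\<lambda>x. of_real (exp (exp 1) / real CARD('n)) * (- laplacian \<phi> x + of_real (x \<bullet> x) * \<phi> x))}"

text \<open>The oscillator is essentially self-adjoint on Schwartz functions, so the adjoint is its unique
  self-adjoint extension.\<close>

definition oscillator :: "'n::finite op" where
  "oscillator = L2_adjoint oscillator_on_schwartz"

text \<open>Projection-valued Borel measures on the line: \<open>E B\<close> is an orthogonal projection for each Borel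
  set \<open>B\<close> (linearity modulo null functions follows from symmetry).\<close>

definition spectral_measure :: "(real set \<Rightarrow> 'n::finite fn \<Rightarrow> 'n fn) \<Rightarrow> bool" where
  "spectral_measure E \<longleftrightarrow>
     (\<forall>B\<in>sets borel. \<forall>\<phi>\<in>L2. E B \<phi> \<in> L2 \<and> ae_eq (E B (E B \<phi>)) (E B \<phi>)) \<and>
     (\<forall>B\<in>sets borel. \<forall>\<phi>\<in>L2. \<forall>\<psi>\<in>L2. L2inner (E B \<phi>) \<psi> = L2inner \<phi> (E B \<psi>)) \<and>
     (\<forall>\<phi>\<in>L2. ae_eq (E UNIV \<phi>) \<phi>) \<and>
     (\<forall>\<phi>\<in>L2. countably_additive (sets borel) (\<lambda>B. (L2norm (E B \<phi>))\<^sup>2))"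

text \<open>The scalar measure \<open>\<langle>\<phi>, E(B) \<phi>\<rangle> = \<parallel>E(B) \<phi>\<parallel>\<^sup>2\<close>.\<close>

definition scalar_measure ::
    "(real set \<Rightarrow> 'n::finite fn \<Rightarrow> 'n fn) \<Rightarrow> 'n fn \<Rightarrow> real measure" where
  "scalar_measure E \<phi> = measure_of UNIV (sets borel) (\<lambda>B. (L2norm (E B \<phi>))\<^sup>2)"

text \<open>\<open>T\<close> is the operator \<open>\<integral> F dE\<close>. By polarization the diagonal values determine \<open>T\<close> on its
  domain.\<close>

definition spectral_integral ::
    "(real set \<Rightarrow> 'n::finite fn \<Rightarrow> 'n fn) \<Rightarrow> (real \<Rightarrow> real) \<Rightarrow> 'n op \<Rightarrow> bool" where
  "spectral_integral E F T \<longleftrightarrow> L2_operator T \<and>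
     Domain T = {\<phi>\<in>L2. (\<integral>\<^sup>+ t. ennreal ((F t)\<^sup>2) \<partial>scalar_measure E \<phi>) < top} \<and>
     (\<forall>(\<phi>, \<psi>)\<in>T. L2inner \<phi> \<psi> = of_real (LINT t|scalar_measure E \<phi>. F t))"

text \<open>\<open>F(A)\<close> for self-adjoint \<open>A\<close>; by the spectral theorem there is exactly one \<open>E\<close> (modulo null
  functions) with \<open>A = \<integral> t dE(t)\<close>.\<close>

definition functional_calculus :: "(real \<Rightarrow> real) \<Rightarrow> 'n::finite op \<Rightarrow> 'n op" where
  "functional_calculus F A = {(\<phi>, \<psi>). \<exists>E T. spectral_measure E \<and>
     spectral_integral E (\<lambda>t. t) A \<and> spectral_integral E F T \<and> (\<phi>, \<psi>) \<in> T}"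

text \<open>\<open>\<parallel>T \<phi>\<parallel>\<close>, and \<open>\<infinity>\<close> when \<open>\<phi>\<close> is not in the domain of \<open>T\<close>.\<close>

definition applied_norm :: "'n::finite op \<Rightarrow> 'n fn \<Rightarrow> ennreal" where
  "applied_norm T \<phi> = (INF \<psi>\<in>T `` {\<phi>}. L2norm \<psi>)"

text \<open>The spectrum of the oscillator lies in \<open>{exp (exp 1)..}\<close>; the values of the function below
  that point are irrelevant.\<close>

definition oscillator_log_norm :: "real \<Rightarrow> 'n::finite fn \<Rightarrow> ennreal" where
  "oscillator_log_norm \<epsilon> f =
     applied_norm
       (functional_calculus (\<lambda>t. ln t powr (1/2) * ln (ln t) powr (1/2 + \<epsilon>)) oscillator) f"

section \<open>The two sides of the inequality\<close>

text \<open>\<open>f(x) g(-i\<nabla>)\<close> on its natural domain.\<close>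

definition product_op :: "'n::finite fn \<Rightarrow> (real ^ 'n \<Rightarrow> real) \<Rightarrow> 'n op" where
  "product_op f g = fourier_multiplier (\<lambda>\<xi>. of_real (g \<xi>)) O mult_op f"

definition factorization_norm :: "real \<Rightarrow> (real ^ 'n::finite \<Rightarrow> real) \<Rightarrow> ennreal" where
  "factorization_norm \<delta> g =
     (SUP (p, q)\<in>{(p, q). 2 < p \<and> p \<le> 2 + \<delta> \<and> 1/p + 1/q = 1}.
        INF (a, b)\<in>{(a, b). a \<in> weak_Lp p \<and> b \<in> weak_lq_L2 q \<and>
                          (\<forall>x. (of_real (g x))\<^sup>2 = a x * b x)}.
          ennpowr (weak_Lp_norm p a * weak_lq_L2_norm q b) (1/2))"

end

theory Submission
 imports Defs "HOL-Probability.Probability" "HOL-Library.Diagonal_Subsequence"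
begin

text \<open>For orthonormal systems \<open>u\<close>, \<open>e\<close> of length \<open>N\<close>, a bound of \<open>\<Sum>i<N. \<bar>\<langle>u i, A (e i)\<rangle>\<bar>\<close> by \<open>K * sqrt N\<close>
 implies compactness of \<open>A\<close> and, tested on singular vectors, the weak Schatten bound \<open>K\<close>; unlike the
 quasinorm, such bounds add up. Cut the Hermite expansion of \<open>f\<close> into the windows where
 \<open>ln \<lambda> \<in> [2^n, 2^(n+1))\<close>. The part \<open>f_n\<close> in the \<open>n\<close>-th window is the product of
 \<open>\<Prod>i. 1 / (1 + x_i^2)\<close> and a function that, with its Fourier transform, is bounded by
 \<open>H_n \<parallel>f_n\<parallel>\<close> times the same weight, where \<open>H_n\<close> is a power of \<open>exp (2^n)\<close>. For the exponent
 \<open>p_n = 2 + min \<delta> 1 / 2^n\<close>, split \<open>g\<close> at levels of \<open>g_p\<close>, \<open>g_p'\<close> and at the first \<open>N / H_n^3\<close>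
 cubes of \<open>g_p'\<close> into a bounded, a Hilbert-Schmidt and a trace class part. This gives
 \<open>K = C \<parallel>f_n\<parallel> / sqrt (p_n - 2)\<close> with \<open>C\<close> independent of \<open>n\<close>, because \<open>H_n powr (p_n - 2)\<close> is bounded,
 and the sum over \<open>n\<close> is controlled by the logarithmic weights.\<close>

section \<open>The Hilbert space of square integrable functions\<close>

text \<open>Why these logarithms: an estimate with one exponent p loses the factor 1 / sqrt (p - 2),
  because the large values of a weak Lp function are square summed by a geometric series of ratio 2
  powr (2 - p), and a power of \<open>H\<close> with exponent proportional to p - 2. With p - 2 of
  order 1 / 2^n the second loss stays bounded, and the first is 2^(n/2), the root of ln \<lambda>.
  As n is of order ln (ln \<lambda>), Cauchy-Schwarz over the windows costs n powr (1/2 +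
  \<epsilon>). Why N / H^3 cubes: the trace class part pays \<open>H\<close> per cube, and
  Cauchy-Schwarz over the cubes gives sqrt (N / H^3) times at most sqrt H, so the powers of
  \<open>H\<close> cancel. The remaining cubes cost only H powr (3 \<theta>), where \<theta> is at
  most p - 2. An obstacle is that the oscillator is given as an adjoint and its functional calculus
  by an unspecified spectral measure. Only the action on Hermite functions enters; it is forced by a
  weak eigenvalue equation, and completeness of the Hermite functions does the rest.\<close>

lemma L2_iff:
 "\<phi> \<in> L2 \<longleftrightarrow> \<phi> \<in> borel_measurable lebesgue \<and> integrable lebesgue (\<lambda>x. (cmod (\<phi> x))^2)"
 unfolding L2_def L2norm_def ennpowr_def integrable_iff_bounded
 by (auto simp: less_top)

lemma L2_measurable[measurable_dest]: "\<phi> \<in> L2 \<Longrightarrow> \<phi> \<in> borel_measurable lebesgue"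
 by (simp add: L2_iff)

lemma L2_integrable: "\<phi> \<in> L2 \<Longrightarrow> integrable lebesgue (\<lambda>x. (cmod (\<phi> x))^2)"
 by (simp add: L2_iff)

lemma L2norm_eq: "\<phi> \<in> L2 \<Longrightarrow> L2norm \<phi> = ennreal (sqrt (LINT x|lebesgue. (cmod (\<phi> x))^2))"
 unfolding L2norm_def
 by (subst nn_integral_eq_integral) (auto simp: L2_iff ennpowr_def powr_half_sqrt)

lemma L2_integrable_mult:
 assumes [measurable]: "\<phi> \<in> L2" "\<psi> \<in> L2"
 shows "integrable lebesgue (\<lambda>x. \<phi> x * \<psi> x)"
proof (rule Bochner_Integration.integrable_bound)
 show "integrable lebesgue (\<lambda>x. (cmod (\<phi> x))^2 + (cmod (\<psi> x))^2)"
  using assms by (simp add: L2_iff)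
 have "cmod (\<phi> x * \<psi> x) \<le> (cmod (\<phi> x))^2 + (cmod (\<psi> x))^2" for x
  using sum_squares_bound[of "cmod (\<phi> x)" "cmod (\<psi> x)"]
   mult_nonneg_nonneg[of "cmod (\<phi> x)" "cmod (\<psi> x)"] by (simp add: norm_mult del: mult_nonneg_nonneg)
 then show "AE x in lebesgue. norm (\<phi> x * \<psi> x) \<le> norm ((cmod (\<phi> x))^2 + (cmod (\<psi> x))^2)"
  by auto
qed measurable

lemma borel_measurable_cnj[measurable (raw)]:
 "f \<in> borel_measurable M \<Longrightarrow> (\<lambda>x. cnj (f x)) \<in> borel_measurable M"
 by (rule borel_measurable_continuous_on[where f = cnj]) (auto intro: continuous_intros)

lemma lebesgue_measurable_AE:
 fixes f g :: "'a::euclidean_space \<Rightarrow> 'b::topological_space"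
 assumes f: "f \<in> borel_measurable lebesgue" and ae: "AE x in lebesgue. f x = g x"
 shows "g \<in> borel_measurable lebesgue"
proof (rule measurableI)
 fix A :: "'b set" assume A: "A \<in> sets borel"
 show "g -` A \<inter> space lebesgue \<in> sets lebesgue"
 proof (rule completion.in_sets_AE)
  show "AE x in lebesgue. x \<in> f -` A \<inter> space lebesgue \<longleftrightarrow> x \<in> g -` A \<inter> space lebesgue"
   using ae by eventually_elim auto
 qed (use measurable_sets[OF f A] in auto)
qed simp

lemma L2_cnj: "\<phi> \<in> L2 \<Longrightarrow> (\<lambda>x. cnj (\<phi> x)) \<in> L2"
 by (auto simp: L2_iff)

lemma L2_integrable_inner:
 "\<phi> \<in> L2 \<Longrightarrow> \<psi> \<in> L2 \<Longrightarrow> integrable lebesgue (\<lambda>x. cnj (\<phi> x) * \<psi> x)"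
 by (intro L2_integrable_mult L2_cnj)

lemma L2_bounded_mult:
 assumes [measurable]: "\<phi> \<in> L2" "m \<in> borel_measurable lebesgue" and B: "\<And>x. cmod (m x) \<le> B"
 shows "(\<lambda>x. m x * \<phi> x) \<in> L2"
 unfolding L2_iff
proof (intro conjI)
 show "integrable lebesgue (\<lambda>x. (cmod (m x * \<phi> x))^2)"
 proof (rule Bochner_Integration.integrable_bound)
  show "integrable lebesgue (\<lambda>x. B^2 * (cmod (\<phi> x))^2)"
   using assms by (simp add: L2_iff)
  have "(cmod (m x * \<phi> x))^2 \<le> B^2 * (cmod (\<phi> x))^2" for x
   using power_mono[OF B[of x], of 2]
   by (auto simp: norm_mult power_mult_distrib intro: mult_right_mono)
  then show "AE x in lebesgue. norm ((cmod (m x * \<phi> x))^2) \<le> norm (B^2 * (cmod (\<phi> x))^2)"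
   by auto
 qed measurable
qed measurable

lemma L2_scale: "\<phi> \<in> L2 \<Longrightarrow> (\<lambda>x. c * \<phi> x) \<in> L2"
 by (rule L2_bounded_mult[where B = "cmod c"]) auto

lemma L2_add:
 assumes [measurable]: "\<phi> \<in> L2" "\<psi> \<in> L2"
 shows "(\<lambda>x. \<phi> x + \<psi> x) \<in> L2"
 unfolding L2_iff
proof (intro conjI)
 show "integrable lebesgue (\<lambda>x. (cmod (\<phi> x + \<psi> x))^2)"
 proof (rule Bochner_Integration.integrable_bound)
  show "integrable lebesgue (\<lambda>x. 2 * (cmod (\<phi> x))^2 + 2 * (cmod (\<psi> x))^2)"
   using assms by (simp add: L2_iff)
  have "(cmod (\<phi> x + \<psi> x))^2 \<le> 2 * (cmod (\<phi> x))^2 + 2 * (cmod (\<psi> x))^2" for x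
   using power_mono[OF norm_triangle_ineq[of "\<phi> x" "\<psi> x"], of 2]
    sum_squares_bound[of "cmod (\<phi> x)" "cmod (\<psi> x)"] by (simp add: power2_sum)
  then show "AE x in lebesgue. norm ((cmod (\<phi> x + \<psi> x))^2)
    \<le> norm (2 * (cmod (\<phi> x))^2 + 2 * (cmod (\<psi> x))^2)"
   by auto
 qed measurable
qed measurable

lemma L2_zero: "(\<lambda>x. 0) \<in> L2"
 by (simp add: L2_iff)

lemma L2_uminus: "\<phi> \<in> L2 \<Longrightarrow> (\<lambda>x. - \<phi> x) \<in> L2"
 using L2_scale[of \<phi> "-1"] by simp

lemma L2_diff: "\<phi> \<in> L2 \<Longrightarrow> \<psi> \<in> L2 \<Longrightarrow> (\<lambda>x. \<phi> x - \<psi> x) \<in> L2"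
 using L2_add[OF _ L2_uminus] by simp

lemma L2_ae_eq:
 assumes \<phi>: "\<phi> \<in> L2" and \<psi>: "AE x in lebesgue. \<phi> x = \<psi> x"
 shows "\<psi> \<in> L2"
proof -
 have [measurable]: "\<phi> \<in> borel_measurable lebesgue" using \<phi> by measurable
 have [measurable]: "\<psi> \<in> borel_measurable lebesgue"
  by (rule lebesgue_measurable_AE[OF _ \<psi>]) measurable
 moreover have "integrable lebesgue (\<lambda>x. (cmod (\<psi> x))^2)"
  using L2_integrable[OF \<phi>] \<psi>
  by (subst integrable_cong_AE[of _ _ "\<lambda>x. (cmod (\<phi> x))^2"]) auto
 ultimately show ?thesis by (simp add: L2_iff)
qed

text \<open>The Fubini arguments below run on products of Borel spaces, so classes need Borel
  representatives. They exist because \<open>lebesgue\<close> is the completion of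
  \<open>lborel\<close>.\<close>

lemma lebesgue_borel_version:
 fixes f :: "'a::euclidean_space \<Rightarrow> complex"
 assumes [measurable]: "f \<in> borel_measurable lebesgue"
 obtains g where "g \<in> borel_measurable borel" "AE x in lebesgue. f x = g x"
proof -
 obtain g1 where g1: "g1 \<in> borel_measurable lborel" "AE x in lborel. Re (f x) = g1 x"
  using completion_ex_borel_measurable_real[of "\<lambda>x. Re (f x)" lborel] by auto
 obtain g2 where g2: "g2 \<in> borel_measurable lborel" "AE x in lborel. Im (f x) = g2 x"
  using completion_ex_borel_measurable_real[of "\<lambda>x. Im (f x)" lborel] by auto
 have [measurable]: "g1 \<in> borel_measurable borel" "g2 \<in> borel_measurable borel"
  using g1 g2 by auto
 have "AE x in lborel. f x = of_real (g1 x) + \<i> * of_real (g2 x)"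
  using g1(2) g2(2) by eventually_elim (simp add: complex_eq_iff)
 then show ?thesis
  by (intro that[of "\<lambda>x. of_real (g1 x) + \<i> * of_real (g2 x)"]) (auto intro: AE_completion)
qed

\<comment> \<open>Classes of square integrable functions modulo null functions\<close>
quotient_type (overloaded) 'n l2 = "'n::finite fn" / partial:
 "\<lambda>\<phi> \<psi>. \<phi> \<in> L2 \<and> \<psi> \<in> L2 \<and> ae_eq \<phi> \<psi>"
 morphisms rep_l2 cls
proof (rule part_equivpI)
 show "\<exists>\<phi>. \<phi> \<in> L2 \<and> \<phi> \<in> L2 \<and> ae_eq \<phi> (\<phi> :: 'n fn)"
  using L2_zero by (auto simp: ae_eq_def)
 show "symp (\<lambda>\<phi> \<psi>. \<phi> \<in> L2 \<and> \<psi> \<in> L2 \<and> ae_eq \<phi> (\<psi> :: 'n fn))"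
  by (auto simp: symp_def ae_eq_def eq_commute)
 show "transp (\<lambda>\<phi> \<psi>. \<phi> \<in> L2 \<and> \<psi> \<in> L2 \<and> ae_eq \<phi> (\<psi> :: 'n fn))"
  unfolding transp_def ae_eq_def by (auto elim: AE_mp)
qed

lemma cls_eq_iff: "\<phi> \<in> L2 \<Longrightarrow> \<psi> \<in> L2 \<Longrightarrow> cls \<phi> = cls \<psi> \<longleftrightarrow> (AE x in lebesgue. \<phi> x = \<psi> x)"
 using Quotient_rel[OF Quotient_l2, of \<phi> \<psi>] by (auto simp: ae_eq_def)

lemma cls_eqI: "\<phi> \<in> L2 \<Longrightarrow> AE x in lebesgue. \<phi> x = \<psi> x \<Longrightarrow> cls \<phi> = cls \<psi>"
 by (subst cls_eq_iff) (auto intro: L2_ae_eq)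

lemma cls_surj: "\<exists>\<phi>. \<phi> \<in> borel_measurable borel \<and> \<phi> \<in> L2 \<and> cls \<phi> = u"
proof -
 obtain \<phi> where \<phi>: "\<phi> \<in> L2" "cls \<phi> = u"
  using Quotient_rep_reflp[OF Quotient_l2, of u] Quotient_abs_rep[OF Quotient_l2, of u] by blast
 obtain \<psi> where \<psi>: "\<psi> \<in> borel_measurable borel" "AE x in lebesgue. \<phi> x = \<psi> x"
  using lebesgue_borel_version[of \<phi>] \<phi> by (auto simp: L2_iff)
 then show ?thesis
  using \<phi> L2_ae_eq[of \<phi> \<psi>] cls_eqI[of \<phi> \<psi>] by auto
qed

definition rep :: "'n::finite l2 \<Rightarrow> 'n fn" where
 "rep u = (SOME \<phi>. \<phi> \<in> borel_measurable borel \<and> \<phi> \<in> L2 \<and> cls \<phi> = u)"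

lemma rep_measurable[measurable]: "rep u \<in> borel_measurable borel"
 and rep_L2[simp]: "rep u \<in> L2"
 and cls_rep[simp]: "cls (rep u) = u"
 using someI_ex[OF cls_surj[of u]] by (auto simp: rep_def)

lemma rep_lebesgue_measurable[measurable]: "rep u \<in> borel_measurable lebesgue"
 by (rule L2_measurable) simp

lemma rep_cls: "\<phi> \<in> L2 \<Longrightarrow> AE x in lebesgue. rep (cls \<phi>) x = \<phi> x"
 by (subst cls_eq_iff[symmetric]) auto

instantiation l2 :: (finite) "{zero, plus, minus, uminus, scaleR}"
begin

lift_definition zero_l2 :: "'a l2" is "\<lambda>x. 0"
 by (simp add: L2_zero ae_eq_def)

lift_definition plus_l2 :: "'a l2 \<Rightarrow> 'a l2 \<Rightarrow> 'a l2" is "\<lambda>\<phi> \<psi> x. \<phi> x + \<psi> x"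
 by (auto simp: L2_add ae_eq_def elim: AE_mp)

lift_definition minus_l2 :: "'a l2 \<Rightarrow> 'a l2 \<Rightarrow> 'a l2" is "\<lambda>\<phi> \<psi> x. \<phi> x - \<psi> x"
 by (auto simp: L2_diff ae_eq_def elim: AE_mp)

lift_definition uminus_l2 :: "'a l2 \<Rightarrow> 'a l2" is "\<lambda>\<phi> x. - \<phi> x"
 by (auto simp: L2_uminus ae_eq_def elim: AE_mp)

lift_definition scaleR_l2 :: "real \<Rightarrow> 'a l2 \<Rightarrow> 'a l2" is "\<lambda>r \<phi> x. of_real r * \<phi> x"
 by (auto simp: L2_scale ae_eq_def elim: AE_mp)

instance ..
end

text \<open>The type class \<open>real_inner\<close> only knows the real structure. The complex one
  is carried by \<open>cs\<close> and \<open>cin\<close>, and the inner product of the class becomes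
  the real part of \<open>cin\<close>.\<close>

lift_definition cs :: "complex \<Rightarrow> 'n::finite l2 \<Rightarrow> 'n l2" is "\<lambda>c \<phi> x. c * \<phi> x"
 by (auto simp: L2_scale ae_eq_def elim: AE_mp)

lift_definition cin :: "'n::finite l2 \<Rightarrow> 'n l2 \<Rightarrow> complex" is L2inner
proof -
 fix \<phi> \<phi>' \<psi> \<psi>' :: "'n fn"
 assume *: "\<phi> \<in> L2 \<and> \<phi>' \<in> L2 \<and> ae_eq \<phi> \<phi>'" "\<psi> \<in> L2 \<and> \<psi>' \<in> L2 \<and> ae_eq \<psi> \<psi>'"
 show "L2inner \<phi> \<psi> = L2inner \<phi>' \<psi>'"
  unfolding L2inner_def
  by (rule integral_cong_AE)
    (use * in \<open>auto simp: ae_eq_def intro!: borel_measurable_integrable L2_integrable_inner elim: AE_mp\<close>)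
qed

lemma L2inner_same: "L2inner \<phi> \<phi> = of_real (LINT x|lebesgue. (cmod (\<phi> x))^2)"
proof -
 have "cnj (\<phi> x) * \<phi> x = complex_of_real ((cmod (\<phi> x))^2)" for x
  by (simp only: complex_norm_square mult.commute)
 then show ?thesis
  unfolding L2inner_def by (simp only: integral_complex_of_real)
qed

lemma L2inner_commute: "cnj (L2inner \<phi> \<psi>) = L2inner \<psi> \<phi>"
 unfolding L2inner_def using Bochner_Integration.integral_cnj[of lebesgue "\<lambda>x. cnj (\<phi> x) * \<psi> x"] by (simp add: mult.commute)

lemma L2inner_add_right:
 "\<phi> \<in> L2 \<Longrightarrow> \<psi> \<in> L2 \<Longrightarrow> \<eta> \<in> L2 \<Longrightarrow> L2inner \<phi> (\<lambda>x. \<psi> x + \<eta> x) = L2inner \<phi> \<psi> + L2inner \<phi> \<eta>"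
 unfolding L2inner_def by (simp only: distrib_left Bochner_Integration.integral_add L2_integrable_inner)

lemma L2inner_scale_right: "L2inner \<phi> (\<lambda>x. c * \<psi> x) = c * L2inner \<phi> \<psi>"
 unfolding L2inner_def by (simp only: mult.left_commute[of _ c] integral_mult_right_zero)

lemma cin_cs_right: "cin u (cs c v) = c * cin u v"
 by transfer (simp add: L2inner_scale_right)

lemma cin_commute: "cnj (cin u v) = cin v u"
 by transfer (simp add: L2inner_commute)

lemma cin_add_right: "cin u (v + w) = cin u v + cin u w"
 by transfer (simp add: L2inner_add_right)

lemma cs_scaleR: "cs (of_real r) u = r *\<^sub>R u"
 by transfer (simp add: L2_scale ae_eq_def)

instantiation l2 :: (finite) real_inner
begin

definition "u \<bullet> v = Re (cin u (v :: 'a l2))"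
definition "norm_l2 u = sqrt (u \<bullet> (u :: 'a l2))"
definition "dist_l2 u (v :: 'a l2) = norm (u - v)"
definition "sgn_l2 u = inverse (norm u) *\<^sub>R (u :: 'a l2)"
definition "uniformity_l2 = (INF e\<in>{0<..}. principal {(u :: 'a l2, v). dist u v < e})"
definition "open_l2 (U :: 'a l2 set) \<longleftrightarrow>
 (\<forall>x\<in>U. eventually (\<lambda>(x', y). x' = x \<longrightarrow> y \<in> U) uniformity)"

lemma inner_eq_Re_cin: "u \<bullet> v = Re (cin u (v :: 'a l2))"
 by (rule inner_l2_def)

instance
proof
 fix u v w :: "'a l2" and r s :: real
 show "u + v + w = u + (v + w)"
  by transfer (auto simp: ae_eq_def L2_add algebra_simps)
 show "u + v = v + u"
  by transfer (auto simp: ae_eq_def L2_add algebra_simps)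
 show "0 + u = u"
  by transfer (auto simp: ae_eq_def)
 show "- u + u = 0"
  by transfer (auto simp: ae_eq_def L2_zero)
 show "u - v = u + - v"
  by transfer (auto simp: ae_eq_def L2_diff)
 show "r *\<^sub>R (u + v) = r *\<^sub>R u + r *\<^sub>R v"
  by transfer (auto simp: ae_eq_def L2_add L2_scale distrib_left distrib_right)
 show "(r + s) *\<^sub>R u = r *\<^sub>R u + s *\<^sub>R u"
  by transfer (auto simp: ae_eq_def L2_add L2_scale distrib_left distrib_right)
 show "r *\<^sub>R s *\<^sub>R u = (r * s) *\<^sub>R u"
  by transfer (auto simp: ae_eq_def L2_scale mult.assoc)
 show "1 *\<^sub>R u = u"
  by transfer (auto simp: ae_eq_def)
 show "dist u v = norm (u - v)" "norm u = sqrt (u \<bullet> u)" "sgn u = u /\<^sub>R norm u"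
  by (simp_all add: dist_l2_def norm_l2_def sgn_l2_def)
 show "(uniformity :: ('a l2 \<times> 'a l2) filter) = (INF e\<in>{0<..}. principal {(x, y). dist x y < e})"
  by (rule uniformity_l2_def)
 show "open U \<longleftrightarrow> (\<forall>x\<in>U. \<forall>\<^sub>F (x', y) in uniformity. x' = x \<longrightarrow> y \<in> U)" for U :: "'a l2 set"
  by (rule open_l2_def)
 show comm: "u \<bullet> v = v \<bullet> u" for u v :: "'a l2"
  using arg_cong[OF cin_commute[of u v], of Re] by (simp add: inner_eq_Re_cin)
 have "u \<bullet> (v + w) = u \<bullet> v + u \<bullet> w" for u v w :: "'a l2"
  by (simp add: inner_eq_Re_cin cin_add_right)
 then show "(u + v) \<bullet> w = u \<bullet> w + v \<bullet> w"
  by (simp add: comm[of _ w])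
 have "u \<bullet> (r *\<^sub>R v) = r * (u \<bullet> v)" for u v :: "'a l2"
  by (simp add: inner_eq_Re_cin cin_cs_right flip: cs_scaleR)
 then show "r *\<^sub>R u \<bullet> v = r * (u \<bullet> v)"
  by (simp add: comm[of _ v])
 show "0 \<le> u \<bullet> u"
  unfolding inner_l2_def by transfer (simp add: L2inner_same)
 show "u \<bullet> u = 0 \<longleftrightarrow> u = 0"
  unfolding inner_l2_def by transfer (auto simp: L2inner_same L2_zero ae_eq_def L2_integrable integral_nonneg_eq_0_iff_AE)
qed
end

lemma cs_add_right: "cs c (u + v) = cs c u + cs c v"
 by transfer (auto simp: ae_eq_def L2_add L2_scale distrib_left distrib_right)

lemma cs_cs[simp]: "cs c (cs d u) = cs (c * d) u"
 by transfer (auto simp: ae_eq_def L2_scale mult.assoc)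

lemma cs_1[simp]: "cs 1 u = u"
 by transfer (auto simp: ae_eq_def)

lemma cs_0[simp]: "cs 0 u = 0"
 by transfer (auto simp: ae_eq_def L2_zero)

lemma cs_zero[simp]: "cs c 0 = 0"
 by transfer (auto simp: ae_eq_def L2_zero)

lemma cs_scaleR_right: "cs c (r *\<^sub>R u) = r *\<^sub>R cs c u"
 by (simp flip: cs_scaleR add: mult.commute)

lemma cs_sum_right: "cs c (sum f A) = (\<Sum>a\<in>A. cs c (f a))"
 by (induction A rule: infinite_finite_induct) (auto simp: cs_add_right)

lemma cin_scaleR_right: "cin u (r *\<^sub>R v) = r * cin u v"
 by (simp flip: cs_scaleR add: cin_cs_right)

lemma cin_add_left: "cin (u + v) w = cin u w + cin v w"
 by (metis cin_add_right cin_commute complex_cnj_add)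

lemma cin_cs_left: "cin (cs c u) v = cnj c * cin u v"
 by (metis cin_cs_right cin_commute complex_cnj_mult)

lemma cin_zero[simp]: "cin u 0 = 0" "cin 0 u = 0"
 using cin_cs_right[of u 0 u] cin_cs_left[of 0 u u] by auto

lemma cin_minus_right: "cin u (v - w) = cin u v - cin u w"
 using cin_add_right[of u v "cs (-1) w"] cin_cs_right[of u "-1" w] cs_scaleR[of "-1" w] by simp

lemma cin_minus_left: "cin (v - w) u = cin v u - cin w u"
 by (metis cin_minus_right cin_commute complex_cnj_diff)

lemma cin_sum_right: "cin u (sum f A) = (\<Sum>a\<in>A. cin u (f a))"
 by (induction A rule: infinite_finite_induct) (auto simp: cin_add_right)

lemma cin_sum_left: "cin (sum f A) u = (\<Sum>a\<in>A. cin (f a) u)"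
 by (induction A rule: infinite_finite_induct) (auto simp: cin_add_left)

lemma cin_same: "cin u u = of_real ((norm u)^2)"
proof -
 have "Im (cin u u) = 0"
  using arg_cong[OF cin_commute[of u u], of Im] by simp
 moreover have "Re (cin u u) = (norm u)^2"
  by (simp add: power2_norm_eq_inner inner_eq_Re_cin)
 ultimately show ?thesis by (simp add: complex_eq_iff)
qed

text \<open>Facts proved over the reals, such as Bessel's inequality and the Euler-Lagrange
  equation, pass to \<open>cin\<close> by using them twice, for a vector and for its multiple by
  \<open>\<i>\<close>.\<close>

lemma cin_eq_inner: "cin u v = Complex (u \<bullet> v) (cs \<i> u \<bullet> v)"
 by (simp add: complex_eq_iff inner_eq_Re_cin cin_cs_left)

lemma norm_cs: "norm (cs c u) = cmod c * norm u"
proof -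
 have "complex_of_real ((norm (cs c u))^2) = of_real ((cmod c)^2) * of_real ((norm u)^2)"
  unfolding cin_same[symmetric] cin_cs_left cin_cs_right complex_norm_square
  by (simp only: mult.assoc mult.left_commute)
 then have "(norm (cs c u))^2 = (cmod c * norm u)^2"
  by (simp only: of_real_mult[symmetric] of_real_eq_iff power_mult_distrib)
 then show ?thesis by (simp add: power2_eq_iff_nonneg)
qed

lemma cmod_cin_le: "cmod (cin u v) \<le> norm u * norm v"
proof (cases "cin u v = 0")
 case False
 \<comment> \<open>A unimodular factor that turns \<open>cin u v\<close> into its modulus, so that
   the real Cauchy-Schwarz inequality applies.\<close>
 define c where "c = cnj (cin u v) / cmod (cin u v)"
 have "cmod c = 1" using False by (simp add: c_def norm_divide)
 have "cnj (cin u v) * cin u v = of_real (cmod (cin u v)) * of_real (cmod (cin u v))"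
  using complex_norm_square[of "cin u v"] by (simp add: power2_eq_square mult.commute)
 then have "c * cin u v = cmod (cin u v)"
  using False by (simp add: c_def)
 then have "cmod (cin u v) = u \<bullet> cs c v"
  by (simp add: inner_eq_Re_cin cin_cs_right)
 also have "\<dots> \<le> norm u * norm (cs c v)" by (rule norm_cauchy_schwarz)
 finally show ?thesis using \<open>cmod c = 1\<close> by (simp add: norm_cs)
qed simp

lemma bounded_linear_cin: "bounded_linear (cin u)"
 by (rule bounded_linear_intro[where K = "norm u"])
   (auto simp: cin_add_right cin_scaleR_right scaleR_conv_of_real mult.commute[of "norm _" "norm u"] cmod_cin_le)

lemma bounded_linear_cs: "bounded_linear (cs c)"
 by (rule bounded_linear_intro[where K = "cmod c"])
   (auto simp: cs_add_right cs_scaleR_right norm_cs mult.commute)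

lemmas tendsto_cs = bounded_linear.tendsto[OF bounded_linear_cs]

lemma cin_cls: "\<phi> \<in> L2 \<Longrightarrow> \<psi> \<in> L2 \<Longrightarrow> cin (cls \<phi>) (cls \<psi>) = L2inner \<phi> \<psi>"
 by (rule cin.abs_eq) (auto simp: ae_eq_def)

lemma cin_rep: "cin u v = L2inner (rep u) (rep v)"
 using cin_cls[of "rep u" "rep v"] by simp

lemma norm_cls_sq: "\<phi> \<in> L2 \<Longrightarrow> (norm (cls \<phi>))^2 = (LINT x|lebesgue. (cmod (\<phi> x))^2)"
 using cin_same[of "cls \<phi>"] by (simp add: cin_cls L2inner_same del: of_real_power)

lemma norm_sq: "(norm u)^2 = (LINT x|lebesgue. (cmod (rep u x))^2)"
 using norm_cls_sq[of "rep u"] by simp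

lemma L2norm_cls: "\<phi> \<in> L2 \<Longrightarrow> L2norm \<phi> = ennreal (norm (cls \<phi>))"
 by (simp add: L2norm_eq flip: norm_cls_sq)

lemma cls_add: "\<phi> \<in> L2 \<Longrightarrow> \<psi> \<in> L2 \<Longrightarrow> cls \<phi> + cls \<psi> = cls (\<lambda>x. \<phi> x + \<psi> x)"
 by (rule plus_l2.abs_eq) (auto simp: ae_eq_def)

lemma cls_diff: "\<phi> \<in> L2 \<Longrightarrow> \<psi> \<in> L2 \<Longrightarrow> cls \<phi> - cls \<psi> = cls (\<lambda>x. \<phi> x - \<psi> x)"
 by (rule minus_l2.abs_eq) (auto simp: ae_eq_def)

lemma cs_cls: "\<phi> \<in> L2 \<Longrightarrow> cs c (cls \<phi>) = cls (\<lambda>x. c * \<phi> x)"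
 by (rule cs.abs_eq) (auto simp: ae_eq_def)

lemma zero_cls: "0 = cls (\<lambda>x. 0)"
 by (rule zero_l2.abs_eq)

lemma rep_add: "AE x in lebesgue. rep (u + v) x = rep u x + rep v x"
 using rep_cls[OF L2_add, of "rep u" "rep v"] by (simp flip: cls_add)

lemma rep_diff: "AE x in lebesgue. rep (u - v) x = rep u x - rep v x"
 using rep_cls[OF L2_diff, of "rep u" "rep v"] by (simp flip: cls_diff)

lemma rep_zero: "AE x in lebesgue. rep 0 x = 0"
 using rep_cls[OF L2_zero] by (simp flip: zero_cls)

lemma rep_sum:
 "finite A \<Longrightarrow> AE x in lebesgue. rep (sum u A) x = (\<Sum>a\<in>A. rep (u a) x)"
proof (induction A rule: finite_induct)
 case empty
 then show ?case using rep_zero by simp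
next
 case (insert a A)
 then show ?case using rep_add[of "u a" "sum u A"] by (auto elim!: eventually_elim2)
qed

lemma integrable_rep: "integrable lebesgue (\<lambda>x. (cmod (rep u x))^2)"
 by (simp add: L2_integrable)

lemma ennreal_norm_sq: "ennreal ((norm u)^2) = (\<integral>\<^sup>+ x. ennreal ((cmod (rep u x))^2) \<partial>lebesgue)"
 by (simp add: norm_sq nn_integral_eq_integral integrable_rep)

text \<open>Norm convergence is convergence in L1 of the squared differences, and such a sequence
  has a subsequence that converges almost everywhere.\<close>

lemma ae_subseq:
 assumes lim: "X \<longlonglongrightarrow> (u :: 'n::finite l2)"
 shows "\<exists>r::nat\<Rightarrow>nat. strict_mono r \<and> (AE x in lebesgue. (\<lambda>n. rep (X (r n)) x) \<longlonglongrightarrow> rep u x)"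
proof -
 have "(\<lambda>n. (norm (X n - u))^2) \<longlonglongrightarrow> 0"
  using tendsto_power[OF tendsto_norm_zero[OF LIM_zero[OF lim]], of 2] by simp
 then have "(\<lambda>n. LINT x|lebesgue. norm ((cmod (rep (X n - u) x))^2)) \<longlonglongrightarrow> 0"
  by (simp add: norm_sq)
 then obtain r :: "nat \<Rightarrow> nat" where r: "strict_mono r"
   "AE x in lebesgue. (\<lambda>n. (cmod (rep (X (r n) - u) x))^2) \<longlonglongrightarrow> 0"
  using tendsto_L1_AE_subseq[of lebesgue "\<lambda>n x. (cmod (rep (X n - u) x))^2"] integrable_rep
  by blast
 have "AE x in lebesgue. \<forall>n. rep (X (r n) - u) x = rep (X (r n)) x - rep u x"
  by (simp add: AE_all_countable rep_diff)
 with r(2) have "AE x in lebesgue. (\<lambda>n. rep (X (r n)) x) \<longlonglongrightarrow> rep u x"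
 proof eventually_elim
  case (elim x)
  then have "(\<lambda>n. cmod (rep (X (r n)) x - rep u x)) \<longlonglongrightarrow> 0"
   using tendsto_real_sqrt[of "\<lambda>n. (cmod (rep (X (r n)) x - rep u x))^2" 0] by simp
  then show ?case by (simp add: LIM_zero_iff tendsto_norm_zero_iff)
 qed
 with r show ?thesis by blast
qed

text \<open>Pointwise products are not continuous in the norm, but a relation between three
  convergent sequences passes to the limit along a common subsequence, found by three successive
  extractions. It later identifies a limit of operators as multiplication by an unbounded
  function.\<close>

lemma ae_product_limit:
 assumes "X \<longlonglongrightarrow> x" "Y \<longlonglongrightarrow> y" "Z \<longlonglongrightarrow> (z :: 'n::finite l2)"
  and Z: "\<And>n. AE t in lebesgue. rep (Z n) t = rep (X n) t * rep (Y n) t"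
 shows "AE t in lebesgue. rep z t = rep x t * rep y t"
proof -
 obtain r1 :: "nat \<Rightarrow> nat" where r1: "strict_mono r1"
   "AE t in lebesgue. (\<lambda>n. rep (X (r1 n)) t) \<longlonglongrightarrow> rep x t"
  using ae_subseq[OF assms(1)] by blast
 have "(\<lambda>n. Y (r1 n)) \<longlonglongrightarrow> y" using LIMSEQ_subseq_LIMSEQ[OF assms(2) r1(1)] by (simp add: o_def)
 from ae_subseq[OF this] obtain r2 :: "nat \<Rightarrow> nat" where r2: "strict_mono r2"
   "AE t in lebesgue. (\<lambda>n. rep (Y (r1 (r2 n))) t) \<longlonglongrightarrow> rep y t" by blast
 have "(\<lambda>n. Z (r1 (r2 n))) \<longlonglongrightarrow> z"
  using LIMSEQ_subseq_LIMSEQ[OF LIMSEQ_subseq_LIMSEQ[OF assms(3) r1(1)] r2(1)] by (simp add: o_def)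
 from ae_subseq[OF this] obtain r3 :: "nat \<Rightarrow> nat" where r3: "strict_mono r3"
   "AE t in lebesgue. (\<lambda>n. rep (Z (r1 (r2 (r3 n)))) t) \<longlonglongrightarrow> rep z t" by blast
 have "AE t in lebesgue. \<forall>n. rep (Z n) t = rep (X n) t * rep (Y n) t"
  using Z by (simp add: AE_all_countable)
 with r1(2) r2(2) r3(2) show ?thesis
 proof eventually_elim
  case (elim t)
  have "(\<lambda>n. rep (X (r1 (r2 (r3 n)))) t * rep (Y (r1 (r2 (r3 n)))) t) \<longlonglongrightarrow> rep x t * rep y t"
   using LIMSEQ_subseq_LIMSEQ[OF LIMSEQ_subseq_LIMSEQ[OF elim(1) r2(1)] r3(1)]
    LIMSEQ_subseq_LIMSEQ[OF elim(2) r3(1)]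
   by (intro tendsto_mult) (simp_all add: o_def)
  moreover have "(\<lambda>n. rep (X (r1 (r2 (r3 n)))) t * rep (Y (r1 (r2 (r3 n)))) t) \<longlonglongrightarrow> rep z t"
   using elim(3,4) by simp
  ultimately show ?case by (rule LIMSEQ_unique[symmetric])
 qed
qed

text \<open>Riesz-Fischer: a subsequence with geometrically small steps converges almost everywhere,
  Fatou's lemma shows that its pointwise limit is also its limit in the norm, and a Cauchy sequence
  with a convergent subsequence converges.\<close>

instance l2 :: (finite) banach
proof
 fix X :: "nat \<Rightarrow> 'a l2"
 assume C: "Cauchy X"
 have "\<exists>N. \<forall>m\<ge>N. norm (X m - X N) < (1/2)^k" for k
  using C[unfolded Cauchy_altdef2, rule_format, of "(1/2)^k"] by (auto simp: dist_norm)
 then obtain M where M: "norm (X m - X (M k)) < (1/2)^k" if "m \<ge> M k" for m k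
  by metis
 \<comment> \<open>The maximum makes \<open>r\<close> strictly increasing and keeps
   \<open>r k\<close> beyond the index \<open>M k\<close>.\<close>
 define r where "r = rec_nat (M 0) (\<lambda>k n. max (Suc n) (M (Suc k)))"
 have rM: "r k \<ge> M k" for k by (cases k) (auto simp: r_def)
 have r: "strict_mono r" by (auto simp: strict_mono_Suc_iff r_def less_max_iff_disj)
 have close: "norm (X (r m) - X (r k)) \<le> 2 * (1/2)^k" if "m \<ge> k" for m k
 proof -
  have "r m \<ge> r k" using r that by (simp add: strict_mono_less_eq)
  then have "norm (X (r m) - X (M k)) < (1/2)^k" "norm (X (r k) - X (M k)) < (1/2)^k"
   using M[where k = k] rM[of k] by (meson order_trans)+
  then show ?thesis using norm_triangle_ineq4[of "X (r m) - X (M k)" "X (r k) - X (M k)"] by simp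
 qed
 define d where "d k = X (r (Suc k)) - X (r k)" for k
 have dk: "(norm (d k))^2 \<le> 4 * (1/4)^k" for k
  using power_mono[OF close[of k "Suc k"], of 2] by (simp add: d_def power_mult_distrib power_even_eq)
    (simp add: power_divide power2_eq_square flip: power_mult power_mult_distrib)
 have "(\<integral>\<^sup>+ x. (\<Sum>k. ennreal (2^k * (cmod (rep (d k) x))^2)) \<partial>lebesgue)
   = (\<Sum>k. \<integral>\<^sup>+ x. ennreal (2^k * (cmod (rep (d k) x))^2) \<partial>lebesgue)"
  by (rule nn_integral_suminf) measurable
 also have "\<dots> = (\<Sum>k. ennreal (2^k * (norm (d k))^2))"
  by (simp add: ennreal_mult nn_integral_cmult ennreal_norm_sq)
 also have "\<dots> \<le> (\<Sum>k. ennreal (4 * (1/2)^k))"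
 proof (rule suminf_le)
  fix k
  have "2^k * (norm (d k))^2 \<le> 2^k * (4 * (1/4)^k)" using dk[of k] by simp
  also have "\<dots> = 4 * (2 * (1/4))^k" unfolding power_mult_distrib by simp
  finally show "ennreal (2^k * (norm (d k))^2) \<le> ennreal (4 * (1/2)^k)" by (simp add: ennreal_leI)
 qed auto
 also have "\<dots> = ennreal (\<Sum>k. 4 * (1/2)^k)"
  by (rule suminf_ennreal2) (auto intro: summable_mult)
 also have "\<dots> < \<infinity>" by simp
 finally have "AE x in lebesgue. (\<Sum>k. ennreal (2^k * (cmod (rep (d k) x))^2)) \<noteq> \<infinity>"
  by (intro nn_integral_PInf_AE) auto
 moreover have "AE x in lebesgue. \<forall>k. rep (d k) x = rep (X (r (Suc k))) x - rep (X (r k)) x"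
  by (simp add: AE_all_countable d_def rep_diff)
 ultimately have conv: "AE x in lebesgue. convergent (\<lambda>n. rep (X (r n)) x)"
 proof eventually_elim
  case (elim x)
  \<comment> \<open>The weight 2^k leaves room: a finite value of this sum bounds the k-th step at x
    by a geometric sequence of ratio sqrt (1/2).\<close>
  define S where "S = enn2real (\<Sum>k. ennreal (2^k * (cmod (rep (d k) x))^2))"
  have "ennreal (2^k * (cmod (rep (d k) x))^2) \<le> ennreal S" for k
   using elim(1) sum_le_suminf[OF _ _ zero_le, of "\<lambda>k. ennreal (2^k * (cmod (rep (d k) x))^2)" "{k}"]
   by (simp add: S_def less_top)
  then have *: "2^k * (cmod (rep (d k) x))^2 \<le> S" for k
   by (simp add: S_def)
  have "cmod (rep (d k) x) \<le> sqrt S * (sqrt (1/2))^k" for k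
  proof (rule power2_le_imp_le)
   have "(cmod (rep (d k) x))^2 \<le> S * (1/2)^k"
    using *[of k] by (simp add: field_simps power_divide)
   also have "\<dots> = (sqrt S * (sqrt (1/2))^k)^2"
    by (simp add: power_mult_distrib S_def flip: power_mult) (simp add: mult.commute[of k] power_mult power_divide real_sqrt_divide)
   finally show "(cmod (rep (d k) x))^2 \<le> (sqrt S * (sqrt (1/2))^k)^2" .
  qed (simp add: S_def)
  moreover have "summable (\<lambda>k. sqrt S * (sqrt (1/2))^k)"
   by (intro summable_mult summable_geometric) (simp add: real_sqrt_divide)
  ultimately have "summable (\<lambda>k. rep (d k) x)"
   by (rule summable_comparison_test'[rotated, where N = 0])
  then have "summable (\<lambda>k. rep (X (r (Suc k))) x - rep (X (r k)) x)"
   using elim(2) by simp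
  then show ?case
   by (simp add: summable_iff_convergent sum_lessThan_telescope[of "\<lambda>n. rep (X (r n)) x"] convergent_diff_const_right_iff)
 qed
 define G where "G x = lim (\<lambda>n. rep (X (r n)) x)" for x
 have [measurable]: "G \<in> borel_measurable lebesgue"
  unfolding G_def by measurable
 have fatou: "(\<integral>\<^sup>+ x. ennreal ((cmod (rep (X (r j)) x - G x))^2) \<partial>lebesgue) \<le> ennreal ((2 * (1/2)^j)^2)" for j
 proof -
  have "(\<integral>\<^sup>+ x. ennreal ((cmod (rep (X (r j)) x - G x))^2) \<partial>lebesgue)
    = (\<integral>\<^sup>+ x. liminf (\<lambda>n. ennreal ((cmod (rep (X (r n)) x - rep (X (r j)) x))^2)) \<partial>lebesgue)"
  proof (rule nn_integral_cong_AE)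
   show "AE x in lebesgue. ennreal ((cmod (rep (X (r j)) x - G x))^2)
    = liminf (\<lambda>n. ennreal ((cmod (rep (X (r n)) x - rep (X (r j)) x))^2))"
    using conv
   proof eventually_elim
    case (elim x)
    then have "(\<lambda>n. rep (X (r n)) x) \<longlonglongrightarrow> G x"
     by (simp add: G_def convergent_LIMSEQ_iff)
    then have "(\<lambda>n. ennreal ((cmod (rep (X (r n)) x - rep (X (r j)) x))^2))
      \<longlonglongrightarrow> ennreal ((cmod (G x - rep (X (r j)) x))^2)"
     by (intro tendsto_intros) auto
    then show ?case
     using lim_imp_Liminf[OF sequentially_bot] by (metis norm_minus_commute)
   qed
  qed
  also have "\<dots> \<le> liminf (\<lambda>n. \<integral>\<^sup>+ x. ennreal ((cmod (rep (X (r n)) x - rep (X (r j)) x))^2) \<partial>lebesgue)"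
   by (rule nn_integral_liminf) measurable
  also have "\<dots> = liminf (\<lambda>n. ennreal ((norm (X (r n) - X (r j)))^2))"
  proof -
   have "(\<integral>\<^sup>+ x. ennreal ((cmod (rep (X (r n)) x - rep (X (r j)) x))^2) \<partial>lebesgue)
    = ennreal ((norm (X (r n) - X (r j)))^2)" for n
    unfolding ennreal_norm_sq
    by (rule nn_integral_cong_AE) (use rep_diff[of "X (r n)" "X (r j)"] in \<open>auto elim: eventually_mono\<close>)
   then show ?thesis by simp
  qed
  also have "\<dots> \<le> ennreal ((2 * (1/2)^j)^2)"
  proof (rule Liminf_le)
   show "\<forall>\<^sub>F n in sequentially. ennreal ((norm (X (r n) - X (r j)))^2) \<le> ennreal ((2 * (1/2)^j)^2)"
    unfolding eventually_sequentially
    by (intro exI[of _ j] allI impI ennreal_leI power_mono close) auto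
  qed simp
  finally show ?thesis .
 qed
 have D: "(\<lambda>x. rep (X (r j)) x - G x) \<in> L2" for j
  unfolding L2_iff integrable_iff_bounded
  using le_less_trans[OF fatou[of j]] by auto
 have G: "G \<in> L2"
  using L2_diff[OF rep_L2[of "X (r 0)"] D[of 0]] by simp
 have "norm (X (r j) - cls G) \<le> 2 * (1/2)^j" for j
 proof (rule power2_le_imp_le)
  have "X (r j) - cls G = cls (\<lambda>x. rep (X (r j)) x - G x)"
   using cls_diff[OF rep_L2[of "X (r j)"] G] by simp
  then have "ennreal ((norm (X (r j) - cls G))^2) = (\<integral>\<^sup>+ x. ennreal ((cmod (rep (X (r j)) x - G x))^2) \<partial>lebesgue)"
   using norm_cls_sq[OF D[of j]] L2_integrable[OF D[of j]] by (simp add: nn_integral_eq_integral)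
  also note fatou
  finally show "(norm (X (r j) - cls G))^2 \<le> (2 * (1/2)^j)^2"
   by (subst (asm) ennreal_le_iff) auto
 qed auto
 moreover have "(\<lambda>j. 2 * (1/2)^j :: real) \<longlonglongrightarrow> 0"
  by (intro tendsto_mult_right_zero LIMSEQ_power_zero) auto
 ultimately have "(\<lambda>j. X (r j) - cls G) \<longlonglongrightarrow> 0"
  by (rule Lim_null_comparison[OF always_eventually, rule_format])
 then have "(X \<circ> r) \<longlonglongrightarrow> cls G"
  by (simp add: LIM_zero_iff o_def)
 then show "convergent X"
  using Cauchy_converges_subseq[OF C r] unfolding convergent_def by blast
qed

subsection \<open>Multiplication by bounded functions\<close>

definition bounded_measurable :: "'n::finite fn \<Rightarrow> bool" where
 "bounded_measurable m \<longleftrightarrow> m \<in> borel_measurable lebesgue \<and> (\<exists>B. \<forall>x. cmod (m x) \<le> B)"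

lemma bounded_measurableI:
 "m \<in> borel_measurable lebesgue \<Longrightarrow> (\<And>x. cmod (m x) \<le> B) \<Longrightarrow> bounded_measurable m"
 by (auto simp: bounded_measurable_def)

lemma bounded_measurable_measurable[measurable_dest]:
 "bounded_measurable m \<Longrightarrow> m \<in> borel_measurable lebesgue"
 by (simp add: bounded_measurable_def)

lemma bounded_measurable_L2: "bounded_measurable m \<Longrightarrow> \<phi> \<in> L2 \<Longrightarrow> (\<lambda>x. m x * \<phi> x) \<in> L2"
 by (auto simp: bounded_measurable_def intro: L2_bounded_mult)

lemma bounded_measurable_mult:
 assumes "bounded_measurable m" "bounded_measurable k"
 shows "bounded_measurable (\<lambda>x. m x * k x)"
proof -
 obtain B C where "\<forall>x. cmod (m x) \<le> B" "\<forall>x. cmod (k x) \<le> C"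
  using assms by (auto simp: bounded_measurable_def)
 then have "cmod (m x * k x) \<le> B * C" for x
  using mult_mono'[of "cmod (m x)" B "cmod (k x)" C] by (simp add: norm_mult)
 then show ?thesis
  using assms by (intro bounded_measurableI) (auto simp: bounded_measurable_def)
qed

lemma bounded_measurable_add:
 assumes "bounded_measurable m" "bounded_measurable k"
 shows "bounded_measurable (\<lambda>x. m x + k x)"
proof -
 obtain B C where "\<forall>x. cmod (m x) \<le> B" "\<forall>x. cmod (k x) \<le> C"
  using assms by (auto simp: bounded_measurable_def)
 then have "cmod (m x + k x) \<le> B + C" for x
  by (meson add_mono norm_triangle_le)
 then show ?thesis
  using assms by (intro bounded_measurableI) (auto simp: bounded_measurable_def)
qed

lemma bounded_measurable_cnj: "bounded_measurable m \<Longrightarrow> bounded_measurable (\<lambda>x. cnj (m x))"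
 by (auto simp: bounded_measurable_def)

lemma bounded_measurable_indicator:
 "S \<in> sets lebesgue \<Longrightarrow> bounded_measurable (indicator S :: 'n::finite fn)"
 by (rule bounded_measurableI[where B = 1]) (auto simp: indicator_def)

text \<open>For an unbounded multiplier the product may leave \<open>L2\<close>, where
  \<open>cls\<close> carries no information. The laws below therefore ask for bounded
  multipliers.\<close>

definition mul :: "'n::finite fn \<Rightarrow> 'n l2 \<Rightarrow> 'n l2" where
 "mul m u = cls (\<lambda>x. m x * rep u x)"

lemma rep_mul: "bounded_measurable m \<Longrightarrow> AE x in lebesgue. rep (mul m u) x = m x * rep u x"
 unfolding mul_def by (rule rep_cls) (simp add: bounded_measurable_L2)

lemma mul_cls: "bounded_measurable m \<Longrightarrow> \<phi> \<in> L2 \<Longrightarrow> mul m (cls \<phi>) = cls (\<lambda>x. m x * \<phi> x)"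
 unfolding mul_def
 by (rule cls_eqI) (use rep_cls[of \<phi>] in \<open>auto simp: bounded_measurable_L2 elim: eventually_mono\<close>)

lemma l2_eqI: "AE x in lebesgue. rep u x = rep v x \<Longrightarrow> u = v"
 using cls_eq_iff[of "rep u" "rep v"] by simp

lemma mul_add_right: "bounded_measurable m \<Longrightarrow> mul m (u + v) = mul m u + mul m v"
 using cls_add[of "\<lambda>x. m x * rep u x" "\<lambda>x. m x * rep v x"] mul_cls[of m "\<lambda>x. rep u x + rep v x"]
  cls_add[of "rep u" "rep v"]
 by (simp add: mul_def bounded_measurable_L2 L2_add distrib_left)

lemma mul_cs: "bounded_measurable m \<Longrightarrow> mul m (cs c u) = cs c (mul m u)"
 using cs_cls[of "\<lambda>x. m x * rep u x" c] mul_cls[of m "\<lambda>x. c * rep u x"]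
  cs_cls[of "rep u" c]
 by (simp add: mul_def bounded_measurable_L2 L2_scale mult.left_commute)

lemma mul_scaleR: "bounded_measurable m \<Longrightarrow> mul m (r *\<^sub>R u) = r *\<^sub>R mul m u"
 by (simp add: mul_cs flip: cs_scaleR)

lemma mul_mul: "bounded_measurable m \<Longrightarrow> bounded_measurable k \<Longrightarrow> mul m (mul k u) = mul (\<lambda>x. m x * k x) u"
 unfolding mul_def[of k] by (subst mul_cls) (auto simp: bounded_measurable_L2 mult.assoc mul_def)

lemma mul_add_left:
 "bounded_measurable m \<Longrightarrow> bounded_measurable k \<Longrightarrow> mul (\<lambda>x. m x + k x) u = mul m u + mul k u"
 unfolding mul_def by (subst cls_add) (auto simp: bounded_measurable_L2 distrib_right)

lemma cin_mul: "bounded_measurable m \<Longrightarrow> cin u (mul m v) = cin (mul (\<lambda>x. cnj (m x)) u) v"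
 using cin_cls[of "rep u" "\<lambda>x. m x * rep v x"] cin_cls[of "\<lambda>x. cnj (m x) * rep u x" "rep v"]
 by (simp add: mul_def bounded_measurable_L2 bounded_measurable_cnj L2inner_def) (simp add: ac_simps)

lemma norm_mul_sq:
 "bounded_measurable m \<Longrightarrow> (norm (mul m u))^2 = (LINT x|lebesgue. (cmod (m x))^2 * (cmod (rep u x))^2)"
 unfolding mul_def by (subst norm_cls_sq) (auto simp: bounded_measurable_L2 norm_mult power_mult_distrib)

lemma norm_mul_le:
 assumes m: "m \<in> borel_measurable lebesgue" and B: "\<And>x. cmod (m x) \<le> B"
 shows "norm (mul m u) \<le> B * norm u"
proof (rule power2_le_imp_le)
 have "0 \<le> B" using norm_ge_zero[of "m 0"] B[of 0] by linarith
 then show "0 \<le> B * norm u" by simp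
 have bm: "bounded_measurable m" using assms by (rule bounded_measurableI)
 have "(norm (mul m u))^2 \<le> (LINT x|lebesgue. B^2 * (cmod (rep u x))^2)"
  unfolding norm_mul_sq[OF bm]
 proof (rule integral_mono)
  show "integrable lebesgue (\<lambda>x. (cmod (m x))^2 * (cmod (rep u x))^2)"
   using L2_integrable[OF bounded_measurable_L2[OF bm rep_L2[of u]]]
   by (simp add: norm_mult power_mult_distrib)
  show "(cmod (m x))^2 * (cmod (rep u x))^2 \<le> B^2 * (cmod (rep u x))^2" for x
   using power_mono[OF B[of x], of 2] by (auto intro: mult_right_mono)
 qed (simp add: integrable_rep)
 then show "(norm (mul m u))^2 \<le> (B * norm u)^2"
  by (simp add: power_mult_distrib norm_sq)
qed

lemma bounded_linear_mul: "bounded_measurable m \<Longrightarrow> bounded_linear (mul m)"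
 by (rule bounded_linear_intro[where K = "SOME B. \<forall>x. cmod (m x) \<le> B"])
   (auto simp: mul_add_right mul_scaleR mult.commute[of "norm _"] bounded_measurable_def
    intro!: norm_mul_le intro: someI2_ex)

section \<open>Ky Fan bounds and singular values\<close>

text \<open>Orthonormal for the real inner product, hence on \<open>l2\<close> a weaker demand than
  for \<open>cin\<close>. The price is a factor 2 in \<open>bessel_pointwise\<close>.\<close>

definition orthonormal :: "nat \<Rightarrow> (nat \<Rightarrow> 'a::real_inner) \<Rightarrow> bool" where
 "orthonormal N u \<longleftrightarrow> (\<forall>i<N. \<forall>j<N. u i \<bullet> u j = (if i = j then 1 else 0))"

lemma orthonormal_norm: "orthonormal N u \<Longrightarrow> i < N \<Longrightarrow> norm (u i) = 1"
 by (simp add: orthonormal_def norm_eq_sqrt_inner)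

lemma bessel_real:
 assumes "orthonormal N u"
 shows "(\<Sum>i<N. (x \<bullet> u i)^2) \<le> (norm x)^2"
proof -
 define y where "y = (\<Sum>i<N. (x \<bullet> u i) *\<^sub>R u i)"
 have xy: "x \<bullet> y = (\<Sum>i<N. (x \<bullet> u i)^2)"
  by (simp add: y_def inner_sum_right power2_eq_square)
 have uy: "u i \<bullet> y = x \<bullet> u i" if "i < N" for i
 proof -
  have "u i \<bullet> y = (\<Sum>j<N. if i = j then x \<bullet> u i else 0)"
   unfolding y_def inner_sum_right using assms that
   by (intro sum.cong) (auto simp: orthonormal_def)
  then show ?thesis using that by simp
 qed
 have "y \<bullet> y = (\<Sum>i<N. (x \<bullet> u i) * (u i \<bullet> y))"
  by (subst (1) y_def) (simp add: inner_sum_left)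
 also have "\<dots> = (\<Sum>i<N. (x \<bullet> u i)^2)"
  using uy by (intro sum.cong) (auto simp: power2_eq_square)
 finally have "(norm (x - y))^2 = (norm x)^2 - (\<Sum>i<N. (x \<bullet> u i)^2)"
  by (simp add: power2_norm_eq_inner inner_diff inner_commute[of y x] xy)
 then show ?thesis using zero_le_power2[of "norm (x - y)"] by linarith
qed

text \<open>By Ky Fan's principle the supremum of the sums for fixed N is the sum of the N largest
  singular values, for a compact operator over the real scalars. Growth like sqrt N characterizes
  weak square summability of the singular values, and the least K is subadditive in the
  operator.\<close>

definition ky_fan_bound :: "('a::real_inner \<Rightarrow> 'a) \<Rightarrow> real \<Rightarrow> bool" where
 "ky_fan_bound T K \<longleftrightarrow> (\<forall>N u e. orthonormal N u \<longrightarrow> orthonormal N e \<longrightarrow>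
   (\<Sum>i<N. \<bar>u i \<bullet> T (e i)\<bar>) \<le> K * sqrt (real N))"

lemma ky_fan_boundD:
 "ky_fan_bound T K \<Longrightarrow> orthonormal N u \<Longrightarrow> orthonormal N e \<Longrightarrow>
   (\<Sum>i<N. \<bar>u i \<bullet> T (e i)\<bar>) \<le> K * sqrt (real N)"
 by (simp add: ky_fan_bound_def)

lemma ky_fan_bound_mono: "ky_fan_bound T K \<Longrightarrow> K \<le> L \<Longrightarrow> ky_fan_bound T L"
 unfolding ky_fan_bound_def by (meson mult_right_mono order_trans real_sqrt_ge_zero of_nat_0_le_iff)

lemma ky_fan_bound_add:
 assumes "ky_fan_bound S K" "ky_fan_bound T L"
 shows "ky_fan_bound (\<lambda>x. S x + T x) (K + L)"
 unfolding ky_fan_bound_def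
proof (intro allI impI)
 fix N and u e :: "nat \<Rightarrow> 'a"
 assume o: "orthonormal N u" "orthonormal N e"
 have "(\<Sum>i<N. \<bar>u i \<bullet> (S (e i) + T (e i))\<bar>) \<le> (\<Sum>i<N. \<bar>u i \<bullet> S (e i)\<bar> + \<bar>u i \<bullet> T (e i)\<bar>)"
  by (intro sum_mono) (simp add: inner_add_right abs_triangle_ineq)
 also have "\<dots> \<le> K * sqrt N + L * sqrt N"
  unfolding sum.distrib using assms o by (intro add_mono ky_fan_boundD)
 finally show "(\<Sum>i<N. \<bar>u i \<bullet> (S (e i) + T (e i))\<bar>) \<le> (K + L) * sqrt N"
  by (simp add: distrib_right)
qed

lemma ky_fan_bound_zero: "ky_fan_bound (\<lambda>x. 0) 0"
 by (simp add: ky_fan_bound_def)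

lemma ky_fan_bound_sum:
 "finite A \<Longrightarrow> (\<And>a. a \<in> A \<Longrightarrow> ky_fan_bound (T a) (K a)) \<Longrightarrow>
  ky_fan_bound (\<lambda>x. \<Sum>a\<in>A. T a x) (\<Sum>a\<in>A. K a)"
 by (induction A rule: finite_induct) (auto intro: ky_fan_bound_zero ky_fan_bound_add)

text \<open>Each instance of the bound tests finitely many vectors, so pointwise convergence of the
  operators suffices.\<close>

lemma ky_fan_bound_limit:
 assumes T: "\<And>x. (\<lambda>n. T n x) \<longlonglongrightarrow> S x" and K: "\<And>n. ky_fan_bound (T n) (K n)" "K \<longlonglongrightarrow> L"
 shows "ky_fan_bound S L"
 unfolding ky_fan_bound_def
proof (intro allI impI)
 fix N and u e :: "nat \<Rightarrow> 'a"
 assume o: "orthonormal N u" "orthonormal N e"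
 have "(\<lambda>n. \<Sum>i<N. \<bar>u i \<bullet> T n (e i)\<bar>) \<longlonglongrightarrow> (\<Sum>i<N. \<bar>u i \<bullet> S (e i)\<bar>)"
  by (intro tendsto_intros T)
 moreover have "(\<lambda>n. K n * sqrt N) \<longlonglongrightarrow> L * sqrt N"
  by (intro tendsto_intros K)
 ultimately show "(\<Sum>i<N. \<bar>u i \<bullet> S (e i)\<bar>) \<le> L * sqrt N"
  using ky_fan_boundD[OF K(1) o] by (intro LIMSEQ_le[of _ _ "\<lambda>n. K n * sqrt N"]) auto
qed

section \<open>From a Ky Fan bound to compactness\<close>

lemma inner_normalize: "x \<noteq> 0 \<Longrightarrow> (x /\<^sub>R norm x) \<bullet> (x /\<^sub>R norm x) = (1 :: real)"
 for x :: "'a::real_inner"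
 using power2_norm_eq_inner[of x, symmetric] by (simp add: power2_eq_square field_simps)

lemma orthonormal_normalize: "x \<noteq> 0 \<Longrightarrow> orthonormal 1 (\<lambda>_. x /\<^sub>R norm x)"
 unfolding orthonormal_def using inner_normalize[of x] by simp

lemma ky_fan_bound_norm:
 fixes T :: "'a::real_inner \<Rightarrow> 'a"
 assumes K: "ky_fan_bound T K" and T: "linear T"
 shows "norm (T x) \<le> K * norm x"
proof (cases "x = 0")
 case True
 then show ?thesis using linear_0[OF T] by simp
next
 case x: False
 show ?thesis
 proof (cases "T x = 0")
  case True
  have "0 \<le> K"
   using ky_fan_boundD[OF K orthonormal_normalize[OF x] orthonormal_normalize[OF x]]
    abs_ge_zero[of "(x /\<^sub>R norm x) \<bullet> T (x /\<^sub>R norm x)"] by simp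
  then show ?thesis using True by simp
 next
  case False
  from ky_fan_boundD[OF K orthonormal_normalize[OF False] orthonormal_normalize[OF x]]
  have "\<bar>(T x /\<^sub>R norm (T x)) \<bullet> T (x /\<^sub>R norm x)\<bar> \<le> K" by simp
  moreover have "(T x /\<^sub>R norm (T x)) \<bullet> T (x /\<^sub>R norm x) = norm (T x) / norm x"
   using False x by (simp add: linear_scale[OF T] power2_norm_eq_inner[symmetric] power2_eq_square field_simps)
  ultimately have "norm (T x) / norm x \<le> K" by (simp only: abs_divide abs_norm_cancel)
  then show ?thesis using x by (simp add: field_simps)
 qed
qed

text \<open>Take an orthonormal system \<open>e\<close> of maximal length whose images are pairwise
  orthogonal and longer than \<eta>. Tested on it, the Ky Fan bound limits the length to (K /
  \<eta>)^2. A vector orthogonal to \<open>e\<close>, with image orthogonal to those of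
  \<open>e\<close>, that violated the conclusion would extend the system.\<close>

lemma ky_fan_bound_finite_defect:
 fixes T :: "'a::real_inner \<Rightarrow> 'a"
 assumes K: "ky_fan_bound T K" and T: "bounded_linear T" and \<eta>: "0 < \<eta>"
 shows "\<exists>(N::nat) l. (\<forall>i<N. bounded_linear (l i :: 'a \<Rightarrow> real)) \<and>
  (\<forall>x. (\<forall>i<N. l i x = 0) \<longrightarrow> norm (T x) \<le> \<eta> * norm x)"
proof -
 define good where "good N e \<longleftrightarrow> orthonormal N e \<and> (\<forall>i<N. norm (T (e i)) > \<eta>) \<and>
  (\<forall>i<N. \<forall>j<N. i \<noteq> j \<longrightarrow> T (e i) \<bullet> T (e j) = 0)" for N and e :: "nat \<Rightarrow> 'a"
 have bound: "real N \<le> (K / \<eta>)^2" if g: "good N e" for N e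
 proof -
  define u where "u i = T (e i) /\<^sub>R norm (T (e i))" for i
  have nz: "T (e i) \<noteq> 0" if "i < N" for i using g \<eta> that by (force simp: good_def)
  have "orthonormal N u"
   unfolding orthonormal_def
  proof (intro allI impI)
   fix i j assume ij: "i < N" "j < N"
   show "u i \<bullet> u j = (if i = j then 1 else 0)"
   proof (cases "i = j")
    case True
    then show ?thesis using inner_normalize[OF nz[OF ij(1)]] by (simp only: u_def) simp
   next
    case False
    then show ?thesis using g ij by (simp add: good_def u_def)
   qed
  qed
  from ky_fan_boundD[OF K this] g have "(\<Sum>i<N. \<bar>u i \<bullet> T (e i)\<bar>) \<le> K * sqrt N"
   by (simp add: good_def)
  moreover have "(\<Sum>i<N. \<eta>) \<le> (\<Sum>i<N. \<bar>u i \<bullet> T (e i)\<bar>)"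
  proof (rule sum_mono)
   fix i assume i: "i \<in> {..<N}"
   have "u i \<bullet> T (e i) = norm (T (e i))"
    using nz[of i] i by (simp add: u_def power2_norm_eq_inner[symmetric] power2_eq_square)
   then show "\<eta> \<le> \<bar>u i \<bullet> T (e i)\<bar>" using g i by (force simp: good_def)
  qed
  ultimately have "\<eta> * (sqrt N * sqrt N) \<le> K * sqrt N" by (simp add: mult.commute)
  then have "\<eta> * sqrt N \<le> K" if "N > 0"
   using that by (simp only: mult.assoc[symmetric]) (erule mult_right_le_imp_le, simp)
  then have "N > 0 \<Longrightarrow> sqrt N \<le> K / \<eta>"
   using \<eta> by (simp add: field_simps)
  then have "N > 0 \<Longrightarrow> (sqrt N)^2 \<le> (K / \<eta>)^2"
   by (intro power_mono) auto
  then show ?thesis by (cases "N > 0") auto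
 qed
 define N where "N = (GREATEST N. \<exists>e. good N e)"
 have "\<exists>e. good 0 e" by (auto simp: good_def orthonormal_def)
 moreover have bN: "\<exists>e. good M e \<Longrightarrow> M \<le> nat \<lceil>(K / \<eta>)^2\<rceil>" for M
  using bound by (metis ceiling_mono ceiling_of_nat nat_int nat_mono)
 ultimately have "\<exists>e. good N e"
  unfolding N_def by (rule GreatestI_nat) auto
 then obtain e where e: "good N e" by blast
 have max: "\<not> good (Suc N) e" for e
 proof
  assume "good (Suc N) e"
  then have "\<exists>e. good (Suc N) e" by blast
  then have "Suc N \<le> N"
   unfolding N_def by (rule Greatest_le_nat) (rule bN)
  then show False by simp
 qed
 \<comment> \<open>Two batches of N functionals: the first keeps a new vector orthogonal to
   \<open>e\<close>, the second keeps its image orthogonal to the images of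
   \<open>e\<close>.\<close>
 define l where "l i x = (if i < N then e i \<bullet> x else T (e (i - N)) \<bullet> T x)" for i x
 have "bounded_linear (l i)" for i
  unfolding l_def
  by (cases "i < N") (auto intro!: bounded_linear_inner_right bounded_linear_compose[OF bounded_linear_inner_right T])
 moreover have "norm (T x) \<le> \<eta> * norm x" if x: "\<forall>i<N+N. l i x = 0" for x
 proof (rule ccontr)
  assume c: "\<not> norm (T x) \<le> \<eta> * norm x"
  then have nz: "x \<noteq> 0" using linear_0[OF bounded_linear.linear[OF T]] by auto
  have x1: "e i \<bullet> x = 0" if "i < N" for i using x that by (auto simp: l_def dest: spec[of _ i])
  have x2: "T (e i) \<bullet> T x = 0" if "i < N" for i using x that by (auto simp: l_def dest: spec[of _ "N + i"])
  have Ts: "T (c *\<^sub>R x) = c *\<^sub>R T x" for c by (rule linear_scale[OF bounded_linear.linear[OF T]])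
  define y where "y = x /\<^sub>R norm x"
  have y: "y \<bullet> y = 1" unfolding y_def by (rule inner_normalize[OF nz])
  have y1: "e i \<bullet> y = 0" "y \<bullet> e i = 0" "T (e i) \<bullet> T y = 0" "T y \<bullet> T (e i) = 0" if "i < N" for i
   using x1[OF that] x2[OF that] by (simp_all add: y_def Ts inner_commute)
  have y2: "norm (T y) > \<eta>" using c nz by (simp add: y_def Ts field_simps)
  have "good (Suc N) (e(N := y))"
   unfolding good_def orthonormal_def using e y y1 y2
   by (auto simp: good_def orthonormal_def less_Suc_eq)
  then show False using max by blast
 qed
 ultimately show ?thesis by (intro exI[of _ "N + N"] exI[of _ l]) simp
qed

text \<open>The kernel conditions are dropped one at a time. A vector \<open>v\<close> on which the
  last functional equals 1 corrects \<open>x\<close> into the smaller kernel, at a cost proportional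
  to that functional. The outcome holds for all vectors and can be applied to differences in a
  sequence.\<close>

lemma absorb_functionals:
 fixes T :: "'a::real_normed_vector \<Rightarrow> 'a" and l :: "nat \<Rightarrow> 'a \<Rightarrow> real"
 assumes T: "bounded_linear T" and l: "\<And>i. i < N \<Longrightarrow> bounded_linear (l i)" and \<eta>: "0 \<le> \<eta>"
  and small: "\<And>x. (\<forall>i<N. l i x = 0) \<Longrightarrow> norm (T x) \<le> \<eta> * norm x"
 shows "\<exists>C\<ge>0. \<forall>x. norm (T x) \<le> \<eta> * norm x + C * (\<Sum>i<N. \<bar>l i x\<bar>)"
proof -
 have "\<exists>C\<ge>0. \<forall>x. (\<forall>i<N-k. l i x = 0) \<longrightarrow> norm (T x) \<le> \<eta> * norm x + C * (\<Sum>i<N. \<bar>l i x\<bar>)"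
  if "k \<le> N" for k
  using that
 proof (induction k)
  case 0
  then show ?case using small by (intro exI[of _ 0]) auto
 next
  case (Suc k)
  then obtain C where C: "C \<ge> 0"
   "\<And>x. (\<forall>i<N-k. l i x = 0) \<Longrightarrow> norm (T x) \<le> \<eta> * norm x + C * (\<Sum>i<N. \<bar>l i x\<bar>)" by auto
  define m where "m = N - Suc k"
  have m: "N - k = Suc m" "m < N" using Suc.prems by (auto simp: m_def)
  show ?case
  proof (cases "\<exists>v. (\<forall>i<m. l i v = 0) \<and> l m v \<noteq> 0")
   case False
   then have "norm (T x) \<le> \<eta> * norm x + C * (\<Sum>i<N. \<bar>l i x\<bar>)" if "\<forall>i<m. l i x = 0" for x
    using that C(2)[of x] unfolding m by (auto simp: less_Suc_eq)
   then show ?thesis using C(1) unfolding m_def by blast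
  next
   case True
   then obtain w where w: "\<forall>i<m. l i w = 0" "l m w \<noteq> 0" by blast
   define v where "v = w /\<^sub>R l m w"
   have v: "l i v = 0" if "i < m" for i
    using w that linear_scale[OF bounded_linear.linear[OF l]] m by (simp add: v_def)
   have v1: "l m v = 1"
    using w linear_scale[OF bounded_linear.linear[OF l[OF m(2)]]] by (simp add: v_def)
   \<comment> \<open>Besides C, it pays for subtracting a multiple of \<open>v\<close>: in the norm,
     in the image and in the values of the functionals.\<close>
   define D where "D = C + (\<eta> * norm v + norm (T v) + C * (\<Sum>i<N. \<bar>l i v\<bar>))"
   have D0: "D - C \<ge> 0" using C(1) \<eta> by (simp add: D_def sum_nonneg)
   have "norm (T x) \<le> \<eta> * norm x + D * (\<Sum>i<N. \<bar>l i x\<bar>)" if x: "\<forall>i<m. l i x = 0" for x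
   proof -
    define y where "y = x - l m x *\<^sub>R v"
    have ly: "l i y = l i x - l m x * l i v" if "i < N" for i
     using linear_diff[OF bounded_linear.linear[OF l[OF that]]]
      linear_scale[OF bounded_linear.linear[OF l[OF that]]] by (simp add: y_def)
    have "\<forall>i<N-k. l i y = 0"
     using x v v1 ly m by (auto simp: less_Suc_eq)
    then have *: "norm (T y) \<le> \<eta> * norm y + C * (\<Sum>i<N. \<bar>l i y\<bar>)" by (rule C(2))
    have "norm y \<le> norm x + \<bar>l m x\<bar> * norm v"
     unfolding y_def using norm_triangle_ineq4[of x "l m x *\<^sub>R v"] by simp
    then have 1: "\<eta> * norm y \<le> \<eta> * norm x + \<bar>l m x\<bar> * (\<eta> * norm v)"
     using mult_left_mono[OF _ \<eta>] by (fastforce simp: algebra_simps)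
    have "(\<Sum>i<N. \<bar>l i y\<bar>) \<le> (\<Sum>i<N. \<bar>l i x\<bar> + \<bar>l m x\<bar> * \<bar>l i v\<bar>)"
     by (intro sum_mono) (use ly in \<open>auto simp: abs_mult[symmetric] intro: abs_triangle_ineq4\<close>)
    then have 2: "C * (\<Sum>i<N. \<bar>l i y\<bar>) \<le> C * (\<Sum>i<N. \<bar>l i x\<bar>) + \<bar>l m x\<bar> * (C * (\<Sum>i<N. \<bar>l i v\<bar>))"
     using mult_left_mono[OF _ C(1)] by (fastforce simp: algebra_simps sum.distrib sum_distrib_left)
    have "T x = T y + l m x *\<^sub>R T v"
     using linear_diff[OF bounded_linear.linear[OF T]] linear_scale[OF bounded_linear.linear[OF T]]
     by (simp add: y_def)
    then have 3: "norm (T x) \<le> norm (T y) + \<bar>l m x\<bar> * norm (T v)"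
     using norm_triangle_ineq[of "T y" "l m x *\<^sub>R T v"] by simp
    have "\<bar>l m x\<bar> \<le> (\<Sum>i<N. \<bar>l i x\<bar>)" using m by (intro member_le_sum) auto
    then have "\<bar>l m x\<bar> * (D - C) \<le> (\<Sum>i<N. \<bar>l i x\<bar>) * (D - C)"
     using D0 by (rule mult_right_mono)
    moreover have "norm (T x) \<le> \<eta> * norm x + C * (\<Sum>i<N. \<bar>l i x\<bar>) + \<bar>l m x\<bar> * (D - C)"
     using * 1 2 3 by (simp add: D_def algebra_simps)
    ultimately show ?thesis by (simp add: algebra_simps)
   qed
   moreover have "D \<ge> 0" using D0 C by simp
   ultimately show ?thesis unfolding m_def by blast
  qed
 qed
 from this[of N] show ?thesis by simp
qed

text \<open>A diagonal subsequence makes all of the countably many functionals converge along the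
  bounded sequence. For each k the images then differ in the limit by at most 2 M / (k + 1), so they
  form a Cauchy sequence.\<close>

lemma ky_fan_bound_compact:
 fixes T :: "'a::{real_inner, banach} \<Rightarrow> 'a"
 assumes K: "ky_fan_bound T K" and T: "bounded_linear T" and x: "\<And>n::nat. norm (x n) \<le> M"
 shows "\<exists>r::nat\<Rightarrow>nat. strict_mono r \<and> convergent (\<lambda>n. T (x (r n)))"
proof -
 have "\<exists>(N::nat) l C. (\<forall>i<N. bounded_linear (l i :: 'a \<Rightarrow> real)) \<and> C \<ge> 0 \<and>
   (\<forall>x. norm (T x) \<le> 1 / Suc k * norm x + C * (\<Sum>i<N. \<bar>l i x\<bar>))" for k
 proof -
  obtain N :: nat and l where Nl: "\<forall>i<N. bounded_linear (l i :: 'a \<Rightarrow> real)"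
    "\<forall>x. (\<forall>i<N. l i x = 0) \<longrightarrow> norm (T x) \<le> 1 / Suc k * norm x"
   using ky_fan_bound_finite_defect[OF K T, of "1 / Suc k"] by auto
  with absorb_functionals[OF T, of N l "1 / Suc k"] show ?thesis by auto
 qed
 then obtain N :: "nat \<Rightarrow> nat" and l C where l: "\<And>k i. i < N k \<Longrightarrow> bounded_linear (l k i :: 'a \<Rightarrow> real)"
  and C: "\<And>k. C k \<ge> 0" "\<And>k x. norm (T x) \<le> 1 / Suc k * norm x + C k * (\<Sum>i<N k. \<bar>l k i x\<bar>)"
  by metis
 \<comment> \<open>All pairs (k, i) are listed in one sequence; the value 0 at idle indices keeps
   the numbers bounded.\<close>
 define f where "f j n = (case prod_decode j of (k, i) \<Rightarrow> if i < N k then l k i (x n) else 0)" for j n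
 interpret subseqs "\<lambda>j s. convergent (\<lambda>n. f j (s n))"
 proof
  fix j and s :: "nat \<Rightarrow> nat"
  assume "strict_mono s"
  obtain k i where ki: "prod_decode j = (k, i)" by fastforce
  have "bounded (range (\<lambda>n. f j (s n)))"
  proof (cases "i < N k")
   case True
   obtain B where B: "\<And>x. norm (l k i x) \<le> norm x * B"
    using bounded_linear.bounded[OF l[OF True]] by blast
   have "norm (f j (s n)) \<le> M * \<bar>B\<bar>" for n
   proof -
    have "norm (l k i (x (s n))) \<le> norm (x (s n)) * \<bar>B\<bar>"
     using order_trans[OF B mult_left_mono[OF abs_ge_self]] by auto
    also have "\<dots> \<le> M * \<bar>B\<bar>" by (intro mult_right_mono x) auto
    finally show ?thesis by (simp add: f_def ki True)
   qed
   then show ?thesis unfolding bounded_iff by auto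
  qed (auto simp: f_def ki)
  then obtain L r where "strict_mono (r :: nat \<Rightarrow> nat)" "((\<lambda>n. f j (s n)) \<circ> r) \<longlonglongrightarrow> L"
   using bounded_imp_convergent_subsequence by blast
  then show "\<exists>r'. strict_mono r' \<and> convergent (\<lambda>n. f j ((s \<circ> r') n))"
   by (auto simp: o_def convergent_def)
 qed
 define r where "r = diagseq"
 have r: "strict_mono r" unfolding r_def by (rule subseq_diagseq)
 have conv: "convergent (\<lambda>n. f j (r n))" for j
 proof -
  have "convergent (\<lambda>n. f j ((diagseq \<circ> (+) (Suc j)) n))"
  proof (rule diagseq_holds)
   fix j and s t :: "nat \<Rightarrow> nat"
   assume "strict_mono t" "convergent (\<lambda>n. f j (s n))"
   then show "convergent (\<lambda>n. f j ((s \<circ> t) n))"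
    using convergent_subseq_convergent[of "\<lambda>n. f j (s n)" t] by (simp add: o_def)
  qed
  then have "convergent (\<lambda>n. f j (r (n + Suc j)))"
   by (simp add: r_def o_def add.commute)
  then show ?thesis by (subst (asm) convergent_ignore_initial_segment)
 qed
 have "Cauchy (\<lambda>n. T (x (r n)))"
 proof (rule metric_CauchyI)
  fix e :: real assume e: "0 < e"
  have M0: "M \<ge> 0" using order_trans[OF norm_ge_zero x[of 0]] .
  obtain k where k: "4 * M / e < real k"
   using reals_Archimedean2 by blast
  have k1: "1 / Suc k * (2 * M) < e / 2"
   using k e by (simp add: field_simps)
  define \<delta> where "\<delta> = e / (2 * (C k * N k + 1))"
  have \<delta>: "\<delta> > 0" using e C(1)[of k] by (simp add: \<delta>_def add_nonneg_pos)
  have "\<exists>n0. \<forall>m\<ge>n0. \<forall>n\<ge>n0. \<bar>l k i (x (r m)) - l k i (x (r n))\<bar> < \<delta>" if i: "i < N k" for i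
  proof -
   have "Cauchy (\<lambda>n. f (prod_encode (k, i)) (r n))"
    using conv by (rule convergent_Cauchy)
   then show ?thesis
    using i \<delta> by (auto simp: f_def Cauchy_def dist_real_def)
  qed
  then obtain n0 where n0: "\<And>i m n. i < N k \<Longrightarrow> m \<ge> n0 i \<Longrightarrow> n \<ge> n0 i \<Longrightarrow> \<bar>l k i (x (r m)) - l k i (x (r n))\<bar> < \<delta>"
   by metis
  define n1 where "n1 = (\<Sum>i<N k. n0 i)"
  have n1: "n0 i \<le> n1" if "i < N k" for i
   unfolding n1_def using that by (intro member_le_sum) auto
  show "\<exists>n1. \<forall>m\<ge>n1. \<forall>n\<ge>n1. dist (T (x (r m))) (T (x (r n))) < e"
  proof (intro exI allI impI)
   fix m n assume mn: "m \<ge> n1" "n \<ge> n1"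
   define d where "d = x (r m) - x (r n)"
   have "norm d \<le> 2 * M"
    using norm_triangle_ineq4[of "x (r m)" "x (r n)"] x[of "r m"] x[of "r n"] by (simp add: d_def)
   then have a: "1 / Suc k * norm d < e / 2"
    using le_less_trans[OF mult_left_mono[of "norm d" "2 * M" "1 / Suc k"] k1] by simp
   have "(\<Sum>i<N k. \<bar>l k i d\<bar>) \<le> (\<Sum>i<N k. \<delta>)"
   proof (rule sum_mono)
    fix i assume i: "i \<in> {..<N k}"
    then show "\<bar>l k i d\<bar> \<le> \<delta>"
     using n0[of i m n] n1[of i] mn linear_diff[OF bounded_linear.linear[OF l[of i k]]]
     by (force simp: d_def)
   qed
   then have "C k * (\<Sum>i<N k. \<bar>l k i d\<bar>) \<le> C k * (N k * \<delta>)"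
    using C(1) by (intro mult_left_mono) auto
   also have "\<dots> \<le> e / 2"
   proof -
    have "C k * N k * e \<le> (C k * N k + 1) * e" using e by simp
    moreover have "0 < C k * N k + 1" using C(1)[of k] by (simp add: add_nonneg_pos)
    ultimately show ?thesis by (simp add: \<delta>_def field_simps)
   qed
   finally have "norm (T d) < e"
    using C(2)[of d k] a by linarith
   then show "dist (T (x (r m))) (T (x (r n))) < e"
    using linear_diff[OF bounded_linear.linear[OF T]] by (simp add: dist_norm d_def)
  qed
 qed
 then show ?thesis using r by (auto simp: Cauchy_convergent_iff)
qed

section \<open>Maximizers and the Euler-Lagrange equation\<close>

lemma quadratic_nonneg_linear_zero:
 fixes a b :: real
 assumes "\<And>t. 0 \<le> a * t + b * t^2"
 shows "a = 0"
proof (rule ccontr)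
 assume a: "a \<noteq> 0"
 define c where "c = \<bar>b\<bar> + 1"
 have c: "c > 0" "b < c" by (auto simp: c_def)
 have "0 \<le> (a * (- a / c) + b * (- a / c)^2) * c^2"
  using assms[of "- a / c"] by simp
 also have "\<dots> = a^2 * (b - c)"
  using c by (simp add: field_simps power2_eq_square)
 also have "\<dots> < 0"
  using a c by (intro mult_pos_neg) auto
 finally show False by simp
qed

text \<open>By compactness a maximizing sequence has convergent images along a subsequence. The
  parallelogram law, applied to the points and to their images, turns this into convergence of the
  points themselves because the supremum \<mu> is positive; the limit stays in the closed
  subspace.\<close>

lemma maximizer_exists:
 fixes T :: "'a::{real_inner, banach} \<Rightarrow> 'a"
 assumes K: "ky_fan_bound T K" and T: "bounded_linear T"
  and V: "subspace V" "closed V" and w: "w \<in> V" "w \<noteq> 0"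
 shows "\<exists>e\<in>V. norm e = 1 \<and> (\<forall>x\<in>V. norm (T x) \<le> norm (T e) * norm x)"
proof -
 note lin = bounded_linear.linear[OF T]
 define S where "S = (\<lambda>x. norm (T x)) ` {x\<in>V. norm x = 1}"
 define \<mu> where "\<mu> = Sup S"
 have w1: "w /\<^sub>R norm w \<in> V" "norm (w /\<^sub>R norm w) = 1"
  using w V(1) by (auto intro: subspace_scale)
 then have ne: "S \<noteq> {}" by (auto simp: S_def)
 have bdd: "bdd_above S"
  using ky_fan_bound_norm[OF K lin] by (auto simp: S_def intro!: bdd_aboveI2[where M = K]) (metis mult.right_neutral)
 have upper: "norm (T x) \<le> \<mu> * norm x" if "x \<in> V" for x
 proof (cases "x = 0")
  case False
  have "norm (T (x /\<^sub>R norm x)) \<le> \<mu>"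
   unfolding \<mu>_def using that False V(1)
   by (intro cSup_upper bdd) (auto simp: S_def intro!: imageI subspace_scale)
  then show ?thesis using False by (simp add: linear_scale[OF lin] field_simps)
 qed (simp add: linear_0[OF lin])
 have "\<mu> \<ge> 0" using upper[OF w(1)] w by (metis mult_le_cancel_right_pos mult_zero_left norm_ge_zero order_trans zero_less_norm_iff)
 show ?thesis
 proof (cases "\<mu> = 0")
  case True
  then show ?thesis using upper w1 by (intro bexI[of _ "w /\<^sub>R norm w"]) auto
 next
  case False
  then have \<mu>: "\<mu> > 0" using \<open>\<mu> \<ge> 0\<close> by simp
  have "\<exists>x\<in>V. norm x = 1 \<and> norm (T x) > \<mu> - 1 / Suc n" for n
   using less_cSup_iff[OF ne bdd, of "\<mu> - 1 / Suc n"] by (auto simp: \<mu>_def S_def)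
  then obtain x where x: "\<And>n. x n \<in> V" "\<And>n. norm (x n) = 1" "\<And>n. norm (T (x n)) > \<mu> - 1 / Suc n"
   by metis
  have lim: "(\<lambda>n. norm (T (x n))) \<longlonglongrightarrow> \<mu>"
  proof (rule tendsto_sandwich[of "\<lambda>n. \<mu> - 1 / Suc n" _ _ "\<lambda>_. \<mu>"])
   show "(\<lambda>n. \<mu> - 1 / Suc n) \<longlonglongrightarrow> \<mu>"
    using tendsto_diff[OF tendsto_const LIMSEQ_inverse_real_of_nat] by (simp add: inverse_eq_divide)
   show "\<forall>\<^sub>F n in sequentially. norm (T (x n)) \<le> \<mu>"
    using upper[OF x(1)] x(2) by (intro always_eventually) (metis mult.right_neutral)
  qed (use x(3) in \<open>auto intro!: always_eventually less_imp_le\<close>)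
  obtain r :: "nat \<Rightarrow> nat" where r: "strict_mono r" "convergent (\<lambda>n. T (x (r n)))"
   using ky_fan_bound_compact[OF K T, of x 1] x(2) by auto
  define y where "y n = x (r n)" for n
  have y: "y n \<in> V" "norm (y n) = 1" for n by (simp_all add: y_def x)
  have limy: "(\<lambda>n. (norm (T (y n)))^2) \<longlonglongrightarrow> \<mu>^2"
   using LIMSEQ_subseq_LIMSEQ[OF lim r(1)] by (intro tendsto_power) (simp add: o_def y_def)
  have key: "\<mu>^2 * (norm (y a - y b))^2 \<le> (norm (T (y a) - T (y b)))^2
    + 2 * \<bar>(norm (T (y a)))^2 - \<mu>\<^sup>2\<bar> + 2 * \<bar>(norm (T (y b)))^2 - \<mu>\<^sup>2\<bar>" for a b
  proof -
   have "(norm (T (y a + y b)))^2 \<le> (\<mu> * norm (y a + y b))^2"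
    using upper[of "y a + y b"] y V(1) by (intro power_mono) (auto intro: subspace_add)
   then have "(norm (T (y a) + T (y b)))^2 \<le> \<mu>^2 * (norm (y a + y b))^2"
    by (simp add: linear_add[OF lin] power_mult_distrib)
   moreover have par: "(norm (u + v))^2 + (norm (u - v))^2 = 2 * (norm u)^2 + 2 * (norm v)^2" for u v :: 'a
    unfolding power2_norm_eq_inner by (simp add: inner_simps)
   note par[of "T (y a)" "T (y b)"]
   moreover have "\<mu>^2 * (norm (y a - y b))^2 = \<mu>^2 * 4 - \<mu>\<^sup>2 * (norm (y a + y b))^2"
    unfolding right_diff_distrib[symmetric] using par[of "y a" "y b"] y(2) by simp
   ultimately have "\<mu>^2 * (norm (y a - y b))^2 \<le> (norm (T (y a) - T (y b)))^2
    + 4 * \<mu>^2 - 2 * (norm (T (y a)))^2 - 2 * (norm (T (y b)))^2" by linarith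
   moreover have "P \<le> D + 4 * m - 2 * A - 2 * B \<Longrightarrow> P \<le> D + 2 * \<bar>A - m\<bar> + 2 * \<bar>B - m\<bar>" for P D m A B :: real
    by (simp add: abs_if)
   ultimately show ?thesis by blast
  qed
  have "Cauchy y"
  proof (rule metric_CauchyI)
   fix e :: real assume e: "0 < e"
   \<comment> \<open>The three terms of \<open>key\<close> contribute less than \<delta>, 2 \<delta>
     and 2 \<delta>, in total less than 6 \<delta>.\<close>
   define \<delta> where "\<delta> = \<mu>^2 * e^2 / 6"
   have \<delta>: "\<delta> > 0" using e \<mu> by (simp add: \<delta>_def)
   obtain n1 where n1: "\<And>n. n \<ge> n1 \<Longrightarrow> \<bar>(norm (T (y n)))^2 - \<mu>\<^sup>2\<bar> < \<delta>"
    using LIMSEQ_D[OF limy \<delta>] by auto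
   obtain n2 where n2: "\<And>m n. m \<ge> n2 \<Longrightarrow> n \<ge> n2 \<Longrightarrow> norm (T (y m) - T (y n)) < sqrt \<delta>"
    using CauchyD[OF convergent_Cauchy[OF r(2)], of "sqrt \<delta>"] \<delta> by (auto simp: y_def)
   show "\<exists>M. \<forall>m\<ge>M. \<forall>n\<ge>M. dist (y m) (y n) < e"
   proof (intro exI[of _ "max n1 n2"] allI impI)
    fix m n assume mn: "m \<ge> max n1 n2" "n \<ge> max n1 n2"
    have "(norm (T (y m) - T (y n)))^2 < (sqrt \<delta>)^2"
     using n2[of m n] mn by (intro power_strict_mono) auto
    then have "\<mu>^2 * (norm (y m - y n))^2 < \<mu>^2 * e^2"
     using key[of m n] n1[of m] n1[of n] mn \<delta> by (simp add: \<delta>_def)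
    then have "(norm (y m - y n))^2 < e^2" using \<mu> by simp
    then show "dist (y m) (y n) < e"
     using e by (simp add: dist_norm power2_less_imp_less)
   qed
  qed
  then obtain e where e: "y \<longlonglongrightarrow> e" by (auto simp: Cauchy_convergent_iff convergent_def)
  have "e \<in> V" using closed_sequentially[OF V(2) _ e] y by blast
  moreover have "norm e = 1"
   using LIMSEQ_unique[OF tendsto_norm[OF e]] y(2) by simp
  moreover have "norm (T e) = \<mu>"
   using LIMSEQ_unique[OF tendsto_norm[OF bounded_linear.tendsto[OF T e]]]
    LIMSEQ_subseq_LIMSEQ[OF lim r(1)] by (simp add: o_def y_def)
  ultimately show ?thesis using upper by (intro bexI[of _ e]) auto
 qed
qed

text \<open>The function \<open>(norm (T e))^2 * (norm x)^2 - (norm (T x))^2\<close> is nonnegative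
  on V and vanishes at \<open>e\<close>. Along \<open>e + t *\<^sub>R z\<close> it is a quadratic
  polynomial in t without constant term, so its linear coefficient is 0.\<close>

lemma maximizer_euler_lagrange:
 fixes T :: "'a::real_inner \<Rightarrow> 'a"
 assumes T: "linear T" and V: "subspace V" and e: "e \<in> V" "norm e = 1"
  and max: "\<And>x. x \<in> V \<Longrightarrow> norm (T x) \<le> norm (T e) * norm x" and z: "z \<in> V"
 shows "T z \<bullet> T e = (norm (T e))^2 * (z \<bullet> e)"
proof -
 let ?m = "(norm (T e))^2"
 have "0 \<le> 2 * (?m * (z \<bullet> e) - T z \<bullet> T e) * t + (?m * (z \<bullet> z) - T z \<bullet> T z) * t^2" for t
 proof -
  have "(norm (T (e + t *\<^sub>R z)))^2 \<le> (norm (T e) * norm (e + t *\<^sub>R z))^2"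
   using V e(1) z by (intro power_mono max) (auto intro: subspace_add subspace_scale)
  moreover have expand: "(norm (a + t *\<^sub>R b))^2 = (norm a)^2 + 2 * t * (b \<bullet> a) + t^2 * (b \<bullet> b)" for a b :: 'a
   unfolding power2_norm_eq_inner
   by (simp add: inner_simps inner_commute[of a b] power2_eq_square algebra_simps)
  note expand[of e z] expand[of "T e" "T z"]
  ultimately show ?thesis using e(2)
   by (simp add: linear_add[OF T] linear_scale[OF T] power_mult_distrib algebra_simps)
 qed
 then have "2 * (?m * (z \<bullet> e) - T z \<bullet> T e) = 0"
  by (rule quadratic_nonneg_linear_zero)
 then show ?thesis by simp
qed

subsection \<open>Singular vectors of operators on square integrable functions\<close>

lemma cin_orthonormal_expand:
 fixes u :: "'i \<Rightarrow> 'n::finite l2"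
 assumes A: "finite A" and u: "\<And>a b. a \<in> A \<Longrightarrow> b \<in> A \<Longrightarrow> cin (u a) (u b) = (if a = b then 1 else 0)"
  and b: "b \<in> A"
 shows "cin (u b) (\<Sum>a\<in>A. cs (c a) (u a)) = c b"
proof -
 have "cin (u b) (\<Sum>a\<in>A. cs (c a) (u a)) = (\<Sum>a\<in>A. if b = a then c b else 0)"
  unfolding cin_sum_right using u b by (intro sum.cong) (auto simp: cin_cs_right)
 then show ?thesis using A b by simp
qed

lemma norm_cin_orthonormal_sum:
 fixes u :: "'i \<Rightarrow> 'n::finite l2"
 assumes A: "finite A" and u: "\<And>a b. a \<in> A \<Longrightarrow> b \<in> A \<Longrightarrow> cin (u a) (u b) = (if a = b then 1 else 0)"
 shows "(norm (\<Sum>a\<in>A. cs (c a) (u a)))^2 = (\<Sum>a\<in>A. (cmod (c a))^2)"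
proof -
 have "cin (\<Sum>a\<in>A. cs (c a) (u a)) (\<Sum>a\<in>A. cs (c a) (u a)) = (\<Sum>a\<in>A. cnj (c a) * c a)"
  unfolding cin_sum_left[of _ A]
  by (intro sum.cong refl) (simp only: cin_cs_left cin_orthonormal_expand[OF A u])
 also have "\<dots> = of_real (\<Sum>a\<in>A. (cmod (c a))^2)"
  by (simp only: of_real_sum complex_norm_square mult.commute)
 finally show ?thesis by (simp only: cin_same of_real_eq_iff)
qed

lemma bessel_complex:
 fixes u :: "'i \<Rightarrow> 'n::finite l2"
 assumes A: "finite A" and u: "\<And>a b. a \<in> A \<Longrightarrow> b \<in> A \<Longrightarrow> cin (u a) (u b) = (if a = b then 1 else 0)"
 shows "(\<Sum>a\<in>A. (cmod (cin (u a) x))^2) \<le> (norm x)^2"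
proof -
 define y where "y = (\<Sum>a\<in>A. cs (cin (u a) x) (u a))"
 have "cin y x = (\<Sum>a\<in>A. cnj (cin (u a) x) * cin (u a) x)"
  by (simp only: y_def cin_sum_left cin_cs_left)
 also have "\<dots> = of_real (\<Sum>a\<in>A. (cmod (cin (u a) x))^2)"
  by (simp only: of_real_sum complex_norm_square mult.commute)
 finally have "y \<bullet> x = (\<Sum>a\<in>A. (cmod (cin (u a) x))^2)"
  by (simp add: inner_eq_Re_cin del: of_real_sum)
 moreover have "y \<bullet> y = (\<Sum>a\<in>A. (cmod (cin (u a) x))^2)"
  using norm_cin_orthonormal_sum[OF A u] by (simp add: y_def flip: power2_norm_eq_inner)
 ultimately have "(norm (x - y))^2 = (norm x)^2 - (\<Sum>a\<in>A. (cmod (cin (u a) x))^2)"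
  by (simp add: power2_norm_eq_inner inner_diff inner_commute[of x y])
 then show ?thesis using zero_le_power2[of "norm (x - y)"] by linarith
qed

text \<open>Dimension count by Bessel in both directions. If nothing were orthogonal to the n
  vectors \<open>e\<close>, they would span each \<open>h k\<close>, and the squared coefficients of
  n + 1 vectors \<open>h k\<close> would sum to n + 1 by rows and to at most n by columns.\<close>

lemma cin_orthogonal_exists:
 fixes h e :: "nat \<Rightarrow> 'n::finite l2"
 assumes h: "\<And>j k. cin (h j) (h k) = (if j = k then 1 else 0)"
  and e: "\<And>i j. i < n \<Longrightarrow> j < n \<Longrightarrow> cin (e i) (e j) = (if i = j then 1 else 0)"
 shows "\<exists>x\<noteq>0. \<forall>i<n. cin (e i) x = 0"
proof (rule ccontr)
 assume *: "\<not> ?thesis"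
 have h_eq: "h k = (\<Sum>i<n. cs (cin (e i) (h k)) (e i))" for k
 proof -
  have "cin (e i) (h k - (\<Sum>i<n. cs (cin (e i) (h k)) (e i))) = 0" if "i < n" for i
   using cin_orthonormal_expand[of "{..<n}" e i "\<lambda>i. cin (e i) (h k)"] e that
   by (simp add: cin_minus_right)
  then have "h k - (\<Sum>i<n. cs (cin (e i) (h k)) (e i)) = 0" using * by blast
  then show ?thesis by simp
 qed
 have norm1: "(norm v)^2 = 1" if "cin v v = 1" for v :: "'n l2"
  using that cin_same[of v] by (simp del: of_real_power)
 have one: "(\<Sum>i<n. (cmod (cin (e i) (h k)))^2) = 1" for k
 proof -
  have "(\<Sum>i<n. (cmod (cin (e i) (h k)))^2) = (norm (\<Sum>i<n. cs (cin (e i) (h k)) (e i)))^2"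
   by (rule norm_cin_orthonormal_sum[symmetric]) (use e in auto)
  also have "\<dots> = 1" using norm1[of "h k"] h[of k k] h_eq[of k] by simp
  finally show ?thesis .
 qed
 have "real (Suc n) = (\<Sum>k<Suc n. \<Sum>i<n. (cmod (cin (e i) (h k)))^2)"
  by (simp only: one) simp
 also have "\<dots> = (\<Sum>i<n. \<Sum>k<Suc n. (cmod (cin (h k) (e i)))^2)"
  by (subst sum.swap) (simp only: cin_commute[symmetric, of "e _" "h _"] complex_mod_cnj)
 also have "\<dots> \<le> (\<Sum>i<n. 1)"
 proof (rule sum_mono)
  fix i assume i: "i \<in> {..<n}"
  have "(\<Sum>k<Suc n. (cmod (cin (h k) (e i)))^2) \<le> (norm (e i))^2"
   using h by (intro bessel_complex) auto
  also have "\<dots> = 1" using e[of i i] i norm1[of "e i"] by simp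
  finally show "(\<Sum>k<Suc n. (cmod (cin (h k) (e i)))^2) \<le> 1" .
 qed
 finally show False by simp
qed

text \<open>Each \<open>e j\<close> maximizes the length of the image among the unit vectors
  orthogonal to its predecessors; the infinite system \<open>h\<close> ensures that there are such
  vectors at every stage. The Euler-Lagrange equation makes \<open>e j\<close> an eigenvector of the
  adjoint of T composed with T. The Ky Fan bound is then tested on \<open>e\<close> and the
  normalized images.\<close>

lemma singular_vectors:
 fixes T :: "'n::finite l2 \<Rightarrow> 'n l2" and h :: "nat \<Rightarrow> 'n l2"
 assumes T: "bounded_linear T" and Tc: "\<And>c x. T (cs c x) = cs c (T x)" and K: "ky_fan_bound T K"
  and h: "\<And>j k. cin (h j) (h k) = (if j = k then 1 else 0)"
 obtains e where
  "\<And>j k. cin (e j) (e k) = (if j = k then 1 else 0)"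
  "decseq (\<lambda>j. norm (T (e j)))"
  "\<And>j z. cin (T z) (T (e j)) = of_real ((norm (T (e j)))^2) * cin z (e j)"
  "\<And>x. \<forall>j. cin (e j) x = 0 \<Longrightarrow> T x = 0"
  "\<And>j. sqrt (real j + 1) * norm (T (e j)) \<le> K"
proof -
 note lin = bounded_linear.linear[OF T]
 define V where "V e j = {x. \<forall>i<j. cin (e i) x = 0}" for e :: "nat \<Rightarrow> 'n l2" and j :: nat
 have subV: "subspace (V e j)" for e j
  by (auto simp: V_def subspace_def cin_add_right cin_scaleR_right)
 have closedV: "closed (V e j)" for e j
 proof -
  have "V e j = (\<Inter>i\<in>{..<j}. {x. cin (e i) x = 0})" by (auto simp: V_def)
  moreover have "closed {x. cin (e i) x = 0}" for i
   by (intro closed_Collect_eq bounded_linear.continuous_on[OF bounded_linear_cin] continuous_intros)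
  ultimately show ?thesis by auto
 qed
 define P where "P e j r \<longleftrightarrow> r \<in> V e j \<and> norm r = 1 \<and> (\<forall>x\<in>V e j. norm (T x) \<le> norm (T r) * norm x)" for e j r
 have on: "cin (e i) (e k) = (if i = k then 1 else 0)" if "\<And>y. y < j \<Longrightarrow> P e y (e y)" "i < j" "k < j" for e i j k
 proof (cases i k rule: linorder_cases)
  case less
  then show ?thesis using that(1)[OF that(3)] by (simp add: P_def V_def)
 next
  case equal
  then show ?thesis using that(1)[OF that(3)] cin_same[of "e k"] by (simp add: P_def)
 next
  case greater
  then have "cin (e k) (e i) = 0" using that(1)[OF that(2)] by (simp add: P_def V_def)
  then show ?thesis using greater cin_commute[of "e k" "e i"] by simp
 qed
 \<comment> \<open>Choice along the order of the indices: \<open>P f j\<close> depends on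
   \<open>f\<close> only below j.\<close>
 have "\<exists>e. \<forall>j. P e j (e j)"
 proof (rule dependent_wellorder_choice)
  fix r and f g :: "nat \<Rightarrow> 'n l2" and x :: nat
  assume "\<And>y. y < x \<Longrightarrow> f y = g y"
  then have "V f x = V g x" by (auto simp: V_def)
  then show "P f x r = P g x r" by (simp add: P_def)
 next
  fix j :: nat and f :: "nat \<Rightarrow> 'n l2"
  assume IH: "\<And>y. y < j \<Longrightarrow> P f y (f y)"
  obtain w where "w \<noteq> 0" "w \<in> V f j"
   using cin_orthogonal_exists[OF h, of j f] on[OF IH] by (auto simp: V_def)
  then show "\<exists>r. P f j r"
   using maximizer_exists[OF K T subV closedV] unfolding P_def by blast
 qed
 then obtain e where e: "\<And>j. P e j (e j)" by blast
 have orth: "cin (e j) (e k) = (if j = k then 1 else 0)" for j k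
  by (rule on[of "Suc (max j k)"]) (use e in auto)
 have max: "norm (T x) \<le> norm (T (e j)) * norm x" if "x \<in> V e j" for x j
  using e[of j] that by (simp add: P_def)
 have normT: "norm (e j) = 1" for j using e[of j] by (simp add: P_def)
 have inV: "e k \<in> V e j" if "j \<le> k" for j k
  using that orth by (auto simp: V_def)
 have EL0: "cin (T z) (T (e j)) = of_real ((norm (T (e j)))^2) * cin z (e j)" if "z \<in> V e j" for z j
 proof -
  \<comment> \<open>The Euler-Lagrange equation concerns real inner products; used at z and at its
    multiple by \<open>\<i>\<close> it gives both parts of \<open>cin\<close>.\<close>
  have "cs \<i> z \<in> V e j" using that by (auto simp: V_def cin_cs_right)
  from maximizer_euler_lagrange[OF lin subV inV[OF order_refl] normT max this]
   maximizer_euler_lagrange[OF lin subV inV[OF order_refl] normT max that]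
  show ?thesis by (simp add: cin_eq_inner Tc complex_eq_iff)
 qed
 have EL: "cin (T z) (T (e j)) = of_real ((norm (T (e j)))^2) * cin z (e j)" for z j
 proof (induction j arbitrary: z rule: less_induct)
  case (less j)
  \<comment> \<open>The components of z along the earlier vectors. For these the equation follows
    from the induction hypothesis with the roles of the two vectors exchanged.\<close>
  define y where "y = (\<Sum>i<j. cs (cin (e i) z) (e i))"
  have "z - y \<in> V e j"
   using cin_orthonormal_expand[of "{..<j}" e _ "\<lambda>i. cin (e i) z"] orth
   by (auto simp: V_def y_def cin_minus_right)
  note EL0[OF this]
  moreover have "cin y (e j) = 0"
   unfolding y_def cin_sum_left by (intro sum.neutral) (auto simp: cin_cs_left orth)
  moreover have "cin (T y) (T (e j)) = 0"
  proof -
   have "cin (T (e i)) (T (e j)) = 0" if "i < j" for i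
    using less.IH[OF that, of "e j"] that orth[of j i] cin_commute[of "T (e j)" "T (e i)"] by simp
   then show ?thesis
    unfolding y_def linear_sum[OF lin] cin_sum_left
    by (intro sum.neutral) (auto simp: Tc cin_cs_left)
  qed
  ultimately show ?case
   by (simp add: linear_diff[OF lin] cin_minus_left)
 qed
 have dec: "norm (T (e k)) \<le> norm (T (e j))" if "j \<le> k" for j k
  using max[OF inV[OF that]] normT by simp
 have bound: "sqrt (real j + 1) * norm (T (e j)) \<le> K" for j
 proof (cases "norm (T (e j)) = 0")
  case True
  have "0 \<le> K * norm (e 0)"
   by (rule order_trans[OF norm_ge_zero ky_fan_bound_norm[OF K lin]])
  then show ?thesis using True normT by simp
 next
  case False
  have pos: "T (e i) \<noteq> 0" if "i \<le> j" for i
   using dec[OF that] False by auto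
  define u where "u i = T (e i) /\<^sub>R norm (T (e i))" for i
  have Re_orth: "a \<bullet> b = 0" if "cin a b = 0" for a b :: "'n l2" using that by (simp add: inner_eq_Re_cin)
  have "orthonormal (Suc j) u"
   unfolding orthonormal_def
  proof (intro allI impI)
   fix i k assume ik: "i < Suc j" "k < Suc j"
   show "u i \<bullet> u k = (if i = k then 1 else 0)"
   proof (cases "i = k")
    case True
    then show ?thesis using inner_normalize[OF pos[of i]] ik by (simp only: u_def) simp
   next
    case False
    then show ?thesis using Re_orth[of "T (e i)" "T (e k)"] EL[of "e i" k] orth by (simp add: u_def)
   qed
  qed
  moreover have "orthonormal (Suc j) e"
   unfolding orthonormal_def by (auto simp: inner_eq_Re_cin orth)
  ultimately have "(\<Sum>i<Suc j. \<bar>u i \<bullet> T (e i)\<bar>) \<le> K * sqrt (Suc j)"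
   by (rule ky_fan_boundD[OF K])
  moreover have "(\<Sum>i<Suc j. norm (T (e j))) \<le> (\<Sum>i<Suc j. \<bar>u i \<bullet> T (e i)\<bar>)"
  proof (rule sum_mono)
   fix i assume i: "i \<in> {..<Suc j}"
   have "u i \<bullet> T (e i) = norm (T (e i))"
    using pos[of i] i power2_norm_eq_inner[of "T (e i)", symmetric]
    by (simp add: u_def power2_eq_square)
   then show "norm (T (e j)) \<le> \<bar>u i \<bullet> T (e i)\<bar>" using dec[of i j] i by simp
  qed
  ultimately have "real (Suc j) * norm (T (e j)) \<le> K * sqrt (Suc j)" by simp
  then have "sqrt (Suc j) * (sqrt (Suc j) * norm (T (e j))) \<le> sqrt (Suc j) * K"
   by (simp only: mult.assoc[symmetric] real_sqrt_mult_self) (simp add: mult.commute)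
  then show ?thesis by (simp add: add.commute)
 qed
 have "T x = 0" if x: "\<forall>j. cin (e j) x = 0" for x
 proof -
  \<comment> \<open>A vector orthogonal to all \<open>e j\<close> competes at every stage of the
    maximization, so its image is bounded by a null sequence.\<close>
  have "norm (T x) \<le> K / sqrt (real j + 1) * norm x" for j
  proof -
   have "norm (T x) \<le> norm (T (e j)) * norm x" using x by (intro max) (simp add: V_def)
   also have "\<dots> \<le> K / sqrt (real j + 1) * norm x"
    using bound[of j] by (intro mult_right_mono) (auto simp: field_simps add_pos_nonneg)
   finally show ?thesis .
  qed
  moreover have "(\<lambda>j. K / sqrt (real j + 1) * norm x) \<longlonglongrightarrow> 0 * norm x"
  proof -
   have "(\<lambda>j. K * sqrt (inverse (real (Suc j))) * norm x) \<longlonglongrightarrow> K * sqrt 0 * norm x"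
    by (intro tendsto_intros LIMSEQ_inverse_real_of_nat)
   then show ?thesis by (simp add: divide_inverse real_sqrt_inverse add.commute)
  qed
  ultimately have "norm (T x) \<le> 0 * norm x"
   by (intro LIMSEQ_le_const) auto
  then show ?thesis by simp
 qed
 with that[OF orth _ EL _ bound] dec show ?thesis by (auto simp: decseq_def)
qed

section \<open>From bounded operators on classes back to relations on functions\<close>

definition graph_of :: "('n::finite l2 \<Rightarrow> 'n l2) \<Rightarrow> 'n op" where
 "graph_of T = {(\<phi>, \<psi>). \<phi> \<in> L2 \<and> \<psi> \<in> L2 \<and> cls \<psi> = T (cls \<phi>)}"

lemma graph_of_rep: "\<phi> \<in> L2 \<Longrightarrow> (\<phi>, rep (T (cls \<phi>))) \<in> graph_of T"
 by (simp add: graph_of_def)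

lemma graph_of_L2_operator:
 fixes T :: "'n::finite l2 \<Rightarrow> 'n l2"
 assumes T: "bounded_linear T" and Tc: "\<And>c x. T (cs c x) = cs c (T x)"
 shows "L2_operator (graph_of T)"
proof -
 have ne: "graph_of T \<noteq> {}" using graph_of_rep[OF L2_zero] by blast
 have lin: "cls (\<lambda>x. a * \<phi>' x + \<psi>' x) = T (cls (\<lambda>x. a * \<phi> x + \<psi> x))"
  if "\<phi> \<in> L2" "\<phi>' \<in> L2" "\<psi> \<in> L2" "\<psi>' \<in> L2" "cls \<phi>' = T (cls \<phi>)" "cls \<psi>' = T (cls \<psi>)" for a \<phi> \<phi>' \<psi> \<psi>'
  using that linear_add[OF bounded_linear.linear[OF T]]
  by (simp add: Tc L2_scale flip: cls_add cs_cls)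
 have eq: "ae_eq \<phi> \<psi> \<longleftrightarrow> cls \<phi> = cls \<psi>" if "\<phi> \<in> L2" "\<psi> \<in> L2" for \<phi> \<psi> :: "'n fn"
  using that by (simp add: cls_eq_iff ae_eq_def)
 show ?thesis
  unfolding L2_operator_def
 proof (intro conjI)
  show "graph_of T \<subseteq> L2 \<times> L2" by (auto simp: graph_of_def)
  show "\<forall>\<phi> \<phi>' \<psi> \<psi>' a. (\<phi>, \<phi>') \<in> graph_of T \<longrightarrow> (\<psi>, \<psi>') \<in> graph_of T \<longrightarrow>
    ((\<lambda>x. a * \<phi> x + \<psi> x), (\<lambda>x. a * \<phi>' x + \<psi>' x)) \<in> graph_of T"
   using lin by (auto simp: graph_of_def L2_add L2_scale)
  show "\<forall>\<phi> \<phi>' \<psi> \<psi>'. (\<phi>, \<phi>') \<in> graph_of T \<longrightarrow> (\<psi>, \<psi>') \<in> graph_of T \<longrightarrow>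
    ae_eq \<phi> \<psi> \<longrightarrow> ae_eq \<phi>' \<psi>'"
   by (auto simp: graph_of_def eq)
  show "\<forall>\<phi> \<phi>'. \<forall>\<psi>\<in>L2. \<forall>\<psi>'\<in>L2. (\<phi>, \<phi>') \<in> graph_of T \<longrightarrow>
    ae_eq \<phi> \<psi> \<longrightarrow> ae_eq \<phi>' \<psi>' \<longrightarrow> (\<psi>, \<psi>') \<in> graph_of T"
   by (auto simp: graph_of_def eq)
 qed (rule ne)
qed

text \<open>The infimum in \<open>weak_schatten2_norm\<close> is estimated by the eigenvalue
  sequence that the singular vectors provide.\<close>

lemma weak_schatten2_graph_of:
 fixes T :: "'n::finite l2 \<Rightarrow> 'n l2" and h :: "nat \<Rightarrow> 'n l2"
 assumes T: "bounded_linear T" and Tc: "\<And>c x. T (cs c x) = cs c (T x)" and K: "ky_fan_bound T K"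
  and h: "\<And>j k. cin (h j) (h k) = (if j = k then 1 else 0)"
 shows "compact_operator (graph_of T)" "weak_schatten2_norm (graph_of T) \<le> ennreal K"
proof -
 show "compact_operator (graph_of T)"
  unfolding compact_operator_def
 proof (intro conjI allI impI)
  show "L2_operator (graph_of T)" by (rule graph_of_L2_operator[OF T Tc])
  show "Domain (graph_of T) = L2"
  proof (intro equalityI subsetI)
   show "\<phi> \<in> Domain (graph_of T)" if "\<phi> \<in> L2" for \<phi>
    using graph_of_rep[OF that, of T] by (rule DomainI)
  qed (auto simp: graph_of_def)
  fix \<phi> \<psi> and M :: real
  assume *: "\<forall>n::nat. (\<phi> n, \<psi> n) \<in> graph_of T \<and> L2norm (\<phi> n) \<le> ennreal M"
  then have L: "\<phi> n \<in> L2" "\<psi> n \<in> L2" "cls (\<psi> n) = T (cls (\<phi> n))" for n by (auto simp: graph_of_def)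
  have "norm (cls (\<phi> n)) \<le> \<bar>M\<bar>" for n
  proof -
   have "ennreal (norm (cls (\<phi> n))) \<le> ennreal M" using * L by (simp flip: L2norm_cls)
   also have "\<dots> \<le> ennreal \<bar>M\<bar>" by (intro ennreal_leI) simp
   finally show ?thesis by simp
  qed
  then have "\<exists>r::nat \<Rightarrow> nat. strict_mono r \<and> convergent (\<lambda>n. T (cls (\<phi> (r n))))"
   by (rule ky_fan_bound_compact[OF K T])
  then obtain r :: "nat \<Rightarrow> nat" where r: "strict_mono r" "convergent (\<lambda>n. T (cls (\<phi> (r n))))"
   by (elim exE conjE)
  then obtain y where y: "(\<lambda>n. T (cls (\<phi> (r n)))) \<longlonglongrightarrow> y" by (auto simp: convergent_def)
  have "L2norm (\<lambda>x. \<psi> (r n) x - rep y x) = ennreal (norm (T (cls (\<phi> (r n))) - y))" for n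
   using L by (simp add: L2norm_cls L2_diff flip: cls_diff)
  moreover have "(\<lambda>n. ennreal (norm (T (cls (\<phi> (r n))) - y))) \<longlonglongrightarrow> ennreal 0"
   using y by (intro tendsto_ennrealI tendsto_norm_zero) (simp add: LIM_zero)
  ultimately show "\<exists>r \<eta>. strict_mono r \<and> \<eta> \<in> L2 \<and> (\<lambda>n. L2norm (\<lambda>x. \<psi> (r n) x - \<eta> x)) \<longlonglongrightarrow> 0"
   using r(1) by (intro exI[of _ r] exI[of _ "rep y"]) simp
 qed
 obtain e where e: "\<And>j k. cin (e j) (e k) = (if j = k then 1 else 0)"
  "decseq (\<lambda>j. norm (T (e j)))"
  "\<And>j z. cin (T z) (T (e j)) = of_real ((norm (T (e j)))^2) * cin z (e j)"
  "\<And>x. \<forall>j. cin (e j) x = 0 \<Longrightarrow> T x = 0"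
  "\<And>j. sqrt (real j + 1) * norm (T (e j)) \<le> K"
  by (rule singular_vectors[OF T Tc K h]) (rule that)
 define l where "l j = (norm (T (e j)))^2" for j
 \<comment> \<open>\<open>L2_adjoint\<close> is a relation, so each pair is verified separately,
   from the identity for singular vectors.\<close>
 have adj: "(\<psi>, \<eta>) \<in> L2_adjoint (graph_of T)"
  if "\<psi> \<in> L2" "\<eta> \<in> L2" "\<And>z. cin (T z) (cls \<psi>) = cin z (cls \<eta>)" for \<psi> \<eta>
  using that unfolding L2_adjoint_def graph_of_def
  by (auto simp flip: cin_cls)
 have "decreasing_eigenvalues (graph_of T O L2_adjoint (graph_of T)) l"
  unfolding decreasing_eigenvalues_def
 proof (intro conjI exI[of _ "\<lambda>j. rep (e j)"] allI ballI impI)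
  show "decseq l"
   using e(2) by (auto simp: l_def decseq_def intro: power_mono)
  show "L2inner (rep (e j)) (rep (e k)) = (if j = k then 1 else 0)" for j k
   using e(1) by (simp flip: cin_rep)
  show "(rep (e j), \<lambda>x. of_real (l j) * rep (e j) x) \<in> graph_of T O L2_adjoint (graph_of T)" for j
  proof (rule relcompI)
   show "(rep (e j), rep (T (e j))) \<in> graph_of T"
    using graph_of_rep[of "rep (e j)" T] by simp
   show "(rep (T (e j)), \<lambda>x. of_real (l j) * rep (e j) x) \<in> L2_adjoint (graph_of T)"
    by (rule adj) (use e(3) in \<open>simp_all add: L2_scale l_def cin_cs_right flip: cs_cls\<close>)
  qed
  fix \<phi> :: "'n fn" assume \<phi>: "\<phi> \<in> L2" "\<forall>j. L2inner (rep (e j)) \<phi> = 0"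
  have "\<forall>j. cin (e j) (cls \<phi>) = 0" using \<phi> cin_cls[of "rep (e _)" \<phi>] by simp
  then have T0: "T (cls \<phi>) = 0" by (rule e(4))
  show "(\<phi>, \<lambda>x. 0) \<in> graph_of T O L2_adjoint (graph_of T)"
  proof (rule relcompI)
   show "(\<phi>, rep 0) \<in> graph_of T"
    using \<phi> T0 by (simp add: graph_of_def)
   show "(rep 0, \<lambda>x. 0) \<in> L2_adjoint (graph_of T)"
    by (rule adj) (simp_all add: L2_zero flip: zero_cls)
  qed
 qed
 then have "weak_schatten2_norm (graph_of T) \<le> (SUP j. ennreal (sqrt (real j + 1) * sqrt (l j)))"
  unfolding weak_schatten2_norm_def by (intro INF_lower) simp
 also have "\<dots> \<le> ennreal K"
  by (intro SUP_least ennreal_leI) (simp add: l_def e(5))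
 finally show "weak_schatten2_norm (graph_of T) \<le> ennreal K" .
qed

section \<open>Hermite functions of one variable\<close>

lemma vector_derivative_sequence:
 fixes g :: "real \<Rightarrow> 'a::real_normed_vector"
 assumes g: "(g has_vector_derivative D) (at 0)"
 shows "(\<lambda>n. real (Suc n) *\<^sub>R (g (1 / Suc n) - g 0)) \<longlonglongrightarrow> D"
proof -
 have "((\<lambda>y. norm ((g y - g 0) - (y - 0) *\<^sub>R D) / norm (y - 0)) \<longlongrightarrow> 0) (at 0)"
  using g unfolding has_vector_derivative_def has_derivative_iff_norm by simp
 moreover have "filterlim (\<lambda>n. 1 / real (Suc n)) (at 0) sequentially"
  using LIMSEQ_inverse_real_of_nat unfolding filterlim_at by (simp add: inverse_eq_divide)
 ultimately have "(\<lambda>n. norm ((g (1 / Suc n) - g 0) - (1 / Suc n - 0) *\<^sub>R D) / norm (1 / real (Suc n) - 0)) \<longlonglongrightarrow> 0"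
  by (rule filterlim_compose)
 moreover have "norm ((g (1 / Suc n) - g 0) - (1 / Suc n - 0) *\<^sub>R D) / norm (1 / real (Suc n) - 0)
   = norm (real (Suc n) *\<^sub>R (g (1 / Suc n) - g 0) - D)" for n
 proof -
  have "real (Suc n) *\<^sub>R (g (1 / Suc n) - g 0) - D = real (Suc n) *\<^sub>R ((g (1 / Suc n) - g 0) - (1 / Suc n - 0) *\<^sub>R D)"
   by (simp add: scaleR_diff_right del: of_nat_Suc)
  then have "norm (real (Suc n) *\<^sub>R (g (1 / Suc n) - g 0) - D)
    = real (Suc n) * norm ((g (1 / Suc n) - g 0) - (1 / Suc n - 0) *\<^sub>R D)"
   by (simp only: norm_scaleR abs_of_nat)
  then show ?thesis by (simp only: diff_zero) simp
 qed
 ultimately show ?thesis by (simp add: tendsto_norm_zero_iff LIM_zero_iff)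
qed

text \<open>Increments 1 / (n + 1) make the limit sequential, as dominated convergence requires. The
  mean value inequality bounds the difference quotients by \<open>E\<close>.\<close>

lemma integral_difference_quotient:
 fixes F F' :: "real \<Rightarrow> 'a \<Rightarrow> complex"
 assumes F: "\<And>t. 0 \<le> t \<Longrightarrow> t \<le> 1 \<Longrightarrow> integrable M (F t)"
  and F': "\<And>t x. 0 \<le> t \<Longrightarrow> t \<le> 1 \<Longrightarrow> ((\<lambda>t. F t x) has_vector_derivative F' t x) (at t)"
  and bound: "\<And>t x. 0 \<le> t \<Longrightarrow> t \<le> 1 \<Longrightarrow> cmod (F' t x) \<le> E x" and E: "integrable M E"
 shows "integrable M (F' 0)"
  and "(\<lambda>n. real (Suc n) *\<^sub>R ((LINT x|M. F (1 / Suc n) x) - (LINT x|M. F 0 x))) \<longlonglongrightarrow> (LINT x|M. F' 0 x)"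
proof -
 define s where "s n x = real (Suc n) *\<^sub>R (F (1 / Suc n) x - F 0 x)" for n x
 have [measurable]: "F t \<in> borel_measurable M" if "0 \<le> t" "t \<le> 1" for t
  using F[OF that] by simp
 have s[measurable]: "s n \<in> borel_measurable M" for n
  unfolding s_def by (intro borel_measurable_scaleR borel_measurable_diff borel_measurable_const) auto
 have lim: "(\<lambda>n. s n x) \<longlonglongrightarrow> F' 0 x" for x
  unfolding s_def by (rule vector_derivative_sequence) (use F' in auto)
 have mF': "F' 0 \<in> borel_measurable M"
  by (rule borel_measurable_LIMSEQ_metric[OF s lim])
 have b: "cmod (s n x) \<le> E x" for n x
 proof -
  have "norm (F (1 / Suc n) x - F 0 x) \<le> E x * norm (1 / real (Suc n) - 0)"
  proof (rule differentiable_bound[where S = "{0..1}" and f' = "\<lambda>t h. h *\<^sub>R F' t x"])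
   fix t :: real assume t: "t \<in> {0..1}"
   then show "((\<lambda>t. F t x) has_derivative (\<lambda>h. h *\<^sub>R F' t x)) (at t within {0..1})"
    using F'[of t x] by (auto simp: has_vector_derivative_def intro: has_derivative_at_withinI)
   show "onorm (\<lambda>h. h *\<^sub>R F' t x) \<le> E x"
    using bound[of t x] t by (intro onorm_bound) (auto intro: order_trans[OF norm_ge_zero]
      simp: mult.commute[of "E x"] intro!: mult_left_mono)
  qed auto
  then have "real (Suc n) * cmod (F (1 / Suc n) x - F 0 x) \<le> E x"
   by (simp add: field_simps del: of_nat_Suc)
  then show ?thesis by (simp only: s_def norm_scaleR abs_of_nat)
 qed
 have E0: "0 \<le> E x" for x using bound[of 0 x] norm_ge_zero[of "F' 0 x"] by linarith
 show I': "integrable M (F' 0)"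
  by (rule Bochner_Integration.integrable_bound[OF E mF']) (use bound[of 0] E0 in auto)
 have "(\<lambda>n. LINT x|M. s n x) \<longlonglongrightarrow> (LINT x|M. F' 0 x)"
  by (rule integral_dominated_convergence[OF mF' s E]) (use lim b in auto)
 moreover have "(LINT x|M. s n x) = real (Suc n) *\<^sub>R ((LINT x|M. F (1 / Suc n) x) - (LINT x|M. F 0 x))" for n
  unfolding s_def using F[of "1 / Suc n"] F[of 0] by (simp del: of_nat_Suc)
 ultimately show "(\<lambda>n. real (Suc n) *\<^sub>R ((LINT x|M. F (1 / Suc n) x) - (LINT x|M. F 0 x))) \<longlonglongrightarrow> (LINT x|M. F' 0 x)"
  by simp
qed

text \<open>All translates of \<open>f\<close> along \<open>v\<close> have the same integral, and
  the constant is differentiated under the integral sign. This replaces integration by parts, in one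
  variable and in several.\<close>

lemma integral_directional_derivative:
 fixes f f' :: "'a::euclidean_space \<Rightarrow> complex"
 assumes f: "integrable lborel f"
  and f': "\<And>x. ((\<lambda>t. f (x + t *\<^sub>R v)) has_vector_derivative f' x) (at 0)"
  and bound: "\<And>t x. 0 \<le> t \<Longrightarrow> t \<le> 1 \<Longrightarrow> cmod (f' (x + t *\<^sub>R v)) \<le> E x" and E: "integrable lborel E"
 shows "(LINT x|lborel. f' x) = 0"
proof -
 have [measurable]: "f \<in> borel_measurable borel" using borel_measurable_integrable[OF f] by simp
 have shift: "lborel = distr lborel borel (\<lambda>x. x + t *\<^sub>R v)" for t
  using lborel_affine[of 1 "t *\<^sub>R v"] by (simp add: density_1 add.commute)
 have I: "(LINT x|lborel. f (x + t *\<^sub>R v)) = (LINT x|lborel. f x)"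
  and int: "integrable lborel (\<lambda>x. f (x + t *\<^sub>R v))" for t
 proof -
  show "(LINT x|lborel. f (x + t *\<^sub>R v)) = (LINT x|lborel. f x)"
   by (subst (2) shift[of t], subst integral_distr) auto
  show "integrable lborel (\<lambda>x. f (x + t *\<^sub>R v))"
   using f by (subst (asm) shift[of t], subst (asm) integrable_distr_eq) auto
 qed
 have "((\<lambda>t. f (x + t *\<^sub>R v)) has_vector_derivative f' (x + t *\<^sub>R v)) (at t)" for x t
 proof -
  have "((\<lambda>s. f ((x + t *\<^sub>R v) + s *\<^sub>R v)) has_vector_derivative f' (x + t *\<^sub>R v)) (at (t - t))"
   using f'[of "x + t *\<^sub>R v"] by simp
  then have "((\<lambda>s. f ((x + t *\<^sub>R v) + s *\<^sub>R v)) \<circ> (\<lambda>s. s - t) has_vector_derivative 1 *\<^sub>R f' (x + t *\<^sub>R v)) (at t)"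
   by (intro vector_diff_chain_at) (auto intro!: derivative_eq_intros)
  then show ?thesis by (simp add: o_def algebra_simps)
 qed
 note D = integral_difference_quotient(2)[of lborel "\<lambda>t x. f (x + t *\<^sub>R v)" "\<lambda>t x. f' (x + t *\<^sub>R v)", OF int this bound E]
 from D have "(\<lambda>n. 0) \<longlonglongrightarrow> (LINT x|lborel. f' x)"
  unfolding I by simp
 then show ?thesis by (simp add: LIMSEQ_const_iff)
qed

lemma integrable_inverse_square:
 shows "integrable lborel (\<lambda>x::real. inverse (1 + x^2))" "(LINT x|lborel. inverse (1 + x^2)) = pi"
 using integrable_inverse_1_plus_square LBINT_inverse_1_plus_square
 by (simp_all add: set_integrable_def interval_lebesgue_integral_def set_lebesgue_integral_def)

text \<open>The unnormalized Hermite function: the k-th Hermite polynomial in the convention of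
  physics, with leading coefficient 2^k, times exp (- x^2 / 2).\<close>

fun hermite :: "nat \<Rightarrow> real \<Rightarrow> real" where
 "hermite 0 x = exp (- x\<^sup>2 / 2)"
| "hermite (Suc 0) x = 2 * x * exp (- x\<^sup>2 / 2)"
| "hermite (Suc (Suc k)) x = 2 * x * hermite (Suc k) x - 2 * real (Suc k) * hermite k x"

lemma hermite_rec: "hermite (Suc k) x = 2 * x * hermite k x - 2 * real k * hermite (k - 1) x"
 by (cases k) auto

lemma hermite_deriv:
 "(hermite k has_real_derivative (x * hermite k x - hermite (Suc k) x)) (at x)"
proof (induction k arbitrary: x rule: induct_nat_012)
 case 0
 show ?case unfolding hermite.simps[abs_def]
  by (auto intro!: derivative_eq_intros simp: power2_eq_square)
next
 case 1
 show ?case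
  unfolding hermite.simps[abs_def] One_nat_def
  by (auto intro!: derivative_eq_intros simp: power2_eq_square algebra_simps)
next
 case (ge2 k)
 have "(hermite (Suc (Suc k)) has_real_derivative
   (2 * hermite (Suc k) x + 2 * x * (x * hermite (Suc k) x - hermite (Suc (Suc k)) x)
    - 2 * real (Suc k) * (x * hermite k x - hermite (Suc k) x))) (at x)"
  unfolding hermite.simps(3)[abs_def, of k]
  by (rule derivative_eq_intros ge2 refl | simp)+
 then show ?case
  by (rule DERIV_cong) (simp add: algebra_simps)
qed

lemma hermite_continuous: "continuous_on UNIV (hermite k)"
 using hermite_deriv by (intro DERIV_continuous_on) (auto intro: DERIV_subset)

lemma hermite_measurable[measurable]: "hermite k \<in> borel_measurable borel"
 by (rule borel_measurable_continuous_onI[OF hermite_continuous])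

lemma hermite_minus: "hermite k (- x) = (-1)^k * hermite k x"
 by (induction k x rule: hermite.induct) (auto simp: algebra_simps)

lemma power_le_fact_exp: "x ^ n \<le> fact n * exp (x::real)" if "0 \<le> x"
proof -
 have "(\<Sum>k\<in>{n}. x^k /\<^sub>R fact k) \<le> exp x"
  unfolding exp_def using that by (intro sum_le_suminf summable_exp_generic) auto
 then show ?thesis by (simp add: field_simps)
qed

lemma gaussian_decay: "\<bar>x\<bar>^m * exp (- x\<^sup>2 / 2) \<le> fact m * exp (1/2)" for x :: real
proof -
 have "\<bar>x\<bar>^m * exp (- x\<^sup>2 / 2) \<le> fact m * exp \<bar>x\<bar> * exp (- x\<^sup>2 / 2)"
  by (intro mult_right_mono power_le_fact_exp) auto
 also have "\<dots> = fact m * exp (\<bar>x\<bar> + (- x\<^sup>2 / 2))" by (simp only: exp_add mult.assoc)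
 also have "\<bar>x\<bar> + (- x\<^sup>2 / 2) \<le> 1 / 2"
  using zero_le_power2[of "\<bar>x\<bar> - 1"] by (simp add: power2_diff)
 then have "fact m * exp (\<bar>x\<bar> + (- x\<^sup>2 / 2)) \<le> fact m * exp (1 / 2)" by simp
 finally show ?thesis .
qed

lemma hermite_decay: "\<exists>C. \<forall>x. \<bar>x\<bar>^m * \<bar>hermite k x\<bar> \<le> C"
proof (induction k arbitrary: m rule: induct_nat_012)
 case 0
 show ?case using gaussian_decay by auto
next
 case 1
 have "\<bar>x\<bar>^m * \<bar>hermite (Suc 0) x\<bar> = 2 * (\<bar>x\<bar>^Suc m * exp (- x\<^sup>2 / 2))" for x :: real
  by (simp add: abs_mult)
 then show ?case
  by (intro exI[of _ "2 * (fact (Suc m) * exp (1/2))"] allI)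
   (simp only: gaussian_decay mult_left_mono zero_le_numeral One_nat_def)
next
 case (ge2 k)
 obtain C D where C: "\<forall>x. \<bar>x\<bar>^m * \<bar>hermite k x\<bar> \<le> C" and D: "\<forall>x. \<bar>x\<bar>^Suc m * \<bar>hermite (Suc k) x\<bar> \<le> D"
  using ge2.IH by meson
 have "\<bar>x\<bar>^m * \<bar>hermite (Suc (Suc k)) x\<bar> \<le> 2 * D + 2 * real (Suc k) * C" for x
 proof -
  have "\<bar>x\<bar>^m * \<bar>hermite (Suc (Suc k)) x\<bar> \<le> \<bar>x\<bar>^m * (\<bar>2 * x * hermite (Suc k) x\<bar> + \<bar>2 * real (Suc k) * hermite k x\<bar>)"
   unfolding hermite.simps by (intro mult_left_mono abs_triangle_ineq4) auto
  also have "\<dots> = 2 * (\<bar>x\<bar>^Suc m * \<bar>hermite (Suc k) x\<bar>) + 2 * real (Suc k) * (\<bar>x\<bar>^m * \<bar>hermite k x\<bar>)"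
   by (simp add: abs_mult algebra_simps del: of_nat_Suc)
  also have "\<dots> \<le> 2 * D + 2 * real (Suc k) * C"
   using C D by (intro add_mono mult_left_mono) auto
  finally show ?thesis .
 qed
 then show ?case by blast
qed

lemma hermite_integrable_bound: "\<exists>C\<ge>0. \<forall>x. \<bar>x\<bar>^m * \<bar>hermite k x\<bar> \<le> C * inverse (1 + x^2)"
proof -
 obtain C D where C: "\<forall>x. \<bar>x\<bar>^m * \<bar>hermite k x\<bar> \<le> C" and D: "\<forall>x. \<bar>x\<bar>^(m+2) * \<bar>hermite k x\<bar> \<le> D"
  using hermite_decay by meson
 have "\<bar>x\<bar>^m * \<bar>hermite k x\<bar> * (1 + x^2) \<le> C + D" for x
 proof -
  have "\<bar>x\<bar>^m * \<bar>hermite k x\<bar> * (1 + x^2) = \<bar>x\<bar>^m * \<bar>hermite k x\<bar> + \<bar>x\<bar>^(m+2) * \<bar>hermite k x\<bar>"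
   unfolding power_add power2_abs by (simp add: algebra_simps)
  then show ?thesis using C[rule_format, of x] D[rule_format, of x] by linarith
 qed
 then have "\<bar>x\<bar>^m * \<bar>hermite k x\<bar> \<le> (C + D) * inverse (1 + x^2)" for x
  by (simp add: field_simps add_pos_nonneg)
 moreover have "0 \<le> C + D"
  using C[rule_format, of 0] D[rule_format, of 0] by (intro add_nonneg_nonneg) (auto intro: order_trans[rotated])
 ultimately show ?thesis by blast
qed

lemma hermite_integrable: "integrable lborel (\<lambda>x. x^m * hermite k x)"
proof -
 obtain C where C: "C \<ge> 0" "\<forall>x. \<bar>x\<bar>^m * \<bar>hermite k x\<bar> \<le> C * inverse (1 + x^2)"
  using hermite_integrable_bound by meson
 show ?thesis
  by (rule Bochner_Integration.integrable_bound[of _ "\<lambda>x. C * inverse (1 + x^2)"])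
    (use C in \<open>auto simp: integrable_inverse_square abs_mult power_abs\<close>)
qed

lemma hermite_bounded: "\<exists>C. \<forall>x. \<bar>hermite k x\<bar> \<le> C"
 using hermite_decay[of 0 k] by simp

lemma hermite_mult_integrable: "integrable lborel (\<lambda>x. x^m * (hermite j x * hermite k x))"
proof -
 obtain C where C: "\<forall>x. \<bar>hermite k x\<bar> \<le> C" using hermite_bounded by blast
 show ?thesis
 proof (rule Bochner_Integration.integrable_bound)
  show "integrable lborel (\<lambda>x. C * (x^m * hermite j x))"
   by (intro integrable_mult_right hermite_integrable)
  have "norm (x^m * (hermite j x * hermite k x)) \<le> norm (C * (x^m * hermite j x))" for x
   using mult_left_mono[OF order_trans[OF C[rule_format, of x] abs_ge_self], of "\<bar>x^m * hermite j x\<bar>"]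
   by (simp add: abs_mult ac_simps)
  then show "AE x in lborel. norm (x^m * (hermite j x * hermite k x)) \<le> norm (C * (x^m * hermite j x))" by simp
 qed measurable
qed

text \<open>The integral of the derivative of a product of two Hermite functions is 0, as the
  product vanishes at infinity. By \<open>hermite_deriv\<close>, each derivative is a multiple by x
  minus the next function.\<close>

lemma hermite_integral_deriv:
 "(LINT x|lborel. 2 * (x * (hermite j x * hermite k x)))
  = (LINT x|lborel. hermite (Suc j) x * hermite k x) + (LINT x|lborel. hermite j x * hermite (Suc k) x)"
proof -
 define f where "f x = hermite j x * hermite k x" for x
 define f' where "f' x = 2 * (x * (hermite j x * hermite k x)) - (hermite (Suc j) x * hermite k x + hermite j x * hermite (Suc k) x)" for x
 have i: "integrable lborel (\<lambda>x. x * (hermite j x * hermite k x))" "integrable lborel (\<lambda>x. hermite j x * hermite k x)" for j k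
  using hermite_mult_integrable[of 1 j k] hermite_mult_integrable[of 0 j k] by simp_all
 have "(LBINT x=-\<infinity>..\<infinity>. f' x) = 0 - 0"
 proof (rule interval_integral_FTC_integrable[where F = f])
  show "(f has_vector_derivative f' x) (at x)" for x
   unfolding f_def f'_def has_real_derivative_iff_has_vector_derivative[symmetric]
   by (auto intro!: derivative_eq_intros hermite_deriv simp: algebra_simps)
  have "continuous_on UNIV f'"
   unfolding f'_def by (intro continuous_intros hermite_continuous)
  then show "isCont f' x" for x by (simp add: continuous_on_eq_continuous_at)
  show "set_integrable lborel (einterval (-\<infinity>) \<infinity>) f'"
   unfolding f'_def set_integrable_def using i by simp
  obtain C where C: "C \<ge> 0" "\<forall>x. \<bar>x\<bar>^0 * \<bar>hermite j x\<bar> \<le> C * inverse (1 + x^2)"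
   using hermite_integrable_bound by meson
  obtain D where D: "\<forall>x. \<bar>hermite k x\<bar> \<le> D" using hermite_bounded by blast
  have b: "norm (f x) \<le> C * D * inverse (1 + x^2)" for x
   unfolding f_def
   using mult_mono[of "\<bar>hermite j x\<bar>" "C * inverse (1 + x^2)" "\<bar>hermite k x\<bar>" D] C D
   by (simp add: abs_mult ac_simps)
  have "((\<lambda>x. C * D * inverse (1 + x^2)) \<longlongrightarrow> C * D * 0) at_top"
   "((\<lambda>x. C * D * inverse (1 + x^2)) \<longlongrightarrow> C * D * 0) at_bot"
   by (intro tendsto_mult tendsto_const tendsto_inverse_0_at_top filterlim_tendsto_add_at_top[OF tendsto_const]
     filterlim_pow_at_top filterlim_ident filterlim_pow_at_bot_even | simp)+
  then have "(f \<longlongrightarrow> 0) at_top" "(f \<longlongrightarrow> 0) at_bot"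
   using b by (auto intro!: Lim_null_comparison[of f])
  then show "((f \<circ> real_of_ereal) \<longlongrightarrow> 0) (at_right (-\<infinity>))" "((f \<circ> real_of_ereal) \<longlongrightarrow> 0) (at_left \<infinity>)"
   by (simp_all add: ereal_tendsto_simps)
 qed simp
 then have "(LINT x|lborel. f' x) = 0"
  by (simp add: interval_lebesgue_integral_def set_lebesgue_integral_def)
 then show ?thesis
  unfolding f'_def using i by simp
qed

text \<open>The integrated product rule and the three-term recurrence combine: raising one index is
  adjoint to lowering the other. Iteration lowers both indices until one of them is 0.\<close>

lemma hermite_inner_rec:
 "(LINT x|lborel. hermite (Suc j) x * hermite k x) = 2 * real k * (LINT x|lborel. hermite j x * hermite (k - 1) x)"
proof -
 have i: "integrable lborel (\<lambda>x. hermite j x * hermite k x)" for j k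
  using hermite_mult_integrable[of 0 j k] by simp
 have "(LINT x|lborel. 2 * (x * (hermite j x * hermite k x)))
   = (LINT x|lborel. hermite j x * hermite (Suc k) x + 2 * real k * (hermite j x * hermite (k - 1) x))"
  by (intro Bochner_Integration.integral_cong refl) (simp add: hermite_rec[of k] algebra_simps)
 also have "\<dots> = (LINT x|lborel. hermite j x * hermite (Suc k) x) + 2 * real k * (LINT x|lborel. hermite j x * hermite (k - 1) x)"
  using i by simp
 finally show ?thesis using hermite_integral_deriv[of j k] by simp
qed

definition hermite_norm2 :: "nat \<Rightarrow> real" where
 "hermite_norm2 k = 2^k * fact k * sqrt pi"

lemma hermite_norm2_pos: "hermite_norm2 k > 0"
 by (simp add: hermite_norm2_def)

lemma gaussian_integral_square: "(LINT x|lborel. exp (- x\<^sup>2)) = sqrt pi"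
proof -
 have "normal_density 0 (1 / sqrt 2) x = exp (- x\<^sup>2) / sqrt pi" for x
  by (simp add: normal_density_def power_divide)
 moreover have "(LINT x|lborel. normal_density 0 (1 / sqrt 2) x) = 1"
  by (rule integral_normal_density) simp
 ultimately have "(LINT x|lborel. exp (- x\<^sup>2)) / sqrt pi = 1"
  by (simp only: integral_divide_zero)
 then show ?thesis by (simp add: field_simps)
qed

lemma hermite_orthogonal:
 "(LINT x|lborel. hermite j x * hermite k x) = (if j = k then hermite_norm2 k else 0)"
proof (induction j arbitrary: k)
 case 0
 show ?case
 proof (cases k)
  case 0
  have "exp (- x\<^sup>2 / 2) * exp (- x\<^sup>2 / 2) = exp (- (x::real)\<^sup>2)" for x
   by (simp flip: exp_add)
  then show ?thesis using 0 gaussian_integral_square by (simp add: hermite_norm2_def)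
 next
  case (Suc k')
  have "(LINT x|lborel. hermite 0 x * hermite k x) = (LINT x|lborel. hermite (Suc k') x * hermite 0 x)"
   using Suc by (simp only: mult.commute)
  also have "\<dots> = 0" using hermite_inner_rec[of k' 0] by simp
  finally show ?thesis using Suc by simp
 qed
next
 case (Suc j)
 show ?case
  unfolding hermite_inner_rec Suc by (cases k) (auto simp: hermite_norm2_def)
qed

definition herm :: "nat \<Rightarrow> real \<Rightarrow> real" where
 "herm k x = hermite k x / sqrt (hermite_norm2 k)"

lemma herm_measurable[measurable]: "herm k \<in> borel_measurable borel"
 unfolding herm_def[abs_def] by measurable

lemma herm_orthonormal: "(LINT x|lborel. herm j x * herm k x) = (if j = k then 1 else 0)"
proof -
 have "(LINT x|lborel. herm j x * herm k x)
   = (LINT x|lborel. hermite j x * hermite k x) / (sqrt (hermite_norm2 j) * sqrt (hermite_norm2 k))"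
  by (simp add: herm_def)
 then show ?thesis using hermite_norm2_pos[of k] by (simp add: hermite_orthogonal)
qed

lemma herm_integrable: "integrable lborel (\<lambda>x. x^m * herm k x)"
 and herm_mult_integrable: "integrable lborel (\<lambda>x. x^m * (herm j x * herm k x))"
 using hermite_integrable[of m k] hermite_mult_integrable[of m j k] by (simp_all add: herm_def)

lemma herm_rec: "x * herm k x = sqrt ((real k + 1) / 2) * herm (Suc k) x + sqrt (real k / 2) * herm (k - 1) x"
proof -
 have e: "x * hermite k x = hermite (Suc k) x / 2 + real k * hermite (k - 1) x"
  using hermite_rec[of k x] by (simp add: field_simps)
 have n: "sqrt (hermite_norm2 (Suc k)) = sqrt (2 * (real k + 1)) * sqrt (hermite_norm2 k)" for k
  by (simp only: hermite_norm2_def real_sqrt_mult[symmetric]) (simp add: algebra_simps)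
 have p: "sqrt (hermite_norm2 k) > 0" for k using hermite_norm2_pos by simp
 have s: "sqrt ((real k + 1) / 2) / (sqrt (2 * (real k + 1))) = 1 / 2"
 proof -
  have "sqrt (2 * (real k + 1)) = sqrt (4 * ((real k + 1) / 2))" by simp
  also have "\<dots> = 2 * sqrt ((real k + 1) / 2)" by (simp only: real_sqrt_mult real_sqrt_four)
  finally show ?thesis by (simp add: add_pos_nonneg)
 qed
 have 1: "sqrt ((real k + 1) / 2) * herm (Suc k) x = hermite (Suc k) x / 2 / sqrt (hermite_norm2 k)"
 proof -
  have "sqrt ((real k + 1) / 2) * herm (Suc k) x
    = (sqrt ((real k + 1) / 2) / (sqrt (2 * (real k + 1)))) * (hermite (Suc k) x / sqrt (hermite_norm2 k))"
   by (simp add: herm_def n)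
  then show ?thesis unfolding s by simp
 qed
 have 2: "sqrt (real k / 2) * herm (k - 1) x = real k * hermite (k - 1) x / sqrt (hermite_norm2 k)"
 proof (cases k)
  case (Suc j)
  have "sqrt (real k / 2) * sqrt (2 * real k) = real k" by (simp flip: real_sqrt_mult)
  moreover have "sqrt (hermite_norm2 k) = sqrt (2 * real k) * sqrt (hermite_norm2 j)"
   using n[of j] Suc by (simp add: add.commute)
  ultimately show ?thesis using p[of j] Suc
   by (simp add: herm_def field_simps del: real_sqrt_mult of_nat_Suc)
 qed simp
 show ?thesis
  unfolding 1 2 by (simp add: herm_def e add_divide_distrib)
qed

lemma herm_deriv2:
 shows "(herm k has_real_derivative (x * herm k x - sqrt (2 * (real k + 1)) * herm (Suc k) x)) (at x)"
proof -
 have n: "sqrt (hermite_norm2 (Suc k)) = sqrt (2 * (real k + 1)) * sqrt (hermite_norm2 k)"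
  by (simp only: hermite_norm2_def real_sqrt_mult[symmetric]) (simp add: algebra_simps)
 have "(herm k has_real_derivative (x * hermite k x - hermite (Suc k) x) / sqrt (hermite_norm2 k)) (at x)"
  unfolding herm_def[abs_def] using hermite_norm2_pos[of k]
  by (intro DERIV_cdivide hermite_deriv)
 moreover have "(x * hermite k x - hermite (Suc k) x) / sqrt (hermite_norm2 k)
   = x * herm k x - sqrt (2 * (real k + 1)) * herm (Suc k) x"
  using hermite_norm2_pos[of k] by (simp add: herm_def n diff_divide_distrib)
 ultimately show ?thesis by simp
qed

text \<open>Shifts by at most 1 change the weight by a bounded factor. This gives the dominating
  functions for derivatives along short segments.\<close>

lemma inverse_square_shift: "inverse (1 + (x + t)^2) \<le> 3 * inverse (1 + x^2)" if "0 \<le> t" "t \<le> 1" for x t :: real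
proof -
 define S where "S = (x + t)^2"
 have "t^2 \<le> 1" using that power_le_one[of t 2] by simp
 moreover have "x^2 \<le> 2 * S + 2 * t^2"
  using zero_le_power2[of "x + 2 * t"] by (simp add: S_def power2_eq_square algebra_simps)
 moreover have "0 \<le> S" by (simp add: S_def)
 ultimately have "1 + x^2 \<le> 3 * (1 + S)" by simp
 then have "1 + x^2 \<le> 3 * (1 + (x + t)^2)" by (simp only: S_def)
 moreover have "0 < 1 + x^2" "0 < 1 + (x + t)^2" by (simp_all add: add_pos_nonneg)
 ultimately show ?thesis by (simp add: field_simps)
qed

abbreviation phase :: "real \<Rightarrow> complex" where
 "phase t \<equiv> exp (- \<i> * of_real t)"

lemma exp_phase_derivative:
 "((\<lambda>t. phase (x * (\<xi> + t))) has_vector_derivative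
   - \<i> * of_real x * phase (x * (\<xi> + t))) (at t)"
proof -
 have "((\<lambda>z. exp (- \<i> * (of_real x * (of_real \<xi> + z)))) has_field_derivative
   - \<i> * of_real x * exp (- \<i> * (of_real x * (of_real \<xi> + of_real t)))) (at (of_real t))"
  by (auto intro!: derivative_eq_intros)
 from has_vector_derivative_real_field[OF this] show ?thesis by simp
qed

text \<open>Induction through hermite (k + 1) = x hermite k - (hermite k)'. Under the transform,
  multiplication by x becomes a derivative in \<xi>, and the derivative becomes multiplication by
  \<xi>, each with a factor of modulus 1; the same ladder relation reappears on the other
  side.\<close>

lemma hermite_fourier:
 "(LINT x|lborel. phase (x * \<xi>) * of_real (hermite k x))
  = of_real (sqrt (2 * pi)) * (- \<i>)^k * of_real (hermite k \<xi>)"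
proof (induction k arbitrary: \<xi>)
 case 0
 have "of_real (exp (- \<xi>\<^sup>2 / 2)) = (LINT x|std_normal_distribution. iexp (- \<xi> * x))"
  using fun_cong[OF char_std_normal_distribution, of "- \<xi>"] by (simp add: char_def)
 also have "\<dots> = (LINT x|lborel. std_normal_density x *\<^sub>R iexp (- \<xi> * x))"
  by (subst integral_density) auto
 also have "\<dots> = (LINT x|lborel. of_real (1 / sqrt (2 * pi)) * (phase (x * \<xi>) * of_real (hermite 0 x)))"
  by (intro Bochner_Integration.integral_cong refl)
   (simp add: std_normal_density_def scaleR_conv_of_real mult_ac)
 also have "\<dots> = of_real (1 / sqrt (2 * pi)) * (LINT x|lborel. phase (x * \<xi>) * of_real (hermite 0 x))"
  by simp
 finally show ?case by (simp add: field_simps)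
next
 case (Suc k)
 define c :: complex where "c = of_real (sqrt (2 * pi)) * (- \<i>)^k"
 define E where "E \<eta> x = phase (x * \<eta>)" for \<eta> x :: real
 have E[simp]: "cmod (E \<eta> x) = 1" for \<eta> x by (simp add: E_def)
 have [measurable]: "(\<lambda>x. E \<eta> x) \<in> borel_measurable borel" for \<eta> unfolding E_def by measurable
 have int: "integrable lborel (\<lambda>x. E \<eta> x * of_real (x^m * hermite k x))" for \<eta> m k
  by (rule Bochner_Integration.integrable_bound[OF hermite_integrable[of m k]]) (auto simp: norm_mult abs_mult norm_power power_abs)
 note int0 = int[of _ 0, simplified] and int1 = int[of _ 1, simplified]
 have "(\<lambda>n. real (Suc n) *\<^sub>R ((LINT x|lborel. E (\<xi> + 1 / Suc n) x * of_real (hermite k x)) - (LINT x|lborel. E (\<xi> + 0) x * of_real (hermite k x))))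
   \<longlonglongrightarrow> (LINT x|lborel. - \<i> * of_real x * E (\<xi> + 0) x * of_real (hermite k x))"
 proof (rule integral_difference_quotient(2)[where F = "\<lambda>t x. E (\<xi> + t) x * of_real (hermite k x)"])
  show "((\<lambda>t. E (\<xi> + t) x * of_real (hermite k x)) has_vector_derivative - \<i> * of_real x * E (\<xi> + t) x * of_real (hermite k x)) (at t)" for t x
   unfolding E_def by (intro has_vector_derivative_mult_left exp_phase_derivative)
  show "integrable lborel (\<lambda>x. \<bar>x^1 * hermite k x\<bar>)" by (intro integrable_abs hermite_integrable)
 qed (auto simp: int0 norm_mult abs_mult)
 then have "(\<lambda>n. real (Suc n) *\<^sub>R (c * of_real (hermite k (\<xi> + 1 / Suc n)) - c * of_real (hermite k (\<xi> + 0))))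
   \<longlonglongrightarrow> (LINT x|lborel. - \<i> * of_real x * E \<xi> x * of_real (hermite k x))"
  unfolding E_def Suc.IH c_def by simp
 moreover have "(\<lambda>n. real (Suc n) *\<^sub>R (c * of_real (hermite k (\<xi> + 1 / Suc n)) - c * of_real (hermite k (\<xi> + 0))))
   \<longlonglongrightarrow> c * of_real (\<xi> * hermite k \<xi> - hermite (Suc k) \<xi>)"
 proof (rule vector_derivative_sequence)
  have "((\<lambda>t. hermite k (\<xi> + t)) has_real_derivative (\<xi> * hermite k \<xi> - hermite (Suc k) \<xi>)) (at 0)"
   using DERIV_shift[of "hermite k" _ 0 \<xi>] hermite_deriv[of k \<xi>] by (simp add: add.commute)
  then have "((\<lambda>t. complex_of_real (hermite k (\<xi> + t))) has_vector_derivative of_real (\<xi> * hermite k \<xi> - hermite (Suc k) \<xi>)) (at 0)"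
   by (intro has_vector_derivative_of_real)
  then show "((\<lambda>t. c * of_real (hermite k (\<xi> + t))) has_vector_derivative c * of_real (\<xi> * hermite k \<xi> - hermite (Suc k) \<xi>)) (at 0)"
   by (intro has_vector_derivative_mult_right)
 qed
 ultimately have 1: "(LINT x|lborel. - \<i> * of_real x * E \<xi> x * of_real (hermite k x)) = c * of_real (\<xi> * hermite k \<xi> - hermite (Suc k) \<xi>)"
  by (rule LIMSEQ_unique)
 \<comment> \<open>The derivative in x of the integrand for index k. Its vanishing integral trades
   the derivative of the Hermite function for the factor \<xi>.\<close>
 define f' where "f' x = E \<xi> x * of_real (x * hermite k x) - \<i> * of_real \<xi> * (E \<xi> x * of_real (hermite k x)) - E \<xi> x * of_real (hermite (Suc k) x)" for x
 obtain C1 where C1: "C1 \<ge> 0" "\<forall>x. \<bar>x\<bar>^1 * \<bar>hermite k x\<bar> \<le> C1 * inverse (1 + x^2)"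
  using hermite_integrable_bound by meson
 obtain C2 where C2: "C2 \<ge> 0" "\<forall>x. \<bar>x\<bar>^0 * \<bar>hermite k x\<bar> \<le> C2 * inverse (1 + x^2)"
  using hermite_integrable_bound by meson
 obtain C3 where C3: "C3 \<ge> 0" "\<forall>x. \<bar>x\<bar>^0 * \<bar>hermite (Suc k) x\<bar> \<le> C3 * inverse (1 + x^2)"
  using hermite_integrable_bound by meson
 have "(LINT x|lborel. f' x) = 0"
 proof (rule integral_directional_derivative[where f = "\<lambda>x. E \<xi> x * of_real (hermite k x)" and v = 1])
  show "((\<lambda>t. E \<xi> (x + t *\<^sub>R 1) * of_real (hermite k (x + t *\<^sub>R 1))) has_vector_derivative f' x) (at 0)" for x
  proof -
   have "((\<lambda>t. hermite k (x + t)) has_real_derivative (x * hermite k x - hermite (Suc k) x)) (at 0)"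
    using DERIV_shift[of "hermite k" _ 0 x] hermite_deriv[of k x] by (simp add: add.commute)
   then have "((\<lambda>t. complex_of_real (hermite k (x + t))) has_vector_derivative of_real (x * hermite k x - hermite (Suc k) x)) (at 0)"
    by (intro has_vector_derivative_of_real)
   moreover have "((\<lambda>t. E \<xi> (x + t)) has_vector_derivative - \<i> * of_real \<xi> * E \<xi> x) (at 0)"
    unfolding E_def using exp_phase_derivative[of \<xi> x 0] by (simp add: mult.commute)
   ultimately have "((\<lambda>t. E \<xi> (x + t) * of_real (hermite k (x + t))) has_vector_derivative
     E \<xi> (x + 0) * of_real (x * hermite k x - hermite (Suc k) x) + - \<i> * of_real \<xi> * E \<xi> x * of_real (hermite k (x + 0))) (at 0)"
    by (intro has_vector_derivative_mult)
   then show ?thesis by (simp add: f'_def algebra_simps)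
  qed
  have f'b: "cmod (f' y) \<le> (C1 + \<bar>\<xi>\<bar> * C2 + C3) * inverse (1 + y^2)" for y
  proof -
   have "cmod (f' y) \<le> \<bar>y\<bar>^1 * \<bar>hermite k y\<bar> + \<bar>\<xi>\<bar> * (\<bar>y\<bar>^0 * \<bar>hermite k y\<bar>) + \<bar>y\<bar>^0 * \<bar>hermite (Suc k) y\<bar>"
    unfolding f'_def
    by (rule order_trans[OF norm_triangle_ineq4] add_mono order_refl)+ (auto simp: norm_mult)
   also have "\<dots> \<le> C1 * inverse (1 + y^2) + \<bar>\<xi>\<bar> * (C2 * inverse (1 + y^2)) + C3 * inverse (1 + y^2)"
    using C1 C2 C3 by (intro add_mono mult_left_mono) auto
   finally show ?thesis by (simp add: algebra_simps)
  qed
  show "cmod (f' (x + t *\<^sub>R 1)) \<le> (C1 + \<bar>\<xi>\<bar> * C2 + C3) * (3 * inverse (1 + x^2))" if "0 \<le> t" "t \<le> 1" for t x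
   using order_trans[OF f'b[of "x + t"] mult_left_mono[OF inverse_square_shift[OF that, of x]]] C1(1) C2(1) C3(1)
   by simp
  show "integrable lborel (\<lambda>x. (C1 + \<bar>\<xi>\<bar> * C2 + C3) * (3 * inverse (1 + x^2)))"
   by (intro integrable_mult_right integrable_inverse_square)
 qed (rule int0)
 moreover have "(LINT x|lborel. f' x) = (LINT x|lborel. E \<xi> x * of_real (x * hermite k x))
   - \<i> * of_real \<xi> * (LINT x|lborel. E \<xi> x * of_real (hermite k x)) - (LINT x|lborel. E \<xi> x * of_real (hermite (Suc k) x))"
  unfolding f'_def using int0[of \<xi> k] int1[of \<xi> k] int0[of \<xi> "Suc k"] by simp
 moreover have 2: "(LINT x|lborel. - \<i> * of_real x * E \<xi> x * of_real (hermite k x)) = - \<i> * (LINT x|lborel. E \<xi> x * of_real (x * hermite k x))"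
  by (subst integral_mult_right_zero[symmetric]) (simp add: mult_ac)
 moreover have "(LINT x|lborel. E \<xi> x * of_real (hermite k x)) = c * of_real (hermite k \<xi>)"
  unfolding E_def Suc.IH c_def ..
 ultimately have "(LINT x|lborel. E \<xi> x * of_real (hermite (Suc k) x))
   = \<i> * (- \<i> * (LINT x|lborel. E \<xi> x * of_real (x * hermite k x))) - \<i> * of_real \<xi> * (c * of_real (hermite k \<xi>))"
  by (simp add: algebra_simps)
 also have "- \<i> * (LINT x|lborel. E \<xi> x * of_real (x * hermite k x)) = c * of_real (\<xi> * hermite k \<xi> - hermite (Suc k) \<xi>)"
  using 1 2 by simp
 finally show ?case
  unfolding E_def c_def by (simp add: algebra_simps)
qed

lemma herm_fourier:
 "(LINT x|lborel. phase (x * \<xi>) * of_real (herm k x))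
  = of_real (sqrt (2 * pi)) * (- \<i>)^k * of_real (herm k \<xi>)"
proof -
 have "(LINT x|lborel. phase (x * \<xi>) * of_real (herm k x))
   = (LINT x|lborel. phase (x * \<xi>) * of_real (hermite k x)) / of_real (sqrt (hermite_norm2 k))"
  by (simp add: herm_def)
 then show ?thesis unfolding hermite_fourier by (simp add: herm_def)
qed

lemma herm_minus: "herm k (- x) = (-1)^k * herm k x"
 by (simp add: herm_def hermite_minus)

section \<open>Pointwise bounds with polynomial growth in the index\<close>

lemma herm_moment: "(LINT x|lborel. (1 + x^2) * (herm k x * herm k x)) = real k + 3 / 2"
proof -
 define a b where "a = sqrt ((real k + 1) / 2)" and "b = sqrt (real k / 2)"
 have i: "integrable lborel (\<lambda>x. herm j x * herm l x)" for j l
  using herm_mult_integrable[of 0 j l] by simp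
 have "(1 + x^2) * (herm k x * herm k x)
   = herm k x * herm k x + (a^2 * (herm (Suc k) x * herm (Suc k) x) + 2 * a * b * (herm (Suc k) x * herm (k - 1) x)
    + b^2 * (herm (k - 1) x * herm (k - 1) x))" for x
 proof -
  have "(1 + x^2) * (herm k x * herm k x) = herm k x * herm k x + (x * herm k x) * (x * herm k x)"
   by (simp add: power2_eq_square algebra_simps)
  then show ?thesis
   unfolding herm_rec[of x k] a_def[symmetric] b_def[symmetric] by (simp add: power2_eq_square algebra_simps)
 qed
 then have "(LINT x|lborel. (1 + x^2) * (herm k x * herm k x)) = 1 + (a^2 + 0 + b^2)"
  using i by (simp add: herm_orthonormal)
 then show ?thesis by (simp add: a_def b_def field_simps)
qed

text \<open>As a Fourier eigenfunction, a Hermite function is bounded by a multiple of its own L1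
  norm. The latter is controlled by the inequality of arithmetic and geometric mean with weight 1 +
  y^2 and by the second moment.\<close>

lemma herm_sup: "\<bar>herm k x\<bar> \<le> real k + 2"
proof -
 have i: "integrable lborel (\<lambda>x. (1 + x^2) * (herm k x * herm k x))"
  using herm_mult_integrable[of 0 k k] herm_mult_integrable[of 2 k k] by (simp add: distrib_right)
 have "sqrt (2 * pi) * \<bar>herm k x\<bar> = cmod (LINT y|lborel. phase (y * x) * of_real (herm k y))"
  unfolding herm_fourier by (simp add: norm_mult norm_power)
 also have "\<dots> \<le> (LINT y|lborel. norm (phase (y * x) * of_real (herm k y)))"
  by (rule integral_norm_bound)
 also have "\<dots> = (LINT y|lborel. \<bar>herm k y\<bar>)" by (simp add: norm_mult)
 also have "\<dots> \<le> (LINT y|lborel. (inverse (1 + y^2) + (1 + y^2) * (herm k y * herm k y)) / 2)"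
 proof (rule integral_mono)
  show "integrable lborel (\<lambda>y. \<bar>herm k y\<bar>)" using herm_integrable[of 0 k] by simp
  show "integrable lborel (\<lambda>y. (inverse (1 + y^2) + (1 + y^2) * (herm k y * herm k y)) / 2)"
   using i integrable_inverse_square by simp
  fix y :: real
  define s where "s = sqrt (1 + y^2)"
  have s: "s > 0" "s^2 = 1 + y^2" by (simp_all add: s_def add_pos_nonneg)
  have "0 \<le> (1 / s - s * \<bar>herm k y\<bar>)^2" by simp
  also have "\<dots> = inverse (s^2) + s^2 * (herm k y * herm k y) - 2 * \<bar>herm k y\<bar>"
   using s(1) by (simp add: power2_diff power_mult_distrib field_simps) (simp add: power2_eq_square)
  finally show "\<bar>herm k y\<bar> \<le> (inverse (1 + y^2) + (1 + y^2) * (herm k y * herm k y)) / 2"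
   unfolding s(2) by simp
 qed
 also have "\<dots> = (pi + (real k + 3 / 2)) / 2"
  using i integrable_inverse_square by (simp add: herm_moment)
 finally have "sqrt (2 * pi) * \<bar>herm k x\<bar> \<le> (pi + (real k + 3 / 2)) / 2" .
 moreover have "sqrt 4 * \<bar>herm k x\<bar> \<le> sqrt (2 * pi) * \<bar>herm k x\<bar>"
  using pi_gt3 by (intro mult_right_mono real_sqrt_le_mono) auto
 ultimately have "2 * \<bar>herm k x\<bar> \<le> (pi + (real k + 3 / 2)) / 2"
  by (simp only: real_sqrt_four)
 also have "\<dots> \<le> 2 * (real k + 2)" using pi_less_4 by simp
 finally show ?thesis by simp
qed

text \<open>Applied twice, the recurrence writes x^2 times a Hermite function as a combination of
  Hermite functions of nearby index, to which the uniform bound applies.\<close>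

lemma herm_bound: "\<bar>herm k x\<bar> \<le> 4 * (real k + 4)^3 * inverse (1 + x^2)"
proof -
 define a b where "a j = sqrt ((real j + 1) / 2)" and "b j = sqrt (real j / 2)" for j
 have ab: "0 \<le> a j" "a j \<le> real j + 1" "0 \<le> b j" "b j \<le> real j + 1" for j
  by (auto simp: a_def b_def power2_eq_square algebra_simps intro!: real_le_lsqrt)
 have rec: "\<bar>y * (x * herm j x)\<bar> \<le> (real j + 1) * (c + d)"
  if "\<bar>y * herm (Suc j) x\<bar> \<le> c" "\<bar>y * herm (j - 1) x\<bar> \<le> d" for y c d j
 proof -
  have "y * (x * herm j x) = a j * (y * herm (Suc j) x) + b j * (y * herm (j - 1) x)"
   using herm_rec[of x j] unfolding a_def[symmetric] b_def[symmetric] by (simp add: algebra_simps)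
  then have "\<bar>y * (x * herm j x)\<bar> \<le> a j * \<bar>y * herm (Suc j) x\<bar> + b j * \<bar>y * herm (j - 1) x\<bar>"
   using abs_triangle_ineq[of "a j * (y * herm (Suc j) x)" "b j * (y * herm (j - 1) x)"] ab[of j]
   by (simp only: abs_mult abs_of_nonneg)
  also have "\<dots> \<le> (real j + 1) * c + (real j + 1) * d"
   using ab[of j] that by (intro add_mono mult_mono) auto
  finally show ?thesis by (simp add: algebra_simps)
 qed
 have x1: "\<bar>x * herm j x\<bar> \<le> 2 * (real j + 3)^2" for j
 proof -
  have "\<bar>1 * (x * herm j x)\<bar> \<le> (real j + 1) * ((real j + 3) + (real j + 3))"
   using herm_sup[of "Suc j" x] herm_sup[of "j - 1" x] by (intro rec) auto
  also have "\<dots> \<le> 2 * (real j + 3)^2" by (simp add: power2_eq_square algebra_simps)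
  finally show ?thesis by simp
 qed
 have x2: "\<bar>x * (x * herm k x)\<bar> \<le> (real k + 1) * (2 * (real k + 4)^2 + 2 * (real k + 4)^2)"
 proof (rule rec)
  show "\<bar>x * herm (Suc k) x\<bar> \<le> 2 * (real k + 4)^2" using x1[of "Suc k"] by (simp add: algebra_simps)
  have "2 * (real (k - 1) + 3)^2 \<le> 2 * (real k + 4)^2" by (intro mult_left_mono power_mono) auto
  then show "\<bar>x * herm (k - 1) x\<bar> \<le> 2 * (real k + 4)^2" using x1[of "k - 1"] by (rule order_trans[rotated])
 qed
 have "(1 + x^2) * \<bar>herm k x\<bar> = \<bar>herm k x\<bar> + \<bar>x * (x * herm k x)\<bar>"
  by (simp add: abs_mult power2_eq_square algebra_simps)
 also have "\<dots> \<le> (real k + 2) + (real k + 1) * (2 * (real k + 4)^2 + 2 * (real k + 4)^2)"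
  by (intro add_mono herm_sup x2)
 also have "\<dots> \<le> 4 * (real k + 4)^3"
  by (simp add: power2_eq_square power3_eq_cube algebra_simps)
 finally have "(1 + x^2) * \<bar>herm k x\<bar> \<le> 4 * (real k + 4)^3" .
 moreover have "0 < 1 + x^2" by (simp add: add_pos_nonneg)
 ultimately show ?thesis by (simp add: field_simps)
qed

section \<open>Hermite functions of several variables\<close>

lemma
 fixes F :: "'n::finite \<Rightarrow> real \<Rightarrow> 'b::{real_normed_field, banach, second_countable_topology}"
 assumes F: "\<And>i. integrable lborel (F i)"
 shows integrable_prod_vec: "integrable lborel (\<lambda>x::real^'n. \<Prod>i\<in>UNIV. F i (x $ i))"
  and integral_prod_vec: "(LINT x|lborel. (\<Prod>i\<in>UNIV. F i ((x::real^'n) $ i))) = (\<Prod>i\<in>UNIV. (LINT t|lborel. F i t))"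
proof -
 interpret product_sigma_finite "\<lambda>_::real^'n. lborel :: real measure" ..
 let ?ax = "\<lambda>i::'n. axis i (1::real)"
 have inj: "inj ?ax" by (auto simp: inj_on_def axis_eq_axis)
 have B: "Basis = range ?ax" by (auto simp: Basis_vec_def)
 define G where "G b = F (inv ?ax b)" for b
 have G: "G (?ax i) = F i" for i unfolding G_def using inv_f_f[OF inj] by simp
 let ?T = "\<lambda>f::real^'n \<Rightarrow> real. \<Sum>b\<in>Basis. f b *\<^sub>R b"
 have comp: "?T f $ i = f (?ax i)" for f i
 proof -
  have "?T f $ i = (\<Sum>j\<in>UNIV. f (?ax j) * (?ax j $ i))"
   unfolding B by (subst sum.reindex[OF inj]) simp
  also have "\<dots> = (\<Sum>j\<in>UNIV. if j = i then f (?ax i) else 0)"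
   by (intro sum.cong) (auto simp: axis_def)
  finally show ?thesis by simp
 qed
 have prod: "(\<Prod>i\<in>UNIV. F i (?T f $ i)) = (\<Prod>b\<in>Basis. G b (f b))" for f
  unfolding comp unfolding B by (subst prod.reindex[OF inj]) (simp add: G)
 have [measurable]: "F i \<in> borel_measurable borel" for i
  using borel_measurable_integrable[OF F] by simp
 have m[measurable]: "(\<lambda>x::real^'n. \<Prod>i\<in>UNIV. F i (x $ i)) \<in> borel_measurable borel"
  by (intro borel_measurable_prod measurable_compose[OF _ \<open>F _ \<in> borel_measurable borel\<close>]) simp
 have T: "?T \<in> (\<Pi>\<^sub>M b\<in>Basis. lborel) \<rightarrow>\<^sub>M borel" by measurable
 have L: "(lborel :: (real^'n) measure) = distr (\<Pi>\<^sub>M b\<in>Basis. lborel) borel ?T" by (rule lborel_eq)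
 have iG: "integrable lborel (G b)" for b unfolding G_def by (rule F)
 show "integrable lborel (\<lambda>x::real^'n. \<Prod>i\<in>UNIV. F i (x $ i))"
  unfolding L integrable_distr_eq[OF T m] prod
  by (intro product_integrable_prod) (auto simp: iG)
 show "(LINT x|lborel. (\<Prod>i\<in>UNIV. F i ((x::real^'n) $ i))) = (\<Prod>i\<in>UNIV. (LINT t|lborel. F i t))"
  unfolding L integral_distr[OF T m] prod
  by (subst product_integral_prod) (auto simp: iG B prod.reindex[OF inj] G)
qed

text \<open>A product over the coordinates instead of a radial function, so that it factorizes in
  the same way as Hermite functions and their Fourier transforms.\<close>

definition decay_weight :: "real ^ 'n::finite \<Rightarrow> real" where
 "decay_weight x = (\<Prod>i\<in>UNIV. inverse (1 + (x $ i)^2))"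

lemma decay_weight_integrable: "integrable lborel decay_weight"
 unfolding decay_weight_def by (rule integrable_prod_vec) (rule integrable_inverse_square)

lemma decay_weight_measurable[measurable]: "decay_weight \<in> borel_measurable borel"
 using borel_measurable_integrable[OF decay_weight_integrable] by simp

lemma decay_weight_pos: "0 < decay_weight x"
 unfolding decay_weight_def by (intro prod_pos) (simp add: add_pos_nonneg)

lemma inverse_square_le_1: "inverse (1 + (t::real)^2) \<le> 1"
 by (simp add: inverse_le_1_iff)

lemma decay_weight_le_1: "decay_weight x \<le> 1"
 unfolding decay_weight_def by (intro prod_le_1) (auto simp: inverse_square_le_1)

definition herm_vec :: "('n::finite \<Rightarrow> nat) \<Rightarrow> real ^ 'n \<Rightarrow> real" where
 "herm_vec \<alpha> x = (\<Prod>i\<in>UNIV. herm (\<alpha> i) (x $ i))"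

lemma herm_vec_measurable[measurable]: "herm_vec \<alpha> \<in> borel_measurable borel"
 unfolding herm_vec_def[abs_def]
 by (intro borel_measurable_prod measurable_compose[OF _ herm_measurable]) simp

definition hermite_const :: "('n::finite \<Rightarrow> nat) \<Rightarrow> real" where
 "hermite_const \<alpha> = (\<Prod>i\<in>UNIV. 4 * (real (\<alpha> i) + 4)^3)"

lemma hermite_const_nonneg: "0 \<le> hermite_const \<alpha>"
 unfolding hermite_const_def by (intro prod_nonneg) auto

lemma herm_vec_bound: "\<bar>herm_vec \<alpha> x\<bar> \<le> hermite_const \<alpha> * decay_weight x"
 unfolding herm_vec_def hermite_const_def decay_weight_def abs_prod prod.distrib[symmetric]
 by (intro prod_mono) (auto simp: herm_bound)

lemma L2_decay_weight:
 assumes "\<phi> \<in> borel_measurable borel" "\<And>x. cmod (\<phi> x) \<le> B * decay_weight x"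
 shows "\<phi> \<in> L2"
proof -
 have "\<phi> \<in> borel_measurable lebesgue" using assms(1) by (simp add: measurable_completion)
 moreover have "integrable lborel (\<lambda>x. (cmod (\<phi> x))^2)"
 proof (rule Bochner_Integration.integrable_bound)
  show "integrable lborel (\<lambda>x. B^2 * decay_weight x)"
   by (intro integrable_mult_right decay_weight_integrable)
  have "(cmod (\<phi> x))^2 \<le> B^2 * decay_weight x" for x
  proof -
   have "(cmod (\<phi> x))^2 \<le> (B * decay_weight x)^2" using assms(2) by (intro power_mono) auto
   also have "\<dots> = B^2 * (decay_weight x * decay_weight x)" by (simp add: power2_eq_square)
   also have "\<dots> \<le> B^2 * (decay_weight x * 1)"
    using decay_weight_pos[of x] decay_weight_le_1[of x] by (intro mult_left_mono) auto
   finally show ?thesis by simp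
  qed
  then show "AE x in lborel. norm ((cmod (\<phi> x))^2) \<le> norm (B^2 * decay_weight x)"
   using decay_weight_pos by (auto intro: order_trans[OF _ abs_ge_self])
 qed (use assms(1) in measurable)
 then have "integrable lebesgue (\<lambda>x. (cmod (\<phi> x))^2)"
  using assms(1) by (subst integrable_completion) auto
 ultimately show ?thesis by (simp add: L2_iff)
qed

lemma herm_vec_L2: "(\<lambda>x. of_real (herm_vec \<alpha> x)) \<in> L2"
 by (rule L2_decay_weight[where B = "hermite_const \<alpha>"]) (auto simp: herm_vec_bound)

definition hv :: "('n::finite \<Rightarrow> nat) \<Rightarrow> 'n l2" where
 "hv \<alpha> = cls (\<lambda>x. of_real (herm_vec \<alpha> x))"

lemma hv_orthonormal:
 fixes \<alpha> \<beta> :: "'n::finite \<Rightarrow> nat"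
 shows "cin (hv \<alpha>) (hv \<beta>) = (if \<alpha> = \<beta> then 1 else 0)"
proof -
 have "cin (hv \<alpha>) (hv \<beta>) = (LINT x|lebesgue. of_real (herm_vec \<alpha> x * herm_vec \<beta> x))"
  unfolding hv_def by (simp add: cin_cls herm_vec_L2 L2inner_def)
 also have "\<dots> = of_real (LINT x|lborel. herm_vec \<alpha> x * herm_vec \<beta> x)"
  by (subst integral_complex_of_real, subst integral_completion) auto
 also have "(LINT x|lborel. herm_vec \<alpha> x * herm_vec \<beta> x)
   = (LINT x|lborel. (\<Prod>i\<in>UNIV. herm (\<alpha> i) ((x::real^'n) $ i) * herm (\<beta> i) (x $ i)))"
  by (simp add: herm_vec_def prod.distrib)
 also have "\<dots> = (\<Prod>i\<in>UNIV. if \<alpha> i = \<beta> i then 1 else 0)"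
  using herm_mult_integrable[of 0] by (subst integral_prod_vec) (auto simp: herm_orthonormal)
 also have "\<dots> = (if \<alpha> = \<beta> then 1 else 0)"
  by (auto simp: fun_eq_iff)
 finally show ?thesis by simp
qed

definition degree_of :: "('n::finite \<Rightarrow> nat) \<Rightarrow> nat" where
 "degree_of \<alpha> = (\<Sum>i\<in>UNIV. \<alpha> i)"

lemma inner_vec_sum: "x \<bullet> y = (\<Sum>i\<in>UNIV. x $ i * y $ i)" for x y :: "real ^ 'n::finite"
 by (simp add: inner_vec_def)

lemma herm_vec_fourier:
 fixes \<xi> :: "real ^ 'n::finite"
 shows "(LINT x|lborel. phase (x \<bullet> \<xi>) * of_real (herm_vec \<alpha> x))
  = of_real ((2 * pi) powr (real CARD('n) / 2)) * (- \<i>)^degree_of \<alpha> * of_real (herm_vec \<alpha> \<xi>)"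
proof -
 have "phase (x \<bullet> \<xi>) * of_real (herm_vec \<alpha> x)
   = (\<Prod>i\<in>UNIV. phase (x $ i * \<xi> $ i) * of_real (herm (\<alpha> i) (x $ i)))" for x :: "real^'n"
  unfolding prod.distrib by (simp add: herm_vec_def inner_vec_sum sum_distrib_left exp_sum flip: sum_negf)
 then have "(LINT x|lborel. phase (x \<bullet> \<xi>) * of_real (herm_vec \<alpha> x))
  = (\<Prod>i\<in>UNIV. (LINT t|lborel. phase (t * \<xi> $ i) * of_real (herm (\<alpha> i) t)))"
 proof (simp only:, subst integral_prod_vec)
  show "integrable lborel (\<lambda>t. phase (t * \<xi> $ i) * of_real (herm (\<alpha> i) t))" for i
   by (rule Bochner_Integration.integrable_bound[OF herm_integrable[of 0 "\<alpha> i"]]) (auto simp: norm_mult)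
 qed simp
 also have "\<dots> = (\<Prod>i\<in>UNIV. of_real (sqrt (2 * pi)) * (- \<i>)^\<alpha> i * of_real (herm (\<alpha> i) (\<xi> $ i)))"
  by (simp only: herm_fourier)
 also have "\<dots> = of_real (sqrt (2 * pi)) ^ CARD('n) * (- \<i>)^degree_of \<alpha> * of_real (herm_vec \<alpha> \<xi>)"
  by (simp add: prod.distrib degree_of_def power_sum herm_vec_def)
 also have "of_real (sqrt (2 * pi)) ^ CARD('n) = complex_of_real ((2 * pi) powr (real CARD('n) / 2))"
 proof -
  have "(2 * pi) powr (real CARD('n) / 2) = sqrt (2 * pi) ^ CARD('n)"
   using powr_powr[of "2 * pi" "1/2" "real CARD('n)"] powr_realpow[of "sqrt (2 * pi)" "CARD('n)"]
   by (simp add: powr_half_sqrt)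
  then show ?thesis by simp
 qed
 finally show ?thesis .
qed

lemma prod_fun_upd: "(\<Prod>j\<in>UNIV. f j ((\<alpha>(i := k)) j)) = f i k * (\<Prod>j\<in>UNIV - {i}. f j (\<alpha> j))" for i :: "'n::finite"
proof -
 have "(\<Prod>j\<in>UNIV. f j ((\<alpha>(i := k)) j)) = f i ((\<alpha>(i := k)) i) * (\<Prod>j\<in>UNIV - {i}. f j ((\<alpha>(i := k)) j))"
  by (rule prod.remove) auto
 also have "(\<Prod>j\<in>UNIV - {i}. f j ((\<alpha>(i := k)) j)) = (\<Prod>j\<in>UNIV - {i}. f j (\<alpha> j))"
  by (intro prod.cong) auto
 finally show ?thesis by simp
qed

lemma herm_vec_remove: "herm_vec \<alpha> x = herm (\<alpha> i) (x $ i) * (\<Prod>j\<in>UNIV - {i}. herm (\<alpha> j) (x $ j))"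
 unfolding herm_vec_def by (rule prod.remove) auto

lemma herm_vec_rec:
 "x $ i * herm_vec \<alpha> x = sqrt ((real (\<alpha> i) + 1) / 2) * herm_vec (\<alpha>(i := Suc (\<alpha> i))) x
   + sqrt (real (\<alpha> i) / 2) * herm_vec (\<alpha>(i := \<alpha> i - 1)) x"
proof -
 have "herm_vec (\<alpha>(i := k)) x = herm k (x $ i) * (\<Prod>j\<in>UNIV - {i}. herm (\<alpha> j) (x $ j))" for k
  unfolding herm_vec_def by (rule prod_fun_upd[of "\<lambda>j k. herm k (x $ j)"])
 moreover have "x $ i * herm_vec \<alpha> x = (x $ i * herm (\<alpha> i) (x $ i)) * (\<Prod>j\<in>UNIV - {i}. herm (\<alpha> j) (x $ j))"
  unfolding herm_vec_remove[of \<alpha> x i] by simp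
 ultimately show ?thesis
  unfolding herm_rec[of "x $ i" "\<alpha> i"] by (simp add: algebra_simps)
qed

text \<open>Gaussian decay with an exponential loss. The family is stable under multiplication by
  exponentials of linear growth, which the exponential series in the completeness proof
  produces.\<close>

definition gauss_growth :: "real \<Rightarrow> real ^ 'n::finite \<Rightarrow> real" where
 "gauss_growth c x = (\<Prod>i\<in>UNIV. exp (- (x $ i)\<^sup>2 / 2 + c * \<bar>x $ i\<bar>))"

lemma gauss_growth_bound1: "exp (- t\<^sup>2 / 2 + c * \<bar>t\<bar>) \<le> 4 * exp (c^2) * inverse (1 + t^2)" for t c :: real
proof -
 have "c * \<bar>t\<bar> \<le> t^2 / 4 + c^2"
  using zero_le_power2[of "\<bar>t\<bar> / 2 - c"] by (simp add: power2_diff power_divide mult.commute)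
 then have "exp (- t\<^sup>2 / 2 + c * \<bar>t\<bar>) \<le> exp (c^2 - t\<^sup>2 / 4)" by simp
 moreover have "1 + t^2 \<le> 4 * exp (t^2 / 4)" using exp_ge_add_one_self[of "t^2 / 4"] by linarith
 ultimately have "exp (- t\<^sup>2 / 2 + c * \<bar>t\<bar>) * (1 + t^2) \<le> exp (c^2 - t\<^sup>2 / 4) * (4 * exp (t^2 / 4))"
  by (intro mult_mono) auto
 also have "\<dots> = 4 * exp (c^2)" by (simp add: exp_diff)
 finally show ?thesis by (simp add: field_simps add_pos_nonneg)
qed

lemma gauss_growth_pos: "0 < gauss_growth c x"
 unfolding gauss_growth_def by (intro prod_pos) simp

lemma gauss_growth_bound: "gauss_growth c x \<le> (4 * exp (c^2))^CARD('n) * decay_weight x" for x :: "real ^ 'n::finite"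
proof -
 have "gauss_growth c x \<le> (\<Prod>i\<in>UNIV. 4 * exp (c^2) * inverse (1 + (x $ i)^2))"
  unfolding gauss_growth_def using gauss_growth_bound1 by (intro prod_mono) auto
 then show ?thesis by (simp add: prod.distrib decay_weight_def)
qed

lemma gauss_growth_measurable[measurable]: "gauss_growth c \<in> borel_measurable borel"
 unfolding gauss_growth_def[abs_def] by measurable

lemma hermite_growth: "\<exists>C\<ge>0. \<forall>x. \<bar>hermite k x\<bar> \<le> C * exp (- x\<^sup>2 / 2 + real k * \<bar>x\<bar>)"
proof (induction k rule: induct_nat_012)
 case 0
 show ?case by (intro exI[of _ 1]) auto
next
 case 1
 have "\<bar>hermite (Suc 0) x\<bar> \<le> 2 * exp (- x\<^sup>2 / 2 + real (Suc 0) * \<bar>x\<bar>)" for x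
 proof -
  have "\<bar>x\<bar> \<le> exp \<bar>x\<bar>" using exp_ge_add_one_self[of "\<bar>x\<bar>"] by linarith
  then have "\<bar>x\<bar> * exp (- x\<^sup>2 / 2) \<le> exp \<bar>x\<bar> * exp (- x\<^sup>2 / 2)" by (rule mult_right_mono) simp
  also have "\<dots> = exp (- x\<^sup>2 / 2 + \<bar>x\<bar>)" by (simp only: exp_add mult.commute)
  finally show ?thesis by (simp add: abs_mult)
 qed
 then show ?case by (intro exI[of _ 2]) auto
next
 case (ge2 k)
 obtain C D where C: "C \<ge> 0" "\<forall>x. \<bar>hermite k x\<bar> \<le> C * exp (- x\<^sup>2 / 2 + real k * \<bar>x\<bar>)"
  and D: "D \<ge> 0" "\<forall>x. \<bar>hermite (Suc k) x\<bar> \<le> D * exp (- x\<^sup>2 / 2 + real (Suc k) * \<bar>x\<bar>)"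
  using ge2.IH by blast
 have "\<bar>hermite (Suc (Suc k)) x\<bar> \<le> (2 * D + 2 * real (Suc k) * C) * exp (- x\<^sup>2 / 2 + real (Suc (Suc k)) * \<bar>x\<bar>)" for x
 proof -
  let ?e = "exp (- x\<^sup>2 / 2 + real (Suc (Suc k)) * \<bar>x\<bar>)"
  have "\<bar>x\<bar> \<le> exp \<bar>x\<bar>" using exp_ge_add_one_self[of "\<bar>x\<bar>"] by linarith
  then have "\<bar>x\<bar> * \<bar>hermite (Suc k) x\<bar> \<le> exp \<bar>x\<bar> * (D * exp (- x\<^sup>2 / 2 + real (Suc k) * \<bar>x\<bar>))"
   using D by (intro mult_mono) auto
  also have "\<dots> = D * ?e" by (simp add: algebra_simps flip: exp_add)
  finally have 1: "\<bar>x\<bar> * \<bar>hermite (Suc k) x\<bar> \<le> D * ?e" .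
  have "\<bar>hermite k x\<bar> \<le> C * exp (- x\<^sup>2 / 2 + real k * \<bar>x\<bar>)" using C by blast
  also have "\<dots> \<le> C * ?e"
   using C(1) by (intro mult_left_mono) (auto simp: algebra_simps)
  finally have 2: "\<bar>hermite k x\<bar> \<le> C * ?e" .
  have "\<bar>hermite (Suc (Suc k)) x\<bar> \<le> 2 * (\<bar>x\<bar> * \<bar>hermite (Suc k) x\<bar>) + 2 * real (Suc k) * \<bar>hermite k x\<bar>"
   using abs_triangle_ineq4[of "2 * x * hermite (Suc k) x" "2 * real (Suc k) * hermite k x"]
   by (simp add: abs_mult mult.assoc del: of_nat_Suc)
  also have "\<dots> \<le> 2 * (D * ?e) + 2 * real (Suc k) * (C * ?e)"
   using 1 2 by (intro add_mono mult_left_mono) auto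
  finally show ?thesis by (simp add: algebra_simps del: of_nat_Suc)
 qed
 moreover have "2 * D + 2 * real (Suc k) * C \<ge> 0" using C D by simp
 ultimately show ?case by blast
qed

lemma herm_vec_growth: "\<exists>C c. 0 \<le> C \<and> 0 \<le> c \<and> (\<forall>x. \<bar>herm_vec \<alpha> x\<bar> \<le> C * gauss_growth c x)"
proof -
 have "\<forall>i. \<exists>C\<ge>0. \<forall>x. \<bar>hermite (\<alpha> i) x\<bar> \<le> C * exp (- x\<^sup>2 / 2 + real (\<alpha> i) * \<bar>x\<bar>)"
  using hermite_growth by blast
 then obtain C where C: "\<And>i. C i \<ge> 0" "\<And>i x. \<bar>hermite (\<alpha> i) x\<bar> \<le> C i * exp (- x\<^sup>2 / 2 + real (\<alpha> i) * \<bar>x\<bar>)"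
  by metis
 have deg: "\<alpha> i \<le> degree_of \<alpha>" for i unfolding degree_of_def by (intro member_le_sum) auto
 have "\<bar>herm_vec \<alpha> x\<bar> \<le> (\<Prod>i\<in>UNIV. C i / sqrt (hermite_norm2 (\<alpha> i))) * gauss_growth (degree_of \<alpha>) x" for x
  unfolding herm_vec_def gauss_growth_def abs_prod prod.distrib[symmetric]
 proof (intro prod_mono conjI)
  fix i
  have "\<bar>hermite (\<alpha> i) (x $ i)\<bar> \<le> C i * exp (- (x $ i)\<^sup>2 / 2 + real (\<alpha> i) * \<bar>x $ i\<bar>)" by (rule C)
  also have "\<dots> \<le> C i * exp (- (x $ i)\<^sup>2 / 2 + real (degree_of \<alpha>) * \<bar>x $ i\<bar>)"
   using C(1)[of i] deg[of i] by (intro mult_left_mono) (auto intro: mult_right_mono)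
  finally show "\<bar>herm (\<alpha> i) (x $ i)\<bar> \<le> C i / sqrt (hermite_norm2 (\<alpha> i)) * exp (- (x $ i)\<^sup>2 / 2 + real (degree_of \<alpha>) * \<bar>x $ i\<bar>)"
   using hermite_norm2_pos[of "\<alpha> i"] by (simp add: herm_def divide_right_mono)
 qed simp
 moreover have "0 \<le> (\<Prod>i\<in>UNIV. C i / sqrt (hermite_norm2 (\<alpha> i)))"
  by (intro prod_nonneg ballI divide_nonneg_nonneg real_sqrt_ge_zero less_imp_le[OF hermite_norm2_pos] C(1))
 ultimately show ?thesis by (meson of_nat_0_le_iff)
qed

subsection \<open>Completeness\<close>

lemma fubini_dominated:
 fixes k :: "'a::euclidean_space \<Rightarrow> 'b::euclidean_space \<Rightarrow> complex"
 assumes [measurable]: "(\<lambda>(x, y). k x y) \<in> borel_measurable (borel \<Otimes>\<^sub>M borel)"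
  and A: "integrable lborel A" and B: "integrable lborel B"
  and bound: "\<And>x y. cmod (k x y) \<le> A x * B y"
 shows "(LINT x|lborel. (LINT y|lborel. k x y)) = (LINT y|lborel. (LINT x|lborel. k x y))"
proof -
 have [measurable]: "A \<in> borel_measurable borel" "B \<in> borel_measurable borel"
  using A B borel_measurable_integrable by fastforce+
 have m: "(\<lambda>(x, y). k x y) \<in> borel_measurable (lborel \<Otimes>\<^sub>M lborel)" by measurable
 have mx: "(\<lambda>y. k x y) \<in> borel_measurable lborel" for x by measurable
 have iy: "integrable lborel (\<lambda>y. k x y)" for x
  by (rule Bochner_Integration.integrable_bound[OF integrable_mult_right[OF B, of "A x"]])
    (use bound mx in \<open>auto intro: order_trans[OF _ abs_ge_self]\<close>)
 have "integrable lborel (\<lambda>x. LINT y|lborel. norm (k x y))"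
 proof (rule Bochner_Integration.integrable_bound)
  show "integrable lborel (\<lambda>x. A x * (LINT y|lborel. B y))" by (intro integrable_mult_left A)
  have "norm (LINT y|lborel. norm (k x y)) \<le> norm (A x * (LINT y|lborel. B y))" for x
  proof -
   have "(LINT y|lborel. norm (k x y)) \<le> (LINT y|lborel. A x * B y)"
    using bound iy B by (intro integral_mono) auto
   then have "(LINT y|lborel. norm (k x y)) \<le> A x * (LINT y|lborel. B y)" by simp
   moreover have "0 \<le> (LINT y|lborel. norm (k x y))" by simp
   ultimately show ?thesis by simp
  qed
  then show "AE x in lborel. norm (LINT y|lborel. norm (k x y)) \<le> norm (A x * (LINT y|lborel. B y))" by simp
 qed measurable
 then have "integrable (lborel \<Otimes>\<^sub>M lborel) (\<lambda>(x, y). k x y)"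
  using m iy by (intro lborel_pair.Fubini_integrable) auto
 then show ?thesis by (rule lborel_pair.Fubini_integral[symmetric])
qed

text \<open>Boxes generate the Borel sets and are closed under intersection; the vanishing total
  integral takes care of complements. Real and imaginary part are then determined by their integrals
  over Borel sets.\<close>

lemma AE_zero_of_box_integrals:
 fixes v :: "'a::euclidean_space \<Rightarrow> complex"
 assumes v: "integrable lborel v" and total: "(LINT x|lborel. v x) = 0"
  and box: "\<And>a b. (LINT x:box a b|lborel. v x) = 0"
 shows "AE x in lborel. v x = 0"
proof -
 have si: "set_integrable lborel A v" if "A \<in> sets borel" for A
  unfolding set_integrable_def by (rule integrable_mult_indicator[OF _ v]) (use that in auto)
 have zero: "(LINT x:A|lborel. v x) = 0" if A: "A \<in> sets borel" for A
 proof -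
  let ?G = "range (\<lambda>(a, b). box a b :: 'a set)"
  have "Int_stable ?G" by (auto simp: Int_stable_def box_Int_box)
  moreover have "?G \<subseteq> Pow UNIV" by auto
  moreover have "A \<in> sigma_sets UNIV ?G" using A unfolding borel_eq_box by simp
  ultimately show ?thesis
  proof (induction rule: sigma_sets_induct_disjoint)
   case (basic A)
   then show ?case using box by auto
  next
   case empty
   show ?case by (simp add: set_lebesgue_integral_def)
  next
   case (compl A)
   have [measurable]: "A \<in> sets borel" using compl(1) unfolding borel_eq_box by simp
   have "(LINT x:(A \<union> (UNIV - A))|lborel. v x) = (LINT x:A|lborel. v x) + (LINT x:(UNIV - A)|lborel. v x)"
    by (intro set_integral_Un si) auto
   then show ?case using compl(2) total by (simp add: set_lebesgue_integral_def)
  next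
   case (union A)
   have [measurable]: "A i \<in> sets borel" for i
    using union(2) unfolding borel_eq_box by auto
   have "(LINT x:(\<Union>i. A i)|lborel. v x) = (\<Sum>i. LINT x:A i|lborel. v x)"
    using union(1) by (intro lebesgue_integral_countable_add si) (auto simp: disjoint_family_on_def)
   then show ?case using union(3) by simp
  qed
 qed
 have Re0: "AE x in lborel. Re (v x) = 0"
 proof (rule density_unique_real)
  fix A assume "A \<in> sets (lborel :: 'a measure)"
  then have A: "A \<in> sets borel" by simp
  have "(LINT x:A|lborel. Re (v x)) = Re (LINT x:A|lborel. v x)"
   using si[OF A] unfolding set_lebesgue_integral_def set_integrable_def
   by (subst integral_Re[symmetric]) auto
  then show "(LINT x:A|lborel. Re (v x)) = (LINT x:A|lborel. 0)"
   using zero[OF A] by (simp add: set_lebesgue_integral_def)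
 qed (use v in auto)
 have Im0: "AE x in lborel. Im (v x) = 0"
 proof (rule density_unique_real)
  fix A assume "A \<in> sets (lborel :: 'a measure)"
  then have A: "A \<in> sets borel" by simp
  have "(LINT x:A|lborel. Im (v x)) = Im (LINT x:A|lborel. v x)"
   using si[OF A] unfolding set_lebesgue_integral_def set_integrable_def
   by (subst integral_Im[symmetric]) auto
  then show "(LINT x:A|lborel. Im (v x)) = (LINT x:A|lborel. 0)"
   using zero[OF A] by (simp add: set_lebesgue_integral_def)
 qed (use v in auto)
 from Re0 Im0 show ?thesis by eventually_elim (simp add: complex_eq_iff)
qed

text \<open>The Gaussian \<open>\<gamma>\<close> is a multiple of its own Fourier transform, so a
  vanishing transform of \<open>v\<close> annihilates all translated and dilated Gaussians.
  Integrated over a box and concentrated by the dilation, these tend to a multiple of the indicator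
  of the box.\<close>

lemma fourier_unique:
 fixes v :: "real ^ 'n::finite \<Rightarrow> complex"
 assumes v: "integrable lborel v"
  and zero: "\<And>y. (LINT x|lborel. exp (\<i> * of_real (x \<bullet> y)) * v x) = 0"
 shows "AE x in lborel. v x = 0"
proof (rule AE_zero_of_box_integrals[OF v])
 have [measurable]: "v \<in> borel_measurable borel" using borel_measurable_integrable[OF v] by simp
 show "(LINT x|lborel. v x) = 0" using zero[of 0] by simp
 define \<gamma> where "\<gamma> = herm_vec (\<lambda>_::'n. 0)"
 define c where "c = (2 * pi) powr (real CARD('n) / 2)"
 have c: "c > 0" by (simp add: c_def)
 have [measurable]: "\<gamma> \<in> borel_measurable borel" by (simp add: \<gamma>_def)
 obtain B where B: "B \<ge> 0" "\<And>x. \<bar>\<gamma> x\<bar> \<le> B * decay_weight x"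
  using herm_vec_bound hermite_const_nonneg unfolding \<gamma>_def by blast
 have B1: "\<bar>\<gamma> x\<bar> \<le> B" for x
  using order_trans[OF B(2) mult_left_mono[OF decay_weight_le_1 B(1)]] by simp
 have i\<gamma>: "integrable lborel \<gamma>"
  by (rule Bochner_Integration.integrable_bound[OF integrable_mult_right[OF decay_weight_integrable, of B]])
   (use B in \<open>auto simp: abs_mult abs_of_pos[OF decay_weight_pos]\<close>)
 have F\<gamma>: "(LINT y|lborel. phase (y \<bullet> \<xi>) * of_real (\<gamma> y)) = of_real c * of_real (\<gamma> \<xi>)" for \<xi>
  unfolding \<gamma>_def c_def herm_vec_fourier by (simp add: degree_of_def)
 \<comment> \<open>The Gaussian is written as a Fourier integral; after the exchange, the inner
   integral is the transform of \<open>v\<close>.\<close>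
 have conv0: "(LINT x|lborel. v x * of_real (\<gamma> (s *\<^sub>R (z - x)))) = 0" for s z
 proof -
  define k where "k y x = of_real (\<gamma> y) * phase (y \<bullet> (s *\<^sub>R (z - x))) * v x" for y x
  have "(LINT y|lborel. (LINT x|lborel. k y x)) = (LINT x|lborel. (LINT y|lborel. k y x))"
  proof (rule fubini_dominated)
   show "(\<lambda>(y, x). k y x) \<in> borel_measurable (borel \<Otimes>\<^sub>M borel)" unfolding k_def by measurable
   show "integrable lborel (\<lambda>y. \<bar>\<gamma> y\<bar>)" "integrable lborel (\<lambda>x. cmod (v x))" using i\<gamma> v by simp_all
  qed (simp add: k_def norm_mult)
  moreover have "(LINT x|lborel. k y x) = 0" for y
  proof -
   have "k y x = (of_real (\<gamma> y) * phase (y \<bullet> (s *\<^sub>R z))) * (exp (\<i> * of_real (x \<bullet> (s *\<^sub>R y))) * v x)" for x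
   proof -
    have "phase (y \<bullet> (s *\<^sub>R (z - x))) = phase (y \<bullet> (s *\<^sub>R z)) * exp (\<i> * of_real (x \<bullet> (s *\<^sub>R y)))"
     unfolding exp_add[symmetric] by (simp add: inner_diff_right algebra_simps inner_commute[of x y])
    then show ?thesis by (simp add: k_def)
   qed
   then show ?thesis by (simp only: integral_mult_right_zero zero) simp
  qed
  moreover have "(LINT y|lborel. k y x) = of_real c * (v x * of_real (\<gamma> (s *\<^sub>R (z - x))))" for x
  proof -
   have "(LINT y|lborel. k y x) = (LINT y|lborel. (phase (y \<bullet> (s *\<^sub>R (z - x))) * of_real (\<gamma> y)) * v x)"
    by (simp add: k_def mult_ac)
   also have "\<dots> = (LINT y|lborel. phase (y \<bullet> (s *\<^sub>R (z - x))) * of_real (\<gamma> y)) * v x"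
    by (rule integral_mult_left_zero)
   finally show ?thesis unfolding F\<gamma> by simp
  qed
  ultimately show ?thesis using c by (simp del: of_real_mult)
 qed
 fix a b :: "real^'n"
 define Q where "Q = box a b"
 \<comment> \<open>The indicator of the box averaged over a Gaussian of width s, after the
   substitution z = x + s t.\<close>
 define \<Phi> where "\<Phi> s x = (LINT t|lborel. indicator Q (x + s *\<^sub>R t) * \<gamma> t)" for s x
 have iQ: "integrable lborel (\<lambda>x. indicator Q x :: real)"
  unfolding Q_def by (rule integrable_real_indicator) (auto intro!: emeasure_lborel_box_finite simp flip: infinity_ennreal_def)
 have [measurable]: "Q \<in> sets borel" by (simp add: Q_def)
 have \<Phi>0: "(LINT x|lborel. v x * of_real (\<Phi> s x)) = 0" if s: "s > 0" for s
 proof -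
  have sub: "(LINT z|lborel. indicator Q z * \<gamma> (inverse s *\<^sub>R (z - x))) = s ^ CARD('n) * \<Phi> s x" for x
  proof -
   have "(lborel :: (real^'n) measure) = density (distr lborel borel (\<lambda>t. x + s *\<^sub>R t)) (\<lambda>_. ennreal (\<bar>s\<bar>^DIM(real^'n)))"
    using lborel_affine[of s x] s by simp
   then have "(LINT z|lborel. indicator Q z * \<gamma> (inverse s *\<^sub>R (z - x)))
     = (LINT z|density (distr lborel borel (\<lambda>t. x + s *\<^sub>R t)) (\<lambda>_. ennreal (\<bar>s\<bar>^DIM(real^'n))). indicator Q z * \<gamma> (inverse s *\<^sub>R (z - x)))"
    by simp
   also have "\<dots> = (LINT z|distr lborel borel (\<lambda>t. x + s *\<^sub>R t). \<bar>s\<bar>^DIM(real^'n) *\<^sub>R (indicator Q z * \<gamma> (inverse s *\<^sub>R (z - x))))"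
    by (rule integral_density) auto
   also have "\<dots> = (LINT t|lborel. \<bar>s\<bar>^DIM(real^'n) *\<^sub>R (indicator Q (x + s *\<^sub>R t) * \<gamma> (inverse s *\<^sub>R ((x + s *\<^sub>R t) - x))))"
    by (rule integral_distr) auto
   also have "\<dots> = s ^ CARD('n) * \<Phi> s x"
    using s by (simp add: \<Phi>_def)
   finally show ?thesis .
  qed
  define k where "k z x = of_real (indicator Q z) * (v x * of_real (\<gamma> (inverse s *\<^sub>R (z - x))))" for z x
  have "(LINT z|lborel. (LINT x|lborel. k z x)) = (LINT x|lborel. (LINT z|lborel. k z x))"
  proof (rule fubini_dominated)
   show "(\<lambda>(z, x). k z x) \<in> borel_measurable (borel \<Otimes>\<^sub>M borel)" unfolding k_def by measurable
   show "integrable lborel (\<lambda>z. indicator Q z * B :: real)" "integrable lborel (\<lambda>x. cmod (v x))" using iQ v by simp_all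
   show "cmod (k z x) \<le> indicator Q z * B * cmod (v x)" for z x
    using mult_left_mono[OF B1[of "inverse s *\<^sub>R (z - x)"], of "cmod (v x)"] by (auto simp: k_def norm_mult indicator_def mult.commute)
  qed
  moreover have "(LINT x|lborel. k z x) = 0" for z
   unfolding k_def integral_mult_right_zero conv0 by simp
  moreover have "(LINT z|lborel. k z x) = of_real (s ^ CARD('n)) * (v x * of_real (\<Phi> s x))" for x
  proof -
   have "(LINT z|lborel. k z x) = (LINT z|lborel. v x * of_real (indicator Q z * \<gamma> (inverse s *\<^sub>R (z - x))))"
    by (simp add: k_def mult_ac)
   also have "\<dots> = v x * of_real (LINT z|lborel. indicator Q z * \<gamma> (inverse s *\<^sub>R (z - x)))"
    unfolding integral_mult_right_zero integral_complex_of_real ..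
   finally show ?thesis unfolding sub by simp
  qed
  ultimately show ?thesis using s by (simp del: of_real_power)
 qed
 define I where "I = (LINT t|lborel. \<gamma> t)"
 have I: "I > 0"
 proof -
  have "complex_of_real I = of_real c * of_real (\<gamma> 0)"
   using F\<gamma>[of 0] by (simp add: I_def)
  then have "I = c * \<gamma> 0" by (simp flip: of_real_mult del: of_real_mult)
  moreover have "\<gamma> 0 > 0"
   unfolding \<gamma>_def herm_vec_def by (intro prod_pos) (simp add: herm_def hermite_norm2_pos)
  ultimately show ?thesis using c by simp
 qed
 \<comment> \<open>On the boundary the averaged indicators need not converge to the indicator, but
   it is a null set.\<close>
 have fr: "AE x in lborel. x \<notin> cbox a b - box a b"
 proof -
  have "cbox a b - box a b \<in> null_sets lborel"
  proof -
   have "negligible (cbox a b - box a b)" by (rule negligible_frontier_interval)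
   then have "cbox a b - box a b \<in> null_sets lebesgue" by (simp add: negligible_iff_null_sets)
   then show ?thesis by (simp add: null_sets_completion_iff)
  qed
  then show ?thesis by (rule AE_not_in)
 qed
 have s: "1 / real (Suc n) > 0" for n by simp
 have lim\<Phi>: "(\<lambda>n. \<Phi> (1 / Suc n) x) \<longlonglongrightarrow> indicator Q x * I" if x: "x \<notin> cbox a b - box a b" for x
 proof -
  have "(\<lambda>n. LINT t|lborel. indicator Q (x + (1 / Suc n) *\<^sub>R t) * \<gamma> t) \<longlonglongrightarrow> (LINT t|lborel. indicator Q x * \<gamma> t)"
  proof (rule integral_dominated_convergence[where w = "\<lambda>t. \<bar>\<gamma> t\<bar>"])
   show "AE t in lborel. (\<lambda>n. indicator Q (x + (1 / Suc n) *\<^sub>R t) * \<gamma> t) \<longlonglongrightarrow> indicator Q x * \<gamma> t"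
   proof (rule AE_I2, rule tendsto_mult_right)
    fix t
    have "(\<lambda>n. x + (1 / Suc n) *\<^sub>R t) \<longlonglongrightarrow> x + 0 *\<^sub>R t"
     using LIMSEQ_inverse_real_of_nat by (intro tendsto_intros) (simp add: inverse_eq_divide)
    then have lim: "(\<lambda>n. x + (1 / Suc n) *\<^sub>R t) \<longlonglongrightarrow> x" by simp
    have "\<forall>\<^sub>F n in sequentially. indicator Q (x + (1 / Suc n) *\<^sub>R t) = (indicator Q x :: real)"
    proof (cases "x \<in> Q")
     case True
     have "\<forall>\<^sub>F n in sequentially. x + (1 / Suc n) *\<^sub>R t \<in> Q"
      using True by (intro topological_tendstoD[OF lim]) (auto simp: Q_def open_box)
     then show ?thesis by eventually_elim (use True in simp)
    next
     case False
     then have "x \<in> - cbox a b" using x by (auto simp: Q_def)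
     then have "\<forall>\<^sub>F n in sequentially. x + (1 / Suc n) *\<^sub>R t \<in> - cbox a b"
      by (intro topological_tendstoD[OF lim]) (auto simp: closed_cbox open_Compl)
     then show ?thesis
      by eventually_elim (use False box_subset_cbox[of a b] in \<open>auto simp: Q_def indicator_def\<close>)
    qed
    then show "(\<lambda>n. indicator Q (x + (1 / Suc n) *\<^sub>R t)) \<longlonglongrightarrow> (indicator Q x :: real)"
     by (rule tendsto_eventually)
   qed
  qed (use i\<gamma> in \<open>auto simp: indicator_def abs_mult\<close>)
  then show ?thesis by (simp add: \<Phi>_def I_def)
 qed
 have \<Phi>b: "\<bar>\<Phi> s x\<bar> \<le> (LINT t|lborel. \<bar>\<gamma> t\<bar>)" for s x
 proof -
  have "\<bar>\<Phi> s x\<bar> \<le> (LINT t|lborel. norm (indicator Q (x + s *\<^sub>R t) * \<gamma> t))"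
   unfolding \<Phi>_def real_norm_def[symmetric] by (rule integral_norm_bound)
  also have "\<dots> \<le> (LINT t|lborel. \<bar>\<gamma> t\<bar>)"
  proof (rule integral_mono)
   show "integrable lborel (\<lambda>t. norm (indicator Q (x + s *\<^sub>R t) * \<gamma> t))"
    by (rule Bochner_Integration.integrable_bound[OF integrable_abs[OF i\<gamma>]]) (auto simp: indicator_def)
  qed (use i\<gamma> in \<open>auto simp: indicator_def\<close>)
  finally show ?thesis .
 qed
 have "(\<lambda>n. LINT x|lborel. v x * of_real (\<Phi> (1 / Suc n) x)) \<longlonglongrightarrow> (LINT x|lborel. v x * of_real (indicator Q x * I))"
 proof (rule integral_dominated_convergence[where w = "\<lambda>x. cmod (v x) * (LINT t|lborel. \<bar>\<gamma> t\<bar>)"])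
  show "(\<lambda>x. v x * of_real (\<Phi> (1 / Suc n) x)) \<in> borel_measurable lborel" for n
   unfolding \<Phi>_def by measurable
  show "AE x in lborel. (\<lambda>n. v x * of_real (\<Phi> (1 / Suc n) x)) \<longlonglongrightarrow> v x * of_real (indicator Q x * I)"
   using fr by eventually_elim (intro tendsto_intros lim\<Phi>)
  show "AE x in lborel. cmod (v x * of_real (\<Phi> (1 / Suc n) x)) \<le> cmod (v x) * (LINT t|lborel. \<bar>\<gamma> t\<bar>)" for n
   by (intro AE_I2) (simp add: norm_mult mult_left_mono \<Phi>b del: of_nat_Suc)
 qed (use v in auto)
 then have "(LINT x|lborel. v x * of_real (indicator Q x * I)) = 0"
  unfolding \<Phi>0[OF s] by (simp add: LIMSEQ_const_iff)
 moreover have "v x * of_real (indicator Q x * I) = of_real I * (indicator Q x *\<^sub>R v x)" for x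
  by (simp add: scaleR_conv_of_real)
 ultimately have "of_real I * (LINT x|lborel. indicator Q x *\<^sub>R v x) = 0"
  by (simp only: integral_mult_right_zero)
 then show "(LINT x:box a b|lborel. v x) = 0"
  using I by (simp add: set_lebesgue_integral_def Q_def)
qed

lemma abs_inner_le_sum: "\<bar>x \<bullet> y\<bar> \<le> (\<Sum>i\<in>UNIV. (\<Sum>j\<in>UNIV. \<bar>y $ j\<bar>) * \<bar>x $ i\<bar>)" for x y :: "real ^ 'n::finite"
proof -
 have "\<bar>x \<bullet> y\<bar> \<le> (\<Sum>i\<in>UNIV. \<bar>x $ i * y $ i\<bar>)"
  unfolding inner_vec_sum by (rule sum_abs)
 also have "\<dots> \<le> (\<Sum>i\<in>UNIV. (\<Sum>j\<in>UNIV. \<bar>y $ j\<bar>) * \<bar>x $ i\<bar>)"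
 proof (rule sum_mono)
  fix i :: 'n
  have "\<bar>y $ i\<bar> \<le> (\<Sum>j\<in>UNIV. \<bar>y $ j\<bar>)" by (intro member_le_sum) auto
  then show "\<bar>x $ i * y $ i\<bar> \<le> (\<Sum>j\<in>UNIV. \<bar>y $ j\<bar>) * \<bar>x $ i\<bar>"
   unfolding abs_mult by (subst mult.commute) (rule mult_right_mono, auto)
 qed
 finally show ?thesis .
qed

lemma gauss_growth_exp: "exp (\<Sum>i\<in>UNIV. d * \<bar>x $ i\<bar>) * gauss_growth c x = gauss_growth (c + d) x" for x :: "real ^ 'n::finite"
 by (simp add: gauss_growth_def exp_sum distrib_right flip: prod.distrib exp_add) (simp add: algebra_simps)

text \<open>By the recurrence \<open>w\<close> is orthogonal to all polynomials in x \<bullet> y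
  times Hermite functions. Summing the exponential series shows that \<open>w\<close> times a
  Gaussian has vanishing Fourier transform. The integrability assumption is weaker than being in
  \<open>L2\<close>, so that bounded functions are covered as well.\<close>

lemma hermite_complete:
 fixes w :: "real ^ 'n::finite \<Rightarrow> complex"
 assumes [measurable]: "w \<in> borel_measurable borel"
  and int: "\<And>c. integrable lborel (\<lambda>x. cmod (w x) * gauss_growth c x)"
  and zero: "\<And>\<alpha>. (LINT x|lborel. w x * of_real (herm_vec \<alpha> x)) = 0"
 shows "AE x in lborel. w x = 0"
proof -
 have dom: "\<exists>c C. \<forall>x. exp \<bar>x \<bullet> y\<bar> * \<bar>herm_vec \<alpha> x\<bar> \<le> C * gauss_growth c x" for \<alpha> y
 proof -
  obtain C c where C: "0 \<le> C" "\<And>x. \<bar>herm_vec \<alpha> x\<bar> \<le> C * gauss_growth c x"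
   using herm_vec_growth by blast
  have "exp \<bar>x \<bullet> y\<bar> * \<bar>herm_vec \<alpha> x\<bar> \<le> C * gauss_growth (c + (\<Sum>j\<in>UNIV. \<bar>y $ j\<bar>)) x" for x
  proof -
   have "exp \<bar>x \<bullet> y\<bar> * \<bar>herm_vec \<alpha> x\<bar>
     \<le> exp (\<Sum>i\<in>UNIV. (\<Sum>j\<in>UNIV. \<bar>y $ j\<bar>) * \<bar>x $ i\<bar>) * (C * gauss_growth c x)"
    using abs_inner_le_sum[of x y] C(2)[of x] by (intro mult_mono) auto
   also have "\<dots> = C * gauss_growth (c + (\<Sum>j\<in>UNIV. \<bar>y $ j\<bar>)) x"
    unfolding gauss_growth_exp[symmetric] by simp
   finally show ?thesis .
  qed
  then show ?thesis by blast
 qed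
 have idom: "integrable lborel (\<lambda>x. cmod (w x) * (exp \<bar>x \<bullet> y\<bar> * \<bar>herm_vec \<alpha> x\<bar>))" for \<alpha> y
 proof -
  obtain c C where C: "\<And>x. exp \<bar>x \<bullet> y\<bar> * \<bar>herm_vec \<alpha> x\<bar> \<le> C * gauss_growth c x" using dom by blast
  have "cmod (w x) * (exp \<bar>x \<bullet> y\<bar> * \<bar>herm_vec \<alpha> x\<bar>) \<le> C * (cmod (w x) * gauss_growth c x)" for x
   using mult_left_mono[OF C, of "cmod (w x)"] by (simp add: mult_ac)
  then show ?thesis
   by (intro Bochner_Integration.integrable_bound[OF integrable_mult_right[OF int[of c], of C]])
    (auto intro: order_trans[OF _ abs_ge_self])
 qed
 have intp: "integrable lborel (\<lambda>x. w x * of_real ((x \<bullet> y)^k * herm_vec \<alpha> x))" for y k \<alpha>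
 proof (rule Bochner_Integration.integrable_bound)
  show "integrable lborel (\<lambda>x. fact k * (cmod (w x) * (exp \<bar>x \<bullet> y\<bar> * \<bar>herm_vec \<alpha> x\<bar>)))"
   by (intro integrable_mult_right idom)
  have "cmod (w x * of_real ((x \<bullet> y)^k * herm_vec \<alpha> x)) \<le> fact k * (cmod (w x) * (exp \<bar>x \<bullet> y\<bar> * \<bar>herm_vec \<alpha> x\<bar>))" for x
  proof -
   have "cmod (w x * of_real ((x \<bullet> y)^k * herm_vec \<alpha> x)) = cmod (w x) * \<bar>herm_vec \<alpha> x\<bar> * \<bar>x \<bullet> y\<bar>^k"
    by (simp add: norm_mult abs_mult power_abs norm_power mult_ac)
   also have "\<dots> \<le> cmod (w x) * \<bar>herm_vec \<alpha> x\<bar> * (fact k * exp \<bar>x \<bullet> y\<bar>)"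
    by (intro mult_left_mono power_le_fact_exp) auto
   finally show ?thesis by (simp add: mult_ac)
  qed
  then show "AE x in lborel. norm (w x * of_real ((x \<bullet> y)^k * herm_vec \<alpha> x))
    \<le> norm (fact k * (cmod (w x) * (exp \<bar>x \<bullet> y\<bar> * \<bar>herm_vec \<alpha> x\<bar>)))"
   by (auto intro: order_trans[OF _ abs_ge_self])
 qed measurable
 \<comment> \<open>Induction on k: each coordinate in the factor x \<bullet> y moves the index of
   the Hermite function up and down by one.\<close>
 have pzero: "(LINT x|lborel. w x * of_real ((x \<bullet> y)^k * herm_vec \<alpha> x)) = 0" for y k \<alpha>
 proof (induction k arbitrary: \<alpha>)
  case 0
  then show ?case using zero by simp
 next
  case (Suc k)
  define up dn where "up i = \<alpha>(i := Suc (\<alpha> i))" and "dn i = \<alpha>(i := \<alpha> i - 1)" for i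
  define a b where "a i = sqrt ((real (\<alpha> i) + 1) / 2)" and "b i = sqrt (real (\<alpha> i) / 2)" for i
  have "w x * of_real ((x \<bullet> y)^Suc k * herm_vec \<alpha> x)
   = (\<Sum>i\<in>UNIV. of_real (y $ i * a i) * (w x * of_real ((x \<bullet> y)^k * herm_vec (up i) x))
     + of_real (y $ i * b i) * (w x * of_real ((x \<bullet> y)^k * herm_vec (dn i) x)))" for x
  proof -
   have "(x \<bullet> y)^Suc k * herm_vec \<alpha> x = (\<Sum>i\<in>UNIV. (x \<bullet> y)^k * (y $ i * (x $ i * herm_vec \<alpha> x)))"
    by (subst power_Suc, subst (1) inner_vec_sum) (simp add: sum_distrib_left sum_distrib_right mult_ac)
   also have "\<dots> = (\<Sum>i\<in>UNIV. (y $ i * a i) * ((x \<bullet> y)^k * herm_vec (up i) x) + (y $ i * b i) * ((x \<bullet> y)^k * herm_vec (dn i) x))"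
    unfolding herm_vec_rec a_def b_def up_def dn_def by (intro sum.cong refl) (simp add: algebra_simps)
   finally have "w x * of_real ((x \<bullet> y)^Suc k * herm_vec \<alpha> x) = w x * of_real (\<dots>)" by simp
   then show ?thesis by (simp only: of_real_sum of_real_add of_real_mult sum_distrib_left distrib_left mult_ac)
  qed
  then show ?case
   using intp by (simp only: Bochner_Integration.integral_sum Bochner_Integration.integral_add integrable_mult_right Bochner_Integration.integrable_add integral_mult_right_zero Suc.IH) simp
 qed
 define \<gamma> where "\<gamma> = herm_vec (\<lambda>_::'n. 0)"
 have [measurable]: "\<gamma> \<in> borel_measurable borel" by (simp add: \<gamma>_def)
 have "AE x in lborel. w x * of_real (\<gamma> x) = 0"
 proof (rule fourier_unique)
  show "integrable lborel (\<lambda>x. w x * of_real (\<gamma> x))"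
   using intp[of 0 0 "\<lambda>_. 0"] by (simp add: \<gamma>_def)
  fix y :: "real^'n"
  \<comment> \<open>Partial sums of the exponential series, all dominated by the exponential of the
    modulus.\<close>
  define S where "S n x = (\<Sum>k<n. (\<i> * of_real (x \<bullet> y))^k /\<^sub>R fact k) * (w x * of_real (\<gamma> x))" for n x
  have "(\<lambda>n. LINT x|lborel. S n x) \<longlonglongrightarrow> (LINT x|lborel. exp (\<i> * of_real (x \<bullet> y)) * (w x * of_real (\<gamma> x)))"
  proof (rule integral_dominated_convergence)
   show "integrable lborel (\<lambda>x. cmod (w x) * (exp \<bar>x \<bullet> y\<bar> * \<bar>\<gamma> x\<bar>))" unfolding \<gamma>_def by (rule idom)
   show "AE x in lborel. (\<lambda>n. S n x) \<longlonglongrightarrow> exp (\<i> * of_real (x \<bullet> y)) * (w x * of_real (\<gamma> x))"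
    unfolding S_def using exp_converges[of "\<i> * of_real (_ \<bullet> y)"]
    by (intro AE_I2 tendsto_intros) (simp add: sums_def)
   have "cmod (S n x) \<le> cmod (w x) * (exp \<bar>x \<bullet> y\<bar> * \<bar>\<gamma> x\<bar>)" for n x
   proof -
    have "cmod (\<Sum>k<n. (\<i> * of_real (x \<bullet> y))^k /\<^sub>R fact k) \<le> (\<Sum>k<n. cmod ((\<i> * of_real (x \<bullet> y))^k /\<^sub>R fact k))"
     by (rule norm_sum)
    also have "\<dots> = (\<Sum>k<n. \<bar>x \<bullet> y\<bar>^k /\<^sub>R fact k)"
     by (simp add: norm_power norm_mult)
    also have "\<dots> \<le> exp \<bar>x \<bullet> y\<bar>"
     unfolding exp_def by (intro sum_le_suminf summable_exp_generic) auto
    finally show ?thesis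
     unfolding S_def norm_mult by (simp add: mult_ac mult_left_mono)
   qed
   then show "AE x in lborel. cmod (S n x) \<le> cmod (w x) * (exp \<bar>x \<bullet> y\<bar> * \<bar>\<gamma> x\<bar>)" for n by simp
  qed (unfold S_def, measurable)
  moreover have "(LINT x|lborel. S n x) = 0" for n
  proof -
   have "S n x = (\<Sum>k<n. (\<i>^k /\<^sub>R fact k) * (w x * of_real ((x \<bullet> y)^k * \<gamma> x)))" for x
    unfolding S_def sum_distrib_right by (intro sum.cong refl) (simp add: power_mult_distrib scaleR_conv_of_real)
   then show ?thesis
    using intp[of y _ "\<lambda>_. 0"] pzero[of y _ "\<lambda>_. 0"]
    by (simp only: Bochner_Integration.integral_sum integrable_mult_right integral_mult_right_zero \<gamma>_def) simp
  qed
  ultimately show "(LINT x|lborel. exp (\<i> * of_real (x \<bullet> y)) * (w x * of_real (\<gamma> x))) = 0"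
   by (simp add: LIMSEQ_const_iff)
 qed
 moreover have "\<gamma> x \<noteq> 0" for x
  unfolding \<gamma>_def herm_vec_def using hermite_norm2_pos[of 0] by (simp add: herm_def)
 ultimately show ?thesis by simp
qed

section \<open>Hermite expansions and the Fourier transform\<close>

lemma lebesgue_integral_borel:
 "f \<in> borel_measurable borel \<Longrightarrow> integral\<^sup>L lebesgue f = integral\<^sup>L lborel (f :: 'a::euclidean_space \<Rightarrow> 'b::{banach, second_countable_topology})"
 by (rule integral_completion) simp

lemma lebesgue_integrable_borel:
 "f \<in> borel_measurable borel \<Longrightarrow> integrable lebesgue f \<longleftrightarrow> integrable lborel (f :: 'a::euclidean_space \<Rightarrow> 'b::{banach, second_countable_topology})"
 by (rule integrable_completion) simp

lemma cin_hv: "cin (hv \<alpha>) u = (LINT x|lborel. rep u x * of_real (herm_vec \<alpha> x))"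
proof -
 have "cin (hv \<alpha>) u = (LINT x|lebesgue. of_real (herm_vec \<alpha> x) * rep u x)"
  unfolding hv_def using cin_cls[OF herm_vec_L2[of \<alpha>], of "rep u"] by (simp add: L2inner_def)
 also have "\<dots> = (LINT x|lborel. of_real (herm_vec \<alpha> x) * rep u x)"
  by (rule lebesgue_integral_borel) measurable
 finally show ?thesis by (simp add: mult.commute)
qed

lemma gauss_growth_decay: "\<exists>B\<ge>0. \<forall>x :: real ^ 'n::finite. \<bar>gauss_growth c x\<bar> \<le> B * decay_weight x"
proof (intro exI conjI allI)
 show "\<bar>gauss_growth c x\<bar> \<le> (4 * exp (c^2))^CARD('n) * decay_weight x" for x :: "real ^ 'n"
  using gauss_growth_bound[of c x] abs_of_pos[OF gauss_growth_pos[of c x]] by (simp only:)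
qed simp

lemma gauss_growth_L2: "(\<lambda>x. of_real (gauss_growth c x)) \<in> L2"
proof -
 obtain B where "\<forall>x. \<bar>gauss_growth c (x :: real ^ 'a)\<bar> \<le> B * decay_weight x" using gauss_growth_decay by blast
 then show ?thesis by (intro L2_decay_weight[where B = B]) auto
qed

lemma gauss_growth_integrable: "integrable lborel (gauss_growth c :: real ^ 'n::finite \<Rightarrow> real)"
proof -
 obtain B where "\<forall>x. \<bar>gauss_growth c (x :: real ^ 'n)\<bar> \<le> B * decay_weight x" using gauss_growth_decay by blast
 then show ?thesis
  by (intro Bochner_Integration.integrable_bound[OF integrable_mult_right[OF decay_weight_integrable, of B]])
   (auto intro: order_trans[OF _ abs_ge_self])
qed

lemma rep_gauss_integrable: "integrable lborel (\<lambda>x. cmod (rep u x) * gauss_growth c x)"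
proof -
 have "integrable lebesgue (\<lambda>x. rep u x * of_real (gauss_growth c x))"
  by (intro L2_integrable_mult rep_L2 gauss_growth_L2)
 then have "integrable lborel (\<lambda>x. rep u x * of_real (gauss_growth c x))"
  by (subst (asm) lebesgue_integrable_borel) auto
 from integrable_norm[OF this] show ?thesis
  by (simp add: norm_mult abs_of_pos[OF gauss_growth_pos])
qed

lemma hv_complete:
 assumes "\<And>\<alpha>. cin (hv \<alpha>) u = 0"
 shows "u = 0"
proof -
 have "AE x in lborel. rep u x = 0"
  using assms by (intro hermite_complete rep_gauss_integrable) (auto simp: cin_hv)
 then have "AE x in lebesgue. rep u x = 0" by (rule AE_completion)
 with rep_zero have "AE x in lebesgue. rep u x = rep 0 x" by eventually_elim simp
 then show ?thesis by (rule l2_eqI)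
qed

lemma hv_eqI:
 assumes "\<And>\<alpha>. cin (hv \<alpha>) u = cin (hv \<alpha>) v"
 shows "u = v"
 using hv_complete[of "u - v"] assms by (simp add: cin_minus_right)

section \<open>Block decompositions of Hermite expansions\<close>

lemma summable_orthogonal:
 fixes x :: "nat \<Rightarrow> 'a::{real_inner, banach}"
 assumes orth: "\<And>j k. j \<noteq> k \<Longrightarrow> x j \<bullet> x k = 0" and bound: "\<And>n. (\<Sum>k<n. (norm (x k))^2) \<le> B"
 shows "summable x"
proof -
 have "summable (\<lambda>k. (norm (x k))^2)"
  by (rule bounded_imp_summable[where B = B]) (use bound[of "Suc _"] in \<open>auto simp: lessThan_Suc_atMost\<close>)
 have pyth: "(norm (sum x {m..<n}))^2 = (\<Sum>k\<in>{m..<n}. (norm (x k))^2)" for m n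
 proof -
  have "(norm (sum x {m..<n}))^2 = (\<Sum>j\<in>{m..<n}. \<Sum>k\<in>{m..<n}. if j = k then (norm (x k))^2 else 0)"
   unfolding power2_norm_eq_inner inner_sum_left inner_sum_right
   by (intro sum.cong refl) (auto simp: orth)
  then show ?thesis by simp
 qed
 show ?thesis
  unfolding summable_Cauchy
 proof (intro allI impI)
  fix e :: real assume e: "0 < e"
  obtain N where N: "\<And>m n. m \<ge> N \<Longrightarrow> norm (\<Sum>k\<in>{m..<n}. (norm (x k))^2) < e^2"
   using \<open>summable (\<lambda>k. (norm (x k))^2)\<close> e unfolding summable_Cauchy by (meson zero_less_power)
  have "norm (sum x {m..<n}) < e" if "m \<ge> N" for m n
   using N[OF that, of n] e by (intro power2_less_imp_less[of _ e]) (auto simp: pyth)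
  then show "\<exists>N. \<forall>m\<ge>N. \<forall>n. norm (sum x {m..<n}) < e" by blast
 qed
qed

text \<open>The index map is a parameter because two groupings occur: by degree for the Fourier
  transform and by \<open>osc_window\<close> for the windows of the oscillator.\<close>

definition block :: "(('n::finite \<Rightarrow> nat) \<Rightarrow> nat) \<Rightarrow> nat \<Rightarrow> 'n l2 \<Rightarrow> 'n l2" where
 "block \<nu> k u = (\<Sum>\<alpha> | \<nu> \<alpha> = k. cs (cin (hv \<alpha>) u) (hv \<alpha>))"

context
 fixes \<nu> :: "('n::finite \<Rightarrow> nat) \<Rightarrow> nat"
 assumes fin: "\<And>k. finite {\<alpha>. \<nu> \<alpha> = k}"
begin

lemma cin_hv_block: "cin (hv \<beta>) (block \<nu> k u) = (if \<nu> \<beta> = k then cin (hv \<beta>) u else 0)"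
proof -
 have "cin (hv \<beta>) (block \<nu> k u) = (\<Sum>\<alpha> | \<nu> \<alpha> = k. if \<alpha> = \<beta> then cin (hv \<beta>) u else 0)"
  unfolding block_def cin_sum_right by (intro sum.cong) (auto simp: cin_cs_right hv_orthonormal)
 then show ?thesis using fin[of k] by simp
qed

lemma cin_block_left: "cin (block \<nu> k u) v = (\<Sum>\<alpha> | \<nu> \<alpha> = k. cnj (cin (hv \<alpha>) u) * cin (hv \<alpha>) v)"
 by (simp add: block_def cin_sum_left cin_cs_left)

lemma cin_block_orth: "j \<noteq> k \<Longrightarrow> cin (block \<nu> j u) (block \<nu> k v) = 0"
 unfolding cin_block_left by (intro sum.neutral) (auto simp: cin_hv_block)

lemma cin_block_commute: "cin (block \<nu> k u) v = cin u (block \<nu> k v)"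
proof -
 have "cin u (block \<nu> k v) = (\<Sum>\<alpha> | \<nu> \<alpha> = k. cin (hv \<alpha>) v * cin u (hv \<alpha>))"
  by (simp add: block_def cin_sum_right cin_cs_right)
 then show ?thesis
  unfolding cin_block_left by (simp add: cin_commute mult.commute)
qed

lemma norm_block: "(norm (block \<nu> k u))^2 = (\<Sum>\<alpha> | \<nu> \<alpha> = k. (cmod (cin (hv \<alpha>) u))^2)"
 unfolding block_def by (rule norm_cin_orthonormal_sum) (auto simp: fin hv_orthonormal)

lemma sum_norm_block: "(\<Sum>k<n. (norm (block \<nu> k u))^2) \<le> (norm u)^2"
proof -
 have "(\<Sum>k<n. (norm (block \<nu> k u))^2) = (\<Sum>\<alpha>\<in>(\<Union>k<n. {\<alpha>. \<nu> \<alpha> = k}). (cmod (cin (hv \<alpha>) u))^2)"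
  unfolding norm_block by (rule sum.UNION_disjoint[symmetric]) (auto simp: fin)
 also have "\<dots> \<le> (norm u)^2"
  by (rule bessel_complex) (auto simp: fin hv_orthonormal)
 finally show ?thesis .
qed

lemma summable_block:
 assumes "\<And>k. cmod (d k) = 1"
 shows "summable (\<lambda>k. cs (d k) (block \<nu> k u))"
proof (rule summable_orthogonal)
 show "cs (d j) (block \<nu> j u) \<bullet> cs (d k) (block \<nu> k u) = 0" if "j \<noteq> k" for j k
  using cin_block_orth[OF that, of u u] by (simp add: inner_eq_Re_cin cin_cs_left cin_cs_right)
 show "(\<Sum>k<n. (norm (cs (d k) (block \<nu> k u)))^2) \<le> (norm u)^2" for n
  using sum_norm_block by (simp add: norm_cs assms)
qed

lemma cin_hv_suminf_block:
 assumes "\<And>k. cmod (d k) = 1"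
 shows "cin (hv \<beta>) (\<Sum>k. cs (d k) (block \<nu> k u)) = d (\<nu> \<beta>) * cin (hv \<beta>) u"
proof -
 have "cin (hv \<beta>) (\<Sum>k. cs (d k) (block \<nu> k u)) = (\<Sum>k. cin (hv \<beta>) (cs (d k) (block \<nu> k u)))"
  by (rule bounded_linear.suminf[OF bounded_linear_cin summable_block[OF assms]])
 also have "\<dots> = (\<Sum>k. if k = \<nu> \<beta> then d (\<nu> \<beta>) * cin (hv \<beta>) u else 0)"
  by (intro suminf_cong) (auto simp: cin_cs_right cin_hv_block)
 also have "\<dots> = d (\<nu> \<beta>) * cin (hv \<beta>) u"
  by (subst suminf_finite[of "{\<nu> \<beta>}"]) auto
 finally show ?thesis .
qed

lemma block_sums: "(\<lambda>k. block \<nu> k u) sums u"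
proof -
 have s: "summable (\<lambda>k. block \<nu> k u)" using summable_block[of "\<lambda>_. 1" u] by simp
 have "(\<Sum>k. block \<nu> k u) = u"
  using cin_hv_suminf_block[of "\<lambda>_. 1" _ u] by (intro hv_eqI) simp
 with summable_sums[OF s] show ?thesis by simp
qed

end

lemma finite_bounded_index: "finite {\<alpha> :: 'n::finite \<Rightarrow> nat. \<forall>i. \<alpha> i \<le> m}"
 and card_bounded_index: "card {\<alpha> :: 'n::finite \<Rightarrow> nat. \<forall>i. \<alpha> i \<le> m} = Suc m ^ CARD('n)"
proof -
 have eq: "{\<alpha> :: 'n \<Rightarrow> nat. \<forall>i. \<alpha> i \<le> m} = PiE UNIV (\<lambda>_. {..m})"
  by (auto simp: PiE_def Pi_def extensional_def)
 show "finite {\<alpha> :: 'n \<Rightarrow> nat. \<forall>i. \<alpha> i \<le> m}" unfolding eq by (intro finite_PiE) auto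
 show "card {\<alpha> :: 'n \<Rightarrow> nat. \<forall>i. \<alpha> i \<le> m} = Suc m ^ CARD('n)"
  unfolding eq by (subst card_PiE) auto
qed

lemma component_le_degree: "\<alpha> i \<le> degree_of \<alpha>"
 unfolding degree_of_def by (intro member_le_sum) auto

lemma finite_degree: "finite {\<alpha> :: 'n::finite \<Rightarrow> nat. degree_of \<alpha> = k}"
 by (rule finite_subset[OF _ finite_bounded_index[of k]]) (use component_le_degree in blast)

text \<open>Multiplies the coefficient at \<alpha> by \<open>z ^ degree_of \<alpha>\<close>. The
  value - \<i> gives the Fourier transform and \<i> its inverse. For z on the unit circle the
  operators form a unitary group, which makes Plancherel and inversion algebraic identities.\<close>

definition rotate_l2 :: "complex \<Rightarrow> 'n::finite l2 \<Rightarrow> 'n l2" where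
 "rotate_l2 z u = (\<Sum>k. cs (z^k) (block degree_of k u))"

context
 fixes z :: complex
 assumes z: "cmod z = 1"
begin

lemma z_pow: "cmod (z^k) = 1"
 using z by (simp add: norm_power)

lemma cin_hv_rotate: "cin (hv \<alpha>) (rotate_l2 z u) = z^degree_of \<alpha> * cin (hv \<alpha>) u"
 unfolding rotate_l2_def by (rule cin_hv_suminf_block[OF finite_degree z_pow])

lemma rotate_add: "rotate_l2 z (u + v) = rotate_l2 z u + rotate_l2 z v"
 by (rule hv_eqI) (simp add: cin_hv_rotate cin_add_right algebra_simps)

lemma rotate_cs: "rotate_l2 z (cs c u) = cs c (rotate_l2 z u)"
 by (rule hv_eqI) (simp add: cin_hv_rotate cin_cs_right)

lemma rotate_sums: "(\<lambda>k. cs (z^k) (block degree_of k u)) sums rotate_l2 z u"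
 unfolding rotate_l2_def by (rule summable_sums[OF summable_block[OF finite_degree z_pow]])

lemma rotate_scaleR: "rotate_l2 z (r *\<^sub>R u) = r *\<^sub>R rotate_l2 z u"
 by (simp add: rotate_cs flip: cs_scaleR)

end

lemma rotate_rotate:
 "cmod z = 1 \<Longrightarrow> cmod w = 1 \<Longrightarrow> rotate_l2 z (rotate_l2 w u) = rotate_l2 (z * w) u"
 by (rule hv_eqI) (simp add: cin_hv_rotate norm_mult power_mult_distrib)

lemma rotate_1: "rotate_l2 1 u = u"
 by (rule hv_eqI) (simp add: cin_hv_rotate)

lemma cin_rotate_left:
 assumes z: "cmod z = 1"
 shows "cin (rotate_l2 z u) v = cin u (rotate_l2 (cnj z) v)"
proof -
 have z': "cmod (cnj z) = 1" using z by simp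
 have 1: "(\<lambda>k. cin u (cs (cnj z^k) (block degree_of k v))) sums cin u (rotate_l2 (cnj z) v)"
  by (rule bounded_linear.sums[OF bounded_linear_cin rotate_sums[OF z']])
 have "(\<lambda>k. cin v (cs (z^k) (block degree_of k u))) sums cin v (rotate_l2 z u)"
  by (rule bounded_linear.sums[OF bounded_linear_cin rotate_sums[OF z]])
 from sums_cnj[THEN iffD2, OF this]
 have "(\<lambda>k. cin (cs (z^k) (block degree_of k u)) v) sums cin (rotate_l2 z u) v"
  by (simp add: cin_commute)
 moreover have "cin (cs (z^k) (block degree_of k u)) v = cin u (cs (cnj z^k) (block degree_of k v))" for k
  by (simp add: cin_cs_left cin_cs_right cin_block_commute[OF finite_degree])
 ultimately show ?thesis using 1 sums_unique2 by simp
qed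

lemma norm_rotate:
 assumes z: "cmod z = 1"
 shows "norm (rotate_l2 z u) = norm u"
proof -
 have "cnj z * z = 1" using complex_norm_square[of z] z by (simp add: mult.commute)
 then have "cin (rotate_l2 z u) (rotate_l2 z u) = cin u u"
  using z by (simp add: cin_rotate_left rotate_rotate rotate_1)
 then have "(norm (rotate_l2 z u))^2 = (norm u)^2" by (simp add: cin_same del: of_real_power)
 then show ?thesis by simp
qed

lemma bounded_linear_rotate: "cmod z = 1 \<Longrightarrow> bounded_linear (rotate_l2 z)"
 by (rule bounded_linear_intro[where K = 1]) (auto simp: rotate_add rotate_scaleR norm_rotate)

subsection \<open>The Fourier transform\<close>

lemma herm_vec_reflect:
 "s = 1 \<or> s = -1 \<Longrightarrow> herm_vec \<alpha> (s *\<^sub>R x) = s ^ degree_of \<alpha> * herm_vec \<alpha> x"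
 by (auto simp: herm_vec_def herm_minus prod.distrib degree_of_def power_sum)

definition fconst :: "'n::finite itself \<Rightarrow> real" where
 "fconst _ = (2 * pi) powr (- real CARD('n) / 2)"

lemma fconst_pos: "0 < fconst TYPE('n::finite)"
 by (simp add: fconst_def)

text \<open>Both sides have the same Hermite coefficients: Fubini moves the Fourier integral to the
  Hermite function, which is an eigenfunction. The integral is at first only known to be bounded, so
  equality comes from \<open>hermite_complete\<close>. The sign s treats the transform and its
  inverse together.\<close>

lemma rotate_eq_fourier_integral:
 fixes \<phi> :: "'n::finite fn"
 assumes s: "s = 1 \<or> s = (-1::real)" and L: "\<phi> \<in> L2" and int: "integrable lebesgue \<phi>"
 shows "AE \<xi> in lebesgue. rep (rotate_l2 (- \<i> * of_real s) (cls \<phi>)) \<xi> = fourier_integral \<phi> (s *\<^sub>R \<xi>)"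
proof -
 define \<psi> where "\<psi> = rep (cls \<phi>)"
 have ae: "AE x in lebesgue. \<psi> x = \<phi> x" unfolding \<psi>_def by (rule rep_cls[OF L])
 have [measurable]: "\<psi> \<in> borel_measurable borel" by (simp add: \<psi>_def)
 have "integrable lebesgue \<psi>"
  using int ae by (subst integrable_cong_AE[of _ _ \<phi>]) (auto simp: \<psi>_def)
 then have i\<psi>: "integrable lborel \<psi>" by (subst (asm) lebesgue_integrable_borel) auto
 define E where "E x \<xi> = phase (x \<bullet> (s *\<^sub>R \<xi>))" for x \<xi> :: "real^'n"
 have mE: "(\<lambda>(x, \<xi>). E x \<xi>) \<in> borel_measurable (borel \<Otimes>\<^sub>M borel)" unfolding E_def by measurable
 have Em[measurable]: "(\<lambda>x. E x \<xi>) \<in> borel_measurable borel" for \<xi> unfolding E_def by measurable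
 have E1: "cmod (E x \<xi>) = 1" for x \<xi> by (simp add: E_def)
 define F where "F \<xi> = of_real (fconst TYPE('n)) * (LINT x|lborel. E x \<xi> * \<psi> x)" for \<xi>
 have F: "fourier_integral \<phi> (s *\<^sub>R \<xi>) = F \<xi>" for \<xi>
 proof -
  have "(LINT x|lebesgue. E x \<xi> * \<phi> x) = (LINT x|lebesgue. E x \<xi> * \<psi> x)"
  proof (rule integral_cong_AE)
   show "AE x in lebesgue. E x \<xi> * \<phi> x = E x \<xi> * \<psi> x" using ae by eventually_elim simp
   have [measurable]: "(\<lambda>x. E x \<xi>) \<in> borel_measurable lebesgue" "\<psi> \<in> borel_measurable lebesgue"
    using Em by (simp_all add: measurable_completion)
   show "(\<lambda>x. E x \<xi> * \<psi> x) \<in> borel_measurable lebesgue" by measurable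
   show "(\<lambda>x. E x \<xi> * \<phi> x) \<in> borel_measurable lebesgue" using L by measurable
  qed
  also have "\<dots> = (LINT x|lborel. E x \<xi> * \<psi> x)" by (rule lebesgue_integral_borel) measurable
  finally show ?thesis by (simp add: fourier_integral_def F_def fconst_def E_def)
 qed
 have [measurable]: "F \<in> borel_measurable borel"
 proof -
  have "(\<lambda>\<xi>. LINT x|lborel. E x \<xi> * \<psi> x) \<in> borel_measurable borel"
   by (rule lborel.borel_measurable_lebesgue_integral)
    (unfold E_def, measurable)
  then show ?thesis unfolding F_def by measurable
 qed
 define B where "B = fconst TYPE('n) * (LINT x|lborel. cmod (\<psi> x))"
 have FB: "cmod (F \<xi>) \<le> B" for \<xi>
 proof -
  have "cmod (LINT x|lborel. E x \<xi> * \<psi> x) \<le> (LINT x|lborel. cmod (E x \<xi> * \<psi> x))"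
   by (rule integral_norm_bound)
  then show ?thesis
   unfolding F_def B_def using fconst_pos[where 'n = 'n] by (simp add: norm_mult E1 mult_left_mono)
 qed
 define u where "u = rotate_l2 (- \<i> * of_real s) (cls \<phi>)"
 have z: "cmod (- \<i> * of_real s) = 1" using s by (auto simp: norm_mult)
 have igF: "integrable lborel (\<lambda>x. cmod (F x) * gauss_growth c x)" for c
  by (rule Bochner_Integration.integrable_bound[OF integrable_mult_right[OF gauss_growth_integrable[of c], of B]])
   (use FB in \<open>auto simp: abs_mult abs_of_pos[OF gauss_growth_pos] intro!: AE_I2 mult_right_mono
    less_imp_le[OF gauss_growth_pos] order_trans[OF _ abs_ge_self]\<close>)
 have ihF: "integrable lborel (\<lambda>x. F x * of_real (herm_vec \<alpha> x))" for \<alpha>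
 proof -
  obtain C c where C: "0 \<le> C" "\<And>x. \<bar>herm_vec \<alpha> x\<bar> \<le> C * gauss_growth c x"
   using herm_vec_growth by blast
  have "cmod (F x * of_real (herm_vec \<alpha> x)) \<le> C * (cmod (F x) * gauss_growth c x)" for x
   using mult_left_mono[OF C(2)[of x], of "cmod (F x)"] by (simp add: norm_mult mult_ac)
  then show ?thesis
   by (intro Bochner_Integration.integrable_bound[OF integrable_mult_right[OF igF[of c], of C]])
    (auto intro: order_trans[OF _ abs_ge_self])
 qed
 have iuh: "integrable lborel (\<lambda>x. rep u x * of_real (herm_vec \<alpha> x))" for u :: "'n l2" and \<alpha>
  using L2_integrable_mult[OF rep_L2[of u] herm_vec_L2[of \<alpha>]] by (subst (asm) lebesgue_integrable_borel) auto
 have "AE \<xi> in lborel. rep u \<xi> - F \<xi> = 0"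
 proof (rule hermite_complete)
  fix c
  show "integrable lborel (\<lambda>x. cmod (rep u x - F x) * gauss_growth c x)"
  proof (rule Bochner_Integration.integrable_bound)
   show "integrable lborel (\<lambda>x. cmod (rep u x) * gauss_growth c x + cmod (F x) * gauss_growth c x)"
    by (intro Bochner_Integration.integrable_add rep_gauss_integrable igF)
   show "AE x in lborel. norm (cmod (rep u x - F x) * gauss_growth c x)
     \<le> norm (cmod (rep u x) * gauss_growth c x + cmod (F x) * gauss_growth c x)"
    using gauss_growth_pos[of c] norm_triangle_ineq4[of "rep u _" "F _"]
    by (auto simp: abs_mult less_imp_le simp flip: distrib_right intro!: AE_I2 mult_right_mono)
  qed measurable
 next
  fix \<alpha> :: "'n \<Rightarrow> nat"
  have ih: "integrable lborel (herm_vec \<alpha>)"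
   by (rule Bochner_Integration.integrable_bound[OF integrable_mult_right[OF decay_weight_integrable, of "hermite_const \<alpha>"]])
    (auto simp: abs_mult abs_of_pos[OF decay_weight_pos] hermite_const_nonneg herm_vec_bound)
  have "(LINT \<xi>|lborel. F \<xi> * of_real (herm_vec \<alpha> \<xi>))
    = (LINT \<xi>|lborel. of_real (fconst TYPE('n)) * (LINT x|lborel. E x \<xi> * \<psi> x * of_real (herm_vec \<alpha> \<xi>)))"
   by (simp add: F_def mult.assoc integral_mult_left_zero flip: integral_mult_left_zero)
  also have "\<dots> = of_real (fconst TYPE('n)) * (LINT \<xi>|lborel. (LINT x|lborel. E x \<xi> * \<psi> x * of_real (herm_vec \<alpha> \<xi>)))"
   by (rule integral_mult_right_zero)
  also have "(LINT \<xi>|lborel. (LINT x|lborel. E x \<xi> * \<psi> x * of_real (herm_vec \<alpha> \<xi>)))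
    = (LINT x|lborel. (LINT \<xi>|lborel. E x \<xi> * \<psi> x * of_real (herm_vec \<alpha> \<xi>)))"
  proof (rule fubini_dominated[symmetric])
   show "(\<lambda>(x, \<xi>). E x \<xi> * \<psi> x * of_real (herm_vec \<alpha> \<xi>)) \<in> borel_measurable (borel \<Otimes>\<^sub>M borel)"
    unfolding E_def by measurable
   show "integrable lborel (\<lambda>x. cmod (\<psi> x))" "integrable lborel (\<lambda>x. \<bar>herm_vec \<alpha> x\<bar>)"
    using i\<psi> ih by simp_all
  qed (simp add: norm_mult E1)
  also have "\<dots> = (LINT x|lborel. (of_real ((2 * pi) powr (real CARD('n) / 2)) * (- \<i> * of_real s)^degree_of \<alpha>) * (\<psi> x * of_real (herm_vec \<alpha> x)))"
  proof (intro Bochner_Integration.integral_cong refl)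
   fix x
   have "(LINT \<xi>|lborel. E x \<xi> * \<psi> x * of_real (herm_vec \<alpha> \<xi>))
    = \<psi> x * (LINT \<xi>|lborel. phase (\<xi> \<bullet> (s *\<^sub>R x)) * of_real (herm_vec \<alpha> \<xi>))"
    by (subst integral_mult_right_zero[symmetric]) (simp add: E_def inner_commute[of x] mult_ac)
   then show "(LINT \<xi>|lborel. E x \<xi> * \<psi> x * of_real (herm_vec \<alpha> \<xi>))
    = (of_real ((2 * pi) powr (real CARD('n) / 2)) * (- \<i> * of_real s)^degree_of \<alpha>) * (\<psi> x * of_real (herm_vec \<alpha> x))"
    unfolding herm_vec_fourier herm_vec_reflect[OF s] power_mult_distrib of_real_mult of_real_power
    by (simp only: mult_ac)
  qed
  also have "\<dots> = (of_real ((2 * pi) powr (real CARD('n) / 2)) * (- \<i> * of_real s)^degree_of \<alpha>) * cin (hv \<alpha>) (cls \<phi>)"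
   unfolding integral_mult_right_zero cin_hv \<psi>_def ..
  also have "of_real (fconst TYPE('n)) * \<dots> = cin (hv \<alpha>) u"
  proof -
   have "complex_of_real (fconst TYPE('n)) * of_real ((2 * pi) powr (real CARD('n) / 2)) = 1"
    unfolding fconst_def of_real_mult[symmetric] powr_add[symmetric] by simp
   then show ?thesis unfolding u_def cin_hv_rotate[OF z] by simp
  qed
  finally have "(LINT \<xi>|lborel. F \<xi> * of_real (herm_vec \<alpha> \<xi>)) = (LINT \<xi>|lborel. rep u \<xi> * of_real (herm_vec \<alpha> \<xi>))"
   by (simp only: cin_hv)
  then show "(LINT \<xi>|lborel. (rep u \<xi> - F \<xi>) * of_real (herm_vec \<alpha> \<xi>)) = 0"
   using ihF iuh by (simp add: left_diff_distrib)
 qed measurable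
 then have "AE \<xi> in lebesgue. rep u \<xi> - F \<xi> = 0" by (rule AE_completion)
 then show ?thesis unfolding u_def F by eventually_elim simp
qed

lemma mul_tendsto:
 fixes m :: "nat \<Rightarrow> 'n::finite fn"
 assumes [measurable]: "\<And>n. m n \<in> borel_measurable lebesgue" "k \<in> borel_measurable lebesgue"
  and B: "\<And>n x. cmod (m n x) \<le> B" "\<And>x. cmod (k x) \<le> B"
  and lim: "\<And>x. (\<lambda>n. m n x) \<longlonglongrightarrow> k x"
 shows "(\<lambda>n. mul (m n) u) \<longlonglongrightarrow> mul k u"
proof -
 have bm: "bounded_measurable (m n)" "bounded_measurable k" "bounded_measurable (\<lambda>x. m n x - k x)" for n
 proof -
  show "bounded_measurable (m n)" using B(1) by (intro bounded_measurableI) auto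
  show "bounded_measurable k" using B(2) by (intro bounded_measurableI) auto
  have "cmod (m n x - k x) \<le> B + B" for x
   using norm_triangle_ineq4[of "m n x" "k x"] B(1)[of n x] B(2)[of x] by linarith
  then show "bounded_measurable (\<lambda>x. m n x - k x)" by (intro bounded_measurableI) auto
 qed
 have diff: "mul (m n) u - mul k u = mul (\<lambda>x. m n x - k x) u" for n
  unfolding mul_def by (subst cls_diff) (auto simp: bounded_measurable_L2 bm left_diff_distrib)
 have "(\<lambda>n. LINT x|lebesgue. (cmod (m n x - k x))^2 * (cmod (rep u x))^2) \<longlonglongrightarrow> (LINT x::real^'n|lebesgue. 0 :: real)"
 proof (rule integral_dominated_convergence[of "\<lambda>_. 0 :: real" _ "\<lambda>n x. (cmod (m n x - k x))^2 * (cmod (rep u x))^2" "\<lambda>x. (B + B)^2 * (cmod (rep u x))^2"])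
  show "AE x in lebesgue. (\<lambda>n. (cmod (m n x - k x))^2 * (cmod (rep u x))^2) \<longlonglongrightarrow> 0"
  proof (rule AE_I2)
   fix x
   have "(\<lambda>n. (cmod (m n x - k x))^2 * (cmod (rep u x))^2) \<longlonglongrightarrow> (cmod (k x - k x))^2 * (cmod (rep u x))^2"
    by (intro tendsto_intros lim)
   then show "(\<lambda>n. (cmod (m n x - k x))^2 * (cmod (rep u x))^2) \<longlonglongrightarrow> 0" by simp
  qed
  have "(cmod (m n x - k x))^2 \<le> (B + B)^2" for n x
   using norm_triangle_ineq4[of "m n x" "k x"] B(1)[of n x] B(2)[of x] by (intro power_mono) auto
  then show "AE x in lebesgue. norm ((cmod (m n x - k x))^2 * (cmod (rep u x))^2) \<le> (B + B)^2 * (cmod (rep u x))^2" for n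
   by (auto intro!: mult_right_mono AE_I2)
 qed (use integrable_rep in auto)
 then have "(\<lambda>n. (norm (mul (m n) u - mul k u))^2) \<longlonglongrightarrow> 0"
  unfolding diff norm_mul_sq[OF bm(3)] by simp
 from tendsto_real_sqrt[OF this] have "(\<lambda>n. norm (mul (m n) u - mul k u)) \<longlonglongrightarrow> 0" by simp
 then show ?thesis by (simp add: tendsto_norm_zero_iff LIM_zero_iff)
qed

lemma bounded_measurable_1: "bounded_measurable (\<lambda>x. 1)"
 by (rule bounded_measurableI[where B = 1]) auto

lemma mul_1[simp]: "mul (\<lambda>x. 1) u = u"
 by (simp add: mul_def)

lemma L2_truncate_integrable:
 fixes \<phi> :: "'n::finite fn"
 assumes "\<phi> \<in> L2"
 shows "integrable lebesgue (\<lambda>x. indicator (ball 0 R) x * \<phi> x)"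
proof (rule L2_integrable_mult[OF _ assms])
 have "integrable lebesgue (indicator (ball 0 R) :: real^'n \<Rightarrow> real)"
  by (rule integrable_real_indicator) (auto simp: emeasure_lborel_ball_finite simp flip: infinity_ennreal_def)
 moreover have "(cmod (indicator (ball 0 R) x))^2 = (indicator (ball 0 R) x :: real)" for x :: "real^'n"
  by (simp add: indicator_def)
 moreover have "(indicator (ball 0 R) :: 'n fn) \<in> borel_measurable lebesgue" by (intro borel_measurable_indicator) simp
 ultimately show "(\<lambda>x. indicator (ball 0 R) x) \<in> (L2 :: 'n fn set)" by (simp add: L2_iff)
qed

lemma cmod_minus_ii: "cmod (- \<i>) = 1"
 by simp

text \<open>Truncations of a square integrable function are integrable, so that
  \<open>rotate_eq_fourier_integral\<close> covers them. Continuity of \<open>rotate_l2\<close>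
  identifies the limit of large radius.\<close>

lemma fourier_op_iff:
 "(\<phi>, \<psi>) \<in> fourier_op \<longleftrightarrow> \<phi> \<in> L2 \<and> \<psi> \<in> L2 \<and> cls \<psi> = rotate_l2 (- \<i>) (cls \<phi>)"
proof (cases "\<phi> \<in> L2 \<and> \<psi> \<in> L2")
 case True
 then have L: "\<phi> \<in> L2" "\<psi> \<in> L2" by auto
 define \<phi>R where "\<phi>R R x = indicator (ball 0 R) x * \<phi> x" for R x
 have b: "bounded_measurable (indicator (ball 0 R) :: 'a fn)" for R
  by (rule bounded_measurable_indicator) simp
 have \<phi>R: "\<phi>R R \<in> L2" "cls (\<phi>R R) = mul (indicator (ball 0 R)) (cls \<phi>)" "integrable lebesgue (\<phi>R R)" for R
  unfolding \<phi>R_def using L(1) b by (auto simp: bounded_measurable_L2 mul_cls L2_truncate_integrable)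
 have FL: "L2norm (\<lambda>\<xi>. fourier_integral (\<phi>R R) \<xi> - \<psi> \<xi>) = ennreal (norm (rotate_l2 (- \<i>) (cls (\<phi>R R)) - cls \<psi>))" for R
 proof -
  have "AE \<xi> in lebesgue. rep (rotate_l2 (- \<i>) (cls (\<phi>R R))) \<xi> = fourier_integral (\<phi>R R) \<xi>"
   using rotate_eq_fourier_integral[of 1 "\<phi>R R"] \<phi>R by simp
  from L2_ae_eq[OF rep_L2 this] cls_eqI[OF rep_L2 this]
  have F: "fourier_integral (\<phi>R R) \<in> L2" "cls (fourier_integral (\<phi>R R)) = rotate_l2 (- \<i>) (cls (\<phi>R R))"
   by simp_all
  then show ?thesis using L(2) by (simp add: L2norm_cls L2_diff flip: cls_diff)
 qed
 have "((\<lambda>R. rotate_l2 (- \<i>) (cls (\<phi>R R))) \<longlongrightarrow> rotate_l2 (- \<i>) (cls \<phi>)) at_top"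
 proof (rule tendsto_at_topI_sequentially)
  fix X :: "nat \<Rightarrow> real" assume X: "filterlim X at_top sequentially"
  have "(\<lambda>n. mul (indicator (ball 0 (X n))) (cls \<phi>)) \<longlonglongrightarrow> mul (\<lambda>x. 1) (cls \<phi>)"
  proof (rule mul_tendsto[where B = 1])
   fix x :: "real^'a"
   have "\<forall>\<^sub>F n in sequentially. X n > norm x" using X by (simp add: filterlim_at_top_dense)
   then have "\<forall>\<^sub>F n in sequentially. indicator (ball 0 (X n)) x = (1::complex)"
    by eventually_elim simp
   then show "(\<lambda>n. indicator (ball 0 (X n)) x) \<longlonglongrightarrow> (1::complex)" by (rule tendsto_eventually)
   show "(indicator (ball 0 (X n)) :: 'a fn) \<in> borel_measurable lebesgue" for n
    by (intro borel_measurable_indicator) simp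
  qed (auto simp: indicator_def)
  then show "(\<lambda>n. rotate_l2 (- \<i>) (cls (\<phi>R (X n)))) \<longlonglongrightarrow> rotate_l2 (- \<i>) (cls \<phi>)"
   unfolding \<phi>R(2) mul_1 by (rule bounded_linear.tendsto[OF bounded_linear_rotate[OF cmod_minus_ii]])
 qed
 then have "((\<lambda>R. ennreal (norm (rotate_l2 (- \<i>) (cls (\<phi>R R)) - cls \<psi>))) \<longlongrightarrow> ennreal (norm (rotate_l2 (- \<i>) (cls \<phi>) - cls \<psi>))) at_top"
  by (intro tendsto_intros)
 then have "((\<lambda>R. L2norm (\<lambda>\<xi>. fourier_integral (\<phi>R R) \<xi> - \<psi> \<xi>)) \<longlongrightarrow> 0) at_top
   \<longleftrightarrow> ennreal (norm (rotate_l2 (- \<i>) (cls \<phi>) - cls \<psi>)) = 0"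
  unfolding FL by (metis tendsto_unique trivial_limit_at_top_linorder)
 then show ?thesis
  using L by (auto simp: fourier_op_def \<phi>R_def[abs_def] ennreal_eq_0_iff)
qed (auto simp: fourier_op_def)

section \<open>The harmonic oscillator and its functional calculus\<close>

definition osc_eigenvalue :: "('n::finite \<Rightarrow> nat) \<Rightarrow> real" where
 "osc_eigenvalue \<alpha> = exp (exp 1) / real CARD('n) * (2 * real (degree_of \<alpha>) + real CARD('n))"

definition herm_vec_deriv :: "'n::finite \<Rightarrow> ('n \<Rightarrow> nat) \<Rightarrow> real ^ 'n \<Rightarrow> real" where
 "herm_vec_deriv i \<alpha> x =
   x $ i * herm_vec \<alpha> x - sqrt (2 * (real (\<alpha> i) + 1)) * herm_vec (\<alpha>(i := Suc (\<alpha> i))) x"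

lemma herm_vec_line:
 "herm_vec \<alpha> (x + t *\<^sub>R axis i 1) = herm (\<alpha> i) (x $ i + t) * (\<Prod>j\<in>UNIV - {i}. herm (\<alpha> j) (x $ j))"
 unfolding herm_vec_remove[of \<alpha> _ i]
 by (intro arg_cong2[where f = "(*)"] prod.cong) (auto simp: axis_def)

lemma herm_vec_upd:
 "herm_vec (\<alpha>(i := k)) x = herm k (x $ i) * (\<Prod>j\<in>UNIV - {i}. herm (\<alpha> j) (x $ j))"
 unfolding herm_vec_def by (rule prod_fun_upd[of "\<lambda>j k. herm k (x $ j)"])

lemma herm_line_deriv:
 "((\<lambda>t. herm k (y + t)) has_real_derivative (y * herm k y - sqrt (2 * (real k + 1)) * herm (Suc k) y)) (at 0)"
 using DERIV_shift[of "herm k" _ 0 y] herm_deriv2[of k y] by (simp add: add.commute)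

lemma herm_vec_line_deriv:
 "((\<lambda>t. herm_vec \<alpha> (x + t *\<^sub>R axis i 1)) has_real_derivative herm_vec_deriv i \<alpha> x) (at 0)"
proof -
 have "((\<lambda>t. herm (\<alpha> i) (x $ i + t) * (\<Prod>j\<in>UNIV - {i}. herm (\<alpha> j) (x $ j))) has_real_derivative
   (x $ i * herm (\<alpha> i) (x $ i) - sqrt (2 * (real (\<alpha> i) + 1)) * herm (Suc (\<alpha> i)) (x $ i)) * (\<Prod>j\<in>UNIV - {i}. herm (\<alpha> j) (x $ j))) (at 0)"
  by (rule DERIV_cmult_right[OF herm_line_deriv])
 then show ?thesis
  unfolding herm_vec_line herm_vec_deriv_def herm_vec_upd herm_vec_remove[of \<alpha> x i]
  by (simp add: algebra_simps)
qed

lemma herm_rec2: "2 * x * herm k x = sqrt (2 * (real k + 1)) * herm (Suc k) x + sqrt (2 * real k) * herm (k - 1) x"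
proof -
 have s: "2 * sqrt (y / 2) = sqrt (2 * y)" for y :: real
  by (simp add: real_sqrt_divide real_sqrt_mult field_simps flip: real_sqrt_mult_self[of 2])
 have "2 * (x * herm k x) = (2 * sqrt ((real k + 1) / 2)) * herm (Suc k) x + (2 * sqrt (real k / 2)) * herm (k - 1) x"
  unfolding herm_rec by simp
 then show ?thesis unfolding s by simp
qed

text \<open>The derivative formula and the three-term recurrence combine into the oscillator
  equation in the i-th variable.\<close>

lemma herm_vec_line_deriv2:
 "((\<lambda>t. herm_vec_deriv i \<alpha> (x + t *\<^sub>R axis i 1)) has_real_derivative
   ((x $ i)^2 - (2 * real (\<alpha> i) + 1)) * herm_vec \<alpha> x) (at 0)"
proof -
 define k y P where "k = \<alpha> i" and "y = x $ i" and "P = (\<Prod>j\<in>UNIV - {i}. herm (\<alpha> j) (x $ j))"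
 define s where "s = sqrt (2 * (real k + 1))"
 have ss: "s * s = 2 * (real k + 1)" by (simp add: s_def)
 have eq: "herm_vec_deriv i \<alpha> (x + t *\<^sub>R axis i 1) = ((y + t) * herm k (y + t) - s * herm (Suc k) (y + t)) * P" for t
  unfolding herm_vec_deriv_def herm_vec_line herm_vec_line[of "\<alpha>(i := Suc (\<alpha> i))"]
  by (simp add: k_def y_def P_def s_def algebra_simps)
 have r: "2 * y * herm (Suc k) y = sqrt (2 * (real (Suc k) + 1)) * herm (Suc (Suc k)) y + s * herm k y"
  using herm_rec2[of y "Suc k"] by (simp add: s_def add.commute)
 have "((\<lambda>t. ((y + t) * herm k (y + t) - s * herm (Suc k) (y + t)) * P) has_real_derivative
   ((1 * herm k (y + 0) + (y * herm k y - s * herm (Suc k) y) * (y + 0))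
   - s * (y * herm (Suc k) y - sqrt (2 * (real (Suc k) + 1)) * herm (Suc (Suc k)) y)) * P) (at 0)"
  unfolding s_def
  by (intro DERIV_cmult_right DERIV_diff DERIV_cmult DERIV_mult herm_line_deriv) (auto intro!: derivative_eq_intros)
 moreover have "((1 * herm k (y + 0) + (y * herm k y - s * herm (Suc k) y) * (y + 0))
   - s * (y * herm (Suc k) y - sqrt (2 * (real (Suc k) + 1)) * herm (Suc (Suc k)) y)) = (y^2 - (2 * real k + 1)) * herm k y"
 proof -
  have "s * (y * herm (Suc k) y - sqrt (2 * (real (Suc k) + 1)) * herm (Suc (Suc k)) y)
    = s * (s * herm k y - y * herm (Suc k) y)"
   using r by (intro arg_cong[where f = "(*) s"]) linarith
  also have "\<dots> = 2 * (real k + 1) * herm k y - s * y * herm (Suc k) y"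
   unfolding right_diff_distrib mult.assoc[symmetric] ss ..
  finally show ?thesis by (simp add: power2_eq_square algebra_simps)
 qed
 ultimately show ?thesis
  unfolding eq by (simp add: herm_vec_remove[of \<alpha> x i] k_def y_def P_def mult.assoc)
qed

lemma herm_vec_x_decay: "\<exists>C. \<forall>x. \<bar>x $ i * herm_vec \<alpha> x\<bar> \<le> C * decay_weight x"
proof -
 let ?a = "sqrt ((real (\<alpha> i) + 1) / 2)" and ?b = "sqrt (real (\<alpha> i) / 2)"
 let ?u = "\<alpha>(i := Suc (\<alpha> i))" and ?d = "\<alpha>(i := \<alpha> i - 1)"
 have "\<bar>x $ i * herm_vec \<alpha> x\<bar> \<le> (?a * hermite_const ?u + ?b * hermite_const ?d) * decay_weight x" for x
 proof -
  have "\<bar>x $ i * herm_vec \<alpha> x\<bar> \<le> ?a * \<bar>herm_vec ?u x\<bar> + ?b * \<bar>herm_vec ?d x\<bar>"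
   unfolding herm_vec_rec by (rule order_trans[OF abs_triangle_ineq]) (simp add: abs_mult)
  also have "\<dots> \<le> ?a * (hermite_const ?u * decay_weight x) + ?b * (hermite_const ?d * decay_weight x)"
   by (intro add_mono mult_left_mono herm_vec_bound) auto
  finally show ?thesis by (simp add: algebra_simps)
 qed
 then show ?thesis by blast
qed

lemma decay_add:
 assumes "\<exists>C. \<forall>x. \<bar>f x\<bar> \<le> C * decay_weight x" "\<exists>C. \<forall>x. \<bar>g x\<bar> \<le> C * decay_weight x"
 shows "\<exists>C. \<forall>x. \<bar>a * f x + b * g x\<bar> \<le> C * decay_weight x"
proof -
 obtain C D where C: "\<And>x. \<bar>f x\<bar> \<le> C * decay_weight x" and D: "\<And>x. \<bar>g x\<bar> \<le> D * decay_weight x"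
  using assms by blast
 have "\<bar>a * f x + b * g x\<bar> \<le> (\<bar>a\<bar> * C + \<bar>b\<bar> * D) * decay_weight x" for x
 proof -
  have "\<bar>a * f x + b * g x\<bar> \<le> \<bar>a\<bar> * \<bar>f x\<bar> + \<bar>b\<bar> * \<bar>g x\<bar>"
   using abs_triangle_ineq[of "a * f x" "b * g x"] by (simp add: abs_mult)
  also have "\<dots> \<le> \<bar>a\<bar> * (C * decay_weight x) + \<bar>b\<bar> * (D * decay_weight x)"
   using C D by (intro add_mono mult_left_mono) auto
  finally show ?thesis by (simp add: algebra_simps)
 qed
 then show ?thesis by blast
qed

lemma herm_vec_decay: "\<exists>C. \<forall>x. \<bar>herm_vec \<alpha> x\<bar> \<le> C * decay_weight x"
 using herm_vec_bound by blast

lemma herm_vec_deriv_decay: "\<exists>C. \<forall>x. \<bar>herm_vec_deriv i \<alpha> x\<bar> \<le> C * decay_weight x"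
 using decay_add[OF herm_vec_x_decay herm_vec_decay, of 1 i \<alpha> "- sqrt (2 * (real (\<alpha> i) + 1))" "\<alpha>(i := Suc (\<alpha> i))"]
 by (simp add: herm_vec_deriv_def)

lemma herm_vec_x2_decay: "\<exists>C. \<forall>x. \<bar>(x $ i)^2 * herm_vec \<alpha> x\<bar> \<le> C * decay_weight x"
proof -
 have "(x $ i)^2 * herm_vec \<alpha> x
  = sqrt ((real (\<alpha> i) + 1) / 2) * (x $ i * herm_vec (\<alpha>(i := Suc (\<alpha> i))) x)
   + sqrt (real (\<alpha> i) / 2) * (x $ i * herm_vec (\<alpha>(i := \<alpha> i - 1)) x)" for x
 proof -
  have "(x $ i)^2 * herm_vec \<alpha> x = x $ i * (x $ i * herm_vec \<alpha> x)" by (simp add: power2_eq_square)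
  then show ?thesis unfolding herm_vec_rec[of x i \<alpha>] by (simp add: algebra_simps)
 qed
 then show ?thesis
  using decay_add[OF herm_vec_x_decay[of i "\<alpha>(i := Suc (\<alpha> i))"] herm_vec_x_decay[of i "\<alpha>(i := \<alpha> i - 1)"]]
  by simp
qed

lemma herm_vec_deriv_measurable[measurable]: "herm_vec_deriv i \<alpha> \<in> borel_measurable borel"
proof -
 have "(\<lambda>x. (x $ i) * herm_vec \<alpha> x - sqrt (2 * (real (\<alpha> i) + 1)) * herm_vec (\<alpha>(i := Suc (\<alpha> i))) x) \<in> borel_measurable borel"
  by measurable
 then show ?thesis by (simp add: herm_vec_deriv_def[abs_def])
qed

lemma decay_weight_shift:
 assumes "0 \<le> t" "t \<le> 1"
 shows "decay_weight (x + t *\<^sub>R axis i 1) \<le> 3 * decay_weight x"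
proof -
 have "decay_weight (x + t *\<^sub>R axis i 1)
   = inverse (1 + (x $ i + t)^2) * (\<Prod>j\<in>UNIV - {i}. inverse (1 + ((x + t *\<^sub>R axis i 1) $ j)^2))"
  unfolding decay_weight_def by (subst prod.remove[of _ i]) (auto simp: axis_def)
 also have "(\<Prod>j\<in>UNIV - {i}. inverse (1 + ((x + t *\<^sub>R axis i 1) $ j)^2)) = (\<Prod>j\<in>UNIV - {i}. inverse (1 + (x $ j)^2))"
  by (intro prod.cong) (auto simp: axis_def)
 also have "inverse (1 + (x $ i + t)^2) * (\<Prod>j\<in>UNIV - {i}. inverse (1 + (x $ j)^2))
   \<le> 3 * inverse (1 + (x $ i)^2) * (\<Prod>j\<in>UNIV - {i}. inverse (1 + (x $ j)^2))"
  by (intro mult_right_mono inverse_square_shift assms prod_nonneg) (auto simp: add_nonneg_nonneg)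
 also have "\<dots> = 3 * decay_weight x"
  unfolding decay_weight_def by (subst (2) prod.remove[of _ i]) auto
 finally show ?thesis .
qed

section \<open>Schwartz functions tested against Hermite functions\<close>

context
 fixes \<phi> :: "'n::finite fn"
 assumes \<phi>: "\<phi> \<in> schwartz"
begin

lemma schwartz_differentiable: "foldr partial_derivative is \<phi> differentiable (at x)"
 using \<phi> by (auto simp: schwartz_def)

lemma schwartz_bounded: "\<exists>C. \<forall>x. cmod (foldr partial_derivative is \<phi> x) \<le> C"
proof -
 have "bounded (range (\<lambda>x. norm x ^ 0 *\<^sub>R foldr partial_derivative is \<phi> x))"
  using \<phi> unfolding schwartz_def by blast
 then show ?thesis by (auto simp: bounded_iff)
qed

lemma schwartz_measurable: "foldr partial_derivative is \<phi> \<in> borel_measurable borel"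
 using schwartz_differentiable
 by (intro borel_measurable_continuous_onI differentiable_imp_continuous_on)
  (auto simp: differentiable_on_def intro: differentiable_at_withinI)

lemma schwartz_line_deriv:
 "((\<lambda>t. foldr partial_derivative is \<phi> (x + t *\<^sub>R axis i 1)) has_vector_derivative
   foldr partial_derivative (i # is) \<phi> x) (at 0)"
proof -
 let ?f = "foldr partial_derivative is \<phi>"
 let ?D = "frechet_derivative ?f (at x)"
 have D: "(?f has_derivative ?D) (at (x + 0 *\<^sub>R axis i 1))"
  using schwartz_differentiable by (simp add: frechet_derivative_works)
 have "((\<lambda>t. x + t *\<^sub>R axis i 1) has_derivative (\<lambda>t. t *\<^sub>R axis i 1)) (at (0::real))"
  by (auto intro!: derivative_eq_intros)
 from has_derivative_compose[OF this D]
 have "((\<lambda>t. ?f (x + t *\<^sub>R axis i 1)) has_derivative (\<lambda>t. ?D (t *\<^sub>R axis i 1))) (at 0)" .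
 moreover have "?D (t *\<^sub>R axis i 1) = t *\<^sub>R ?D (axis i 1)" for t
  using has_derivative_linear[OF D] by (simp add: linear_scale)
 ultimately show ?thesis
  by (simp add: has_vector_derivative_def partial_derivative_def)
qed

lemma bounded_times_decay_integrable:
 fixes g :: "real ^ 'n \<Rightarrow> real"
 assumes "\<exists>C. \<forall>x. \<bar>g x\<bar> \<le> C * decay_weight x" and [measurable]: "g \<in> borel_measurable borel"
 shows "integrable lborel (\<lambda>x. cnj (foldr partial_derivative is \<phi> x) * of_real (g x))"
proof -
 obtain C where C: "\<And>x. \<bar>g x\<bar> \<le> C * decay_weight x" using assms by blast
 obtain D where D: "\<And>x. cmod (foldr partial_derivative is \<phi> x) \<le> D" using schwartz_bounded by blast
 have [measurable]: "foldr partial_derivative is \<phi> \<in> borel_measurable borel" by (rule schwartz_measurable)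
 have "cmod (cnj (foldr partial_derivative is \<phi> x) * of_real (g x)) \<le> D * (C * decay_weight x)" for x
  using mult_mono'[OF D[of x] C[of x]] by (simp add: norm_mult)
 then show ?thesis
  by (intro Bochner_Integration.integrable_bound[OF integrable_mult_right[OF integrable_mult_right[OF decay_weight_integrable, of C], of D]])
   (auto intro: order_trans[OF _ abs_ge_self])
qed

text \<open>Green's identity: differentiating the Wronskian \<open>f\<close> of the two functions
  along the i-th axis leaves only terms with second derivatives, and the result integrates to
  0.\<close>

lemma schwartz_second_derivative_ibp:
 "(LINT x|lborel. cnj (foldr partial_derivative [i, i] \<phi> x) * of_real (herm_vec \<alpha> x))
  = (LINT x|lborel. cnj (\<phi> x) * of_real (((x $ i)^2 - (2 * real (\<alpha> i) + 1)) * herm_vec \<alpha> x))"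
proof -
 define h0 h1 h2 where "h0 = herm_vec \<alpha>" and "h1 = herm_vec_deriv i \<alpha>"
  and "h2 x = ((x $ i)^2 - (2 * real (\<alpha> i) + 1)) * herm_vec \<alpha> x" for x
 let ?p0 = "foldr partial_derivative [] \<phi>" and ?p1 = "foldr partial_derivative [i] \<phi>" and ?p2 = "foldr partial_derivative [i, i] \<phi>"
 have d0: "\<exists>C. \<forall>x. \<bar>h0 x\<bar> \<le> C * decay_weight x" unfolding h0_def by (rule herm_vec_decay)
 have d1: "\<exists>C. \<forall>x. \<bar>h1 x\<bar> \<le> C * decay_weight x" unfolding h1_def by (rule herm_vec_deriv_decay)
 have d2: "\<exists>C. \<forall>x. \<bar>h2 x\<bar> \<le> C * decay_weight x"
  using decay_add[OF herm_vec_x2_decay[of i \<alpha>] herm_vec_decay[of \<alpha>], of 1 "- (2 * real (\<alpha> i) + 1)"]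
  by (simp add: h2_def[abs_def] algebra_simps)
 have [measurable]: "h0 \<in> borel_measurable borel" "h1 \<in> borel_measurable borel" "h2 \<in> borel_measurable borel"
  by (simp_all add: h0_def h1_def h2_def[abs_def])
 define f where "f x = cnj (?p1 x) * of_real (h0 x) - cnj (?p0 x) * of_real (h1 x)" for x
 define f' where "f' x = cnj (?p2 x) * of_real (h0 x) - cnj (?p0 x) * of_real (h2 x)" for x
 have deriv: "((\<lambda>t. f (x + t *\<^sub>R axis i 1)) has_vector_derivative f' x) (at 0)" for x
 proof -
  have c: "((\<lambda>t. cnj (foldr partial_derivative is \<phi> (x + t *\<^sub>R axis i 1))) has_vector_derivative
    cnj (foldr partial_derivative (i # is) \<phi> x)) (at 0)" for "is"
   by (rule bounded_linear.has_vector_derivative[OF bounded_linear_cnj schwartz_line_deriv])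
  have 0: "((\<lambda>t. complex_of_real (h0 (x + t *\<^sub>R axis i 1))) has_vector_derivative of_real (h1 x)) (at 0)"
   unfolding h0_def h1_def by (rule has_vector_derivative_of_real[OF herm_vec_line_deriv])
  have 1: "((\<lambda>t. complex_of_real (h1 (x + t *\<^sub>R axis i 1))) has_vector_derivative of_real (h2 x)) (at 0)"
   unfolding h1_def h2_def by (rule has_vector_derivative_of_real[OF herm_vec_line_deriv2])
  have "((\<lambda>t. f (x + t *\<^sub>R axis i 1)) has_vector_derivative
    (cnj (?p1 (x + 0 *\<^sub>R axis i 1)) * of_real (h1 x) + cnj (?p2 x) * of_real (h0 (x + 0 *\<^sub>R axis i 1)))
    - (cnj (?p0 (x + 0 *\<^sub>R axis i 1)) * of_real (h2 x) + cnj (?p1 x) * of_real (h1 (x + 0 *\<^sub>R axis i 1)))) (at 0)"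
   unfolding f_def by (intro has_vector_derivative_diff has_vector_derivative_mult 0 1 c)
  then show ?thesis by (simp add: f'_def algebra_simps)
 qed
 obtain C0 where C0: "\<And>x. \<bar>h0 x\<bar> \<le> C0 * decay_weight x" using d0 by blast
 obtain C2 where C2: "\<And>x. \<bar>h2 x\<bar> \<le> C2 * decay_weight x" using d2 by blast
 obtain P0 where P0: "\<And>x. cmod (?p0 x) \<le> P0" using schwartz_bounded[of "[]"] by blast
 obtain P2 where P2: "\<And>x. cmod (?p2 x) \<le> P2" using schwartz_bounded[of "[i, i]"] by blast
 have nC0: "0 \<le> C0 * decay_weight x" for x :: "real ^ 'n" by (rule order_trans[OF abs_ge_zero C0])
 have nC2: "0 \<le> C2 * decay_weight x" for x :: "real ^ 'n" by (rule order_trans[OF abs_ge_zero C2])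
 have nP: "0 \<le> P0" "0 \<le> P2" using order_trans[OF norm_ge_zero P0] order_trans[OF norm_ge_zero P2] by blast+
 note nn = nC0 nC2 nP
 have C: "0 \<le> C0" "0 \<le> C2" using nn(1,2)[of 0] decay_weight_pos[of "0 :: real ^ 'n"] by (auto simp: zero_le_mult_iff)
 have f'b: "cmod (f' x) \<le> (P2 * C0 + P0 * C2) * decay_weight x" for x
 proof -
  have "cmod (f' x) \<le> cmod (?p2 x) * \<bar>h0 x\<bar> + cmod (?p0 x) * \<bar>h2 x\<bar>"
   unfolding f'_def by (rule order_trans[OF norm_triangle_ineq4]) (simp add: norm_mult)
  also have "\<dots> \<le> P2 * (C0 * decay_weight x) + P0 * (C2 * decay_weight x)"
   by (intro add_mono mult_mono P0 P2 C0 C2) (use nn in auto)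
  finally show ?thesis by (simp add: algebra_simps)
 qed
 have "(LINT x|lborel. f' x) = 0"
 proof (rule integral_directional_derivative[OF _ deriv])
  show "integrable lborel f"
   unfolding f_def by (intro Bochner_Integration.integrable_diff bounded_times_decay_integrable d0 d1) measurable
  show "cmod (f' (x + t *\<^sub>R axis i 1)) \<le> (P2 * C0 + P0 * C2) * (3 * decay_weight x)" if "0 \<le> t" "t \<le> 1" for t x
   by (rule order_trans[OF f'b mult_left_mono[OF decay_weight_shift[OF that]]]) (use nn C in auto)
  show "integrable lborel (\<lambda>x. (P2 * C0 + P0 * C2) * (3 * decay_weight x))"
   by (intro integrable_mult_right decay_weight_integrable)
 qed
 moreover have "(LINT x|lborel. f' x) = (LINT x|lborel. cnj (?p2 x) * of_real (h0 x)) - (LINT x|lborel. cnj (?p0 x) * of_real (h2 x))"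
  unfolding f'_def by (intro Bochner_Integration.integral_diff bounded_times_decay_integrable d0 d2) measurable
 ultimately show ?thesis by (simp add: h0_def h2_def)
qed

text \<open>Green's identity summed over the axes. Since \<open>oscillator\<close> is an adjoint,
  this weak equation is exactly what makes a Hermite function an eigenvector.\<close>

lemma oscillator_hermite_weak:
 fixes \<alpha> :: "'n \<Rightarrow> nat"
 shows "L2inner (\<lambda>x. of_real (exp (exp 1) / real CARD('n)) * (- laplacian \<phi> x + of_real (x \<bullet> x) * \<phi> x)) (\<lambda>x. of_real (herm_vec \<alpha> x))
  = L2inner \<phi> (\<lambda>x. of_real (osc_eigenvalue \<alpha>) * of_real (herm_vec \<alpha> x))"
proof -
 let ?h = "herm_vec \<alpha>"
 define c where "c = exp (exp 1) / real CARD('n)"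
 define L where "L x = (\<Sum>i\<in>UNIV. foldr partial_derivative [i, i] \<phi> x)" for x
 have L: "laplacian \<phi> x = L x" for x by (simp add: laplacian_def L_def)
 have p[measurable]: "foldr partial_derivative is \<phi> \<in> borel_measurable borel" for "is" by (rule schwartz_measurable)
 have \<phi>m[measurable]: "\<phi> \<in> borel_measurable borel" using p[of "[]"] by simp
 have [measurable]: "L \<in> borel_measurable borel" unfolding L_def[abs_def] by measurable
 have x2: "\<exists>C. \<forall>x. \<bar>(x \<bullet> x) * ?h x\<bar> \<le> C * decay_weight x"
 proof -
  have "\<exists>C. \<forall>x. \<bar>\<Sum>i\<in>I. (x $ i)^2 * ?h x\<bar> \<le> C * decay_weight x" if "finite I" for I
   using that
  proof (induction I)
   case (insert i I)
   then show ?case using decay_add[OF herm_vec_x2_decay[of i \<alpha>] insert(3), of 1 1] by simp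
  qed (auto intro: exI[of _ 0])
  from this[of UNIV] show ?thesis by (simp add: inner_vec_sum power2_eq_square sum_distrib_right)
 qed
 have i2: "integrable lborel (\<lambda>x. cnj (\<phi> x) * of_real (x \<bullet> x * ?h x))"
  using bounded_times_decay_integrable[OF x2, of "[]"] by simp
 have iL: "integrable lborel (\<lambda>x. cnj (foldr partial_derivative [i, i] \<phi> x) * of_real (?h x))" for i
  by (intro bounded_times_decay_integrable herm_vec_decay) measurable
 have ix: "integrable lborel (\<lambda>x. cnj (\<phi> x) * of_real (((x $ i)^2 - (2 * real (\<alpha> i) + 1)) * ?h x))" for i
 proof -
  have "\<exists>C. \<forall>x. \<bar>((x $ i)^2 - (2 * real (\<alpha> i) + 1)) * ?h x\<bar> \<le> C * decay_weight x"
   using decay_add[OF herm_vec_x2_decay[of i \<alpha>] herm_vec_decay[of \<alpha>], of 1 "- (2 * real (\<alpha> i) + 1)"]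
   by (simp add: algebra_simps)
  from bounded_times_decay_integrable[OF this, of "[]"] show ?thesis by simp
 qed
 have "(LINT x|lborel. cnj (L x) * of_real (?h x)) = (\<Sum>i\<in>UNIV. LINT x|lborel. cnj (foldr partial_derivative [i, i] \<phi> x) * of_real (?h x))"
  unfolding L_def cnj_sum sum_distrib_right by (rule Bochner_Integration.integral_sum) (rule iL)
 also have "\<dots> = (\<Sum>i\<in>UNIV. LINT x|lborel. cnj (\<phi> x) * of_real (((x $ i)^2 - (2 * real (\<alpha> i) + 1)) * ?h x))"
  unfolding schwartz_second_derivative_ibp ..
 also have "\<dots> = (LINT x|lborel. (\<Sum>i\<in>UNIV. cnj (\<phi> x) * of_real (((x $ i)^2 - (2 * real (\<alpha> i) + 1)) * ?h x)))"
  by (rule Bochner_Integration.integral_sum[symmetric]) (rule ix)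
 also have "\<dots> = (LINT x|lborel. cnj (\<phi> x) * of_real (x \<bullet> x * ?h x) - cnj (\<phi> x) * of_real ((2 * real (degree_of \<alpha>) + real CARD('n)) * ?h x))"
 proof (intro Bochner_Integration.integral_cong refl)
  fix x
  have "(\<Sum>i\<in>UNIV. ((x $ i)^2 - (2 * real (\<alpha> i) + 1)) * ?h x) = (x \<bullet> x - (2 * real (degree_of \<alpha>) + real CARD('n))) * ?h x"
   unfolding sum_distrib_right[symmetric] sum_subtractf sum.distrib
   by (simp add: inner_vec_sum power2_eq_square degree_of_def flip: sum_distrib_left)
  then show "(\<Sum>i\<in>UNIV. cnj (\<phi> x) * of_real (((x $ i)^2 - (2 * real (\<alpha> i) + 1)) * ?h x))
    = cnj (\<phi> x) * of_real (x \<bullet> x * ?h x) - cnj (\<phi> x) * of_real ((2 * real (degree_of \<alpha>) + real CARD('n)) * ?h x)"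
   unfolding sum_distrib_left[symmetric] of_real_sum[symmetric] by (simp add: left_diff_distrib right_diff_distrib)
 qed
 finally have key: "(LINT x|lborel. cnj (L x) * of_real (?h x))
  = (LINT x|lborel. cnj (\<phi> x) * of_real (x \<bullet> x * ?h x) - cnj (\<phi> x) * of_real ((2 * real (degree_of \<alpha>) + real CARD('n)) * ?h x))" .
 have iLL: "integrable lborel (\<lambda>x. cnj (L x) * of_real (?h x))"
  unfolding L_def cnj_sum sum_distrib_right by (intro Bochner_Integration.integrable_sum iL)
 have i0: "integrable lborel (\<lambda>x. cnj (\<phi> x) * of_real ((2 * real (degree_of \<alpha>) + real CARD('n)) * ?h x))"
 proof -
  have "integrable lborel (\<lambda>x. of_real (2 * real (degree_of \<alpha>) + real CARD('n)) * (cnj (foldr partial_derivative [] \<phi> x) * of_real (?h x)))"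
   by (intro integrable_mult_right bounded_times_decay_integrable herm_vec_decay) measurable
  then show ?thesis by (simp add: mult_ac)
 qed
 have "L2inner (\<lambda>x. of_real c * (- laplacian \<phi> x + of_real (x \<bullet> x) * \<phi> x)) (\<lambda>x. of_real (?h x))
   = (LINT x|lebesgue. of_real c * (cnj (\<phi> x) * of_real (x \<bullet> x * ?h x) - cnj (L x) * of_real (?h x)))"
  by (simp add: L2inner_def L algebra_simps)
 also have "\<dots> = of_real c * (LINT x|lborel. cnj (\<phi> x) * of_real (x \<bullet> x * ?h x) - cnj (L x) * of_real (?h x))"
  by (subst integral_mult_right_zero, subst lebesgue_integral_borel) auto
 also have "\<dots> = of_real c * (LINT x|lborel. cnj (\<phi> x) * of_real ((2 * real (degree_of \<alpha>) + real CARD('n)) * ?h x))"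
  using i2 iLL i0 key by simp
 also have "\<dots> = (LINT x|lborel. cnj (\<phi> x) * (of_real (osc_eigenvalue \<alpha>) * of_real (?h x)))"
  by (subst integral_mult_right_zero[symmetric]) (simp add: osc_eigenvalue_def c_def mult_ac)
 also have "\<dots> = L2inner \<phi> (\<lambda>x. of_real (osc_eigenvalue \<alpha>) * of_real (?h x))"
  unfolding L2inner_def by (rule lebesgue_integral_borel[symmetric]) measurable
 finally show ?thesis by (simp add: c_def)
qed

end

lemma oscillator_hermite:
 "((\<lambda>x. of_real (herm_vec \<alpha> x)), (\<lambda>x. of_real (osc_eigenvalue \<alpha>) * of_real (herm_vec \<alpha> x))) \<in> oscillator"
proof -
 have "\<forall>(\<phi>, \<phi>')\<in>oscillator_on_schwartz. L2inner \<phi>' (\<lambda>x. of_real (herm_vec \<alpha> x))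
   = L2inner \<phi> (\<lambda>x. of_real (osc_eigenvalue \<alpha>) * of_real (herm_vec \<alpha> x))"
  unfolding oscillator_on_schwartz_def using oscillator_hermite_weak by blast
 then show ?thesis
  unfolding oscillator_def L2_adjoint_def by (auto simp: herm_vec_L2 L2_scale)
qed

subsection \<open>Spectral measures\<close>

context
 fixes E :: "real set \<Rightarrow> 'n::finite fn \<Rightarrow> 'n fn"
 assumes E: "spectral_measure E"
begin

text \<open>\<open>E B\<close> acts on functions. Its symmetry forces it to respect equality almost
  everywhere, see \<open>cls_E\<close>, so it descends to classes.\<close>

definition spec_proj :: "real set \<Rightarrow> 'n l2 \<Rightarrow> 'n l2" where
 "spec_proj B u = cls (E B (rep u))"

lemma E_L2: "B \<in> sets borel \<Longrightarrow> \<phi> \<in> L2 \<Longrightarrow> E B \<phi> \<in> L2"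
 using E by (auto simp: spectral_measure_def)

lemma E_sym: "B \<in> sets borel \<Longrightarrow> \<phi> \<in> L2 \<Longrightarrow> \<psi> \<in> L2 \<Longrightarrow> cin (cls (E B \<phi>)) (cls \<psi>) = cin (cls \<phi>) (cls (E B \<psi>))"
 using E by (simp add: spectral_measure_def cin_cls)

lemma cin_left_eqI: "(\<And>v. cin u v = cin w v) \<Longrightarrow> u = w" for u w :: "'n l2"
 using cin_same[of "u - w"] by (simp add: cin_minus_left del: of_real_power)

lemma cls_E: "B \<in> sets borel \<Longrightarrow> \<phi> \<in> L2 \<Longrightarrow> cls (E B \<phi>) = spec_proj B (cls \<phi>)"
proof (rule cin_left_eqI)
 fix v assume "B \<in> sets borel" "\<phi> \<in> L2"
 then show "cin (cls (E B \<phi>)) v = cin (spec_proj B (cls \<phi>)) v"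
  using E_sym[of B \<phi> "rep v"] E_sym[of B "rep (cls \<phi>)" "rep v"] by (simp add: spec_proj_def)
qed

context
 fixes B :: "real set"
 assumes B: "B \<in> sets borel"
begin

lemma proj_sym: "cin (spec_proj B u) v = cin u (spec_proj B v)"
 using E_sym[OF B, of "rep u" "rep v"] by (simp add: spec_proj_def)

lemma proj_idem: "spec_proj B (spec_proj B u) = spec_proj B u"
proof -
 have "ae_eq (E B (E B (rep u))) (E B (rep u))" using E B by (simp add: spectral_measure_def)
 then have "cls (E B (E B (rep u))) = cls (E B (rep u))"
  using B by (intro cls_eqI) (auto simp: ae_eq_def E_L2)
 then show ?thesis
  using cls_E[OF B, of "E B (rep u)"] cls_E[OF B, of "rep u"] B by (simp add: E_L2)
qed

lemma proj_add: "spec_proj B (u + v) = spec_proj B u + spec_proj B v"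
 by (rule cin_left_eqI) (simp add: proj_sym cin_add_left)

lemma proj_cs: "spec_proj B (cs c u) = cs c (spec_proj B u)"
 by (rule cin_left_eqI) (simp add: proj_sym cin_cs_left)

lemma proj_diff: "spec_proj B (u - v) = spec_proj B u - spec_proj B v"
 by (rule cin_left_eqI) (simp add: proj_sym cin_minus_left)

lemma proj_norm_sq: "cin u (spec_proj B u) = of_real ((norm (spec_proj B u))^2)"
 using proj_sym[of u "spec_proj B u"] by (simp add: proj_idem cin_same del: of_real_power)

lemma proj_norm_le: "(norm (spec_proj B u))^2 \<le> (norm u)^2"
 and proj_fixed: "(norm (spec_proj B u))^2 = (norm u)^2 \<Longrightarrow> spec_proj B u = u"
proof -
 have "u \<bullet> spec_proj B u = (norm (spec_proj B u))^2"
  by (simp add: inner_eq_Re_cin proj_norm_sq del: of_real_power)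
 then have d: "(norm (u - spec_proj B u))^2 = (norm u)^2 - (norm (spec_proj B u))^2"
  by (simp add: power2_norm_eq_inner inner_diff inner_commute[of "spec_proj B u" u])
 then show "(norm (spec_proj B u))^2 \<le> (norm u)^2"
  using zero_le_power2[of "norm (u - spec_proj B u)"] by linarith
 show "spec_proj B u = u" if "(norm (spec_proj B u))^2 = (norm u)^2"
  using d that by simp
qed

end

lemma proj_UNIV: "spec_proj UNIV u = u"
proof -
 have "ae_eq (E UNIV (rep u)) (rep u)" using E by (simp add: spectral_measure_def)
 then have "cls (E UNIV (rep u)) = cls (rep u)" by (intro cls_eqI) (auto simp: ae_eq_def E_L2)
 then show ?thesis by (simp add: spec_proj_def)
qed

lemma proj_countably_additive: "countably_additive (sets borel) (\<lambda>B. ennreal ((norm (spec_proj B u))^2))"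
proof -
 have ca: "countably_additive (sets borel) (\<lambda>B. (L2norm (E B (rep u)))^2)"
  using E by (simp add: spectral_measure_def)
 have eq: "(L2norm (E B (rep u)))^2 = ennreal ((norm (spec_proj B u))^2)" if "B \<in> sets borel" for B
  using that by (simp add: L2norm_cls E_L2 spec_proj_def ennreal_power)
 show ?thesis
  unfolding countably_additive_def
 proof (intro allI impI)
  fix A :: "nat \<Rightarrow> real set"
  assume A: "range A \<subseteq> sets borel" "disjoint_family A" "(\<Union>i. A i) \<in> sets borel"
  have "(\<Sum>i. (L2norm (E (A i) (rep u)))^2) = (L2norm (E (\<Union>i. A i) (rep u)))^2"
   using ca A unfolding countably_additive_def by simp
  moreover have "(L2norm (E (A i) (rep u)))^2 = ennreal ((norm (spec_proj (A i) u))^2)" for i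
   using A(1) by (intro eq) (rule range_subsetD)
  ultimately show "(\<Sum>i. ennreal ((norm (spec_proj (A i) u))^2)) = ennreal ((norm (spec_proj (\<Union>i. A i) u))^2)"
   using eq[OF A(3)] by simp
 qed
qed

text \<open>Additivity over countably many copies of the empty set gives c = c + c + ... for a
  finite number c.\<close>

lemma proj_empty: "spec_proj {} u = 0"
proof -
 define c where "c = ennreal ((norm (spec_proj {} u))^2)"
 have "range (\<lambda>_::nat. {}::real set) \<subseteq> sets borel \<longrightarrow> disjoint_family (\<lambda>_::nat. {}::real set) \<longrightarrow>
   (\<Union>i::nat. {}::real set) \<in> sets borel \<longrightarrow> (\<Sum>i::nat. c) = ennreal ((norm (spec_proj (\<Union>i::nat. {}) u))^2)"
  using proj_countably_additive[of u] unfolding countably_additive_def c_def by (rule allE)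
 then have "(\<Sum>i::nat. c) = ennreal ((norm (spec_proj (\<Union>i::nat. {}) u))^2)"
  by (rule mp[OF mp[OF mp]]) (auto simp: disjoint_family_on_def)
 then have s: "(\<Sum>i::nat. c) = c" by (simp only: c_def UN_empty2)
 have "(\<Sum>i<2::nat. c) \<le> (\<Sum>i::nat. c)" by (rule sum_le_suminf) auto
 then have "c + c \<le> c" unfolding s by (simp only: numeral_2_eq_2 sum.lessThan_Suc lessThan_0 sum.empty add_0)
 then have "(norm (spec_proj {} u))^2 + (norm (spec_proj {} u))^2 \<le> (norm (spec_proj {} u))^2"
  unfolding c_def by (subst (asm) ennreal_plus[symmetric]) (simp_all only: ennreal_le_iff zero_le_power2)
 then show ?thesis by simp
qed

definition spec_meas :: "'n l2 \<Rightarrow> real measure" where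
 "spec_meas u = measure_of UNIV (sets borel) (\<lambda>B. ennreal ((norm (spec_proj B u))^2))"

lemma sets_spec_meas[simp, measurable_cong]: "sets (spec_meas u) = sets borel"
 unfolding spec_meas_def by (simp add: sets_measure_of_conv sets.sigma_sets_eq[of borel, simplified])

lemma space_spec_meas[simp]: "space (spec_meas u) = UNIV"
 unfolding spec_meas_def by (simp add: space_measure_of_conv)

lemma emeasure_spec_meas: "B \<in> sets borel \<Longrightarrow> emeasure (spec_meas u) B = ennreal ((norm (spec_proj B u))^2)"
proof (rule emeasure_measure_of[OF spec_meas_def])
 show "positive (sets (spec_meas u)) (\<lambda>B. ennreal ((norm (spec_proj B u))^2))"
  by (simp add: positive_def proj_empty)
 show "countably_additive (sets (spec_meas u)) (\<lambda>B. ennreal ((norm (spec_proj B u))^2))"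
  using proj_countably_additive by simp
qed auto

lemma finite_measure_spec_meas: "finite_measure (spec_meas u)"
 by (rule finite_measureI) (simp add: emeasure_spec_meas)

lemma scalar_measure_eq: "\<phi> \<in> L2 \<Longrightarrow> scalar_measure E \<phi> = spec_meas (cls \<phi>)"
 unfolding scalar_measure_def spec_meas_def
proof (rule measure_of_eq)
 fix B :: "real set" assume "\<phi> \<in> L2" "B \<in> sigma_sets UNIV (sets borel)"
 then show "(L2norm (E B \<phi>))^2 = ennreal ((norm (spec_proj B (cls \<phi>)))^2)"
  using sets.sigma_sets_eq[of "borel :: real measure"] by (simp add: L2norm_cls E_L2 ennreal_power cls_E)
qed simp

lemma proj_disjoint_norm:
 assumes "A \<in> sets borel" "B \<in> sets borel" "A \<inter> B = {}"
 shows "(norm (spec_proj (A \<union> B) u))^2 = (norm (spec_proj A u))^2 + (norm (spec_proj B u))^2"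
proof -
 have "emeasure (spec_meas u) (A \<union> B) = emeasure (spec_meas u) A + emeasure (spec_meas u) B"
  using assms by (intro plus_emeasure[symmetric]) auto
 then show ?thesis using assms by (simp add: emeasure_spec_meas flip: ennreal_plus)
qed

text \<open>The squared norms of the parts of \<open>spec_proj B u\<close> in A and in B add up to
  at most that of the vector itself, and the part in B already exhausts it.\<close>

lemma proj_disjoint:
 assumes A: "A \<in> sets borel" and B: "B \<in> sets borel" and AB: "A \<inter> B = {}"
 shows "spec_proj A (spec_proj B u) = 0"
proof -
 have "(norm (spec_proj A (spec_proj B u)))^2 + (norm (spec_proj B u))^2 \<le> (norm (spec_proj B u))^2"
  using proj_disjoint_norm[OF A B AB, of "spec_proj B u"] proj_norm_le[of "A \<union> B" "spec_proj B u"] A B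
  by (simp add: proj_idem)
 then show ?thesis by simp
qed

text \<open>The remainder \<open>r\<close> has no part in B, so additivity leaves its full norm to
  the complement, and a vector whose norm is preserved by a projection is fixed by it.\<close>

lemma proj_compl:
 assumes B: "B \<in> sets borel"
 shows "spec_proj B u + spec_proj (- B) u = u"
proof -
 have B': "- B \<in> sets borel" using B by auto
 define r where "r = u - spec_proj B u"
 have "spec_proj B r = 0" by (simp add: r_def proj_diff[OF B] proj_idem[OF B])
 then have "(norm (spec_proj (- B) r))^2 = (norm r)^2"
  using proj_disjoint_norm[OF B B', of r] by (simp add: proj_UNIV)
 from proj_fixed[OF B' this] have "spec_proj (- B) r = r" .
 moreover have "spec_proj (- B) r = spec_proj (- B) u"
  unfolding r_def proj_diff[OF B'] using proj_disjoint[OF B' B] by simp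
 ultimately have "spec_proj (- B) u = u - spec_proj B u" by (simp only: r_def)
 then show ?thesis by simp
qed

lemma spec_meas_proj:
 assumes B: "B \<in> sets borel"
 shows "spec_meas (spec_proj B u) = density (spec_meas u) (indicator B)"
proof (rule measure_eqI)
 fix C assume "C \<in> sets (spec_meas (spec_proj B u))"
 then have C: "C \<in> sets borel" by simp
 have CB: "C \<inter> B \<in> sets borel" "C - B \<in> sets borel" "- B \<in> sets borel" using B C by auto
 have "spec_proj (C \<inter> B) u = spec_proj (C \<inter> B) (spec_proj B u + spec_proj (- B) u)"
  by (simp add: proj_compl[OF B])
 also have "\<dots> = spec_proj (C \<inter> B) (spec_proj B u)"
  unfolding proj_add[OF CB(1)] using proj_disjoint[OF CB(1) CB(3), of u] by auto
 finally have 1: "spec_proj (C \<inter> B) u = spec_proj (C \<inter> B) (spec_proj B u)" .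
 have "(norm (spec_proj C (spec_proj B u)))^2
   = (norm (spec_proj (C \<inter> B) (spec_proj B u)))^2 + (norm (spec_proj (C - B) (spec_proj B u)))^2"
  using proj_disjoint_norm[OF CB(1,2), of "spec_proj B u"] by (simp add: Int_Diff_Un) auto
 also have "spec_proj (C - B) (spec_proj B u) = 0"
  using B CB by (intro proj_disjoint) auto
 finally have "(norm (spec_proj C (spec_proj B u)))^2 = (norm (spec_proj (C \<inter> B) u))^2"
  unfolding 1 by simp
 moreover have "emeasure (density (spec_meas u) (indicator B)) C = emeasure (spec_meas u) (C \<inter> B)"
  using B C by (subst emeasure_density) (auto simp: Int_commute simp flip: indicator_inter_arith)
 ultimately show "emeasure (spec_meas (spec_proj B u)) C = emeasure (density (spec_meas u) (indicator B)) C"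
  using B C by (simp add: emeasure_spec_meas)
qed simp

section \<open>Operators given by spectral integrals\<close>

context
 fixes F :: "real \<Rightarrow> real" and T :: "'n op"
 assumes T: "spectral_integral E F T" and F[measurable]: "F \<in> borel_measurable borel"
begin

definition spec_dom :: "'n l2 set" where
 "spec_dom = {u. (\<integral>\<^sup>+ t. ennreal ((F t)^2) \<partial>spec_meas u) < top}"

definition spec_op :: "'n l2 \<Rightarrow> 'n l2" where
 "spec_op u = cls (SOME \<psi>. (rep u, \<psi>) \<in> T)"

lemma T_facts:
 shows T_sub: "T \<subseteq> L2 \<times> L2"
  and T_lin: "\<forall>\<phi> \<phi>' \<psi> \<psi>' a. (\<phi>, \<phi>') \<in> T \<longrightarrow> (\<psi>, \<psi>') \<in> T \<longrightarrow>
    ((\<lambda>x. a * \<phi> x + \<psi> x), (\<lambda>x. a * \<phi>' x + \<psi>' x)) \<in> T"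
  and T_single: "\<forall>\<phi> \<phi>' \<psi> \<psi>'. (\<phi>, \<phi>') \<in> T \<longrightarrow> (\<psi>, \<psi>') \<in> T \<longrightarrow> ae_eq \<phi> \<psi> \<longrightarrow> ae_eq \<phi>' \<psi>'"
  and T_Domain: "Domain T = {\<phi>\<in>L2. (\<integral>\<^sup>+ t. ennreal ((F t)^2) \<partial>scalar_measure E \<phi>) < top}"
  and T_diag: "\<forall>(\<phi>, \<psi>)\<in>T. L2inner \<phi> \<psi> = of_real (LINT t|scalar_measure E \<phi>. F t)"
 by (insert T[unfolded spectral_integral_def L2_operator_def], (elim conjE, assumption)+)

lemma T_L2: "(\<phi>, \<psi>) \<in> T \<Longrightarrow> \<phi> \<in> L2 \<and> \<psi> \<in> L2"
 using T_sub by (auto dest: subsetD)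

lemma T_domain: "\<phi> \<in> L2 \<Longrightarrow> \<phi> \<in> Domain T \<longleftrightarrow> cls \<phi> \<in> spec_dom"
 by (simp add: T_Domain spec_dom_def scalar_measure_eq)

lemma T_unique: "(\<phi>, \<phi>') \<in> T \<Longrightarrow> (\<psi>, \<psi>') \<in> T \<Longrightarrow> cls \<phi> = cls \<psi> \<Longrightarrow> cls \<phi>' = cls \<psi>'"
proof -
 assume a: "(\<phi>, \<phi>') \<in> T" "(\<psi>, \<psi>') \<in> T" "cls \<phi> = cls \<psi>"
 have "ae_eq \<phi> \<psi>" using a T_L2 by (simp add: ae_eq_def cls_eq_iff)
 then have "ae_eq \<phi>' \<psi>'" using T_single a(1,2) by (metis (no_types))
 then show ?thesis using a T_L2 by (simp add: ae_eq_def cls_eq_iff)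
qed

lemma spec_op_in: "u \<in> spec_dom \<Longrightarrow> \<exists>\<psi>. (rep u, \<psi>) \<in> T \<and> cls \<psi> = spec_op u"
proof -
 assume "u \<in> spec_dom"
 then have "\<exists>\<psi>. (rep u, \<psi>) \<in> T" using T_domain[of "rep u"] by auto
 then show ?thesis unfolding spec_op_def by (metis someI_ex)
qed

lemma T_spec_op: "(\<phi>, \<psi>) \<in> T \<Longrightarrow> cls \<phi> \<in> spec_dom \<and> cls \<psi> = spec_op (cls \<phi>)"
proof -
 assume a: "(\<phi>, \<psi>) \<in> T"
 then have d: "cls \<phi> \<in> spec_dom" using T_domain[of \<phi>] T_L2 by blast
 then obtain \<psi>' where "(rep (cls \<phi>), \<psi>') \<in> T" "cls \<psi>' = spec_op (cls \<phi>)" using spec_op_in by blast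
 then show ?thesis using T_unique[OF a] d by simp
qed

lemma spec_op_linear:
 assumes "u \<in> spec_dom" "v \<in> spec_dom"
 shows "cs a u + v \<in> spec_dom" "spec_op (cs a u + v) = cs a (spec_op u) + spec_op v"
proof -
 obtain \<phi> \<psi> where *: "(rep u, \<phi>) \<in> T" "cls \<phi> = spec_op u" "(rep v, \<psi>) \<in> T" "cls \<psi> = spec_op v"
  using spec_op_in assms by meson
 then have "((\<lambda>x. a * rep u x + rep v x), (\<lambda>x. a * \<phi> x + \<psi> x)) \<in> T"
  using T_lin by blast
 from T_spec_op[OF this]
 show "cs a u + v \<in> spec_dom" "spec_op (cs a u + v) = cs a (spec_op u) + spec_op v"
  using * T_L2 by (simp_all add: L2_scale flip: cls_add cs_cls)
qed

lemma spec_dom_zero: "0 \<in> spec_dom"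
proof -
 have "emeasure (spec_meas 0) UNIV = 0" by (simp add: emeasure_spec_meas proj_UNIV)
 then have "AE t in spec_meas 0. False" by (auto intro!: AE_I[of _ _ UNIV])
 then have "AE t in spec_meas 0. ennreal ((F t)^2) = 0" by (rule AE_mp) simp
 then have "(\<integral>\<^sup>+ t. ennreal ((F t)^2) \<partial>spec_meas 0) = 0"
  by (subst nn_integral_0_iff_AE) auto
 then show ?thesis by (simp add: spec_dom_def)
qed

lemma spec_op_zero: "spec_op 0 = 0"
 using spec_op_linear(2)[OF spec_dom_zero spec_dom_zero, of 1] by simp

lemma spec_op_add: "u \<in> spec_dom \<Longrightarrow> v \<in> spec_dom \<Longrightarrow> spec_op (u + v) = spec_op u + spec_op v"
 using spec_op_linear(2)[of u v 1] by simp

lemma spec_op_cs: "u \<in> spec_dom \<Longrightarrow> cs c u \<in> spec_dom \<and> spec_op (cs c u) = cs c (spec_op u)"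
 using spec_op_linear[of u 0 c] spec_dom_zero by (simp add: spec_op_zero)

lemma spec_op_form: "u \<in> spec_dom \<Longrightarrow> cin u (spec_op u) = of_real (LINT t|spec_meas u. F t)"
proof -
 assume "u \<in> spec_dom"
 then obtain \<psi> where \<psi>: "(rep u, \<psi>) \<in> T" "cls \<psi> = spec_op u" using spec_op_in by blast
 then have "L2inner (rep u) \<psi> = of_real (LINT t|scalar_measure E (rep u). F t)"
  using T_diag by fast
 then show ?thesis using \<psi> T_L2[OF \<psi>(1)] cin_cls[of "rep u" \<psi>] by (simp add: scalar_measure_eq)
qed

lemma spec_dom_proj: "B \<in> sets borel \<Longrightarrow> u \<in> spec_dom \<Longrightarrow> spec_proj B u \<in> spec_dom"
proof -
 assume B: "B \<in> sets borel" and u: "u \<in> spec_dom"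
 have "(\<integral>\<^sup>+ t. ennreal ((F t)^2) \<partial>spec_meas (spec_proj B u)) = (\<integral>\<^sup>+ t. indicator B t * ennreal ((F t)^2) \<partial>spec_meas u)"
  unfolding spec_meas_proj[OF B] by (rule nn_integral_density) (use B in auto)
 also have "\<dots> \<le> (\<integral>\<^sup>+ t. ennreal ((F t)^2) \<partial>spec_meas u)"
  by (intro nn_integral_mono) (auto simp: indicator_def)
 also have "\<dots> < top" using u by (simp add: spec_dom_def)
 finally show ?thesis by (simp add: spec_dom_def)
qed

lemma spec_dom_integrable: "u \<in> spec_dom \<Longrightarrow> integrable (spec_meas u) F"
proof -
 assume u: "u \<in> spec_dom"
 interpret finite_measure "spec_meas u" by (rule finite_measure_spec_meas)
 have "integrable (spec_meas u) (\<lambda>t. (F t)^2)"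
  using u by (simp add: integrable_iff_bounded spec_dom_def)
 then have "integrable (spec_meas u) (\<lambda>t. 1 + (F t)^2)" by simp
 moreover have "\<bar>y\<bar> \<le> 1 + y^2" for y :: real
  using zero_le_power2[of "\<bar>y\<bar> - 1"] zero_le_power2[of y] by (simp add: power2_diff)
 ultimately show ?thesis
  by (elim Bochner_Integration.integrable_bound) (auto intro: order_trans[OF _ abs_ge_self])
qed

text \<open>The integral formula only gives diagonal values. These are additive over B and its
  complement, so the mixed terms cancel; multiplying the second vector by c = 1 and c = \<i> shows
  that each of them is 0.\<close>

lemma spec_op_cross:
 assumes B: "B \<in> sets borel" and u: "u \<in> spec_dom" and v: "v \<in> spec_dom"
 shows "cin (spec_proj B u) (spec_op (spec_proj (- B) v)) = 0"
proof -
 define x y where "x = spec_proj B u" and "y = spec_proj (- B) v"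
 have B': "- B \<in> sets borel" using B by auto
 have xd: "x \<in> spec_dom" and yd: "y \<in> spec_dom"
  unfolding x_def y_def by (intro spec_dom_proj B B' u v)+
 have "c * cin x (spec_op y) + cnj c * cin y (spec_op x) = 0" for c
 proof -
  define w where "w = x + cs c y"
  have cy: "cs c y \<in> spec_dom" "spec_op (cs c y) = cs c (spec_op y)" using spec_op_cs[OF yd] by auto
  have wd: "w \<in> spec_dom" using spec_op_linear(1)[OF xd cy(1), of 1] by (simp add: w_def)
  have Bw: "spec_proj B w = x" "spec_proj (- B) w = cs c y"
   unfolding w_def proj_add[OF B] proj_add[OF B'] proj_cs[OF B] proj_cs[OF B'] x_def y_def
   using proj_disjoint[OF B B'] proj_disjoint[OF B' B] by (simp_all add: proj_idem B B')
  have i: "integrable (spec_meas w) F" by (rule spec_dom_integrable[OF wd])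
  have ind: "(LINT t|spec_meas (spec_proj A w). F t) = (LINT t|spec_meas w. indicator A t * F t)"
   if A: "A \<in> sets borel" for A
  proof -
   have A': "A \<in> sets (spec_meas w)" "A \<inter> space (spec_meas w) \<in> sets (spec_meas w)" using A by simp_all
   note mA = borel_measurable_indicator[OF A'(1)]
   have F': "F \<in> borel_measurable (spec_meas w)" by measurable
   have "density (spec_meas w) (indicator A) = density (spec_meas w) (\<lambda>t. ennreal (indicator A t))"
    by (intro density_cong mA measurable_compose[OF mA measurable_ennreal] AE_I2) (auto simp: indicator_def)
   then show ?thesis unfolding spec_meas_proj[OF A]
    using integral_real_density[OF mA _ F'] by simp
  qed
  have "(LINT t|spec_meas w. F t) = (LINT t|spec_meas w. indicator B t * F t + indicator (- B) t * F t)"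
   by (intro Bochner_Integration.integral_cong) (auto simp: indicator_def)
  also have "\<dots> = (LINT t|spec_meas w. indicator B t * F t) + (LINT t|spec_meas w. indicator (- B) t * F t)"
   using integrable_real_mult_indicator[OF _ i, of B] integrable_real_mult_indicator[OF _ i, of "- B"] B B'
   by (intro Bochner_Integration.integral_add) (simp_all add: mult.commute)
  finally have "(LINT t|spec_meas w. F t) = (LINT t|spec_meas x. F t) + (LINT t|spec_meas (cs c y). F t)"
   unfolding ind[OF B, symmetric] ind[OF B', symmetric] Bw .
  then have "cin w (spec_op w) = cin x (spec_op x) + cin (cs c y) (spec_op (cs c y))"
   using spec_op_form[OF wd] spec_op_form[OF xd] spec_op_form[OF cy(1)] by simp
  moreover have "spec_op w = spec_op x + cs c (spec_op y)"
   unfolding w_def using spec_op_add[OF xd cy(1)] cy(2) by simp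
  ultimately show ?thesis
   unfolding w_def by (simp add: cin_add_left cin_add_right cin_cs_left cin_cs_right cy(2) algebra_simps)
 qed
 from this[of 1] this[of \<i>] have "cin x (spec_op y) = 0"
  by (simp add: complex_eq_iff)
 then show ?thesis by (simp add: x_def y_def)
qed

lemma spec_op_split: "B \<in> sets borel \<Longrightarrow> u \<in> spec_dom \<Longrightarrow>
  spec_op u = spec_op (spec_proj B u) + spec_op (spec_proj (- B) u)"
proof -
 assume B: "B \<in> sets borel" and u: "u \<in> spec_dom"
 have B': "- B \<in> sets borel" using B by auto
 show ?thesis
  using spec_op_add[OF spec_dom_proj[OF B u] spec_dom_proj[OF B' u]] by (simp add: proj_compl[OF B])
qed

lemma AE_spec_meas:
 assumes "B \<in> sets borel" "spec_proj B u = u"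
 shows "AE t in spec_meas u. t \<in> B"
proof (rule AE_I)
 have B': "- B \<in> sets borel" using assms by auto
 show "emeasure (spec_meas u) (- B) = 0"
  using B' proj_disjoint[OF B' assms(1), of u] assms(2) by (simp add: emeasure_spec_meas)
qed (use assms in auto)

text \<open>For vectors in the range of the projection to \<kappa> the function F is constant almost
  everywhere, and polarization gives a multiple of the scalar product. The complementary part of u
  does not contribute by \<open>spec_op_cross\<close>.\<close>

lemma spec_op_point:
 assumes h: "spec_proj {\<kappa>} h = h" and u: "u \<in> spec_dom"
 shows "cin h (spec_op u) = of_real (F \<kappa>) * cin h u"
proof -
 have P: "{\<kappa>} \<in> sets borel" by simp
 have dom: "x \<in> spec_dom" and form: "cin x (spec_op x) = of_real (F \<kappa>) * cin x x"
  if x: "spec_proj {\<kappa>} x = x" for x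
 proof -
  have ae: "AE t in spec_meas x. t = \<kappa>" using AE_spec_meas[OF P x] by simp
  have m: "emeasure (spec_meas x) UNIV = ennreal ((norm x)^2)" by (simp add: emeasure_spec_meas proj_UNIV)
  have "(\<integral>\<^sup>+ t. ennreal ((F t)^2) \<partial>spec_meas x) = (\<integral>\<^sup>+ t. ennreal ((F \<kappa>)^2) \<partial>spec_meas x)"
   by (rule nn_integral_cong_AE) (use ae in auto)
  also have "\<dots> < top" using m by (simp add: ennreal_mult_less_top)
  finally show d: "x \<in> spec_dom" by (simp add: spec_dom_def)
  have "(LINT t|spec_meas x. F t) = (LINT t|spec_meas x. F \<kappa>)"
   by (rule integral_cong_AE) (use ae in auto)
  also have "\<dots> = (norm x)^2 * F \<kappa>" using m by (simp add: measure_def)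
  finally show "cin x (spec_op x) = of_real (F \<kappa>) * cin x x"
   unfolding spec_op_form[OF d] by (simp add: cin_same)
 qed
 define v where "v = spec_proj {\<kappa>} u"
 have v: "spec_proj {\<kappa>} v = v" unfolding v_def by (rule proj_idem[OF P])
 have pol: "c * cin h (spec_op v) + cnj c * cin v (spec_op h) = of_real (F \<kappa>) * (c * cin h v + cnj c * cin v h)" for c
 proof -
  have "spec_proj {\<kappa>} (h + cs c v) = h + cs c v" by (simp add: proj_add[OF P] proj_cs[OF P] h v)
  note form[OF this]
  moreover have "spec_op (h + cs c v) = spec_op h + cs c (spec_op v)"
   using spec_op_add[OF dom[OF h]] spec_op_cs[OF dom[OF v]] by simp
  ultimately show ?thesis
   using form[OF h] form[OF v] by (simp add: cin_add_left cin_add_right cin_cs_left cin_cs_right algebra_simps)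
 qed
 have "cin h (spec_op v) = of_real (F \<kappa>) * cin h v"
  using pol[of 1] pol[of \<i>] by (simp add: complex_eq_iff algebra_simps)
 moreover have "cin h (spec_op u) = cin h (spec_op v)"
  using spec_op_cross[OF P dom[OF h] u] h unfolding spec_op_split[OF P u] v_def by (simp add: cin_add_right)
 moreover have "cin h v = cin h u"
  unfolding v_def using proj_sym[OF P, of h u] h by simp
 ultimately show ?thesis by simp
qed

end

text \<open>For every Borel set B the integral of t - \<kappa> against the measure of
  \<open>spec_proj B u\<close> is 0. On a half-line on one side of \<kappa> the integrand has a
  strict sign, so the projection of u to it vanishes.\<close>

lemma eigenvector_proj:
 assumes A: "spectral_integral E (\<lambda>t. t) A" and u: "(\<phi>, \<psi>) \<in> A" "cls \<phi> = u" "cls \<psi> = cs (of_real \<kappa>) u"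
 shows "spec_proj {\<kappa>} u = u"
proof -
 have m: "(\<lambda>t::real. t) \<in> borel_measurable borel" by simp
 have d: "u \<in> spec_dom (\<lambda>t. t)" and op: "spec_op A u = cs (of_real \<kappa>) u"
  using T_spec_op[OF A m u(1)] u by auto
 have zero: "(LINT t|spec_meas (spec_proj B u). t - \<kappa>) = 0" if B: "B \<in> sets borel" for B
 proof -
  define x where "x = spec_proj B u"
  have xd: "x \<in> spec_dom (\<lambda>t. t)" unfolding x_def by (rule spec_dom_proj[OF A m B d])
  interpret finite_measure "spec_meas x" by (rule finite_measure_spec_meas)
  have "cin x (spec_op A u) = cin x (spec_op A x)"
   using spec_op_cross[OF A m B d d] unfolding spec_op_split[OF A m B d] x_def by (simp add: cin_add_right)
  moreover have "cin x u = cin x x"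
   unfolding x_def using proj_sym[OF B, of u u] proj_sym[OF B, of u "spec_proj B u"] by (simp add: proj_idem[OF B])
  ultimately have "of_real (LINT t|spec_meas x. t) = complex_of_real (\<kappa> * (norm x)^2)"
   using spec_op_form[OF A m xd] by (simp add: op cin_cs_right cin_same)
  then have "(LINT t|spec_meas x. t) = \<kappa> * (norm x)^2" by (simp only: of_real_eq_iff)
  moreover have "measure (spec_meas x) UNIV = (norm x)^2" by (simp add: measure_def emeasure_spec_meas proj_UNIV)
  ultimately show ?thesis
   using spec_dom_integrable[OF A m xd] by (simp add: x_def[symmetric] mult.commute)
 qed
 have vanish: "spec_proj B u = 0"
  if B: "B \<in> sets borel" and s: "s = 1 \<or> s = (-1::real)" "\<And>t. t \<in> B \<Longrightarrow> 0 < s * (t - \<kappa>)" for B s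
 proof -
  define x where "x = spec_proj B u"
  interpret finite_measure "spec_meas x" by (rule finite_measure_spec_meas)
  have xd: "x \<in> spec_dom (\<lambda>t. t)" unfolding x_def by (rule spec_dom_proj[OF A m B d])
  have ae: "AE t in spec_meas x. t \<in> B"
   by (rule AE_spec_meas[OF A m B]) (simp add: x_def proj_idem[OF B])
  have "integrable (spec_meas x) (\<lambda>t. s * (t - \<kappa>))"
   using spec_dom_integrable[OF A m xd] by simp
  moreover have "AE t in spec_meas x. 0 \<le> s * (t - \<kappa>)" using ae s(2) by (auto elim!: eventually_mono intro: less_imp_le)
  moreover have "(LINT t|spec_meas x. s * (t - \<kappa>)) = 0" using zero[OF B] by (simp add: x_def)
  ultimately have "AE t in spec_meas x. s * (t - \<kappa>) = 0"
   by (subst (asm) integral_nonneg_eq_0_iff_AE) auto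
  with ae have "AE t in spec_meas x. False" by eventually_elim (use s(2) in force)
  then have "emeasure (spec_meas x) UNIV = 0" by (subst (asm) AE_iff_null) auto
  then show ?thesis by (simp add: emeasure_spec_meas proj_UNIV x_def[symmetric])
 qed
 have "spec_proj {\<kappa><..} u = 0" by (rule vanish[where s = 1]) auto
 moreover have "spec_proj {..<\<kappa>} u = 0" by (rule vanish[where s = "-1"]) auto
 moreover have "- {\<kappa>} = {\<kappa><..} \<union> {..<\<kappa>}" by auto
 moreover have "{\<kappa><..} \<inter> {..<\<kappa>} = {}" by auto
 ultimately have "spec_proj (- {\<kappa>}) u = 0"
  using proj_disjoint_norm[of "{\<kappa><..}" "{..<\<kappa>}" u] by simp
 then show ?thesis using proj_compl[of "{\<kappa>}" u] by simp
qed

end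

text \<open>Membership supplies some spectral measure. Its projections to single eigenvalues fix the
  Hermite functions, so the coefficients come out the same for every choice of the measure.\<close>

lemma functional_calculus_oscillator:
 assumes F: "F \<in> borel_measurable borel" and f: "(f, \<psi>) \<in> functional_calculus F oscillator"
 shows "f \<in> L2" "\<psi> \<in> L2" "cin (hv \<alpha>) (cls \<psi>) = of_real (F (osc_eigenvalue \<alpha>)) * cin (hv \<alpha>) (cls f)"
proof -
 obtain E T where E: "spectral_measure E" and O: "spectral_integral E (\<lambda>t. t) oscillator"
  and T: "spectral_integral E F T" and f: "(f, \<psi>) \<in> T"
  using f unfolding functional_calculus_def by blast
 show "f \<in> L2" "\<psi> \<in> L2" using T_L2[OF E T F f] by auto
 have "spec_proj E {osc_eigenvalue \<alpha>} (hv \<alpha>) = hv \<alpha>"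
  by (rule eigenvector_proj[OF E O oscillator_hermite[of \<alpha>]])
   (auto simp: hv_def cs_cls herm_vec_L2)
 from spec_op_point[OF E T F this] T_spec_op[OF E T F f]
 show "cin (hv \<alpha>) (cls \<psi>) = of_real (F (osc_eigenvalue \<alpha>)) * cin (hv \<alpha>) (cls f)"
  by simp
qed

section \<open>Hilbert-Schmidt and trace bounds\<close>

text \<open>Since the system is orthonormal in the real sense, the real and the imaginary part of
  the integrals are bounded by Bessel separately, whence the factor 2.\<close>

lemma bessel_pointwise:
 fixes K :: "'n::finite fn"
 assumes K: "K \<in> L2" and v: "orthonormal N v"
 shows "(\<Sum>i<N. (cmod (LINT y|lebesgue. K y * rep (v i) y))^2) \<le> 2 * (LINT y|lebesgue. (cmod (K y))^2)"
proof -
 define k where "k = cls (\<lambda>y. cnj (K y))"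
 have nk: "(norm k)^2 = (LINT y|lebesgue. (cmod (K y))^2)"
  unfolding k_def by (subst norm_cls_sq) (simp_all add: L2_cnj K)
 have "(LINT y|lebesgue. K y * rep (v i) y) = cin k (v i)" for i
  using cin_cls[OF L2_cnj[OF K] rep_L2[of "v i"]] by (simp add: k_def L2inner_def)
 then have "(\<Sum>i<N. (cmod (LINT y|lebesgue. K y * rep (v i) y))^2)
   = (\<Sum>i<N. (k \<bullet> v i)^2) + (\<Sum>i<N. (cs \<i> k \<bullet> v i)^2)"
  by (simp add: cin_eq_inner[of k] cmod_power2 sum.distrib)
 also have "\<dots> \<le> (norm k)^2 + (norm (cs \<i> k))^2"
  by (intro add_mono bessel_real v)
 finally show ?thesis by (simp add: norm_cs nk)
qed

lemma rotate_mul_kernel: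
 fixes G :: "'n::finite fn"
 assumes s: "s = 1 \<or> s = (-1::real)" and G: "G \<in> L2" "bounded_measurable G"
 shows "AE x in lebesgue. rep (rotate_l2 (- \<i> * of_real s) (mul G v)) x =
   of_real (fconst TYPE('n)) * (LINT y|lebesgue. phase (y \<bullet> (s *\<^sub>R x)) * G y * rep v y)"
 using rotate_eq_fourier_integral[OF s bounded_measurable_L2[OF G(2) rep_L2[of v]] L2_integrable_mult[OF G(1) rep_L2]]
 by (simp add: mul_def fourier_integral_def fconst_def mult.assoc)

lemma phase_L2: "G \<in> L2 \<Longrightarrow> (\<lambda>y. phase (y \<bullet> x) * G y) \<in> L2"
 by (rule L2_bounded_mult[where B=1]) (auto intro: measurable_completion)

text \<open>At almost every x the values are integrals against one kernel row, whose modulus is that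
  of \<open>G\<close>; so Bessel applies pointwise in x with a bound independent of x.\<close>

lemma rotate_bessel:
 fixes G :: "'n::finite fn"
 assumes s: "s = 1 \<or> s = (-1::real)" and G: "G \<in> L2" "bounded_measurable G" and v: "orthonormal N v"
 shows "AE x in lebesgue. (\<Sum>i<N. (cmod (rep (rotate_l2 (- \<i> * of_real s) (mul G (v i))) x))^2)
   \<le> 2 * (fconst TYPE('n))^2 * (LINT y|lebesgue. (cmod (G y))^2)"
proof -
 have "AE x in lebesgue. \<forall>i\<in>{..<N}. rep (rotate_l2 (- \<i> * of_real s) (mul G (v i))) x =
   of_real (fconst TYPE('n)) * (LINT y|lebesgue. phase (y \<bullet> (s *\<^sub>R x)) * G y * rep (v i) y)"
  by (intro AE_finite_allI rotate_mul_kernel s G) simp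
 then show ?thesis
 proof eventually_elim
  case (elim x)
  have "(\<Sum>i<N. (cmod (LINT y|lebesgue. phase (y \<bullet> (s *\<^sub>R x)) * G y * rep (v i) y))^2)
    \<le> 2 * (LINT y|lebesgue. (cmod (G y))^2)"
   using bessel_pointwise[OF phase_L2[OF G(1), of "s *\<^sub>R x"] v] by (simp add: norm_mult)
  from mult_left_mono[OF this, of "(fconst TYPE('n))^2"]
  show ?case using elim by (simp add: norm_mult power_mult_distrib sum_distrib_left mult_ac)
 qed
qed

text \<open>The pointwise Bessel bound is integrated against the square of \<open>f\<close>. It is
  the usual Hilbert-Schmidt estimate for a function of position times a function of
  momentum.\<close>

lemma rotate_hilbert_schmidt:
 fixes f G :: "'n::finite fn"
 assumes G: "G \<in> L2" "bounded_measurable G" and f: "f \<in> L2" "bounded_measurable f" and v: "orthonormal N v"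
 shows "(\<Sum>i<N. (norm (mul f (rotate_l2 \<i> (mul G (v i)))))^2)
   \<le> 2 * (fconst TYPE('n))^2 * (LINT y|lebesgue. (cmod (G y))^2) * (LINT y|lebesgue. (cmod (f y))^2)"
proof -
 define c where "c = 2 * (fconst TYPE('n))^2 * (LINT y|lebesgue. (cmod (G y))^2)"
 define z where "z i = rotate_l2 \<i> (mul G (v i))" for i
 have i: "integrable lebesgue (\<lambda>x. (cmod (f x))^2 * (cmod (rep (z i) x))^2)" for i
  using L2_integrable[OF bounded_measurable_L2[OF f(2) rep_L2[of "z i"]]] by (simp add: norm_mult power_mult_distrib)
 have "AE x in lebesgue. (\<Sum>i<N. (cmod (rep (z i) x))^2) \<le> c"
  using rotate_bessel[of "-1", OF _ G v] by (simp add: c_def z_def)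
 then have "AE x in lebesgue. (\<Sum>i<N. (cmod (f x))^2 * (cmod (rep (z i) x))^2) \<le> c * (cmod (f x))^2"
  by eventually_elim (simp add: mult_left_mono mult.commute[of c] flip: sum_distrib_left)
 then have "(LINT x|lebesgue. (\<Sum>i<N. (cmod (f x))^2 * (cmod (rep (z i) x))^2)) \<le> (LINT x|lebesgue. c * (cmod (f x))^2)"
  by (intro integral_mono_AE Bochner_Integration.integrable_sum i integrable_mult_right L2_integrable f)
 then show ?thesis
  unfolding c_def[symmetric] z_def[symmetric] by (simp add: norm_mul_sq[OF f(2)] i)
qed

section \<open>Trace bounds for symbols supported in one cell\<close>

lemma integrable_lborel_shift:
 fixes h :: "'a::euclidean_space \<Rightarrow> real"
 assumes h: "integrable lborel h"
 shows "integrable lborel (\<lambda>x. h (x - c))" "(LINT x|lborel. h (x - c)) = integral\<^sup>L lborel h"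
proof -
 have "distr lborel borel ((+) (- c)) = (lborel :: 'a measure)" by (rule lborel_distr_plus)
 moreover have "h \<in> borel_measurable borel" using h borel_measurable_integrable by fastforce
 ultimately show "integrable lborel (\<lambda>x. h (x - c))" "(LINT x|lborel. h (x - c)) = integral\<^sup>L lborel h"
  using h integrable_distr_eq[of "(+) (-c)" lborel borel h] integral_distr[of "(+) (-c)" lborel borel h] by simp_all
qed

text \<open>Conjugation by the Fourier transform turns multiplication by \<open>\<phi>\<close> into
  convolution with the transform of \<open>\<phi>\<close>; for integrable representatives this is
  Fubini.\<close>

lemma rotate_convolution:
 fixes \<phi> F :: "'n::finite fn"
 assumes \<phi>[measurable]: "\<phi> \<in> borel_measurable borel" and b: "\<And>x. cmod (\<phi> x) \<le> H * decay_weight x"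
  and F: "\<And>\<eta>. fourier_integral \<phi> \<eta> = F \<eta>"
  and y: "integrable lebesgue (rep y)"
 shows "AE \<xi> in lebesgue. rep (rotate_l2 (- \<i>) (mul \<phi> (rotate_l2 \<i> y))) \<xi> =
  of_real (fconst TYPE('n)) * (LINT \<zeta>|lebesgue. F (\<xi> - \<zeta>) * rep y \<zeta>)"
proof -
 define c where "c = complex_of_real (fconst TYPE('n))"
 have H: "0 \<le> H"
  using order_trans[OF norm_ge_zero b[of 0]] decay_weight_pos[of "0::real^'n"] by (simp add: zero_le_mult_iff)
 have bm: "bounded_measurable \<phi>"
 proof (rule bounded_measurableI)
  show "cmod (\<phi> x) \<le> H" for x
   using b[of x] mult_left_mono[OF decay_weight_le_1[of x] H] by simp
 qed (simp add: measurable_completion)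
 have \<phi>L: "\<phi> \<in> L2" by (rule L2_decay_weight[OF \<phi> b])
 have yi: "integrable lborel (rep y)" using y by (simp add: lebesgue_integrable_borel)
 define k where "k x = c * (LINT \<zeta>|lborel. exp (\<i> * of_real (\<zeta> \<bullet> x)) * rep y \<zeta>)" for x
 have kb: "cmod (k x) \<le> fconst TYPE('n) * (LINT \<zeta>|lborel. cmod (rep y \<zeta>))" for x
  using integral_norm_bound[of lborel "\<lambda>\<zeta>. exp (\<i> * of_real (\<zeta> \<bullet> x)) * rep y \<zeta>"] fconst_pos[where 'n='n]
  by (simp add: k_def c_def norm_mult mult_left_mono)
 have [measurable]: "k \<in> borel_measurable borel"
  unfolding k_def by measurable
 have "AE x in lebesgue. rep (rotate_l2 (- \<i> * of_real (-1)) (cls (rep y))) x = fourier_integral (rep y) (- 1 *\<^sub>R x)"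
  by (rule rotate_eq_fourier_integral) (use y in auto)
 then have ry: "AE x in lebesgue. rep (rotate_l2 \<i> y) x = k x"
  by eventually_elim (simp add: fourier_integral_def k_def c_def fconst_def lebesgue_integral_borel)
 have yk: "rotate_l2 \<i> y = cls k" and kL: "k \<in> L2"
  using cls_eqI[OF rep_L2 ry] L2_ae_eq[OF rep_L2 ry] by auto
 have pk: "mul \<phi> (rotate_l2 \<i> y) = cls (\<lambda>x. \<phi> x * k x)" unfolding yk by (rule mul_cls[OF bm kL])
 have pkL: "(\<lambda>x. \<phi> x * k x) \<in> L2" by (rule bounded_measurable_L2[OF bm kL])
 have "AE \<xi> in lebesgue. rep (rotate_l2 (- \<i> * of_real 1) (cls (\<lambda>x. \<phi> x * k x))) \<xi> = fourier_integral (\<lambda>x. \<phi> x * k x) (1 *\<^sub>R \<xi>)"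
  by (rule rotate_eq_fourier_integral[OF _ pkL L2_integrable_mult[OF \<phi>L kL]]) simp
 then show ?thesis
 proof eventually_elim
  case (elim \<xi>)
  have e: "phase (x \<bullet> (\<xi> - \<zeta>)) * \<phi> x * rep y \<zeta>
    = (phase (x \<bullet> \<xi>) * \<phi> x) * (exp (\<i> * of_real (\<zeta> \<bullet> x)) * rep y \<zeta>)" for x \<zeta>
  proof -
   have "- \<i> * of_real (x \<bullet> (\<xi> - \<zeta>)) = - \<i> * of_real (x \<bullet> \<xi>) + \<i> * of_real (\<zeta> \<bullet> x)"
    by (simp add: inner_diff_right inner_commute[of x \<zeta>] algebra_simps)
   then show ?thesis by (simp only: exp_add mult_ac)
  qed
  have "(LINT x|lborel. phase (x \<bullet> \<xi>) * (\<phi> x * k x))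
    = c * (LINT x|lborel. (LINT \<zeta>|lborel. phase (x \<bullet> (\<xi> - \<zeta>)) * \<phi> x * rep y \<zeta>))"
  proof -
   have "(LINT \<zeta>|lborel. phase (x \<bullet> (\<xi> - \<zeta>)) * \<phi> x * rep y \<zeta>)
     = (phase (x \<bullet> \<xi>) * \<phi> x) * (LINT \<zeta>|lborel. exp (\<i> * of_real (\<zeta> \<bullet> x)) * rep y \<zeta>)" for x
    unfolding e by (rule integral_mult_right_zero)
   then have "phase (x \<bullet> \<xi>) * (\<phi> x * k x)
     = c * (LINT \<zeta>|lborel. phase (x \<bullet> (\<xi> - \<zeta>)) * \<phi> x * rep y \<zeta>)" for x
    by (simp only: k_def mult_ac)
   then show ?thesis by (simp only: integral_mult_right_zero)
  qed
  also have "(LINT x|lborel. (LINT \<zeta>|lborel. phase (x \<bullet> (\<xi> - \<zeta>)) * \<phi> x * rep y \<zeta>))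
    = (LINT \<zeta>|lborel. (LINT x|lborel. phase (x \<bullet> (\<xi> - \<zeta>)) * \<phi> x * rep y \<zeta>))"
  proof (rule fubini_dominated)
   show "integrable lborel (\<lambda>x. H * decay_weight x :: real)" by (intro integrable_mult_right decay_weight_integrable)
   show "integrable lborel (\<lambda>\<zeta>. cmod (rep y \<zeta>))" using yi by simp
   show "cmod (phase (x \<bullet> (\<xi> - \<zeta>)) * \<phi> x * rep y \<zeta>) \<le> H * decay_weight x * cmod (rep y \<zeta>)" for x \<zeta>
    using b[of x] by (simp add: norm_mult mult_right_mono)
  qed measurable
  also have "\<dots> = (LINT \<zeta>|lborel. (LINT x|lborel. phase (x \<bullet> (\<xi> - \<zeta>)) * \<phi> x) * rep y \<zeta>)"
   by simp
  also have "c * \<dots> = (LINT \<zeta>|lborel. F (\<xi> - \<zeta>) * rep y \<zeta>)"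
   unfolding F[symmetric] fourier_integral_def
   by (subst lebesgue_integral_borel) (simp_all add: c_def fconst_def mult_ac flip: integral_mult_right_zero)
  finally have "(LINT x|lborel. phase (x \<bullet> \<xi>) * (\<phi> x * k x)) = (LINT \<zeta>|lborel. F (\<xi> - \<zeta>) * rep y \<zeta>)" .
  moreover have "F \<in> borel_measurable borel"
   unfolding F[symmetric] fourier_integral_def[abs_def]
   by (subst lebesgue_integral_borel) measurable
  ultimately show ?case using elim unfolding pk
   by (simp add: fourier_integral_def fconst_def lebesgue_integral_borel)
 qed
qed

text \<open>Rounding yields half-open cubes, which are disjoint, whereas the closed cubes of
  \<open>unit_cube\<close> overlap on faces. Each cell lies in the cube with the same
  centre.\<close>

definition cell :: "real ^ 'n::finite \<Rightarrow> int ^ 'n" where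
 "cell x = (\<chi> i. round (x $ i))"

abbreviation on_cell :: "int ^ 'n::finite \<Rightarrow> real ^ 'n \<Rightarrow> real" where
 "on_cell l \<equiv> indicator {x. cell x = l}"

definition cell_center :: "int ^ 'n::finite \<Rightarrow> real ^ 'n" where
 "cell_center l = (\<chi> i. of_int (l $ i))"

lemma cell_dist: "cell x = l \<Longrightarrow> \<bar>x $ i - of_int (l $ i)\<bar> \<le> 1/2"
 using of_int_round_abs_le[of "x $ i"] by (auto simp: cell_def abs_minus_commute)

text \<open>A displacement of at most 1/2 in a coordinate changes the corresponding factor of the
  weight at most by 2.\<close>

lemma decay_weight_cell_center:
 fixes \<xi> \<zeta> :: "real ^ 'n::finite"
 assumes "cell \<zeta> = l"
 shows "decay_weight (\<xi> - \<zeta>) \<le> 2^CARD('n) * decay_weight (\<xi> - cell_center l)"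
proof -
 have "inverse (1 + ((\<xi> - \<zeta>) $ i)^2) \<le> 2 * inverse (1 + ((\<xi> - cell_center l) $ i)^2)" for i
 proof -
  define s t where "s = (\<xi> - cell_center l) $ i" and "t = (\<xi> - \<zeta>) $ i"
  have "\<bar>s - t\<bar> \<le> 1/2"
   using cell_dist[OF assms, of i] by (simp add: s_def t_def cell_center_def)
  then have "(s - t)^2 \<le> (1/2)^2" by (intro abs_le_square_iff[THEN iffD1]) simp
  moreover have "s^2 \<le> 2 * t^2 + 2 * (s - t)^2"
   using zero_le_power2[of "s - 2 * t"] by (simp add: power2_eq_square algebra_simps)
  ultimately have "1 + s^2 \<le> 2 * (1 + t^2)" by (simp add: power2_eq_square)
  moreover have "0 < 1 + s^2" "0 < 1 + t^2" by (simp_all add: add_pos_nonneg)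
  ultimately show ?thesis unfolding s_def[symmetric] t_def[symmetric] by (simp add: field_simps)
 qed
 then have "decay_weight (\<xi> - \<zeta>) \<le> (\<Prod>i\<in>UNIV. 2 * inverse (1 + ((\<xi> - cell_center l) $ i)^2))"
  unfolding decay_weight_def by (intro prod_mono) (auto simp: add_nonneg_nonneg)
 then show ?thesis by (simp add: prod.distrib decay_weight_def)
qed

definition trace_const :: "'n::finite itself \<Rightarrow> real" where
 "trace_const _ = 2 * (fconst TYPE('n))^2 * 2^CARD('n) * sqrt (LINT x :: real ^ 'n|lebesgue. (decay_weight x)^2)
   * (LINT x :: real ^ 'n|lborel. decay_weight x)"

text \<open>The weight in \<open>f\<close> is moved to the vectors \<open>u\<close>, and the scalar
  products are taken on the Fourier side, between \<open>p i\<close> and \<open>z i\<close>. As for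
  a product of two Hilbert-Schmidt operators, both families obey pointwise Bessel bounds and
  Cauchy-Schwarz is used over i. Since \<open>G\<close> lives on one cell, the bound for
  \<open>z\<close> decays away from its centre, which makes the remaining integral finite.\<close>

lemma rotate_trace:
 fixes f \<phi> F G :: "'n::finite fn"
 assumes \<phi>[measurable]: "\<phi> \<in> borel_measurable borel" and b: "\<And>x. cmod (\<phi> x) \<le> H * decay_weight x"
  and F: "\<And>\<eta>. fourier_integral \<phi> \<eta> = F \<eta>" "\<And>\<eta>. cmod (F \<eta>) \<le> H * decay_weight \<eta>" "F \<in> borel_measurable borel"
  and f: "\<And>x. f x = of_real (decay_weight x) * \<phi> x"
  and G: "G \<in> L2" "bounded_measurable G" "\<And>\<zeta>. G \<zeta> \<noteq> 0 \<Longrightarrow> cell \<zeta> = l"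
  and u: "orthonormal N u" and v: "orthonormal N v"
 shows "(\<Sum>i<N. \<bar>u i \<bullet> mul f (rotate_l2 \<i> (mul G (v i)))\<bar>)
   \<le> trace_const TYPE('n) * H * sqrt (LINT y|lebesgue. (cmod (G y))^2)"
proof -
 have H: "0 \<le> H"
  using order_trans[OF norm_ge_zero b[of 0]] decay_weight_pos[of "0::real^'n"] by (simp add: zero_le_mult_iff)
 define w :: "'n fn" where "w x = of_real (decay_weight x)" for x
 have wm: "w \<in> borel_measurable borel" unfolding w_def by measurable
 have wL: "w \<in> L2" by (rule L2_decay_weight[OF wm, of 1]) (simp add: w_def decay_weight_pos less_imp_le)
 have wb: "bounded_measurable w"
  by (rule bounded_measurableI[where B = 1])
   (use wm in \<open>simp_all add: w_def decay_weight_pos less_imp_le decay_weight_le_1 measurable_completion\<close>)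
 have \<phi>b: "bounded_measurable \<phi>"
 proof (rule bounded_measurableI)
  show "cmod (\<phi> x) \<le> H" for x using b[of x] mult_left_mono[OF decay_weight_le_1[of x] H] by simp
 qed (simp add: measurable_completion)
 have cw: "(\<lambda>x. cnj (w x)) = w" by (simp add: w_def fun_eq_iff)
 define c g2 where "c = fconst TYPE('n)" and "g2 = (LINT y|lebesgue. (cmod (G y))^2)"
 define W where "W = (LINT x :: real ^ 'n|lebesgue. (decay_weight x)^2)"
 have c: "0 < c" by (simp add: c_def fconst_pos)
 have W: "(LINT y|lebesgue. (cmod (w y))^2) = W" by (simp add: W_def w_def)
 have g2: "0 \<le> g2" "0 \<le> W" by (simp_all add: g2_def W_def)
 define y where "y i = mul G (v i)" for i
 define p where "p i = rotate_l2 (- \<i>) (mul w (u i))" for i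
 define z where "z i = rotate_l2 (- \<i>) (mul \<phi> (rotate_l2 \<i> (y i)))" for i
 have ry: "AE \<zeta> in lebesgue. rep (y i) \<zeta> = G \<zeta> * rep (v i) \<zeta>" for i
  unfolding y_def by (rule rep_mul[OF G(2)])
 have yi: "integrable lebesgue (rep (y i))" for i
  using L2_integrable_mult[OF G(1) rep_L2[of "v i"]] ry[of i] G(1)
  by (subst integrable_cong_AE[OF _ _ ry]) (auto simp: L2_measurable)
 have ip: "\<bar>u i \<bullet> mul f (rotate_l2 \<i> (y i))\<bar> \<le> (LINT \<xi>|lebesgue. cmod (rep (p i) \<xi>) * cmod (rep (z i) \<xi>))" for i
 proof -
  have "mul f (rotate_l2 \<i> (y i)) = mul w (mul \<phi> (rotate_l2 \<i> (y i)))"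
   unfolding mul_mul[OF wb \<phi>b] by (simp add: w_def f[abs_def])
  also have "mul \<phi> (rotate_l2 \<i> (y i)) = rotate_l2 \<i> (z i)"
   by (simp add: z_def rotate_rotate rotate_1)
  finally have "cin (u i) (mul f (rotate_l2 \<i> (y i))) = cin (p i) (z i)"
   using cin_mul[OF wb, of "u i" "rotate_l2 \<i> (z i)"] by (simp add: p_def cin_rotate_left cw)
  then have "\<bar>u i \<bullet> mul f (rotate_l2 \<i> (y i))\<bar> \<le> cmod (cin (p i) (z i))"
   unfolding inner_eq_Re_cin by (metis abs_Re_le_cmod)
  also have "\<dots> \<le> (LINT \<xi>|lebesgue. cmod (cnj (rep (p i) \<xi>) * rep (z i) \<xi>))"
   unfolding cin_rep L2inner_def by (rule integral_norm_bound)
  finally show ?thesis by (simp add: norm_mult)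
 qed
 define w' where "w' \<xi> = decay_weight (\<xi> - cell_center l)" for \<xi> :: "real ^ 'n"
 define D where "D = 2 * c^2 * 2^CARD('n) * sqrt W * H * sqrt g2"
 have ae: "AE \<xi> in lebesgue. (\<Sum>i<N. cmod (rep (p i) \<xi>) * cmod (rep (z i) \<xi>)) \<le> D * w' \<xi>"
 proof -
  have "AE \<xi> in lebesgue. (\<Sum>i<N. (cmod (rep (p i) \<xi>))^2) \<le> 2 * c^2 * W"
   using rotate_bessel[of 1, OF _ wL wb u] by (simp add: W c_def p_def)
  moreover have "AE \<xi> in lebesgue. \<forall>i\<in>{..<N}. rep (z i) \<xi> = of_real c * (LINT \<zeta>|lebesgue. F (\<xi> - \<zeta>) * rep (y i) \<zeta>)"
   unfolding z_def c_def by (intro AE_finite_allI rotate_convolution[OF \<phi> b F(1)] yi) simp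
  ultimately show ?thesis
  proof eventually_elim
   case (elim \<xi>)
   \<comment> \<open>The kernel row of the second family at \<xi>. On the support of
     \<open>G\<close> the decay of \<open>F\<close> is comparable to that at the centre of the
     cell.\<close>
   define K where "K \<zeta> = F (\<xi> - \<zeta>) * G \<zeta>" for \<zeta>
   have Fm: "(\<lambda>\<zeta>. F (\<xi> - \<zeta>)) \<in> borel_measurable lebesgue"
    using F(3) by (intro measurable_completion) simp
   have Kb: "cmod (K \<zeta>) \<le> H * (2^CARD('n) * w' \<xi>) * cmod (G \<zeta>)" for \<zeta>
   proof (cases "G \<zeta> = 0")
    case False
    have "cmod (F (\<xi> - \<zeta>)) \<le> H * (2^CARD('n) * w' \<xi>)"
     using F(2)[of "\<xi> - \<zeta>"] mult_left_mono[OF decay_weight_cell_center[OF G(3)[OF False], of \<xi>] H] by (simp add: w'_def)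
    then show ?thesis by (simp add: K_def norm_mult mult_right_mono)
   qed (simp add: K_def)
   have w': "0 \<le> w' \<xi>" by (simp add: w'_def decay_weight_pos less_imp_le)
   have Km: "K \<in> borel_measurable lebesgue" unfolding K_def using Fm G(1) by measurable
   have K2: "(cmod (K \<zeta>))^2 \<le> (H * (2^CARD('n) * w' \<xi>))^2 * (cmod (G \<zeta>))^2" for \<zeta>
    using power_mono[OF Kb norm_ge_zero, of \<zeta> 2] by (simp add: power_mult_distrib)
   have iG: "integrable lebesgue (\<lambda>\<zeta>. (H * (2^CARD('n) * w' \<xi>))^2 * (cmod (G \<zeta>))^2)"
    by (intro integrable_mult_right L2_integrable G)
   have "integrable lebesgue (\<lambda>\<zeta>. (cmod (K \<zeta>))^2)"
   proof (rule Bochner_Integration.integrable_bound[OF iG])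
    show "AE \<zeta> in lebesgue. norm ((cmod (K \<zeta>))^2) \<le> norm ((H * (2^CARD('n) * w' \<xi>))^2 * (cmod (G \<zeta>))^2)"
     unfolding real_norm_def
     by (intro AE_I2 order_trans[OF _ abs_ge_self]) (simp only: abs_of_nonneg[OF zero_le_power2] K2)
   qed (use Km in measurable)
   then have KL: "K \<in> L2" using Km by (simp add: L2_iff)
   have "(LINT \<zeta>|lebesgue. F (\<xi> - \<zeta>) * rep (y i) \<zeta>) = (LINT \<zeta>|lebesgue. K \<zeta> * rep (v i) \<zeta>)" for i
   proof (rule integral_cong_AE)
    show "(\<lambda>\<zeta>. F (\<xi> - \<zeta>) * rep (y i) \<zeta>) \<in> borel_measurable lebesgue" using Fm by measurable
    show "(\<lambda>\<zeta>. K \<zeta> * rep (v i) \<zeta>) \<in> borel_measurable lebesgue" using Km by measurable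
    show "AE \<zeta> in lebesgue. F (\<xi> - \<zeta>) * rep (y i) \<zeta> = K \<zeta> * rep (v i) \<zeta>"
     using ry[of i] by eventually_elim (simp add: K_def)
   qed
   then have "(\<Sum>i<N. (cmod (rep (z i) \<xi>))^2) = c^2 * (\<Sum>i<N. (cmod (LINT \<zeta>|lebesgue. K \<zeta> * rep (v i) \<zeta>))^2)"
    using elim(2) by (simp add: norm_mult power_mult_distrib sum_distrib_left)
   also have "\<dots> \<le> c^2 * (2 * (LINT \<zeta>|lebesgue. (cmod (K \<zeta>))^2))"
    by (intro mult_left_mono bessel_pointwise KL v) simp
   also have "\<dots> \<le> c^2 * (2 * ((H * (2^CARD('n) * w' \<xi>))^2 * g2))"
   proof (intro mult_left_mono)
    have "(LINT \<zeta>|lebesgue. (cmod (K \<zeta>))^2) \<le> (LINT \<zeta>|lebesgue. (H * (2^CARD('n) * w' \<xi>))^2 * (cmod (G \<zeta>))^2)"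
     by (intro integral_mono L2_integrable KL iG K2)
    then show "(LINT \<zeta>|lebesgue. (cmod (K \<zeta>))^2) \<le> (H * (2^CARD('n) * w' \<xi>))^2 * g2"
     by (simp only: g2_def integral_mult_right_zero)
   qed auto
   finally have zb: "(\<Sum>i<N. (cmod (rep (z i) \<xi>))^2) \<le> c^2 * (2 * ((H * (2^CARD('n) * w' \<xi>))^2 * g2))" .
   have "(\<Sum>i<N. cmod (rep (p i) \<xi>) * cmod (rep (z i) \<xi>))
     \<le> sqrt (\<Sum>i<N. (cmod (rep (p i) \<xi>))^2) * sqrt (\<Sum>i<N. (cmod (rep (z i) \<xi>))^2)"
    using L2_set_mult_ineq[of "\<lambda>i. cmod (rep (p i) \<xi>)" "\<lambda>i. cmod (rep (z i) \<xi>)" "{..<N}"] by (simp add: L2_set_def)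
   also have "\<dots> \<le> sqrt (2 * c^2 * W) * sqrt (c^2 * (2 * ((H * (2^CARD('n) * w' \<xi>))^2 * g2)))"
    by (intro mult_mono real_sqrt_le_mono elim zb) (auto intro!: sum_nonneg mult_nonneg_nonneg simp: g2)
   also have "\<dots> = D * w' \<xi>"
    using c w' H by (simp add: D_def real_sqrt_mult power2_eq_square)
   finally show ?case .
  qed
 qed
 have int: "integrable lebesgue (\<lambda>\<xi>. cmod (rep (p i) \<xi>) * cmod (rep (z i) \<xi>))" for i
  using L2_integrable_inner[OF rep_L2[of "p i"] rep_L2[of "z i"]] integrable_norm by (fastforce simp: norm_mult)
 have w'i: "integrable lborel w'" "(LINT \<xi>|lborel. w' \<xi>) = (LINT x :: real ^ 'n|lborel. decay_weight x)"
  unfolding w'_def by (rule integrable_lborel_shift[OF decay_weight_integrable])+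
 have w'm: "w' \<in> borel_measurable borel" unfolding w'_def by measurable
 have "(\<Sum>i<N. \<bar>u i \<bullet> mul f (rotate_l2 \<i> (mul G (v i)))\<bar>)
   \<le> (\<Sum>i<N. (LINT \<xi>|lebesgue. cmod (rep (p i) \<xi>) * cmod (rep (z i) \<xi>)))"
  using ip by (intro sum_mono) (simp add: y_def)
 also have "\<dots> = (LINT \<xi>|lebesgue. (\<Sum>i<N. cmod (rep (p i) \<xi>) * cmod (rep (z i) \<xi>)))"
  by (rule Bochner_Integration.integral_sum[symmetric]) (rule int)
 also have "\<dots> \<le> (LINT \<xi>|lebesgue. D * w' \<xi>)"
  using ae w'i(1) w'm by (intro integral_mono_AE Bochner_Integration.integrable_sum int integrable_mult_right) (simp_all add: lebesgue_integrable_borel)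
 also have "\<dots> = trace_const TYPE('n) * H * sqrt g2"
  using w'i(2) w'm by (simp add: lebesgue_integral_borel D_def trace_const_def W_def c_def)
 finally show ?thesis by (simp add: g2_def)
qed

section \<open>Splitting the symbol\<close>

lemma powr_tail_step:
 fixes t \<theta> :: real
 assumes "1 \<le> t" "0 < \<theta>" "\<theta> \<le> 1"
 shows "t powr (- (1 + \<theta>)) \<le> (4 / \<theta>) * (t powr (- \<theta>) - (t + 1) powr (- \<theta>))"
proof -
 have d: "((\<lambda>x. x powr (- \<theta>)) has_real_derivative - \<theta> * z powr (- \<theta> - 1)) (at z)" if "0 < z" for z :: real
  using that by (auto intro!: derivative_eq_intros)
 obtain z where z: "t < z" "z < t + 1" "(t + 1) powr (- \<theta>) - t powr (- \<theta>) = (t + 1 - t) * (- \<theta> * z powr (- \<theta> - 1))"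
  using MVT2[of t "t + 1" "\<lambda>x. x powr (- \<theta>)" "\<lambda>z. - \<theta> * z powr (- \<theta> - 1)"] d assms by force
 have "t powr (- (1 + \<theta>)) = 2 powr (1 + \<theta>) * (2 * t) powr (- (1 + \<theta>))"
  using assms by (simp add: powr_mult flip: powr_add)
 \<comment> \<open>Here z < t + 1 \<le> 2 t, and 2 powr (1 + \<theta>) \<le> 4 since \<theta> \<le>
   1.\<close>
 also have "\<dots> \<le> 4 * z powr (- (1 + \<theta>))"
 proof (intro mult_mono)
  have "2 powr (1 + \<theta>) \<le> 2 powr (2 :: real)" using assms by (intro powr_mono) auto
  then show "2 powr (1 + \<theta>) \<le> 4" by simp
  show "(2 * t) powr (- (1 + \<theta>)) \<le> z powr (- (1 + \<theta>))"
   using z assms by (intro powr_mono2') auto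
 qed auto
 also have "\<dots> = (4 / \<theta>) * (t powr (- \<theta>) - (t + 1) powr (- \<theta>))"
 proof -
  have "- (1 + \<theta>) = - \<theta> - 1" by simp
  then have "t powr (- \<theta>) - (t + 1) powr (- \<theta>) = \<theta> * z powr (- (1 + \<theta>))" using z(3) by (simp only:) simp
  then show ?thesis using assms by simp
 qed
 finally show ?thesis .
qed

text \<open>The bounds of \<open>powr_tail_step\<close> telescope. The loss 1 / \<theta> is one
  source of the factor 1 / (p - 2).\<close>

lemma powr_tail_sum:
 assumes "0 < \<theta>" "\<theta> \<le> 1"
 shows "(\<Sum>i. ennreal ((real (J + i) + 1) powr (- (1 + \<theta>)))) \<le> ennreal ((4 / \<theta>) * (real J + 1) powr (- \<theta>))"
proof (rule suminf_le_const)
 fix n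
 have "(\<Sum>i<n. (real (J + i) + 1) powr (- (1 + \<theta>))) \<le> (4 / \<theta>) * ((real J + 1) powr (- \<theta>) - (real (J + n) + 1) powr (- \<theta>))"
 proof (induction n)
  case (Suc n)
  then show ?case
   using powr_tail_step[of "real (J + n) + 1" \<theta>] assms by (simp add: algebra_simps)
 qed simp
 also have "\<dots> \<le> (4 / \<theta>) * (real J + 1) powr (- \<theta>)"
  using assms by (intro mult_left_mono) auto
 finally show "(\<Sum>i<n. ennreal ((real (J + i) + 1) powr (- (1 + \<theta>)))) \<le> ennreal ((4 / \<theta>) * (real J + 1) powr (- \<theta>))"
  by (subst sum_ennreal) (auto intro: ennreal_leI)
qed (rule summableI)

lemma powr_head_sum:
 fixes s :: real
 assumes "0 < s" "s < 1"
 shows "(\<Sum>j<J. (real j + 1) powr (- s)) \<le> (1 / (1 - s)) * real J powr (1 - s)"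
proof (induction J)
 case (Suc J)
 have "(real J + 1) powr (- s) \<le> (1 / (1 - s)) * ((real J + 1) powr (1 - s) - real J powr (1 - s))"
 proof (cases "J = 0")
  case True
  then show ?thesis using assms by simp
 next
  case False
  have "\<exists>z. real J < z \<and> z < real J + 1 \<and>
    (real J + 1) powr (1 - s) - real J powr (1 - s) = (real J + 1 - real J) * ((1 - s) * z powr (1 - s - 1))"
   by (rule MVT2) (use False in \<open>auto intro!: derivative_eq_intros\<close>)
  then obtain z where z: "real J < z" "z < real J + 1"
    "(real J + 1) powr (1 - s) - real J powr (1 - s) = (real J + 1 - real J) * ((1 - s) * z powr (1 - s - 1))"
   by auto
  have "(real J + 1) powr (- s) \<le> z powr (- s)"
   using z False assms by (intro powr_mono2') auto
  then show ?thesis using z(3) assms by simp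
 qed
 then show ?case using Suc by (simp add: algebra_simps)
qed simp

lemma integrable_nn_bound:
 fixes h :: "'a \<Rightarrow> real"
 assumes "h \<in> borel_measurable M" "\<And>x. 0 \<le> h x" "(\<integral>\<^sup>+ x. ennreal (h x) \<partial>M) \<le> ennreal B" "0 \<le> B"
 shows "integrable M h" "integral\<^sup>L M h \<le> B"
proof -
 show "integrable M h"
  using assms by (intro integrableI_nonneg) (auto intro: le_less_trans[OF assms(3)])
 show "integral\<^sup>L M h \<le> B"
  using assms by (simp add: integral_eq_nn_integral enn2real_leI)
qed

text \<open>On the shell where a lies between 2^k s and 2^(k+1) s, the weak bound gives the k-th
  term of a geometric series of ratio 2 powr (2 - p). Its sum is of order 1 / (p - 2), the price for
  approaching the exponent 2.\<close>

lemma weak_tail_square: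
 fixes a :: "'a \<Rightarrow> real"
 assumes [measurable]: "a \<in> borel_measurable M" and p: "2 < p" "p \<le> 3" and s: "0 < s"
  and weak: "\<And>t. 0 < t \<Longrightarrow> emeasure M {x \<in> space M. t < a x} \<le> ennreal (t powr (- p))"
 shows "(\<integral>\<^sup>+ x. ennreal ((a x)^2 * indicator {x. s < a x} x) \<partial>M) \<le> ennreal (12 / (p - 2) * s powr (2 - p))"
proof -
 define T where "T k x = ennreal (4 * 4^k * s^2) * indicator {x \<in> space M. 2^k * s < a x} x" for k x
 have "ennreal ((a x)^2 * indicator {x. s < a x} x) \<le> (\<Sum>k. T k x)" if x: "x \<in> space M" for x
 proof (cases "s < a x")
  case True
  obtain m :: nat where "a x / s < 2^m" using real_arch_pow[of 2 "a x / s"] by auto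
  then have m: "a x \<le> 2^m * s" using s by (simp add: field_simps)
  define k where "k = (LEAST m. a x \<le> 2^m * s)"
  have k: "a x \<le> 2^k * s" unfolding k_def by (rule LeastI[of _ m]) (rule m)
  have "k \<noteq> 0" using k True by (intro notI) simp
  then obtain j where j: "k = Suc j" using not0_implies_Suc by blast
  have "\<not> a x \<le> 2^j * s" using not_less_Least[of j "\<lambda>m. a x \<le> 2^m * s"] j by (simp add: k_def)
  then have Tj: "T j x = ennreal (4 * 4^j * s^2)" using x by (simp add: T_def)
  have "(a x)^2 \<le> (2^k * s)^2" using k True s by (intro power_mono) auto
  moreover have "(2^k * s)^2 = 4 * ((2 * 2)^j) * s^2"
   unfolding power_mult_distrib j by (simp add: power2_eq_square)
  ultimately have "(a x)^2 \<le> 4 * 4^j * s^2" by simp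
  then have "ennreal ((a x)^2 * indicator {x. s < a x} x) \<le> T j x"
   using True Tj by (simp add: ennreal_leI)
  also have "\<dots> \<le> (\<Sum>k. T k x)" using sum_le_suminf[of "\<lambda>k. T k x" "{j}"] by (simp add: summableI)
  finally show ?thesis .
 qed simp
 then have "(\<integral>\<^sup>+ x. ennreal ((a x)^2 * indicator {x. s < a x} x) \<partial>M) \<le> (\<integral>\<^sup>+ x. (\<Sum>k. T k x) \<partial>M)"
  by (rule nn_integral_mono)
 also have "\<dots> = (\<Sum>k. \<integral>\<^sup>+ x. T k x \<partial>M)" unfolding T_def by (rule nn_integral_suminf) measurable
 also have "\<dots> \<le> (\<Sum>k. ennreal (4 * s powr (2 - p) * (2 powr (2 - p))^k))"
 proof (intro suminf_le summableI)
  fix k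
  have "(\<integral>\<^sup>+ x. T k x \<partial>M) = ennreal (4 * 4^k * s^2) * emeasure M {x \<in> space M. 2^k * s < a x}"
   unfolding T_def by (subst nn_integral_cmult_indicator) measurable
  also have "\<dots> \<le> ennreal (4 * 4^k * s^2) * ennreal ((2^k * s) powr (- p))"
   using s by (intro mult_left_mono weak) auto
  also have "\<dots> = ennreal (4 * 4^k * s^2 * (2^k * s) powr (- p))"
   by (rule ennreal_mult[symmetric]) auto
  also have "4 * 4^k * s^2 * (2^k * s) powr (- p) = 4 * s powr (2 - p) * (2 powr (2 - p))^k"
  proof -
   have "(2^k * s) powr (- p) = 2 powr (real k * (- p)) * s powr (- p)"
    using s by (simp add: powr_mult powr_powr flip: powr_realpow)
   moreover have "(4::real)^k = 2 powr (real k * 2)"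
    using powr_powr[of 2 2 "real k"] powr_realpow[of 4 k] by (simp add: mult.commute)
   moreover have "s^2 = s powr 2" using s by simp
   ultimately have "4 * 4^k * s^2 * (2^k * s) powr (- p)
     = 4 * (s powr 2 * s powr (- p)) * (2 powr (real k * 2) * 2 powr (real k * (- p)))" by (simp only: mult_ac)
   also have "\<dots> = 4 * s powr (2 - p) * (2 powr (2 - p))^k"
    unfolding powr_add[symmetric] by (simp add: powr_power algebra_simps)
   finally show ?thesis .
  qed
  finally show "(\<integral>\<^sup>+ x. T k x \<partial>M) \<le> ennreal (4 * s powr (2 - p) * (2 powr (2 - p))^k)" .
 qed
 also have "\<dots> = ennreal (4 * s powr (2 - p) * (1 / (1 - 2 powr (2 - p))))"
 proof -
  have "2 powr (2 - p) < 2 powr (0 :: real)" using p by (intro powr_less_mono) auto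
  then have "(\<lambda>k. 4 * s powr (2 - p) * (2 powr (2 - p))^k) sums (4 * s powr (2 - p) * (1 / (1 - 2 powr (2 - p))))"
   by (intro sums_mult geometric_sums) simp
  then show ?thesis by (intro suminf_ennreal_eq) auto
 qed
 also have "\<dots> \<le> ennreal (12 / (p - 2) * s powr (2 - p))"
 proof (rule ennreal_leI)
  \<comment> \<open>An explicit bound of 1 - 2 powr (2 - p) from below by (p - 2) / 3, from ln 2
    \<ge> 1/2 and p \<le> 3.\<close>
  have "1 + (p - 2) / 2 \<le> 1 + (p - 2) * ln 2" using ln2_ge_two_thirds p by simp
  also have "\<dots> \<le> 2 powr (p - 2)" using exp_ge_add_one_self[of "(p - 2) * ln 2"] by (simp add: powr_def)
  finally have le: "1 + (p - 2) / 2 \<le> 2 powr (p - 2)" .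
  have "2 powr (2 - p) = 1 / 2 powr (p - 2)" using powr_minus_divide[of 2 "p - 2"] by simp
  also have "\<dots> \<le> 1 / (1 + (p - 2) / 2)" by (rule frac_le[OF _ _ _ le]) (use p in \<open>auto simp: field_simps\<close>)
  also have "\<dots> \<le> 1 - (p - 2) / 3"
  proof -
   define r where "r = p - 2"
   have "0 \<le> r * (1 - r)" using p by (simp add: r_def)
   then have "1 \<le> (1 - r / 3) * (1 + r / 2)" by (simp add: algebra_simps)
   then show ?thesis unfolding r_def[symmetric] by (subst pos_divide_le_eq) (use p in \<open>auto simp: r_def field_simps\<close>)
  qed
  finally have "1 / (1 - 2 powr (2 - p)) \<le> 3 / (p - 2)" using p by (simp add: field_simps)
  from mult_left_mono[OF this, of "4 * s powr (2 - p)"]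
  show "4 * s powr (2 - p) * (1 / (1 - 2 powr (2 - p))) \<le> 12 / (p - 2) * s powr (2 - p)" by simp
 qed
 finally show ?thesis .
qed

section \<open>The bounded, the Hilbert-Schmidt and the trace class part of the symbol\<close>

lemma term_le_suminf: "h i \<le> (\<Sum>i. h i :: ennreal)"
 using sum_le_suminf[of h "{i}"] by (simp add: summableI)

lemma mul_sum_left:
 fixes m :: "'i \<Rightarrow> 'n::finite fn"
 assumes "finite S" "\<And>l. l \<in> S \<Longrightarrow> bounded_measurable (m l)"
 shows "bounded_measurable (\<lambda>x. \<Sum>l\<in>S. m l x)" "mul (\<lambda>x. \<Sum>l\<in>S. m l x) u = (\<Sum>l\<in>S. mul (m l) u)"
 using assms
proof (induction S)
 case empty
 {
  case 1
  show ?case by (simp add: bounded_measurableI[of _ 0])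
 next
  case 2
  show ?case by (simp add: mul_def zero_cls[symmetric])
 }
next
 case (insert l S)
 {
  case 1
  then show ?case using insert by (simp add: bounded_measurable_add)
 next
  case 2
  then show ?case using insert by (simp add: mul_add_left)
 }
qed

lemma sets_cell[measurable]: "{x :: real ^ 'n::finite. cell x = l} \<in> sets borel"
proof -
 have "round y = k \<longleftrightarrow> of_int k \<le> y + 1/2 \<and> y + 1/2 < of_int k + 1" for y :: real and k
  unfolding round_def by (simp add: floor_eq_iff)
 then have "{x :: real ^ 'n. cell x = l} = {x. \<forall>i. of_int (l $ i) \<le> x $ i + 1/2 \<and> x $ i + 1/2 < of_int (l $ i) + 1}"
  by (simp add: cell_def vec_eq_iff)
 also have "\<dots> \<in> sets borel" by measurable
 finally show ?thesis .
qed

lemma sets_cells: "finite S \<Longrightarrow> {x :: real ^ 'n::finite. cell x \<in> S} \<in> sets borel"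
proof -
 assume "finite S"
 then have "(\<Union>l\<in>S. {x. cell x = l}) \<in> sets borel" by (intro sets.finite_UN sets_cell)
 moreover have "(\<Union>l\<in>S. {x. cell x = l}) = {x :: real ^ 'n. cell x \<in> S}" by auto
 ultimately show ?thesis by simp
qed

text \<open>The summands belong to the bounded, the Hilbert-Schmidt and the trace class part. The
  number 7 exceeds sqrt 48 in the second and is 4 + 3 in the third.\<close>

definition core_const :: "'n::finite itself \<Rightarrow> real" where
 "core_const _ = 1 + 7 * fconst TYPE('n) + 7 * trace_const TYPE('n)"

lemma trace_const_nonneg: "0 \<le> trace_const TYPE('n::finite)"
 unfolding trace_const_def
 by (intro mult_nonneg_nonneg integral_nonneg_AE) (auto simp: decay_weight_pos less_imp_le)

text \<open>\<open>a\<close> and \<open>b\<close> stand for the moduli of the two factors,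
  normalized to quasinorm 1, and \<open>\<sigma>\<close> lists cells such that the mass of
  \<open>b\<close> on the j-th one decays. \<open>\<tau>\<close> is the L2 size of \<open>f\<close>,
  and \<open>H\<close> measures by how much the pointwise bounds exceed it.\<close>

context
 fixes f \<phi> F g :: "'n::finite fn" and a b :: "real ^ 'n \<Rightarrow> real" and \<sigma> :: "nat \<Rightarrow> int ^ 'n"
  and H \<tau> p q :: real
 assumes \<phi>[measurable]: "\<phi> \<in> borel_measurable borel" and \<phi>b: "\<And>x. cmod (\<phi> x) \<le> H * \<tau> * decay_weight x"
  and F: "\<And>\<eta>. fourier_integral \<phi> \<eta> = F \<eta>" "\<And>\<eta>. cmod (F \<eta>) \<le> H * \<tau> * decay_weight \<eta>" "F \<in> borel_measurable borel"
  and f: "\<And>x. f x = of_real (decay_weight x) * \<phi> x" and \<tau>: "0 \<le> \<tau>" "(LINT x|lebesgue. (cmod (f x))^2) \<le> \<tau>^2"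
  and H: "1 \<le> H" and g: "bounded_measurable g"
  and ab[measurable]: "a \<in> borel_measurable lebesgue" "b \<in> borel_measurable lebesgue"
  and ab0: "\<And>x. 0 \<le> a x" "\<And>x. 0 \<le> b x" and gab: "\<And>x. (cmod (g x))^2 \<le> a x * b x"
  and p: "2 < p" "p \<le> 3" and pq: "1/p + 1/q = 1"
  and weak: "\<And>t. 0 < t \<Longrightarrow> emeasure lebesgue {x. t < a x} \<le> ennreal (t powr (- p))"
  and inj: "inj \<sigma>"
  and cells: "\<And>j. (\<integral>\<^sup>+ x. ennreal ((b x)^2 * on_cell (\<sigma> j) x) \<partial>lebesgue) \<le> ennreal ((real j + 1) powr (- (2/q)))"
  and outside: "AE x in lebesgue. b x = 0 \<or> cell x \<in> range \<sigma>"
begin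

text \<open>The distance of the exponents from 2: 2/p = 1 - theta and 2/q = 1 + theta. The masses of
  the two factors therefore carry inverse powers of N.\<close>

definition "theta = (p - 2) / p"

lemma theta: "0 < theta" "theta \<le> p - 2" "(p - 2) / 3 \<le> theta" "theta \<le> 1"
 "2 / q = 1 + theta" "1 / q = (1 + theta) / 2" "1 / p = (1 - theta) / 2"
proof -
 show "0 < theta" "theta \<le> p - 2" "(p - 2) / 3 \<le> theta" "theta \<le> 1"
  using p mult_nonneg_nonneg[of "p - 2" "p - 1"] mult_nonneg_nonneg[of "p - 2" "3 - p"]
  by (auto simp: theta_def field_simps)
 show "1 / p = (1 - theta) / 2" using p by (simp add: theta_def field_simps)
 then show "1 / q = (1 + theta) / 2" using pq by (simp add: field_simps)
 then show "2 / q = 1 + theta" by (simp add: field_simps)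
qed

lemma f_bounded: "cmod (f x) \<le> H * \<tau>"
proof -
 have w: "0 < decay_weight x" "decay_weight x \<le> 1" by (simp_all add: decay_weight_pos decay_weight_le_1)
 have "cmod (f x) = decay_weight x * cmod (\<phi> x)" using w by (simp add: f norm_mult)
 also have "\<dots> \<le> 1 * (H * \<tau> * 1)"
  using w H \<tau> by (intro mult_mono order_trans[OF \<phi>b] mult_left_mono) auto
 finally show ?thesis by simp
qed

lemma f_measurable: "f \<in> borel_measurable borel"
 unfolding f[abs_def] by measurable

lemma f_L2: "f \<in> L2"
proof (rule L2_decay_weight[OF f_measurable])
 show "cmod (f x) \<le> H * \<tau> * decay_weight x" for x
  using mult_mono[OF decay_weight_le_1[of x] \<phi>b[of x]] decay_weight_pos[of x] by (simp add: f norm_mult)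
qed

lemma f_bounded_measurable: "bounded_measurable f"
 using f_measurable by (intro bounded_measurableI[OF _ f_bounded]) (simp add: measurable_completion)

abbreviation opf :: "'n l2 \<Rightarrow> 'n l2" where "opf u \<equiv> mul f (rotate_l2 \<i> u)"

lemma opf_linear: "bounded_linear opf"
 by (intro bounded_linear_compose[OF bounded_linear_mul[OF f_bounded_measurable] bounded_linear_rotate]) simp

context
 fixes N :: nat
 assumes N: "1 \<le> N"
begin

text \<open>The levels N powr (- 1/p) / H and N powr (- 1/q) / H for \<open>a\<close> and
  \<open>b\<close>. Their product is 1 / (N H^2), so below both of them g is at most 1 / (sqrt N H),
  and this H compensates the pointwise bound of f.\<close>

definition "sa = real N powr (- ((1 - theta) / 2)) / H"
definition "rh = real N powr (- ((1 + theta) / 2)) / H"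
definition "good = {x. a x \<le> sa \<and> b x \<le> rh}"
text \<open>The number of cells treated by trace bounds. More cells would be too expensive at the
  cost H for each; fewer would leave a larger power of H in the Hilbert-Schmidt part.\<close>

definition "J = nat \<lfloor>real N / H^3\<rfloor>"
definition "S = \<sigma> ` {..<J}"

lemma N_powr_pos: "0 < real N powr t" using N by simp

lemma sa_pos: "0 < sa" "0 < rh" using N H by (auto simp: sa_def rh_def)

lemma sa_rh: "sa = real N powr theta * rh" "sa * rh = 1 / (real N * H^2)"
proof -
 have "real N powr (- ((1 - theta) / 2)) = real N powr theta * real N powr (- ((1 + theta) / 2))"
 proof -
  have "theta + - ((1 + theta) / 2) = - ((1 - theta) / 2)" by (simp add: field_simps)
  then show ?thesis by (simp only: powr_add[symmetric])
 qed
 then show "sa = real N powr theta * rh" by (simp add: sa_def rh_def)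
 have "real N powr (- ((1 - theta) / 2)) * real N powr (- ((1 + theta) / 2)) = real N powr (- 1)"
 proof -
  have "- ((1 - theta) / 2) + - ((1 + theta) / 2) = - 1" by (simp add: field_simps)
  then show ?thesis by (simp only: powr_add[symmetric])
 qed
 also have "\<dots> = 1 / real N" using N by (simp add: powr_minus_divide)
 finally show "sa * rh = 1 / (real N * H^2)" by (simp add: sa_def rh_def power2_eq_square)
qed

lemma J_bound: "real J \<le> real N / H^3" "real N / H^3 \<le> real J + 1"
proof -
 have "0 \<le> real N / H^3" using H by simp
 then show "real J \<le> real N / H^3" "real N / H^3 \<le> real J + 1"
  unfolding J_def by linarith+
qed

lemma good_measurable[measurable]: "good \<in> sets lebesgue"
proof -
 have "{x \<in> space lebesgue. a x \<le> sa \<and> b x \<le> rh} \<in> sets lebesgue" by measurable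
 then show ?thesis by (simp add: good_def)
qed

text \<open>On the complement of the region where \<open>g\<close> is small, \<open>g^2\<close> is controlled by the large
 values of \<open>a\<close> and by \<open>b\<close>.\<close>

lemma bad_bound:
 assumes x: "x \<notin> good"
 shows "(cmod (g x))^2 \<le> real N powr (- theta) * ((a x)^2 * indicator {x. sa < a x} x) + real N powr theta * (b x)^2"
proof (cases "sa < a x")
 case True
 define t where "t = real N powr theta"
 have t: "0 < t" unfolding t_def by (rule N_powr_pos)
 have "0 \<le> (a x - t * b x)^2" by simp
 then have "2 * (t * (a x * b x)) \<le> (a x)^2 + t * (t * (b x)^2)"
  by (simp add: power2_eq_square algebra_simps)
 moreover have "0 \<le> t * (a x * b x)" using t ab0 by simp
 ultimately have "t * (a x * b x) \<le> (a x)^2 + t * (t * (b x)^2)" by simp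
 then have "a x * b x \<le> (a x)^2 / t + t * (b x)^2" using t by (simp add: field_simps)
 then show ?thesis using gab[of x] True
  by (simp add: t_def[symmetric] powr_minus_divide)
next
 case False
 then have "rh < b x" "a x \<le> sa" using x by (auto simp: good_def)
 then have "a x \<le> real N powr theta * b x"
  unfolding sa_rh(1) using mult_left_mono[of rh "b x" "real N powr theta"] by simp
 then have "a x * b x \<le> real N powr theta * (b x)^2"
  using mult_right_mono[OF _ ab0(2)[of x]] by (fastforce simp: power2_eq_square mult.assoc)
 then show ?thesis using gab[of x] False by simp
qed

lemma large_a: "integrable lebesgue (\<lambda>x. (a x)^2 * indicator {x. sa < a x} x)"
  "(LINT x|lebesgue. (a x)^2 * indicator {x. sa < a x} x) \<le> 12 / (p - 2) * (real N powr theta * H powr (p - 2))"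
proof -
 have eq: "sa powr (2 - p) = real N powr theta * H powr (p - 2)"
 proof -
  have "- ((1 - theta) / 2) * (2 - p) = theta" using p by (simp add: theta_def field_simps)
  then have "real N powr theta = (real N powr (- ((1 - theta) / 2))) powr (2 - p)" by (simp add: powr_powr)
  moreover have "H powr (p - 2) = 1 / H powr (2 - p)" using powr_minus_divide[of H "2 - p"] by simp
  ultimately show ?thesis using H by (simp add: sa_def powr_divide)
 qed
 have m: "(\<lambda>x. (a x)^2 * indicator {x. sa < a x} x) \<in> borel_measurable lebesgue" by measurable
 have n: "(\<integral>\<^sup>+ x. ennreal ((a x)^2 * indicator {x. sa < a x} x) \<partial>lebesgue) \<le> ennreal (12 / (p - 2) * sa powr (2 - p))"
  by (rule weak_tail_square[OF ab(1) p sa_pos(1)]) (use weak in simp)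
 show "integrable lebesgue (\<lambda>x. (a x)^2 * indicator {x. sa < a x} x)"
  "(LINT x|lebesgue. (a x)^2 * indicator {x. sa < a x} x) \<le> 12 / (p - 2) * (real N powr theta * H powr (p - 2))"
  using integrable_nn_bound[OF m _ n] p unfolding eq by simp_all
qed

text \<open>A cell outside S that carries mass of \<open>b\<close> has index at least J, so the
  masses form a power tail, which starts at J + 1 \<ge> N / H^3.\<close>

lemma tail_b: "integrable lebesgue (\<lambda>x. (b x)^2 * indicator {x. cell x \<notin> S} x)"
  "(LINT x|lebesgue. (b x)^2 * indicator {x. cell x \<notin> S} x) \<le> 4 / theta * (real N powr (- theta) * H powr (3 * theta))"
proof -
 have [measurable]: "{x. cell x \<in> S} \<in> sets lebesgue" "{x. cell x = l} \<in> sets lebesgue" for l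
  by (auto intro!: sets_completionI_sets simp: S_def sets_cells sets_cell)
 have "space lebesgue - {x. cell x \<in> S} \<in> sets lebesgue" by measurable
 moreover have "space lebesgue - {x. cell x \<in> S} = {x. cell x \<notin> S}" by auto
 ultimately have [measurable]: "{x. cell x \<notin> S} \<in> sets lebesgue" by simp
 have m: "(\<lambda>x. (b x)^2 * indicator {x. cell x \<notin> S} x) \<in> borel_measurable lebesgue" by measurable
 have "AE x in lebesgue. ennreal ((b x)^2 * indicator {x. cell x \<notin> S} x)
   \<le> (\<Sum>i. ennreal ((b x)^2 * indicator {x. cell x = \<sigma> (J + i)} x))"
  using outside
 proof eventually_elim
  case (elim x)
  show ?case
  proof (cases "b x = 0 \<or> cell x \<in> S")
   case False
   then obtain k where k: "cell x = \<sigma> k" using elim by auto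
   then have "\<not> k < J" using False by (auto simp: S_def)
   then obtain i where i: "k = J + i" using le_Suc_ex not_less by blast
   have "ennreal ((b x)^2 * indicator {x. cell x \<notin> S} x) = ennreal ((b x)^2 * indicator {x. cell x = \<sigma> (J + i)} x)"
    using k i False by simp
   also have "\<dots> \<le> (\<Sum>i. ennreal ((b x)^2 * indicator {x. cell x = \<sigma> (J + i)} x))"
    by (rule term_le_suminf)
   finally show ?thesis .
  qed auto
 qed
 then have "(\<integral>\<^sup>+ x. ennreal ((b x)^2 * indicator {x. cell x \<notin> S} x) \<partial>lebesgue)
   \<le> (\<integral>\<^sup>+ x. (\<Sum>i. ennreal ((b x)^2 * indicator {x. cell x = \<sigma> (J + i)} x)) \<partial>lebesgue)"
  by (rule nn_integral_mono_AE)
 also have "\<dots> = (\<Sum>i. \<integral>\<^sup>+ x. ennreal ((b x)^2 * indicator {x. cell x = \<sigma> (J + i)} x) \<partial>lebesgue)"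
  by (rule nn_integral_suminf) measurable
 also have "\<dots> \<le> (\<Sum>i. ennreal ((real (J + i) + 1) powr (- (1 + theta))))"
  using cells[unfolded theta(5)] by (intro suminf_le summableI)
 also have "\<dots> \<le> ennreal ((4 / theta) * (real J + 1) powr (- theta))"
  by (rule powr_tail_sum) (use theta in auto)
 also have "\<dots> \<le> ennreal (4 / theta * (real N powr (- theta) * H powr (3 * theta)))"
 proof (intro ennreal_leI mult_left_mono)
  have "(real J + 1) powr (- theta) \<le> (real N / H^3) powr (- theta)"
   using J_bound(2) theta(1) N H by (intro powr_mono2') auto
  also have "\<dots> = real N powr (- theta) * H powr (3 * theta)"
  proof -
   have "(H^3) powr (- theta) = H powr (- (3 * theta))" using H powr_powr[of H 3 "- theta"] by simp
   moreover have "1 / H powr (- (3 * theta)) = H powr (3 * theta)"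
    using powr_minus_divide[of H "- (3 * theta)"] by simp
   ultimately show ?thesis using H by (simp add: powr_divide) (simp add: divide_inverse)
  qed
  finally show "(real J + 1) powr (- theta) \<le> real N powr (- theta) * H powr (3 * theta)" .
 qed (use theta in auto)
 finally have n: "(\<integral>\<^sup>+ x. ennreal ((b x)^2 * indicator {x. cell x \<notin> S} x) \<partial>lebesgue)
   \<le> ennreal (4 / theta * (real N powr (- theta) * H powr (3 * theta)))" .
 show "integrable lebesgue (\<lambda>x. (b x)^2 * indicator {x. cell x \<notin> S} x)"
  "(LINT x|lebesgue. (b x)^2 * indicator {x. cell x \<notin> S} x) \<le> 4 / theta * (real N powr (- theta) * H powr (3 * theta))"
  using integrable_nn_bound[OF m _ n] theta by simp_all
qed

abbreviation piece :: "(real ^ 'n) set \<Rightarrow> 'n fn" where "piece B x \<equiv> indicator B x * g x"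

lemma piece_bounded_measurable: "B \<in> sets lebesgue \<Longrightarrow> bounded_measurable (piece B)"
 by (intro bounded_measurable_mult bounded_measurable_indicator g)

lemma piece_L2:
 assumes B: "B \<in> sets lebesgue" and h: "integrable lebesgue h"
  and le: "\<And>x. x \<in> B \<Longrightarrow> (cmod (g x))^2 \<le> h x" "\<And>x. 0 \<le> h x"
 shows "piece B \<in> L2" "(LINT x|lebesgue. (cmod (piece B x))^2) \<le> (LINT x|lebesgue. h x)"
proof -
 have m: "piece B \<in> borel_measurable lebesgue"
  by (rule bounded_measurable_measurable[OF piece_bounded_measurable[OF B]])
 have le': "(cmod (piece B x))^2 \<le> h x" for x
  using le by (cases "x \<in> B") auto
 have "integrable lebesgue (\<lambda>x. (cmod (piece B x))^2)"
 proof (rule Bochner_Integration.integrable_bound[OF h])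
  show "AE x in lebesgue. norm ((cmod (piece B x))^2) \<le> norm (h x)"
   unfolding real_norm_def by (intro AE_I2 order_trans[OF _ abs_ge_self]) (simp only: abs_of_nonneg[OF zero_le_power2] le')
 qed (use m in measurable)
 with m show L: "piece B \<in> L2" by (simp add: L2_iff)
 show "(LINT x|lebesgue. (cmod (piece B x))^2) \<le> (LINT x|lebesgue. h x)"
  by (intro integral_mono L2_integrable L h le')
qed

lemma sets_cells_lebesgue: "finite E \<Longrightarrow> {x :: real ^ 'n. cell x \<in> E} \<in> sets lebesgue"
 "{x :: real ^ 'n. cell x = l} \<in> sets lebesgue" "{x. cell x \<notin> S} \<in> sets lebesgue"
proof -
 show fin: "finite E \<Longrightarrow> {x :: real ^ 'n. cell x \<in> E} \<in> sets lebesgue" for E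
  by (intro sets_completionI_sets) (simp add: sets_cells)
 show "{x :: real ^ 'n. cell x = l} \<in> sets lebesgue" using fin[of "{l}"] by simp
 have "space lebesgue - {x. cell x \<in> S} \<in> sets lebesgue" by (intro sets.compl_sets fin) (simp add: S_def)
 moreover have "space lebesgue - {x. cell x \<in> S} = {x. cell x \<notin> S}" by auto
 ultimately show "{x. cell x \<notin> S} \<in> sets lebesgue" by simp
qed

lemma bad_measurable: "- good \<in> sets lebesgue"
proof -
 have "space lebesgue - good \<in> sets lebesgue" using good_measurable by (rule sets.compl_sets)
 then show ?thesis by (simp add: Compl_eq_Diff_UNIV)
qed

text \<open>Operator norms suffice: \<open>f\<close> contributes H \<tau> and the symbol 1 / (sqrt N
  H), which gives N terms of size \<tau> / sqrt N.\<close>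

lemma good_part:
 assumes u: "orthonormal N u" and v: "orthonormal N v"
 shows "(\<Sum>i<N. \<bar>u i \<bullet> opf (mul (piece good) (v i))\<bar>) \<le> \<tau> * sqrt (real N)"
proof -
 have gb: "cmod (piece good x) \<le> 1 / (sqrt (real N) * H)" for x
 proof (cases "x \<in> good")
  case True
  have "(cmod (g x))^2 \<le> sa * rh"
   using True ab0 sa_pos by (intro order_trans[OF gab] mult_mono) (auto simp: good_def)
  then have "cmod (g x) \<le> sqrt (1 / (real N * H^2))" unfolding sa_rh(2) by (rule real_le_rsqrt)
  then show ?thesis using True H by (simp add: real_sqrt_divide real_sqrt_mult)
 qed (use H in simp)
 have "\<bar>u i \<bullet> opf (mul (piece good) (v i))\<bar> \<le> \<tau> / sqrt (real N)" if "i < N" for i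
 proof -
  have "\<bar>u i \<bullet> opf (mul (piece good) (v i))\<bar> \<le> norm (u i) * norm (opf (mul (piece good) (v i)))"
   by (rule Cauchy_Schwarz_ineq2)
  also have "\<dots> \<le> 1 * (H * \<tau> * norm (rotate_l2 \<i> (mul (piece good) (v i))))"
   using f_measurable by (intro mult_mono norm_mul_le f_bounded)
    (simp_all add: orthonormal_norm[OF u that] measurable_completion)
  also have "norm (rotate_l2 \<i> (mul (piece good) (v i))) \<le> 1 / (sqrt (real N) * H) * norm (v i)"
   by (subst norm_rotate, simp, rule norm_mul_le[OF bounded_measurable_measurable[OF piece_bounded_measurable[OF good_measurable]] gb])
  finally show ?thesis using H \<tau> orthonormal_norm[OF v that] by (simp add: mult_left_mono)
 qed
 then have "(\<Sum>i<N. \<bar>u i \<bullet> opf (mul (piece good) (v i))\<bar>) \<le> (\<Sum>i<N. \<tau> / sqrt (real N))"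
  by (intro sum_mono) simp
 also have "\<dots> = \<tau> * sqrt (real N)" using N by (simp add: field_simps)
 finally show ?thesis .
qed

text \<open>The power of H that remains in the final bound. Its exponent tends to 0 with p -
  2.\<close>

definition "Hp = H powr (3 * (p - 2) / 2)"

lemma Hp: "1 \<le> Hp" "Hp^2 = H powr (3 * (p - 2))" "H powr (p - 2) \<le> Hp^2" "H powr (3 * theta) \<le> Hp^2"
proof -
 show "1 \<le> Hp" using H p by (simp add: Hp_def ge_one_powr_ge_zero)
 show e: "Hp^2 = H powr (3 * (p - 2))" unfolding Hp_def power2_eq_square powr_add[symmetric] by simp
 show "H powr (p - 2) \<le> Hp^2" "H powr (3 * theta) \<le> Hp^2"
  unfolding e using H p theta by (auto intro!: powr_mono)
qed

text \<open>Both contributions in \<open>bad_bound\<close>, the large values of \<open>a\<close> and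
  the values of \<open>b\<close> off the first cells, have integral of order Hp^2 / (p - 2), as the
  powers of N cancel. Cauchy-Schwarz over the N terms turns the Hilbert-Schmidt bound into sqrt
  N.\<close>

lemma tail_part:
 assumes u: "orthonormal N u" and v: "orthonormal N v"
 shows "(\<Sum>i<N. \<bar>u i \<bullet> opf (mul (piece (- good \<inter> {x. cell x \<notin> S})) (v i))\<bar>)
  \<le> 7 * fconst TYPE('n) * (\<tau> * Hp / sqrt (p - 2)) * sqrt (real N)"
proof -
 define B where "B = - good \<inter> {x. cell x \<notin> S}"
 have B: "B \<in> sets lebesgue" unfolding B_def by (intro sets.Int bad_measurable sets_cells_lebesgue)
 define h where "h x = real N powr (- theta) * ((a x)^2 * indicator {x. sa < a x} x)
   + real N powr theta * ((b x)^2 * indicator {x. cell x \<notin> S} x)" for x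
 have hi: "integrable lebesgue h"
  unfolding h_def by (intro Bochner_Integration.integrable_add integrable_mult_right large_a tail_b)
 have NN: "real N powr (- theta) * real N powr theta = 1" using N by (simp flip: powr_add)
 have "(LINT x|lebesgue. h x) = real N powr (- theta) * (LINT x|lebesgue. (a x)^2 * indicator {x. sa < a x} x)
   + real N powr theta * (LINT x|lebesgue. (b x)^2 * indicator {x. cell x \<notin> S} x)"
  unfolding h_def using large_a(1) tail_b(1) by (subst Bochner_Integration.integral_add) auto
 also have "\<dots> \<le> real N powr (- theta) * (12 / (p - 2) * (real N powr theta * H powr (p - 2)))
   + real N powr theta * (4 / theta * (real N powr (- theta) * H powr (3 * theta)))"
  by (intro add_mono mult_left_mono large_a(2) tail_b(2)) auto
 also have "\<dots> = (real N powr (- theta) * real N powr theta) * (12 / (p - 2) * H powr (p - 2) + 4 / theta * H powr (3 * theta))"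
  by (simp add: algebra_simps)
 also have "\<dots> \<le> 12 / (p - 2) * Hp^2 + 12 / (p - 2) * Hp^2"
  unfolding NN mult_1
 proof (intro add_mono mult_mono)
  show "4 / theta \<le> 12 / (p - 2)" using theta(1,3) p by (simp add: field_simps)
 qed (use Hp theta p in auto)
 finally have hle: "(LINT x|lebesgue. h x) \<le> 24 * Hp^2 / (p - 2)" by simp
 have G: "piece B \<in> L2" "(LINT x|lebesgue. (cmod (piece B x))^2) \<le> (LINT x|lebesgue. h x)"
  by (rule piece_L2[OF B hi]; use bad_bound in \<open>auto simp: h_def B_def indicator_def\<close>)+
 define z where "z i = opf (mul (piece B) (v i))" for i
 have "(\<Sum>i<N. (norm (z i))^2) \<le> 2 * (fconst TYPE('n))^2 * (LINT y|lebesgue. (cmod (piece B y))^2) * (LINT y|lebesgue. (cmod (f y))^2)"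
  unfolding z_def by (rule rotate_hilbert_schmidt[OF G(1) piece_bounded_measurable[OF B] f_L2 f_bounded_measurable v])
 also have "\<dots> \<le> 2 * (fconst TYPE('n))^2 * (24 * Hp^2 / (p - 2)) * \<tau>^2"
  using order_trans[OF G(2) hle] \<tau> p by (intro mult_mono) auto
 \<comment> \<open>2 * 24 = 48 is below 7^2.\<close>
 also have "\<dots> \<le> (7 * fconst TYPE('n) * (\<tau> * Hp / sqrt (p - 2)))^2"
  using p by (simp add: power_mult_distrib power_divide mult_right_mono divide_right_mono)
 finally have zs: "(\<Sum>i<N. (norm (z i))^2) \<le> (7 * fconst TYPE('n) * (\<tau> * Hp / sqrt (p - 2)))^2" .
 have "(\<Sum>i<N. \<bar>u i \<bullet> z i\<bar>) \<le> (\<Sum>i<N. \<bar>1\<bar> * \<bar>norm (z i)\<bar>)"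
 proof (intro sum_mono)
  fix i assume "i \<in> {..<N}"
  then show "\<bar>u i \<bullet> z i\<bar> \<le> \<bar>1\<bar> * \<bar>norm (z i)\<bar>"
   using Cauchy_Schwarz_ineq2[of "u i" "z i"] orthonormal_norm[OF u, of i] by simp
 qed
 also have "\<dots> \<le> L2_set (\<lambda>_. 1) {..<N} * L2_set (\<lambda>i. norm (z i)) {..<N}" by (rule L2_set_mult_ineq)
 also have "\<dots> \<le> sqrt (real N) * (7 * fconst TYPE('n) * (\<tau> * Hp / sqrt (p - 2)))"
  unfolding L2_set_def using zs fconst_pos[where 'n='n] Hp(1) \<tau> p by (intro mult_mono real_le_lsqrt) (auto intro!: sum_nonneg)
 finally show ?thesis by (simp add: z_def B_def mult.commute)
qed

text \<open>The trace bound is applied on each of the J cells. The root of the mass of g on a cell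
  splits into a term from \<open>a\<close> and a term from \<open>b\<close>, which are summed over
  the cells by different means.\<close>

lemma head_part:
 assumes u: "orthonormal N u" and v: "orthonormal N v"
 shows "(\<Sum>l\<in>S. \<Sum>i<N. \<bar>u i \<bullet> opf (mul (piece (- good \<inter> {x. cell x = l})) (v i))\<bar>)
  \<le> 7 * trace_const TYPE('n) * (\<tau> / sqrt (p - 2)) * sqrt (real N)"
proof -
 define L where "L = trace_const TYPE('n)"
 \<comment> \<open>Half of the power that balances \<open>a\<close> against \<open>b\<close>, since
   the trace bound involves the root of the mass.\<close>
 define n2 where "n2 = real N powr (theta / 2)"
 have n2: "0 < n2" "n2^2 = real N powr theta" "1 / n2^2 = real N powr (- theta)"
  using N by (auto simp: n2_def power2_eq_square powr_minus_divide simp flip: powr_add)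
 define A where "A j = (LINT x|lebesgue. ((a x)^2 * indicator {x. sa < a x} x) * on_cell (\<sigma> j) x)" for j
 have Ai: "integrable lebesgue (\<lambda>x. ((a x)^2 * indicator {x. sa < a x} x) * on_cell (\<sigma> j) x)" for j
  by (rule integrable_real_mult_indicator[OF sets_cells_lebesgue(2) large_a(1)])
 have A0: "0 \<le> A j" for j unfolding A_def by (intro integral_nonneg_AE) auto
 have bm: "(\<lambda>x. (b x)^2 * on_cell (\<sigma> j) x) \<in> borel_measurable lebesgue" for j
  using sets_cells_lebesgue(2)[of "\<sigma> j"] by measurable
 have b: "integrable lebesgue (\<lambda>x. (b x)^2 * on_cell (\<sigma> j) x)"
   "(LINT x|lebesgue. (b x)^2 * on_cell (\<sigma> j) x) \<le> (real j + 1) powr (- (2/q))" for j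
  using integrable_nn_bound[OF bm _ cells] by simp_all
 \<comment> \<open>The cells are disjoint, so the masses of the large values of \<open>a\<close> add
   up to at most the total mass.\<close>
 have sumA: "(\<Sum>j<J. A j) \<le> 12 / (p - 2) * (real N powr theta * H powr (p - 2))"
 proof -
  have "(\<Sum>j<J. A j) = (LINT x|lebesgue. (\<Sum>j<J. ((a x)^2 * indicator {x. sa < a x} x) * on_cell (\<sigma> j) x))"
   unfolding A_def by (rule Bochner_Integration.integral_sum[symmetric]) (rule Ai)
  also have "\<dots> \<le> (LINT x|lebesgue. (a x)^2 * indicator {x. sa < a x} x)"
  proof (intro integral_mono Bochner_Integration.integrable_sum Ai large_a)
   fix x
   have "(\<Sum>j<J. on_cell (\<sigma> j) x :: real) = (\<Sum>j<J. if cell x = \<sigma> j then 1 else 0)"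
    by (intro sum.cong) (auto simp: indicator_def)
   also have "\<dots> = (\<Sum>j\<in>{j\<in>{..<J}. cell x = \<sigma> j}. 1)"
    by (rule sum.inter_filter[symmetric]) simp
   also have "\<dots> \<le> 1"
   proof -
    have "card {j\<in>{..<J}. cell x = \<sigma> j} \<le> Suc 0"
     using inj by (auto simp: card_le_Suc0_iff_eq inj_def)
    then show ?thesis by simp
   qed
   finally have "(\<Sum>j<J. on_cell (\<sigma> j) x :: real) \<le> 1" .
   then show "(\<Sum>j<J. ((a x)^2 * indicator {x. sa < a x} x) * on_cell (\<sigma> j) x) \<le> (a x)^2 * indicator {x. sa < a x} x"
    unfolding sum_distrib_left[symmetric] by (intro mult_left_le) auto
  qed
  finally show ?thesis using large_a(2) by (rule order_trans)
 qed
 have cell: "(\<Sum>i<N. \<bar>u i \<bullet> opf (mul (piece (- good \<inter> {x. cell x = \<sigma> j})) (v i))\<bar>)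
   \<le> L * (H * \<tau>) * (sqrt (A j) / n2 + n2 * (real j + 1) powr (- (1 / q)))" for j
 proof -
  define B where "B = - good \<inter> {x. cell x = \<sigma> j}"
  have B: "B \<in> sets lebesgue" unfolding B_def by (intro sets.Int bad_measurable sets_cells_lebesgue)
  define h where "h x = 1 / n2^2 * (((a x)^2 * indicator {x. sa < a x} x) * on_cell (\<sigma> j) x)
    + n2^2 * ((b x)^2 * on_cell (\<sigma> j) x)" for x
  have hi: "integrable lebesgue h"
   unfolding h_def by (intro Bochner_Integration.integrable_add integrable_mult_right Ai b)
  have G: "piece B \<in> L2" "(LINT x|lebesgue. (cmod (piece B x))^2) \<le> (LINT x|lebesgue. h x)"
   by (rule piece_L2[OF B hi]; use bad_bound[folded n2(2,3)] in \<open>auto simp: h_def B_def\<close>)+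
  have "(LINT x|lebesgue. h x) \<le> 1 / n2^2 * A j + n2^2 * (real j + 1) powr (- (2/q))"
   unfolding h_def A_def using Ai b by (subst Bochner_Integration.integral_add) (auto intro!: mult_left_mono)
  also have "(real j + 1) powr (- (2/q)) = ((real j + 1) powr (- (1/q)))^2"
   by (simp add: power2_eq_square flip: powr_add)
  finally have h: "(LINT x|lebesgue. (cmod (piece B x))^2) \<le> (sqrt (A j) / n2)^2 + (n2 * (real j + 1) powr (- (1/q)))^2"
   using G(2) A0 by (simp add: power_mult_distrib power_divide)
  have "(\<Sum>i<N. \<bar>u i \<bullet> opf (mul (piece B) (v i))\<bar>) \<le> L * (H * \<tau>) * sqrt (LINT y|lebesgue. (cmod (piece B y))^2)"
   unfolding L_def
   by (rule rotate_trace[OF \<phi> \<phi>b F f G(1) piece_bounded_measurable[OF B] _ u v])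
    (auto simp: B_def indicator_def split: if_splits)
  also have "\<dots> \<le> L * (H * \<tau>) * (sqrt (A j) / n2 + n2 * (real j + 1) powr (- (1/q)))"
  proof (intro mult_left_mono)
   have "sqrt (LINT y|lebesgue. (cmod (piece B y))^2) \<le> sqrt ((sqrt (A j) / n2)^2 + (n2 * (real j + 1) powr (- (1/q)))^2)"
    by (rule real_sqrt_le_mono[OF h])
   also have "\<dots> \<le> sqrt (A j) / n2 + n2 * (real j + 1) powr (- (1/q))"
    using n2(1) A0 by (intro sqrt_sum_squares_le_sum) auto
   finally show "sqrt (LINT y|lebesgue. (cmod (piece B y))^2) \<le> sqrt (A j) / n2 + n2 * (real j + 1) powr (- (1/q))" .
  qed (use H \<tau> trace_const_nonneg[where 'n='n] in \<open>auto simp: L_def\<close>)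
  finally show ?thesis by (simp add: B_def)
 qed
 \<comment> \<open>Cauchy-Schwarz over J \<le> N / H^3 cells; as H powr (p - 2) \<le> H, the powers
   of H cancel.\<close>
 have s1: "H * (\<Sum>j<J. sqrt (A j) / n2) \<le> 4 / sqrt (p - 2) * sqrt (real N)"
 proof -
  have "(\<Sum>j<J. sqrt (A j)) \<le> sqrt (real J) * sqrt (\<Sum>j<J. A j)"
   using L2_set_mult_ineq[of "\<lambda>_. 1" "\<lambda>j. sqrt (A j)" "{..<J}"] A0 by (simp add: L2_set_def)
  also have "\<dots> \<le> sqrt (real N / H^3) * sqrt (16 / (p - 2) * (n2^2 * H))"
  proof (intro mult_mono real_sqrt_le_mono J_bound)
   have "H powr (p - 2) \<le> H powr 1" using H p by (intro powr_mono) auto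
   then show "(\<Sum>j<J. A j) \<le> 16 / (p - 2) * (n2^2 * H)"
    using H p by (intro order_trans[OF sumA] mult_mono) (auto simp: n2(2) divide_right_mono mult_left_mono)
  qed (use A0 H in \<open>auto intro!: sum_nonneg\<close>)
  also have "\<dots> = 4 / sqrt (p - 2) * sqrt (real N) * n2 / H"
   using n2(1) H by (simp add: real_sqrt_mult real_sqrt_divide power3_eq_cube field_simps)
  finally have "(H / n2) * (\<Sum>j<J. sqrt (A j)) \<le> (H / n2) * (4 / sqrt (p - 2) * sqrt (real N) * n2 / H)"
   using n2(1) H by (intro mult_left_mono) auto
  then show ?thesis using n2(1) H by (simp add: sum_divide_distrib[symmetric])
 qed
 \<comment> \<open>The sum is of order (N / H^3) powr (1/p), and the factor H is absorbed because H
   \<le> H powr (3/p) for p \<le> 3.\<close>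
 have s2: "H * (\<Sum>j<J. n2 * (real j + 1) powr (- (1/q))) \<le> 3 * sqrt (real N)"
 proof -
  have t: "1 - 1/q = 1/p" using pq by simp
  have "(\<Sum>j<J. (real j + 1) powr (- (1/q))) \<le> (1 / (1 - 1/q)) * real J powr (1 - 1/q)"
  proof (rule powr_head_sum)
   show "0 < 1/q" unfolding theta(6) using theta(1) by simp
   have "0 < 1/p" using p by simp
   then show "1/q < 1" using pq by linarith
  qed
  also have "\<dots> \<le> 3 * (real N / H^3) powr (1/p)"
   unfolding t using p J_bound(1) by (intro mult_mono powr_mono2) auto
  also have "(real N / H^3) powr (1/p) = real N powr (1/p) / H powr (3 / p)"
   using H powr_powr[of H 3 "1/p"] by (simp add: powr_divide)
  finally have "H * n2 * (\<Sum>j<J. (real j + 1) powr (- (1/q))) \<le> H * n2 * (3 * (real N powr (1/p) / H powr (3/p)))"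
   using H n2 by (intro mult_left_mono) auto
  also have "\<dots> = 3 * (n2 * real N powr (1/p)) * (H / H powr (3/p))" by simp
  also have "n2 * real N powr (1/p) = sqrt (real N)"
  proof -
   have "theta / 2 + 1 / p = 1/2" unfolding theta(7) by (simp add: field_simps)
   then show ?thesis unfolding n2_def powr_add[symmetric] by (simp only: powr_half_sqrt of_nat_0_le_iff)
  qed
  also have "3 * sqrt (real N) * (H / H powr (3/p)) \<le> 3 * sqrt (real N) * 1"
  proof (intro mult_left_mono)
   have "H powr 1 \<le> H powr (3/p)" using H p by (intro powr_mono) auto
   then show "H / H powr (3/p) \<le> 1" using H by simp
  qed auto
  finally show ?thesis by (simp add: sum_distrib_left mult_ac)
 qed
 have "(\<Sum>l\<in>S. \<Sum>i<N. \<bar>u i \<bullet> opf (mul (piece (- good \<inter> {x. cell x = l})) (v i))\<bar>)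
   = (\<Sum>j<J. \<Sum>i<N. \<bar>u i \<bullet> opf (mul (piece (- good \<inter> {x. cell x = \<sigma> j})) (v i))\<bar>)"
  unfolding S_def using inj by (subst sum.reindex) (auto simp: inj_on_def inj_def)
 also have "\<dots> \<le> (\<Sum>j<J. L * (H * \<tau>) * (sqrt (A j) / n2 + n2 * (real j + 1) powr (- (1 / q))))"
  by (intro sum_mono cell)
 also have "\<dots> = L * \<tau> * (H * (\<Sum>j<J. sqrt (A j) / n2) + H * (\<Sum>j<J. n2 * (real j + 1) powr (- (1/q))))"
  by (simp add: sum_distrib_left sum.distrib distrib_left mult_ac)
 also have "\<dots> \<le> L * \<tau> * (4 / sqrt (p - 2) * sqrt (real N) + 3 * sqrt (real N))"
  using trace_const_nonneg[where 'n='n] \<tau> by (intro mult_left_mono add_mono s1 s2) (auto simp: L_def)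
 \<comment> \<open>The second summand receives the factor 1 / sqrt (p - 2) too, which is at least 1
   for p \<le> 3.\<close>
 also have "\<dots> \<le> L * \<tau> * (4 / sqrt (p - 2) * sqrt (real N) + 3 / sqrt (p - 2) * sqrt (real N))"
  using trace_const_nonneg[where 'n='n] \<tau> p
  by (intro mult_left_mono add_mono mult_right_mono) (auto simp: L_def field_simps)
 finally show ?thesis by (simp add: L_def field_simps)
qed

lemma all_parts:
 assumes u: "orthonormal N u" and v: "orthonormal N v"
 shows "(\<Sum>i<N. \<bar>u i \<bullet> opf (mul g (v i))\<bar>) \<le> core_const TYPE('n) * \<tau> * Hp / sqrt (p - 2) * sqrt (real N)"
proof -
 let ?T = "- good \<inter> {x. cell x \<notin> S}"
 let ?P = "\<lambda>l. - good \<inter> {x. cell x = l}"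
 have finS: "finite S" by (simp add: S_def)
 have meas: "?T \<in> sets lebesgue" "?P l \<in> sets lebesgue" for l
  by (intro sets.Int bad_measurable sets_cells_lebesgue)+
 note bm = piece_bounded_measurable[OF good_measurable] piece_bounded_measurable[OF meas(1)] piece_bounded_measurable[OF meas(2)]
 have "g = (\<lambda>x. piece good x + (piece ?T x + (\<Sum>l\<in>S. piece (?P l) x)))"
 proof
  fix x
  have "(\<Sum>l\<in>S. piece (?P l) x) = (\<Sum>l\<in>S. if cell x = l then piece (- good) x else 0)"
   by (intro sum.cong) (auto simp: indicator_def)
  also have "\<dots> = (if cell x \<in> S then piece (- good) x else 0)" using finS by simp
  finally show "g x = piece good x + (piece ?T x + (\<Sum>l\<in>S. piece (?P l) x))"
   by (auto simp: indicator_def)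
 qed
 then have "mul g = mul (\<lambda>x. piece good x + (piece ?T x + (\<Sum>l\<in>S. piece (?P l) x)))" by (rule arg_cong)
 then have "mul g w = mul (piece good) w + (mul (piece ?T) w + (\<Sum>l\<in>S. mul (piece (?P l)) w))" for w
  using bm mul_sum_left[OF finS, of "\<lambda>l. piece (?P l)"] finS
  by (simp add: mul_add_left bounded_measurable_add)
 then have split: "opf (mul g w) = opf (mul (piece good) w) + (opf (mul (piece ?T) w) + (\<Sum>l\<in>S. opf (mul (piece (?P l)) w)))" for w
  using linear_add[OF bounded_linear.linear[OF opf_linear]] linear_sum[OF bounded_linear.linear[OF opf_linear]] by simp
 have "(\<Sum>i<N. \<bar>u i \<bullet> opf (mul g (v i))\<bar>)
   \<le> (\<Sum>i<N. \<bar>u i \<bullet> opf (mul (piece good) (v i))\<bar> + (\<bar>u i \<bullet> opf (mul (piece ?T) (v i))\<bar>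
     + (\<Sum>l\<in>S. \<bar>u i \<bullet> opf (mul (piece (?P l)) (v i))\<bar>)))"
  unfolding split inner_add_right inner_sum_right
  by (intro sum_mono order_trans[OF abs_triangle_ineq] add_left_mono add_mono order_refl sum_abs)
 also have "\<dots> = (\<Sum>i<N. \<bar>u i \<bullet> opf (mul (piece good) (v i))\<bar>) + ((\<Sum>i<N. \<bar>u i \<bullet> opf (mul (piece ?T) (v i))\<bar>)
     + (\<Sum>l\<in>S. \<Sum>i<N. \<bar>u i \<bullet> opf (mul (piece (?P l)) (v i))\<bar>))"
  unfolding sum.distrib by (subst (2) sum.swap) simp
 also have "\<dots> \<le> \<tau> * sqrt (real N) + (7 * fconst TYPE('n) * (\<tau> * Hp / sqrt (p - 2)) * sqrt (real N)
   + 7 * trace_const TYPE('n) * (\<tau> / sqrt (p - 2)) * sqrt (real N))"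
  by (intro add_mono good_part tail_part head_part u v)
 also have "\<dots> \<le> (\<tau> * Hp / sqrt (p - 2)) * sqrt (real N) + (7 * fconst TYPE('n) * (\<tau> * Hp / sqrt (p - 2)) * sqrt (real N)
   + 7 * trace_const TYPE('n) * (\<tau> * Hp / sqrt (p - 2)) * sqrt (real N))"
 proof -
  have 1: "\<tau> \<le> \<tau> * Hp" using Hp(1) \<tau> by (simp add: mult_le_cancel_left1)
  have s: "0 < sqrt (p - 2)" "sqrt (p - 2) \<le> 1" using p by auto
  have 2: "\<tau> / sqrt (p - 2) \<le> \<tau> * Hp / sqrt (p - 2)" using 1 s by (intro divide_right_mono) auto
  have "\<tau> * sqrt (p - 2) \<le> \<tau>" using s \<tau> by (simp add: mult_left_le)
  then have "\<tau> \<le> \<tau> / sqrt (p - 2)" using s by (simp add: field_simps)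
  with 2 have "\<tau> \<le> \<tau> * Hp / sqrt (p - 2)" by simp
  moreover have "0 \<le> \<tau> * Hp / sqrt (p - 2)" using \<tau> Hp(1) s by simp
  ultimately show ?thesis using 2 trace_const_nonneg[where 'n='n] fconst_pos[where 'n='n]
   by (intro add_mono mult_right_mono mult_left_mono) auto
 qed
 also have "\<dots> = core_const TYPE('n) * \<tau> * Hp / sqrt (p - 2) * sqrt (real N)"
  using p by (simp add: core_const_def field_simps)
 finally show ?thesis .
qed

end

lemma core_bound:
 "ky_fan_bound (\<lambda>u. mul f (rotate_l2 \<i> (mul g u))) (core_const TYPE('n) * \<tau> * H powr (3 * (p - 2) / 2) / sqrt (p - 2))"
 unfolding ky_fan_bound_def
proof (intro allI impI)
 fix N and u v :: "nat \<Rightarrow> 'n l2"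
 assume "orthonormal N u" "orthonormal N v"
 then show "(\<Sum>i<N. \<bar>u i \<bullet> mul f (rotate_l2 \<i> (mul g (v i)))\<bar>)
   \<le> core_const TYPE('n) * \<tau> * H powr (3 * (p - 2) / 2) / sqrt (p - 2) * sqrt (real N)"
 proof (cases "N = 0")
  case False
  then have N: "1 \<le> N" by simp
  show ?thesis
   using all_parts[OF N \<open>orthonormal N u\<close> \<open>orthonormal N v\<close>] unfolding Hp_def[OF N] .
 qed simp
qed

end

section \<open>Windows of Hermite functions\<close>

text \<open>A Hermite function with the weight divided out. As a combination of three Hermite
  functions it still decays, and so does its Fourier transform: in one variable, it provides the
  factor \<open>\<phi>\<close> of \<open>core_bound\<close>.\<close>

definition wherm :: "nat \<Rightarrow> real \<Rightarrow> real" where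
 "wherm k t = (1 + t^2) * herm k t"

definition wherm_hat :: "nat \<Rightarrow> real \<Rightarrow> complex" where
 "wherm_hat k \<xi> = (LINT x|lborel. phase (x * \<xi>) * of_real (wherm k x)) / of_real (sqrt (2 * pi))"

lemma wherm_measurable[measurable]: "wherm k \<in> borel_measurable borel" "wherm_hat k \<in> borel_measurable borel"
 unfolding wherm_def[abs_def] wherm_hat_def[abs_def] by measurable

lemma wherm_expand:
 obtains c :: "nat \<Rightarrow> real" where "\<And>t. wherm k t = c 0 * herm (k - 2) t + c 1 * herm k t + c 2 * herm (k + 2) t"
  "\<bar>c 0\<bar> + \<bar>c 1\<bar> + \<bar>c 2\<bar> \<le> 5 * (real k + 2)^2"
proof -
 define a b where "a j = sqrt ((real j + 1) / 2)" and "b j = sqrt (real j / 2)" for j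
 have rec: "t * herm j t = a j * herm (Suc j) t + b j * herm (j - 1) t" for j t
  using herm_rec[of t j] by (simp add: a_def b_def)
 have ab: "0 \<le> a j" "a j \<le> real j + 1" "0 \<le> b j" "b j \<le> real j + 1" for j
  by (auto simp: a_def b_def power2_eq_square algebra_simps intro!: real_le_lsqrt)
 have p: "0 \<le> x * y" "x * y \<le> (real k + 2)^2" if "0 \<le> x" "x \<le> real k + 2" "0 \<le> y" "y \<le> real k + 2" for x y :: real
  using that mult_mono[of x "real k + 2" y "real k + 2"] by (simp_all add: power2_eq_square)
 define c where "c = (\<lambda>i::nat. if i = 0 then b k * b (k - 1) else if i = 1 then 1 + a k * b (Suc k) + b k * a (k - 1) else a k * a (Suc k))"
 \<comment> \<open>For k = 0 the index k - 1 is truncated to 0, but then the coefficient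
   \<open>b k\<close> vanishes.\<close>
 have d: "b k * herm (Suc (k - 1)) t = b k * herm k t" for t by (cases k) (simp_all add: b_def)
 have "wherm k t = c 0 * herm (k - 2) t + c 1 * herm k t + c 2 * herm (k + 2) t" for t
 proof -
  have "wherm k t = herm k t + t * (a k * herm (Suc k) t + b k * herm (k - 1) t)"
   unfolding rec[symmetric] by (simp add: wherm_def power2_eq_square algebra_simps)
  also have "\<dots> = herm k t + a k * (t * herm (Suc k) t) + b k * (t * herm (k - 1) t)"
   by (simp add: algebra_simps)
  also have "\<dots> = herm k t + a k * (a (Suc k) * herm (k + 2) t + b (Suc k) * herm k t)
    + (a (k - 1) * (b k * herm (Suc (k - 1)) t) + b k * b (k - 1) * herm (k - 2) t)"
   unfolding rec by (simp add: algebra_simps numeral_2_eq_2)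
  finally show ?thesis unfolding d by (simp add: c_def algebra_simps)
 qed
 moreover have "\<bar>c 0\<bar> + \<bar>c 1\<bar> + \<bar>c 2\<bar> \<le> 5 * (real k + 2)^2"
 proof -
  have k: "a k \<le> real k + 2" "a (Suc k) \<le> real k + 2" "b k \<le> real k + 2" "b (Suc k) \<le> real k + 2"
    "a (k - 1) \<le> real k + 2" "b (k - 1) \<le> real k + 2"
   using ab[of k] ab[of "Suc k"] ab[of "k - 1"] by auto
  note p' = p[OF ab(3) k(3) ab(3) k(6)] p[OF ab(1) k(1) ab(3) k(4)] p[OF ab(3) k(3) ab(1) k(5)] p[OF ab(1) k(1) ab(1) k(2)]
  \<comment> \<open>The coefficients consist of 1 and four products, each at most (k + 2)^2, whence
    the constant 5.\<close>
  have "1 \<le> (real k + 2)^2" by (simp add: power2_eq_square algebra_simps)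
  moreover have "\<bar>c 0\<bar> + \<bar>c 1\<bar> + \<bar>c 2\<bar> = b k * b (k - 1) + (1 + a k * b (Suc k) + b k * a (k - 1)) + a k * a (Suc k)"
   using p' by (simp add: c_def)
  ultimately show ?thesis using p' by linarith
 qed
 ultimately show thesis using that by blast
qed

lemma herm_bound_shift: "j \<le> k + 2 \<Longrightarrow> \<bar>herm j t\<bar> \<le> 4 * (real k + 6)^3 * inverse (1 + t^2)"
proof -
 assume j: "j \<le> k + 2"
 have "4 * (real j + 4)^3 * inverse (1 + t^2) \<le> 4 * (real k + 6)^3 * inverse (1 + t^2)"
  using j by (intro mult_right_mono mult_left_mono power_mono) (auto simp: add_nonneg_nonneg)
 then show ?thesis using herm_bound[of j t] by simp
qed

lemma wherm_combination_bound:
 fixes c0 c1 c2 h0 h1 h2 :: complex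
 assumes "cmod h0 \<le> B" "cmod h1 \<le> B" "cmod h2 \<le> B" "cmod c0 + cmod c1 + cmod c2 \<le> A"
 shows "cmod (c0 * h0 + c1 * h1 + c2 * h2) \<le> A * B"
proof -
 have "cmod (c0 * h0 + c1 * h1 + c2 * h2) \<le> cmod c0 * cmod h0 + cmod c1 * cmod h1 + cmod c2 * cmod h2"
  using norm_triangle_ineq[of "c0 * h0 + c1 * h1" "c2 * h2"] norm_triangle_ineq[of "c0 * h0" "c1 * h1"] by (simp add: norm_mult)
 also have "\<dots> \<le> cmod c0 * B + cmod c1 * B + cmod c2 * B"
  using assms by (intro add_mono mult_left_mono) auto
 also have "\<dots> = (cmod c0 + cmod c1 + cmod c2) * B" by (simp add: algebra_simps)
 also have "\<dots> \<le> A * B" using assms(4) order_trans[OF norm_ge_zero assms(1)] by (rule mult_right_mono)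
 finally show ?thesis .
qed

text \<open>Coefficients of order k^2 and Hermite functions of order k^3 give the power 5. The
  transform is a combination with coefficients of the same moduli, because the eigenvalues of
  Hermite functions have modulus 1.\<close>

lemma wherm_bound: "\<bar>wherm k t\<bar> \<le> 20 * (real k + 6)^5 * inverse (1 + t^2)"
 and wherm_hat_bound: "cmod (wherm_hat k t) \<le> 20 * (real k + 6)^5 * inverse (1 + t^2)"
 and wherm_integrable: "integrable lborel (wherm k)"
proof -
 obtain c where c: "\<And>t. wherm k t = c 0 * herm (k - 2) t + c 1 * herm k t + c 2 * herm (k + 2) t"
  "\<bar>c 0\<bar> + \<bar>c 1\<bar> + \<bar>c (2::nat)\<bar> \<le> 5 * (real k + 2)^2" using wherm_expand by blast
 define B where "B = 4 * (real k + 6)^3 * inverse (1 + t^2)"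
 have c': "cmod (of_real (c 0)) + cmod (of_real (c 1)) + cmod (of_real (c 2)) \<le> 5 * (real k + 2)^2"
  using c(2) by simp
 have "5 * (real k + 2)^2 * B \<le> 5 * (real k + 6)^2 * B"
  unfolding B_def by (intro mult_right_mono mult_left_mono power_mono) (auto simp: add_nonneg_nonneg)
 also have "\<dots> = 20 * (real k + 6)^5 * inverse (1 + t^2)"
  unfolding B_def by (simp add: power_add[symmetric, of _ 2 3, simplified])
 finally have B: "5 * (real k + 2)^2 * B \<le> 20 * (real k + 6)^5 * inverse (1 + t^2)" .
 have b: "\<bar>herm (k - 2) t\<bar> \<le> B" "\<bar>herm k t\<bar> \<le> B" "\<bar>herm (k + 2) t\<bar> \<le> B"
  unfolding B_def by (rule herm_bound_shift; simp)+
 have "\<bar>wherm k t\<bar> = cmod (of_real (c 0) * of_real (herm (k - 2) t) + of_real (c 1) * of_real (herm k t) + of_real (c 2) * of_real (herm (k + 2) t))"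
  unfolding c(1) by (simp flip: of_real_mult of_real_add)
 also have "\<dots> \<le> 5 * (real k + 2)^2 * B" using b by (intro wherm_combination_bound c') simp_all
 also note B
 finally show "\<bar>wherm k t\<bar> \<le> 20 * (real k + 6)^5 * inverse (1 + t^2)" .
 have hi: "integrable lborel (herm j)" for j using herm_integrable[of 0 j] by simp
 show "integrable lborel (wherm k)" unfolding c(1)[abs_def] by (intro Bochner_Integration.integrable_add integrable_mult_right hi)
 define I where "I j = (LINT x|lborel. phase (x * t) * complex_of_real (herm j x))" for j
 have I: "I j = of_real (sqrt (2 * pi)) * ((- \<i>)^j * of_real (herm j t))" for j
  unfolding I_def herm_fourier by (simp add: mult.assoc)
 have ei: "integrable lborel (\<lambda>x. phase (x * t) * complex_of_real (herm j x))" for j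
  by (rule Bochner_Integration.integrable_bound[OF hi[of j]]) (auto simp: norm_mult)
 have "(LINT x|lborel. phase (x * t) * of_real (wherm k x))
  = (LINT x|lborel. of_real (c 0) * (phase (x * t) * complex_of_real (herm (k - 2) x))
    + of_real (c 1) * (phase (x * t) * complex_of_real (herm k x))
    + of_real (c 2) * (phase (x * t) * complex_of_real (herm (k + 2) x)))"
  unfolding c(1) by (simp add: algebra_simps)
 also have "\<dots> = of_real (c 0) * I (k - 2) + of_real (c 1) * I k + of_real (c 2) * I (k + 2)"
  unfolding I_def using ei
  by (subst Bochner_Integration.integral_add, (intro Bochner_Integration.integrable_add integrable_mult_right; simp)+,
    subst Bochner_Integration.integral_add, (intro integrable_mult_right; simp)+, simp only: integral_mult_right_zero)
 also have "\<dots> = of_real (sqrt (2 * pi)) * (of_real (c 0) * ((- \<i>)^(k - 2) * of_real (herm (k - 2) t))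
   + of_real (c 1) * ((- \<i>)^k * of_real (herm k t)) + of_real (c 2) * ((- \<i>)^(k + 2) * of_real (herm (k + 2) t)))"
  by (simp only: I distrib_left mult_ac)
 finally have "wherm_hat k t = of_real (c 0) * ((- \<i>)^(k - 2) * of_real (herm (k - 2) t))
   + of_real (c 1) * ((- \<i>)^k * of_real (herm k t)) + of_real (c 2) * ((- \<i>)^(k + 2) * of_real (herm (k + 2) t))"
  unfolding wherm_hat_def by (simp only: nonzero_mult_div_cancel_left of_real_eq_0_iff real_sqrt_eq_zero_cancel_iff) simp
 also have "cmod \<dots> \<le> 5 * (real k + 2)^2 * B"
  using b by (intro wherm_combination_bound c') (simp_all add: norm_mult norm_power)
 also note B
 finally show "cmod (wherm_hat k t) \<le> 20 * (real k + 6)^5 * inverse (1 + t^2)" .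
qed

definition wherm_vec :: "('n::finite \<Rightarrow> nat) \<Rightarrow> real ^ 'n \<Rightarrow> real" where
 "wherm_vec \<alpha> x = (\<Prod>i\<in>UNIV. wherm (\<alpha> i) (x $ i))"

definition wherm_vec_hat :: "('n::finite \<Rightarrow> nat) \<Rightarrow> real ^ 'n \<Rightarrow> complex" where
 "wherm_vec_hat \<alpha> \<xi> = (\<Prod>i\<in>UNIV. wherm_hat (\<alpha> i) (\<xi> $ i))"

lemma wherm_vec_measurable[measurable]: "wherm_vec \<alpha> \<in> borel_measurable borel" "wherm_vec_hat \<alpha> \<in> borel_measurable borel"
 unfolding wherm_vec_def[abs_def] wherm_vec_hat_def[abs_def]
 by (intro borel_measurable_prod measurable_compose[OF _ wherm_measurable(1)] measurable_compose[OF _ wherm_measurable(2)]; simp)+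

lemma herm_vec_wherm: "herm_vec \<alpha> x = decay_weight x * wherm_vec \<alpha> x"
proof -
 have "1 + (x $ i)^2 \<noteq> 0" for i using add_pos_nonneg[of 1 "(x $ i)^2"] by simp
 then show ?thesis
  unfolding herm_vec_def decay_weight_def wherm_vec_def prod.distrib[symmetric]
  by (intro prod.cong) (auto simp: wherm_def)
qed

definition wherm_const :: "'n::finite itself \<Rightarrow> nat \<Rightarrow> real" where
 "wherm_const _ M = (20 * (real M + 6)^5)^CARD('n)"

lemma wherm_prod_bound:
 fixes x :: "real ^ 'n::finite" and \<alpha> :: "'n \<Rightarrow> nat"
 assumes "\<And>i. \<alpha> i \<le> M" "\<And>i. h i \<le> 20 * (real (\<alpha> i) + 6)^5 * inverse (1 + (x $ i)^2)" "\<And>i. 0 \<le> h i"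
 shows "(\<Prod>i\<in>UNIV. h i) \<le> wherm_const TYPE('n) M * decay_weight x"
proof -
 have "(\<Prod>i\<in>UNIV. h i) \<le> (\<Prod>i\<in>UNIV. 20 * (real M + 6)^5 * inverse (1 + (x $ i)^2))"
 proof (intro prod_mono conjI assms(3))
  fix i
  have "20 * (real (\<alpha> i) + 6)^5 * inverse (1 + (x $ i)^2) \<le> 20 * (real M + 6)^5 * inverse (1 + (x $ i)^2)"
   using assms(1)[of i] by (intro mult_right_mono mult_left_mono power_mono) (auto simp: add_nonneg_nonneg)
  then show "h i \<le> 20 * (real M + 6)^5 * inverse (1 + (x $ i)^2)" using assms(2)[of i] by simp
 qed
 then show ?thesis by (simp add: prod.distrib wherm_const_def decay_weight_def)
qed

lemma wherm_vec_bound: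
 fixes \<alpha> :: "'n::finite \<Rightarrow> nat"
 assumes "\<And>i. \<alpha> i \<le> M"
 shows "\<bar>wherm_vec \<alpha> x\<bar> \<le> wherm_const TYPE('n) M * decay_weight x"
  and "cmod (wherm_vec_hat \<alpha> x) \<le> wherm_const TYPE('n) M * decay_weight x"
 unfolding wherm_vec_def abs_prod wherm_vec_hat_def prod_norm[symmetric]
 by (rule wherm_prod_bound[OF assms], rule wherm_bound wherm_hat_bound, simp)+

lemma wherm_vec_fourier:
 fixes \<xi> :: "real ^ 'n::finite"
 shows "(LINT x|lborel. phase (x \<bullet> \<xi>) * of_real (wherm_vec \<alpha> x))
  = of_real (sqrt (2 * pi)) ^ CARD('n) * wherm_vec_hat \<alpha> \<xi>"
proof -
 have "phase (x \<bullet> \<xi>) * of_real (wherm_vec \<alpha> x)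
   = (\<Prod>i\<in>UNIV. phase (x $ i * \<xi> $ i) * of_real (wherm (\<alpha> i) (x $ i)))" for x :: "real^'n"
  unfolding prod.distrib by (simp add: wherm_vec_def inner_vec_sum sum_distrib_left exp_sum flip: sum_negf)
 then have "(LINT x|lborel. phase (x \<bullet> \<xi>) * of_real (wherm_vec \<alpha> x))
  = (\<Prod>i\<in>UNIV. (LINT t|lborel. phase (t * \<xi> $ i) * of_real (wherm (\<alpha> i) t)))"
 proof (simp only:, subst integral_prod_vec)
  show "integrable lborel (\<lambda>t. phase (t * \<xi> $ i) * complex_of_real (wherm (\<alpha> i) t))" for i
   by (rule Bochner_Integration.integrable_bound[OF wherm_integrable[of "\<alpha> i"]]) (auto simp: norm_mult)
 qed simp
 also have "\<dots> = (\<Prod>i\<in>UNIV. of_real (sqrt (2 * pi)) * wherm_hat (\<alpha> i) (\<xi> $ i))"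
  by (simp add: wherm_hat_def)
 finally show ?thesis by (simp add: prod.distrib wherm_vec_hat_def)
qed

lemma fconst_sqrt: "complex_of_real (fconst TYPE('n::finite)) * of_real (sqrt (2 * pi)) ^ CARD('n) = 1"
proof -
 have "sqrt (2 * pi) ^ CARD('n) = (2 * pi) powr (1 / 2 * real CARD('n))"
  unfolding powr_powr[symmetric] by (subst powr_realpow) (simp_all add: powr_half_sqrt)
 then have "fconst TYPE('n) * sqrt (2 * pi) ^ CARD('n) = 1"
  by (simp add: fconst_def flip: powr_add)
 then show ?thesis by (metis of_real_1 of_real_mult of_real_power)
qed

text \<open>The factors are normalized to the unit balls of the two weak spaces; the exponent 2 * (1
  - 1/p) is 2/q. The product only dominates the square of \<open>g\<close>, so that truncations of a
  symbol inherit the property.\<close>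

definition weak_factorable :: "'n::finite fn \<Rightarrow> real \<Rightarrow> bool" where
 "weak_factorable g p \<longleftrightarrow> (\<exists>a b (\<sigma> :: nat \<Rightarrow> int ^ 'n). a \<in> borel_measurable lebesgue \<and> b \<in> borel_measurable lebesgue \<and>
   (\<forall>x. 0 \<le> a x \<and> 0 \<le> b x \<and> (cmod (g x))^2 \<le> a x * b x) \<and>
   (\<forall>t>0. emeasure lebesgue {x. t < a x} \<le> ennreal (t powr (- p))) \<and> inj \<sigma> \<and>
   (\<forall>j. (\<integral>\<^sup>+ x. ennreal ((b x)^2 * on_cell (\<sigma> j) x) \<partial>lebesgue)
    \<le> ennreal ((real j + 1) powr (- (2 * (1 - 1/p))))) \<and>
   (AE x in lebesgue. b x = 0 \<or> cell x \<in> range \<sigma>))"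

lemma weak_factorable_mono:
 assumes h: "weak_factorable h p" and le: "\<And>x. cmod (g x) \<le> cmod (h x)"
 shows "weak_factorable g p"
proof -
 have "(cmod (g x))^2 \<le> (cmod (h x))^2" for x using le by (intro power_mono) auto
 then show ?thesis using h unfolding weak_factorable_def by (meson order_trans)
qed

text \<open>The second factor bounds the number of indices with components up to M. It pays for
  passing from the l1 norm to the l2 norm of the coefficients.\<close>

definition window_const :: "'n::finite itself \<Rightarrow> nat \<Rightarrow> real" where
 "window_const T M = wherm_const T M * (real M + 1)^CARD('n)"

lemma one_le_window_const: "1 \<le> window_const TYPE('n::finite) M"
proof -
 have "1 \<le> (real M + 6)^5" by (rule one_le_power) simp
 then have "1 \<le> 20 * (real M + 6)^5" by linarith
 then have "1 \<le> (20 * (real M + 6)^5)^CARD('n)" by (rule one_le_power)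
 moreover have "1 \<le> (real M + 1)^CARD('n)" by (rule one_le_power) simp
 ultimately show ?thesis unfolding window_const_def wherm_const_def using mult_mono[of 1 _ 1] by force
qed

text \<open>Dividing the weight out of a finite Hermite sum gives the factorization required by
  \<open>core_bound\<close>. The pointwise bounds involve the l1 norm of the coefficients, which is
  at most their l2 norm \<open>\<tau>\<close> times the root of the number of indices.\<close>

lemma hermite_window_core:
 fixes W :: "('n::finite \<Rightarrow> nat) set" and c :: "('n \<Rightarrow> nat) \<Rightarrow> complex" and g :: "'n fn"
 assumes W: "finite W" "\<And>\<alpha> i. \<alpha> \<in> W \<Longrightarrow> \<alpha> i \<le> M"
  and g: "bounded_measurable g" "weak_factorable g p" and p: "2 < p" "p \<le> 3"
 shows "ky_fan_bound (\<lambda>u. mul (\<lambda>x. \<Sum>\<alpha>\<in>W. c \<alpha> * of_real (herm_vec \<alpha> x)) (rotate_l2 \<i> (mul g u)))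
  (core_const TYPE('n) * sqrt (\<Sum>\<alpha>\<in>W. (cmod (c \<alpha>))^2) * window_const TYPE('n) M powr (3 * (p - 2) / 2) / sqrt (p - 2))"
proof -
 define H where "H = window_const TYPE('n) M"
 define \<tau> where "\<tau> = sqrt (\<Sum>\<alpha>\<in>W. (cmod (c \<alpha>))^2)"
 define \<phi> where "\<phi> x = (\<Sum>\<alpha>\<in>W. c \<alpha> * of_real (wherm_vec \<alpha> x))" for x
 define F where "F \<xi> = (\<Sum>\<alpha>\<in>W. c \<alpha> * wherm_vec_hat \<alpha> \<xi>)" for \<xi>
 have K0: "0 \<le> wherm_const TYPE('n) M" by (simp add: wherm_const_def)
 have cW: "real (card W) \<le> (real M + 1)^CARD('n)"
 proof -
  have "card W \<le> card {\<alpha> :: 'n \<Rightarrow> nat. \<forall>i. \<alpha> i \<le> M}"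
   using W by (intro card_mono finite_bounded_index) auto
  then have "real (card W) \<le> real (Suc M ^ CARD('n))" unfolding card_bounded_index by (simp only: of_nat_le_iff)
  then show ?thesis by (simp add: add.commute)
 qed
 have s1: "(\<Sum>\<alpha>\<in>W. cmod (c \<alpha>)) \<le> (real M + 1)^CARD('n) * \<tau>"
 proof -
  have "(\<Sum>\<alpha>\<in>W. cmod (c \<alpha>)) \<le> sqrt (real (card W)) * \<tau>"
   using L2_set_mult_ineq[of "\<lambda>_. 1" "\<lambda>\<alpha>. cmod (c \<alpha>)" W] by (simp add: L2_set_def \<tau>_def)
  also have "\<dots> \<le> (real M + 1)^CARD('n) * \<tau>"
  proof (intro mult_right_mono)
   have "(real M + 1)^CARD('n) \<le> ((real M + 1)^CARD('n))^2"
    using one_le_power[of "real M + 1" "CARD('n)"] by (simp add: power2_eq_square)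
   then show "sqrt (real (card W)) \<le> (real M + 1)^CARD('n)" using cW by (intro real_le_lsqrt) auto
  qed (simp add: \<tau>_def sum_nonneg)
  finally show ?thesis .
 qed
 have comb: "cmod (\<Sum>\<alpha>\<in>W. c \<alpha> * h \<alpha>) \<le> H * \<tau> * decay_weight x"
  if h: "\<And>\<alpha>. \<alpha> \<in> W \<Longrightarrow> cmod (h \<alpha>) \<le> wherm_const TYPE('n) M * decay_weight x" for h and x :: "real ^ 'n"
 proof -
  have "cmod (\<Sum>\<alpha>\<in>W. c \<alpha> * h \<alpha>) \<le> (\<Sum>\<alpha>\<in>W. cmod (c \<alpha>) * (wherm_const TYPE('n) M * decay_weight x))"
   using h by (intro sum_norm_le) (simp add: norm_mult mult_left_mono)
  also have "\<dots> = (\<Sum>\<alpha>\<in>W. cmod (c \<alpha>)) * (wherm_const TYPE('n) M * decay_weight x)" by (simp add: sum_distrib_right)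
  also have "\<dots> \<le> ((real M + 1)^CARD('n) * \<tau>) * (wherm_const TYPE('n) M * decay_weight x)"
   using K0 decay_weight_pos[of x] by (intro mult_right_mono s1) auto
  finally show ?thesis by (simp add: H_def window_const_def mult_ac)
 qed
 have \<phi>m: "\<phi> \<in> borel_measurable borel" and Fm: "F \<in> borel_measurable borel"
  unfolding \<phi>_def F_def by measurable
 have \<phi>b: "cmod (\<phi> x) \<le> H * \<tau> * decay_weight x" for x
  unfolding \<phi>_def by (rule comb, subst norm_of_real) (rule wherm_vec_bound(1)[OF W(2)])
 have Fb: "cmod (F \<xi>) \<le> H * \<tau> * decay_weight \<xi>" for \<xi>
  unfolding F_def by (rule comb) (rule wherm_vec_bound(2)[OF W(2)])
 have wi: "integrable lborel (\<lambda>x. phase (x \<bullet> \<xi>) * complex_of_real (wherm_vec \<alpha> x))" if "\<alpha> \<in> W" for \<alpha> \<xi>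
 proof (rule Bochner_Integration.integrable_bound)
  show "integrable lborel (\<lambda>x::real^'n. wherm_const TYPE('n) M * decay_weight x)" by (intro integrable_mult_right decay_weight_integrable)
  show "AE x in lborel. norm (phase (x \<bullet> \<xi>) * complex_of_real (wherm_vec \<alpha> x)) \<le> norm (wherm_const TYPE('n) M * decay_weight x)"
   by (intro AE_I2, simp add: norm_mult) (rule order_trans[OF wherm_vec_bound(1)[OF W(2)[OF that]] abs_ge_self])
 qed measurable
 have F: "fourier_integral \<phi> \<xi> = F \<xi>" for \<xi>
 proof -
  have "fourier_integral \<phi> \<xi> = of_real (fconst TYPE('n)) * (LINT x|lborel. phase (x \<bullet> \<xi>) * \<phi> x)"
   unfolding fourier_integral_def fconst_def using \<phi>m by (subst lebesgue_integral_borel) auto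
  also have "(LINT x|lborel. phase (x \<bullet> \<xi>) * \<phi> x)
    = (LINT x|lborel. (\<Sum>\<alpha>\<in>W. c \<alpha> * (phase (x \<bullet> \<xi>) * complex_of_real (wherm_vec \<alpha> x))))"
   by (simp add: \<phi>_def sum_distrib_left mult_ac)
  also have "\<dots> = (\<Sum>\<alpha>\<in>W. c \<alpha> * (of_real (sqrt (2 * pi)) ^ CARD('n) * wherm_vec_hat \<alpha> \<xi>))"
   by (subst Bochner_Integration.integral_sum, rule integrable_mult_right, erule wi)
    (simp only: integral_mult_right_zero wherm_vec_fourier)
  also have "of_real (fconst TYPE('n)) * \<dots> = (of_real (fconst TYPE('n)) * of_real (sqrt (2 * pi)) ^ CARD('n)) * F \<xi>"
   by (simp add: F_def sum_distrib_left sum_distrib_right mult_ac)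
  finally show ?thesis unfolding fconst_sqrt by simp
 qed
 have f: "(\<Sum>\<alpha>\<in>W. c \<alpha> * of_real (herm_vec \<alpha> x)) = of_real (decay_weight x) * \<phi> x" for x
  by (simp add: \<phi>_def herm_vec_wherm sum_distrib_left mult_ac)
 have \<tau>2: "(LINT x|lebesgue. (cmod (\<Sum>\<alpha>\<in>W. c \<alpha> * of_real (herm_vec \<alpha> x)))^2) \<le> \<tau>^2"
 proof -
  have ae: "AE x in lebesgue. rep (\<Sum>\<alpha>\<in>W. cs (c \<alpha>) (hv \<alpha>)) x = (\<Sum>\<alpha>\<in>W. c \<alpha> * of_real (herm_vec \<alpha> x))"
  proof -
   have "AE x in lebesgue. \<forall>\<alpha>\<in>W. rep (cs (c \<alpha>) (hv \<alpha>)) x = c \<alpha> * of_real (herm_vec \<alpha> x)"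
    unfolding hv_def cs_cls[OF herm_vec_L2] by (intro AE_finite_allI W rep_cls L2_scale herm_vec_L2)
   with rep_sum[OF W(1), of "\<lambda>\<alpha>. cs (c \<alpha>) (hv \<alpha>)"] show ?thesis by eventually_elim simp
  qed
  have "(LINT x|lebesgue. (cmod (\<Sum>\<alpha>\<in>W. c \<alpha> * of_real (herm_vec \<alpha> x)))^2) = (norm (\<Sum>\<alpha>\<in>W. cs (c \<alpha>) (hv \<alpha>)))^2"
   unfolding norm_sq
  proof (rule integral_cong_AE)
   show "AE x in lebesgue. (cmod (\<Sum>\<alpha>\<in>W. c \<alpha> * of_real (herm_vec \<alpha> x)))^2 = (cmod (rep (\<Sum>\<alpha>\<in>W. cs (c \<alpha>) (hv \<alpha>)) x))^2"
    using ae by eventually_elim simp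
   have "(\<lambda>x. (cmod (\<Sum>\<alpha>\<in>W. c \<alpha> * of_real (herm_vec \<alpha> x)))^2) \<in> borel_measurable borel" by measurable
   then show "(\<lambda>x. (cmod (\<Sum>\<alpha>\<in>W. c \<alpha> * of_real (herm_vec \<alpha> x)))^2) \<in> borel_measurable lebesgue"
    by (simp add: measurable_completion)
  qed measurable
  also have "\<dots> = \<tau>^2"
   by (subst norm_cin_orthonormal_sum[OF W(1)]) (auto simp: hv_orthonormal \<tau>_def sum_nonneg)
  finally show ?thesis by simp
 qed
 obtain a b and \<sigma> :: "nat \<Rightarrow> int ^ 'n" where ab: "a \<in> borel_measurable lebesgue" "b \<in> borel_measurable lebesgue"
   "\<forall>x. 0 \<le> a x \<and> 0 \<le> b x \<and> (cmod (g x))^2 \<le> a x * b x"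
   "\<forall>t>0. emeasure lebesgue {x. t < a x} \<le> ennreal (t powr (- p))" "inj \<sigma>"
   "\<forall>j. (\<integral>\<^sup>+ x. ennreal ((b x)^2 * on_cell (\<sigma> j) x) \<partial>lebesgue)
    \<le> ennreal ((real j + 1) powr (- (2 * (1 - 1/p))))"
   "AE x in lebesgue. b x = 0 \<or> cell x \<in> range \<sigma>"
  using g(2) unfolding weak_factorable_def by (elim exE conjE) (rule that)
 define q where "q = 1 / (1 - 1/p)"
 have q: "1/p + 1/q = 1" "2/q = 2 * (1 - 1/p)" by (simp_all add: q_def)
 show ?thesis
  unfolding H_def[symmetric] \<tau>_def[symmetric]
 proof (rule core_bound[of \<phi> H \<tau> F _ g a b p q \<sigma>])
  show "1 \<le> H" by (simp add: H_def one_le_window_const)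
  show "0 \<le> \<tau>" by (simp add: \<tau>_def sum_nonneg)
  show "(\<integral>\<^sup>+ x. ennreal ((b x)^2 * on_cell (\<sigma> j) x) \<partial>lebesgue) \<le> ennreal ((real j + 1) powr (- (2/q)))" for j
   unfolding q(2) using ab(6) by (rule spec)
 qed (use \<phi>m \<phi>b F Fb Fm f \<tau>2 g ab(1-5,7) q(1) p in simp_all)
qed

section \<open>Dyadic windows in the logarithm of the spectrum\<close>

definition osc_window :: "('n::finite \<Rightarrow> nat) \<Rightarrow> nat" where
 "osc_window \<alpha> = nat \<lfloor>log 2 (ln (osc_eigenvalue \<alpha>))\<rfloor>"

lemma osc_eigenvalue_ge: "exp (exp 1) \<le> osc_eigenvalue (\<alpha> :: 'n::finite \<Rightarrow> nat)"
 by (simp add: osc_eigenvalue_def field_simps)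

text \<open>All eigenvalues are at least exp (exp 1), so their logarithm is at least 2 and the
  window 0 is empty. This keeps n ln 2, a lower bound of the iterated logarithm, positive.\<close>

lemma osc_window:
 fixes \<alpha> :: "'n::finite \<Rightarrow> nat"
 shows "1 \<le> osc_window \<alpha>" "2 ^ osc_window \<alpha> \<le> ln (osc_eigenvalue \<alpha>)"
  "ln (osc_eigenvalue \<alpha>) < 2 ^ Suc (osc_window \<alpha>)"
proof -
 define L where "L = ln (osc_eigenvalue \<alpha>)"
 have pos: "0 < osc_eigenvalue \<alpha>" using osc_eigenvalue_ge[of \<alpha>] exp_gt_zero[of "exp 1 :: real"] by linarith
 have "exp 1 \<le> L" using osc_eigenvalue_ge[of \<alpha>] pos by (simp add: L_def ln_ge_iff)
 then have L: "2 \<le> L" using exp_ge_add_one_self[of 1] by linarith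
 then have l: "1 \<le> log 2 L" using log_le_cancel_iff[of 2 2 L] by simp
 then have f: "real (osc_window \<alpha>) = of_int \<lfloor>log 2 L\<rfloor>" by (simp add: osc_window_def L_def)
 have "1 \<le> \<lfloor>log 2 L\<rfloor>" using l by (simp add: le_floor_iff)
 with f show "1 \<le> osc_window \<alpha>" by linarith
 have "real (osc_window \<alpha>) \<le> log 2 L" unfolding f by simp
 then show "2 ^ osc_window \<alpha> \<le> ln (osc_eigenvalue \<alpha>)"
  using L by (simp add: le_log_iff powr_realpow flip: L_def)
 have "log 2 L < real (Suc (osc_window \<alpha>))" using f by (simp; linarith)
 then have "L < 2 powr real (Suc (osc_window \<alpha>))" using L by (simp only: log_less_iff)
 then show "ln (osc_eigenvalue \<alpha>) < 2 ^ Suc (osc_window \<alpha>)"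
  by (subst (asm) powr_realpow) (simp_all flip: L_def)
qed

definition window_size :: "'n::finite itself \<Rightarrow> nat \<Rightarrow> nat" where
 "window_size _ n = nat \<lfloor>real CARD('n) * exp (2 ^ Suc n)\<rfloor>"

lemma osc_window_index:
 fixes \<alpha> :: "'n::finite \<Rightarrow> nat"
 assumes "osc_window \<alpha> = n"
 shows "\<alpha> i \<le> window_size TYPE('n) n"
proof -
 have pos: "0 < osc_eigenvalue \<alpha>" using osc_eigenvalue_ge[of \<alpha>] exp_gt_zero[of "exp 1 :: real"] by linarith
 have "real (\<alpha> i) \<le> real (degree_of \<alpha>)" using component_le_degree[of \<alpha> i] by simp
 also have "\<dots> \<le> 1 * (2 * real (degree_of \<alpha>) + real CARD('n))" by simp
 also have "\<dots> \<le> exp (exp 1) * (2 * real (degree_of \<alpha>) + real CARD('n))"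
  by (intro mult_right_mono) auto
 also have "\<dots> = real CARD('n) * osc_eigenvalue \<alpha>" by (simp add: osc_eigenvalue_def)
 also have "\<dots> \<le> real CARD('n) * exp (2 ^ Suc n)"
 proof (rule mult_left_mono)
  have "osc_eigenvalue \<alpha> = exp (ln (osc_eigenvalue \<alpha>))" using pos by simp
  also have "\<dots> \<le> exp (2 ^ Suc n)" using osc_window(3)[of \<alpha>] assms by (subst exp_le_cancel_iff) simp
  finally show "osc_eigenvalue \<alpha> \<le> exp (2 ^ Suc n)" .
 qed simp
 finally show ?thesis unfolding window_size_def by (simp add: le_nat_floor)
qed

lemma finite_osc_window: "finite {\<alpha> :: 'n::finite \<Rightarrow> nat. osc_window \<alpha> = n}"
 by (rule finite_subset[OF _ finite_bounded_index[of "window_size TYPE('n) n"]]) (use osc_window_index in blast)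

text \<open>The indices in window n are at most of order exp (2^(n+1)), so
  \<open>window_const\<close> is at most exponential in 2^n, and a power with exponent of order 1 /
  2^n is bounded. This fixes the rate at which p approaches 2.\<close>

lemma window_const_powr:
 "\<exists>C\<ge>0. \<forall>n. \<forall>t. 0 \<le> t \<and> t \<le> 1 / 2 ^ n \<longrightarrow>
   window_const TYPE('n::finite) (window_size TYPE('n) n) powr (3 * t / 2) \<le> C"
proof (intro exI conjI allI impI)
 define d where "d = CARD('n)"
 define B where "B = (20 * (7 * real d)^6) ^ d"
 define A where "A = B * exp (18 * real d)"
 have d: "1 \<le> real d" using zero_less_card_finite[where 'a='n] by (simp add: d_def Suc_le_eq)
 have B1: "1 \<le> B" unfolding B_def
 proof (rule one_le_power)
  have "1 \<le> (7 * real d)^6" using d by (intro one_le_power) simp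
  then show "1 \<le> 20 * (7 * real d)^6" by linarith
 qed
 show "0 \<le> B powr 2 * exp (18 * real d)" by simp
 fix n :: nat and t :: real assume t: "0 \<le> t \<and> t \<le> 1 / 2^n"
 define M where "M = window_size TYPE('n) n"
 define E where "E = exp ((2::real) ^ Suc n)"
 have E: "1 \<le> E" by (simp add: E_def)
 have dE: "1 \<le> real d * E" using mult_mono[of 1 "real d" 1 E] d E by simp
 have M: "real M \<le> real d * E" unfolding M_def window_size_def E_def d_def by (simp add: floor_le_iff)
 have "window_const TYPE('n) M = (20 * ((real M + 6)^5 * (real M + 1))) ^ d"
  by (simp add: window_const_def wherm_const_def d_def power_mult_distrib mult_ac)
 also have "\<dots> \<le> (20 * ((7 * (real d * E))^5 * (7 * (real d * E)))) ^ d"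
  using M dE by (intro power_mono mult_mono) auto
 also have "(20 * ((7 * (real d * E))^5 * (7 * (real d * E)))) = 20 * (7 * real d)^6 * E^6"
  by (simp add: power_mult_distrib eval_nat_numeral)
 also have "\<dots> ^ d = B * exp (6 * real d * 2 ^ Suc n)"
  by (simp add: B_def E_def power_mult_distrib mult_ac flip: exp_of_nat_mult power_mult)
 finally have le: "window_const TYPE('n) M \<le> B * exp (6 * real d * 2 ^ Suc n)" .
 have "window_const TYPE('n) M powr (3 * t / 2) \<le> (B * exp (6 * real d * 2 ^ Suc n)) powr (3 * t / 2)"
  using t le one_le_window_const[where 'n='n, of M] by (intro powr_mono2) auto
 \<comment> \<open>The exponent is 6 d * 2^(n+1) * (3 t / 2) = 18 d * (2^n t).\<close>
 also have "\<dots> = B powr (3 * t / 2) * exp (18 * real d * (2 ^ n * t))"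
  using B1 by (simp add: powr_mult exp_powr_real mult_ac)
 also have "\<dots> \<le> B powr 2 * exp (18 * real d)"
 proof (intro mult_mono powr_mono)
  have "1 / 2 ^ n \<le> (1::real)" by simp
  then have "t \<le> 1" using t by linarith
  then show "3 * t / 2 \<le> 2" by simp
  have "2^n * t \<le> 1" using t by (simp add: field_simps)
  then show "exp (18 * real d * (2 ^ n * t)) \<le> exp (18 * real d)"
   using mult_left_mono[of "2^n * t" 1 "18 * real d"] by simp
 qed (use B1 in auto)
 finally show "window_const TYPE('n) (window_size TYPE('n) n) powr (3 * t / 2) \<le> B powr 2 * exp (18 * real d)"
  by (simp add: M_def)
qed

text \<open>The projection of v to a window as a function rather than a class, because the core
  estimate rests on pointwise bounds.\<close>

definition window_fun :: "nat \<Rightarrow> 'n::finite l2 \<Rightarrow> 'n fn" where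
 "window_fun n v x = (\<Sum>\<alpha> | osc_window \<alpha> = n. cin (hv \<alpha>) v * of_real (herm_vec \<alpha> x))"

lemma window_fun:
 fixes v :: "'n::finite l2"
 shows "bounded_measurable (window_fun n v)" and "AE x in lebesgue. rep (block osc_window n v) x = window_fun n v x"
proof -
 have b: "bounded_measurable (\<lambda>x. c * complex_of_real (herm_vec \<alpha> x))" for c and \<alpha> :: "'n \<Rightarrow> nat"
 proof (rule bounded_measurableI)
  have "(\<lambda>x. c * complex_of_real (herm_vec \<alpha> x)) \<in> borel_measurable borel" by measurable
  then show "(\<lambda>x. c * complex_of_real (herm_vec \<alpha> x)) \<in> borel_measurable lebesgue" by (simp add: measurable_completion)
  fix x
  have "\<bar>herm_vec \<alpha> x\<bar> \<le> hermite_const \<alpha> * 1"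
   by (rule order_trans[OF herm_vec_bound mult_left_mono[OF decay_weight_le_1 hermite_const_nonneg]])
  then show "cmod (c * complex_of_real (herm_vec \<alpha> x)) \<le> cmod c * (hermite_const \<alpha> * 1)"
   unfolding norm_mult norm_of_real by (rule mult_left_mono) simp
 qed
 have "bounded_measurable (\<lambda>x. \<Sum>\<alpha>\<in>W. c \<alpha> * complex_of_real (herm_vec \<alpha> x))"
  if "finite W" for c and W :: "('n \<Rightarrow> nat) set"
  using that
 proof (induction W rule: finite_induct)
  case (insert \<alpha> W)
  then show ?case using bounded_measurable_add[OF b insert.IH] by simp
 qed (auto simp: bounded_measurable_def)
 from this[OF finite_osc_window] show "bounded_measurable (window_fun n v)" unfolding window_fun_def[abs_def] .
 have "AE x in lebesgue. \<forall>\<alpha>\<in>{\<alpha>. osc_window \<alpha> = n}. rep (cs (cin (hv \<alpha>) v) (hv \<alpha>)) x = cin (hv \<alpha>) v * of_real (herm_vec \<alpha> x)"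
  unfolding hv_def cs_cls[OF herm_vec_L2] by (intro AE_finite_allI finite_osc_window rep_cls L2_scale herm_vec_L2)
 with rep_sum[OF finite_osc_window[of n], of "\<lambda>\<alpha>. cs (cin (hv \<alpha>) v) (hv \<alpha>)"]
 show "AE x in lebesgue. rep (block osc_window n v) x = window_fun n v x"
  unfolding block_def window_fun_def by eventually_elim simp
qed

text \<open>With p - 2 = \<eta> / 2^n the factor 1 / sqrt (p - 2) becomes sqrt (2^n / \<eta>), the
  only growth in n that is left.\<close>

lemma window_ky_fan:
 fixes \<eta> :: real
 assumes \<eta>: "0 < \<eta>" "\<eta> \<le> 1"
 shows "\<exists>C\<ge>0. \<forall>n v (g :: 'n::finite fn). bounded_measurable g \<longrightarrow> weak_factorable g (2 + \<eta> / 2 ^ n) \<longrightarrow>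
  ky_fan_bound (\<lambda>u. mul (window_fun n v) (rotate_l2 \<i> (mul g u))) (C * (norm (block osc_window n v) * sqrt (2 ^ n)))"
proof -
 obtain C where C: "0 \<le> C" "\<And>n t. 0 \<le> t \<and> t \<le> 1 / 2 ^ n \<Longrightarrow>
   window_const TYPE('n) (window_size TYPE('n) n) powr (3 * t / 2) \<le> C"
  using window_const_powr[where 'n='n] by blast
 show ?thesis
 proof (intro exI conjI allI impI)
  have K: "0 \<le> core_const TYPE('n)"
   using fconst_pos[where 'n='n] trace_const_nonneg[where 'n='n] by (simp add: core_const_def)
  then show "0 \<le> core_const TYPE('n) * C / sqrt \<eta>" using C(1) \<eta> by simp
  fix n :: nat and v :: "'n l2" and g :: "'n fn"
  assume g: "bounded_measurable g" "weak_factorable g (2 + \<eta> / 2 ^ n)"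
  let ?W = "{\<alpha> :: 'n \<Rightarrow> nat. osc_window \<alpha> = n}"
  have t: "0 < \<eta> / 2 ^ n" "\<eta> / 2 ^ n \<le> 1 / 2 ^ n" using \<eta> by (auto simp: divide_right_mono)
  have "1 / 2 ^ n \<le> (1::real)" by simp
  then have p: "2 < 2 + \<eta> / 2 ^ n" "2 + \<eta> / 2 ^ n \<le> 3" using t by linarith+
  have n: "sqrt (\<Sum>\<alpha>\<in>?W. (cmod (cin (hv \<alpha>) v))^2) = norm (block osc_window n v)"
   by (simp flip: norm_block[OF finite_osc_window])
  have "ky_fan_bound (\<lambda>u. mul (window_fun n v) (rotate_l2 \<i> (mul g u)))
   (core_const TYPE('n) * norm (block osc_window n v) * window_const TYPE('n) (window_size TYPE('n) n)
     powr (3 * ((2 + \<eta> / 2 ^ n) - 2) / 2) / sqrt ((2 + \<eta> / 2 ^ n) - 2))"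
   unfolding window_fun_def[abs_def] n[symmetric]
   by (rule hermite_window_core[OF finite_osc_window _ g p]) (use osc_window_index in blast)
  then show "ky_fan_bound (\<lambda>u. mul (window_fun n v) (rotate_l2 \<i> (mul g u)))
    (core_const TYPE('n) * C / sqrt \<eta> * (norm (block osc_window n v) * sqrt (2 ^ n)))"
  proof (rule ky_fan_bound_mono)
   have "core_const TYPE('n) * norm (block osc_window n v) * window_const TYPE('n) (window_size TYPE('n) n) powr (3 * (2 + \<eta> / 2 ^ n - 2) / 2)
    / sqrt (2 + \<eta> / 2 ^ n - 2) \<le> core_const TYPE('n) * norm (block osc_window n v) * C / sqrt (\<eta> / 2 ^ n)"
    using C(2)[of "\<eta> / 2 ^ n" n] t K by (simp add: divide_right_mono mult_left_mono)
   also have "\<dots> = core_const TYPE('n) * C / sqrt \<eta> * (norm (block osc_window n v) * sqrt (2 ^ n))"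
    by (simp add: real_sqrt_divide)
   finally show "core_const TYPE('n) * norm (block osc_window n v) * window_const TYPE('n) (window_size TYPE('n) n) powr (3 * (2 + \<eta> / 2 ^ n - 2) / 2)
    / sqrt (2 + \<eta> / 2 ^ n - 2) \<le> core_const TYPE('n) * C / sqrt \<eta> * (norm (block osc_window n v) * sqrt (2 ^ n))" .
  qed
 qed
qed

section \<open>Weak quasinorms\<close>

lemma ennpowr_less:
 assumes "ennpowr x a < ennreal \<theta>" "0 < a" "0 < \<theta>"
 shows "x < ennreal (\<theta> powr (1 / a))"
proof -
 have x: "x \<noteq> top" "ennreal (enn2real x powr a) < ennreal \<theta>"
  using assms(1) by (auto simp: ennpowr_def split: if_splits)
 then have "enn2real x powr a < \<theta>" by (simp add: ennreal_less_iff)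
 then have "(enn2real x powr a) powr (1 / a) < \<theta> powr (1 / a)"
  using assms by (intro powr_less_mono2) auto
 then have "enn2real x < \<theta> powr (1 / a)" using assms(2) by (simp add: powr_powr)
 then have "ennreal (enn2real x) < ennreal (\<theta> powr (1 / a))" by (simp add: ennreal_less_iff)
 then show ?thesis using x(1) by (subst (asm) ennreal_enn2real) (simp_all add: less_top)
qed

lemma weak_Lp_norm_emeasure:
 assumes "weak_Lp_norm p \<phi> \<le> ennreal A" "0 < A" "0 < p" "0 < t"
 shows "emeasure lebesgue {x. A * t < cmod (\<phi> x)} \<le> ennreal (t powr (- p))"
proof -
 define m where "m = emeasure lebesgue {x. A * t < cmod (\<phi> x)}"
 have At: "0 < A * t" using assms by simp
 have "ennreal (A * t) * ennpowr m (1/p) \<le> weak_Lp_norm p \<phi>"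
  unfolding weak_Lp_norm_def m_def using At by (intro SUP_upper) simp
 then have le: "ennreal (A * t) * ennpowr m (1/p) \<le> ennreal A" using assms(1) by (rule order_trans)
 have m: "m \<noteq> top"
 proof
  assume "m = top"
  then have "ennreal (A * t) * top \<le> ennreal A" using le by (simp add: ennpowr_def)
  then show False using assms by (auto simp: ennreal_mult_top top_unique)
 qed
 with le have "ennreal (A * t * enn2real m powr (1/p)) \<le> ennreal A"
  using At by (simp add: ennpowr_def ennreal_mult)
 then have "A * t * enn2real m powr (1/p) \<le> A" using assms(2) by (simp add: ennreal_le_iff)
 then have "enn2real m powr (1/p) \<le> inverse t" using assms by (simp add: field_simps)
 then have "(enn2real m powr (1/p)) powr p \<le> inverse t powr p" using assms by (intro powr_mono2) auto
 then have "enn2real m \<le> t powr (- p)" using assms by (simp add: powr_powr powr_minus inverse_powr)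
 then have "ennreal (enn2real m) \<le> ennreal (t powr (- p))" by (rule ennreal_leI)
 then show ?thesis using m unfolding m_def[symmetric] by (subst (asm) ennreal_enn2real) (simp_all add: less_top)
qed

lemma L2norm_le_integral:
 assumes "L2norm \<phi> \<le> ennreal B" "0 \<le> B"
 shows "(\<integral>\<^sup>+ x. ennreal ((cmod (\<phi> x))^2) \<partial>lebesgue) \<le> ennreal (B^2)"
proof -
 define I where "I = (\<integral>\<^sup>+ x. ennreal ((cmod (\<phi> x))^2) \<partial>lebesgue)"
 have I: "I \<noteq> top" "sqrt (enn2real I) \<le> B"
  using assms by (auto simp: L2norm_def ennpowr_def I_def powr_half_sqrt top_unique split: if_splits)
 then have "enn2real I \<le> B^2" by (simp add: sqrt_le_D)
 then have "ennreal (enn2real I) \<le> ennreal (B^2)" by (rule ennreal_leI)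
 then show ?thesis using I(1) unfolding I_def[symmetric] by (subst (asm) ennreal_enn2real) (simp_all add: less_top)
qed

text \<open>The decreasing rearrangement supplies \<open>\<sigma>\<close>. A cell that it misses has
  norm below all terms of a null sequence, so \<open>b\<close> vanishes almost everywhere on
  it.\<close>

lemma weak_lq_L2_cells:
 fixes b :: "'n::finite fn"
 assumes b: "b \<in> borel_measurable lebesgue" and B: "weak_lq_L2_norm q b < ennreal B" "0 < B" and q: "0 < q"
 obtains \<sigma> :: "nat \<Rightarrow> int ^ 'n" where "inj \<sigma>"
  "\<And>j. (\<integral>\<^sup>+ x. ennreal ((cmod (b x))^2 * on_cell (\<sigma> j) x) \<partial>lebesgue) \<le> ennreal (B^2 * (real j + 1) powr (- (2/q)))"
  "AE x in lebesgue. b x = 0 \<or> cell x \<in> range \<sigma>"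
proof -
 define u where "u m = L2norm (\<lambda>x. indicator (unit_cube m) x * b x)" for m :: "int ^ 'n"
 obtain s where s: "decreasing_rearrangement u s" "(SUP j. ennreal ((real j + 1) powr (1/q)) * s j) < ennreal B"
  using B(1) unfolding weak_lq_L2_norm_def weak_lq_norm_def u_def[symmetric] INF_less_iff by auto
 obtain \<sigma> :: "nat \<Rightarrow> int ^ 'n" where \<sigma>: "inj \<sigma>" "\<And>j. s j = u (\<sigma> j)" "\<And>m j. m \<notin> range \<sigma> \<Longrightarrow> u m \<le> s j"
  using s(1) unfolding decreasing_rearrangement_def by blast
 have sj: "s j \<le> ennreal (B * (real j + 1) powr (- (1/q)))" for j
 proof -
  have "ennreal ((real j + 1) powr (1/q)) * s j \<le> ennreal B"
   by (rule order_trans[OF SUP_upper less_imp_le[OF s(2)]]) simp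
  then have "ennreal ((real j + 1) powr (- (1/q))) * (ennreal ((real j + 1) powr (1/q)) * s j)
    \<le> ennreal ((real j + 1) powr (- (1/q))) * ennreal B"
   by (rule mult_left_mono) simp
  moreover have "ennreal ((real j + 1) powr (- (1/q))) * ennreal ((real j + 1) powr (1/q)) = 1"
   by (simp flip: ennreal_mult powr_add)
  moreover have "ennreal ((real j + 1) powr (- (1/q))) * ennreal B = ennreal (B * (real j + 1) powr (- (1/q)))"
   using B(2) by (subst ennreal_mult[symmetric]) (simp_all add: mult.commute)
  ultimately show ?thesis unfolding mult.assoc[symmetric] by simp
 qed
 \<comment> \<open>The half-open cell lies in the closed cube, so it carries at most the mass of the
   cube.\<close>
 have sub: "(\<integral>\<^sup>+ x. ennreal ((cmod (b x))^2 * on_cell l x) \<partial>lebesgue)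
   \<le> (\<integral>\<^sup>+ x. ennreal ((cmod (indicator (unit_cube l) x * b x))^2) \<partial>lebesgue)" for l
 proof (intro nn_integral_mono ennreal_leI)
  fix x
  have "cell x = l \<Longrightarrow> x \<in> unit_cube l" using cell_dist[of x l] by (simp add: unit_cube_def)
  then show "(cmod (b x))^2 * on_cell l x \<le> (cmod (indicator (unit_cube l) x * b x))^2"
   by (auto simp: indicator_def)
 qed
 have bound: "(\<integral>\<^sup>+ x. ennreal ((cmod (b x))^2 * on_cell l x) \<partial>lebesgue) \<le> ennreal (c^2)"
  if "u l \<le> ennreal c" "0 \<le> c" for l c
  by (rule order_trans[OF sub L2norm_le_integral]) (use that in \<open>simp_all add: u_def\<close>)
 have null: "AE x in lebesgue. cell x = l \<longrightarrow> b x = 0" if l: "l \<notin> range \<sigma>" for l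
 proof -
  have "u l \<le> 0"
  proof (rule LIMSEQ_le_const)
   have "(\<lambda>j. (real j + 1) powr (- (1/q))) \<longlonglongrightarrow> 0"
    using q by (intro tendsto_neg_powr filterlim_at_top_mono[OF filterlim_real_sequentially]) auto
   from tendsto_mult_left[OF this, of B] have "(\<lambda>j. ennreal (B * (real j + 1) powr (- (1/q)))) \<longlonglongrightarrow> ennreal 0"
    by (intro tendsto_ennrealI) simp
   then show "(\<lambda>j. ennreal (B * (real j + 1) powr (- (1/q)))) \<longlonglongrightarrow> 0" by simp
   show "\<exists>N. \<forall>j\<ge>N. u l \<le> ennreal (B * (real j + 1) powr (- (1/q)))"
    using \<sigma>(3)[OF l] sj by (meson order_trans)
  qed
  then have "u l \<le> ennreal 0" by simp
  from bound[OF this] have "(\<integral>\<^sup>+ x. ennreal ((cmod (b x))^2 * on_cell l x) \<partial>lebesgue) = 0" by simp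
  then have "AE x in lebesgue. ennreal ((cmod (b x))^2 * on_cell l x) = 0"
   using b sets_cell[of l] by (subst (asm) nn_integral_0_iff_AE) (auto intro!: borel_measurable_times borel_measurable_indicator)
  then show ?thesis by eventually_elim (auto simp: indicator_def split: if_splits)
 qed
 show ?thesis
 proof (rule that[OF \<sigma>(1)])
  show "(\<integral>\<^sup>+ x. ennreal ((cmod (b x))^2 * on_cell (\<sigma> j) x) \<partial>lebesgue) \<le> ennreal (B^2 * (real j + 1) powr (- (2/q)))" for j
  proof -
   have "(B * (real j + 1) powr (- (1/q)))^2 = B^2 * (real j + 1) powr (- (2/q))"
    by (simp add: power_mult_distrib power2_eq_square flip: powr_add)
   then show ?thesis using bound[of "\<sigma> j" "B * (real j + 1) powr (- (1/q))"] sj[of j] B(2) by (simp add: \<sigma>(2))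
  qed
  have "AE x in lebesgue. \<forall>l\<in>- range \<sigma>. cell x = l \<longrightarrow> b x = 0"
   using null by (subst AE_ball_countable) auto
  then show "AE x in lebesgue. b x = 0 \<or> cell x \<in> range \<sigma>" by eventually_elim auto
 qed
qed

text \<open>Since \<theta> exceeds the infimum, an actual factorization is available; its factors
  are divided by positive numbers whose product is at most \<theta>^2.\<close>

lemma factorization_norm_weak_factorable:
 fixes g :: "real ^ 'n::finite \<Rightarrow> real"
 assumes G: "factorization_norm \<delta> g < ennreal \<theta>" and p: "2 < p" "p \<le> 2 + \<delta>"
 shows "weak_factorable (\<lambda>x. complex_of_real (g x / \<theta>)) p"
proof -
 define q where "q = 1 / (1 - 1/p)"
 have q: "1/p + 1/q = 1" "2/q = 2 * (1 - 1/p)" "0 < q" using p by (simp_all add: q_def)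
 have \<theta>: "0 < \<theta>" using le_less_trans[OF zero_le G] by simp
 have "(INF (a, b)\<in>{(a, b). a \<in> weak_Lp p \<and> b \<in> weak_lq_L2 q \<and> (\<forall>x. (of_real (g x))^2 = a x * b x)}.
     ennpowr (weak_Lp_norm p a * weak_lq_L2_norm q b) (1/2)) \<le> factorization_norm \<delta> g"
  unfolding factorization_norm_def by (rule SUP_upper2[of "(p, q)"]) (use p q in auto)
 from this G have "(INF (a, b)\<in>{(a, b). a \<in> weak_Lp p \<and> b \<in> weak_lq_L2 q \<and> (\<forall>x. (of_real (g x))^2 = a x * b x)}.
     ennpowr (weak_Lp_norm p a * weak_lq_L2_norm q b) (1/2)) < ennreal \<theta>" by (rule le_less_trans)
 then obtain a b where ab: "a \<in> weak_Lp p" "b \<in> weak_lq_L2 q" "\<And>x. (of_real (g x))^2 = a x * b x"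
   "ennpowr (weak_Lp_norm p a * weak_lq_L2_norm q b) (1/2) < ennreal \<theta>"
  unfolding INF_less_iff by auto
 have m: "a \<in> borel_measurable lebesgue" "b \<in> borel_measurable lebesgue"
  "weak_Lp_norm p a \<noteq> top" "weak_lq_L2_norm q b \<noteq> top"
  using ab by (auto simp: weak_Lp_def weak_lq_L2_def)
 then obtain P Q where P: "weak_Lp_norm p a = ennreal P" "0 \<le> P" and Q: "weak_lq_L2_norm q b = ennreal Q" "0 \<le> Q"
  by (metis ennreal_cases)
 have PQ: "P * Q < \<theta>^2"
  using ennpowr_less[OF ab(4)] \<theta> P Q by (simp add: ennreal_less_iff flip: ennreal_mult)
 \<comment> \<open>P or Q may be 0, so both are enlarged by a small \<eta> before dividing; the
   strict inequality leaves room for it.\<close>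
 have "((\<lambda>\<eta>. (P + \<eta>) * (Q + \<eta>)) \<longlongrightarrow> (P + 0) * (Q + 0)) (at_right 0)" by (intro tendsto_intros)
 then have "\<forall>\<^sub>F \<eta> in at_right 0. (P + \<eta>) * (Q + \<eta>) < \<theta>^2"
  by (rule order_tendstoD(2)) (use PQ in simp)
 moreover have "\<forall>\<^sub>F \<eta> in at_right (0::real). 0 < \<eta>" by (rule eventually_at_right_less)
 ultimately have "\<forall>\<^sub>F \<eta> in at_right (0::real). (P + \<eta>) * (Q + \<eta>) < \<theta>^2 \<and> 0 < \<eta>" by eventually_elim simp
 from eventually_happens'[OF trivial_limit_at_right_real this]
 obtain \<eta> where \<eta>: "(P + \<eta>) * (Q + \<eta>) < \<theta>^2" "0 < \<eta>" by blast
 define \<alpha> where "\<alpha> = P + \<eta>"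
 define \<beta> where "\<beta> = Q + \<eta>"
 have \<alpha>: "0 < \<alpha>" "0 < \<beta>" "\<alpha> * \<beta> \<le> \<theta>^2" "weak_Lp_norm p a \<le> ennreal \<alpha>" "weak_lq_L2_norm q b < ennreal \<beta>"
  using \<eta> P Q by (auto simp: \<alpha>_def \<beta>_def ennreal_less_iff simp del: ennreal_plus intro!: ennreal_leI)
 obtain \<sigma> :: "nat \<Rightarrow> int ^ 'n" where \<sigma>: "inj \<sigma>"
  "\<And>j. (\<integral>\<^sup>+ x. ennreal ((cmod (b x))^2 * on_cell (\<sigma> j) x) \<partial>lebesgue) \<le> ennreal (\<beta>^2 * (real j + 1) powr (- (2/q)))"
  "AE x in lebesgue. b x = 0 \<or> cell x \<in> range \<sigma>"
  by (rule weak_lq_L2_cells[OF m(2) \<alpha>(5,2) q(3)]) (rule that)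
 show ?thesis
  unfolding weak_factorable_def
 proof (intro exI conjI allI impI)
  show "(\<lambda>x. cmod (a x) / \<alpha>) \<in> borel_measurable lebesgue" "(\<lambda>x. cmod (b x) / \<beta>) \<in> borel_measurable lebesgue"
   using m by measurable
  fix x
  show "0 \<le> cmod (a x) / \<alpha>" "0 \<le> cmod (b x) / \<beta>" using \<alpha> by auto
  have "(g x)^2 = cmod (a x) * cmod (b x)"
   using arg_cong[OF ab(3)[of x], of cmod] by (simp add: norm_mult norm_power)
  moreover have "cmod (a x) * cmod (b x) / \<theta>^2 \<le> cmod (a x) * cmod (b x) / (\<alpha> * \<beta>)"
   using \<alpha> \<theta> by (intro divide_left_mono) auto
  ultimately show "(cmod (complex_of_real (g x / \<theta>)))^2 \<le> cmod (a x) / \<alpha> * (cmod (b x) / \<beta>)"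
   by (simp only: norm_of_real power2_abs power_divide times_divide_times_eq)
 next
  fix t :: real assume t: "0 < t"
  have "{x. t < cmod (a x) / \<alpha>} = {x. \<alpha> * t < cmod (a x)}" using \<alpha> by (auto simp: field_simps)
  then show "emeasure lebesgue {x. t < cmod (a x) / \<alpha>} \<le> ennreal (t powr (- p))"
   using weak_Lp_norm_emeasure[OF \<alpha>(4,1) _ t] p by simp
 next
  fix j
  have "(\<integral>\<^sup>+ x. ennreal ((cmod (b x) / \<beta>)^2 * on_cell (\<sigma> j) x) \<partial>lebesgue)
    = (\<integral>\<^sup>+ x. ennreal (1 / \<beta>^2) * ennreal ((cmod (b x))^2 * on_cell (\<sigma> j) x) \<partial>lebesgue)"
   by (simp add: power_divide flip: ennreal_mult)
  also have "\<dots> = ennreal (1 / \<beta>^2) * (\<integral>\<^sup>+ x. ennreal ((cmod (b x))^2 * on_cell (\<sigma> j) x) \<partial>lebesgue)"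
   using m(2) sets_cell[of "\<sigma> j"] by (intro nn_integral_cmult) (auto intro!: borel_measurable_times borel_measurable_indicator)
  also have "\<dots> \<le> ennreal (1 / \<beta>^2) * ennreal (\<beta>^2 * (real j + 1) powr (- (2/q)))"
   by (intro mult_left_mono \<sigma>) auto
  also have "\<dots> = ennreal ((real j + 1) powr (- (2 * (1 - 1/p))))"
   using \<alpha>(2) q(2) by (simp flip: ennreal_mult)
  finally show "(\<integral>\<^sup>+ x. ennreal ((cmod (b x) / \<beta>)^2 * on_cell (\<sigma> j) x) \<partial>lebesgue)
    \<le> ennreal ((real j + 1) powr (- (2 * (1 - 1/p))))" .
 qed (use \<sigma> \<alpha> in auto)
qed

section \<open>Truncation of the symbol and extension of the product operator\<close>

lemma tendsto_mul_sublevel: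
 fixes g :: "real ^ 'n::finite \<Rightarrow> real"
 assumes g: "g \<in> borel_measurable lebesgue"
 shows "bounded_measurable (indicator {x. \<bar>g x\<bar> \<le> real m} :: 'n fn)"
  and "(\<lambda>m. mul (indicator {x. \<bar>g x\<bar> \<le> real m}) v) \<longlonglongrightarrow> v"
proof -
 have meas: "{x. \<bar>g x\<bar> \<le> real m} \<in> sets lebesgue" for m
 proof -
  have "{x \<in> space lebesgue. \<bar>g x\<bar> \<le> real m} \<in> sets lebesgue" using g by measurable
  then show ?thesis by simp
 qed
 show "bounded_measurable (indicator {x. \<bar>g x\<bar> \<le> real m} :: 'n fn)" by (rule bounded_measurable_indicator[OF meas])
 have "(\<lambda>m. mul (indicator {x. \<bar>g x\<bar> \<le> real m}) v) \<longlonglongrightarrow> mul (\<lambda>x. 1) v"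
 proof (rule mul_tendsto[where B = 1])
  show "(indicator {x. \<bar>g x\<bar> \<le> real m} :: 'n fn) \<in> borel_measurable lebesgue" for m
   by (intro borel_measurable_indicator meas)
  fix x
  obtain k :: nat where k: "\<bar>g x\<bar> \<le> real k" by (rule real_arch_simple[THEN exE])
  have "\<forall>\<^sub>F m in sequentially. indicator {x. \<bar>g x\<bar> \<le> real m} x = (1::complex)"
   using eventually_ge_at_top[of k] by eventually_elim (use k in auto)
  then show "(\<lambda>m. indicator {x. \<bar>g x\<bar> \<le> real m} x) \<longlonglongrightarrow> (1::complex)" by (rule tendsto_eventually)
 qed (auto simp: indicator_def)
 then show "(\<lambda>m. mul (indicator {x. \<bar>g x\<bar> \<le> real m}) v) \<longlonglongrightarrow> v" by simp
qed

lemma bounded_measurable_sublevel: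
 fixes g :: "real ^ 'n::finite \<Rightarrow> real"
 assumes g: "g \<in> borel_measurable lebesgue"
 shows "bounded_measurable (\<lambda>x. of_real (g x) * indicator {x. \<bar>g x\<bar> \<le> real m} x :: complex)"
proof (rule bounded_measurableI)
 show "(\<lambda>x. of_real (g x) * indicator {x. \<bar>g x\<bar> \<le> real m} x :: complex) \<in> borel_measurable lebesgue"
  using g tendsto_mul_sublevel(1)[OF g, of m] by (intro borel_measurable_times) (auto simp: bounded_measurable_def)
 show "cmod (of_real (g x) * indicator {x. \<bar>g x\<bar> \<le> real m} x) \<le> real m" for x
  by (simp add: norm_mult indicator_def)
qed

lemma rotate_inverse: "rotate_l2 \<i> (rotate_l2 (- \<i>) u) = u" "rotate_l2 (- \<i>) (rotate_l2 \<i> u) = u"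
 by (simp_all add: rotate_rotate rotate_1)

text \<open>On the domain of the product the hypothesis \<open>prod\<close> identifies
  \<open>T\<close>, so its graph is an extension. The domain is dense because it contains inverse
  transforms of functions cut off to the set where g is at most m in modulus, and these cutoffs
  exhaust the space.\<close>

lemma product_op_extension:
 fixes T :: "'n::finite l2 \<Rightarrow> 'n l2" and g :: "real ^ 'n \<Rightarrow> real"
 assumes T: "bounded_linear T" "\<And>c u. T (cs c u) = cs c (T u)" and K: "ky_fan_bound T K"
  and g: "g \<in> borel_measurable lebesgue"
  and prod: "\<And>u w. AE x in lebesgue. rep w x = of_real (g x) * rep (rotate_l2 (- \<i>) u) x \<Longrightarrow>
    AE x in lebesgue. rep (T u) x = f x * rep (rotate_l2 \<i> w) x"
 shows "\<exists>A. compact_operator A \<and> extends_densely_defined A (product_op f g) \<and> weak_schatten2_norm A \<le> ennreal K"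
proof (intro exI conjI)
 \<comment> \<open>Constant multi-indices give the infinite orthonormal sequence required for the
   choice of singular vectors.\<close>
 have h: "cin (hv (\<lambda>_. j)) (hv (\<lambda>_. k)) = (if j = k then 1 else 0)" for j k :: nat
  by (simp add: hv_orthonormal fun_eq_iff)
 show "compact_operator (graph_of T)" "weak_schatten2_norm (graph_of T) \<le> ennreal K"
  by (rule weak_schatten2_graph_of[OF T K h])+
 have sub: "(\<phi>, \<psi>) \<in> graph_of T" if mem: "(\<phi>, \<psi>) \<in> product_op f g" for \<phi> \<psi>
 proof -
  obtain \<kappa> \<omega> \<zeta> where *: "(\<phi>, \<kappa>) \<in> fourier_op" "(\<kappa>, \<omega>) \<in> mult_op (\<lambda>\<xi>. of_real (g \<xi>))" "(\<zeta>, \<omega>) \<in> fourier_op"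
    "(\<zeta>, \<psi>) \<in> mult_op f"
   using mem unfolding product_op_def fourier_multiplier_def by blast
  then have L: "\<phi> \<in> L2" "\<kappa> \<in> L2" "\<omega> \<in> L2" "\<zeta> \<in> L2" "\<psi> \<in> L2"
   and c: "cls \<kappa> = rotate_l2 (- \<i>) (cls \<phi>)" "cls \<omega> = rotate_l2 (- \<i>) (cls \<zeta>)"
   and ae: "AE x in lebesgue. \<omega> x = of_real (g x) * \<kappa> x" "AE x in lebesgue. \<psi> x = f x * \<zeta> x"
   by (auto simp: fourier_op_iff mult_op_def ae_eq_def)
  have "AE x in lebesgue. rep (cls \<omega>) x = of_real (g x) * rep (rotate_l2 (- \<i>) (cls \<phi>)) x"
   using ae(1) rep_cls[OF L(2)] rep_cls[OF L(3)] unfolding c(1)[symmetric] by eventually_elim simp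
  from prod[OF this] have "AE x in lebesgue. rep (T (cls \<phi>)) x = f x * rep (cls \<zeta>) x"
   by (simp add: c rotate_inverse)
  then have "AE x in lebesgue. rep (T (cls \<phi>)) x = \<psi> x"
   using ae(2) rep_cls[OF L(4)] by eventually_elim simp
  then show ?thesis using L cls_eqI[OF rep_L2, of "T (cls \<phi>)" \<psi>] by (simp add: graph_of_def)
 qed
 show "extends_densely_defined (graph_of T) (product_op f g)"
  unfolding extends_densely_defined_def
 proof (intro conjI ballI allI impI)
  show "product_op f g \<subseteq> graph_of T" using sub by auto
  fix \<phi> :: "'n fn" and e :: real
  assume \<phi>: "\<phi> \<in> L2" and e: "0 < e"
  define v where "v = rotate_l2 (- \<i>) (cls \<phi>)"
  note lim = tendsto_mul_sublevel[OF g]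
  obtain m where m: "norm (mul (indicator {x. \<bar>g x\<bar> \<le> real m}) v - v) < e"
   using LIMSEQ_D[OF lim(2)[of v] e] by blast
  define u where "u = rotate_l2 \<i> (mul (indicator {x. \<bar>g x\<bar> \<le> real m}) v)"
  define w where "w = mul (\<lambda>x. of_real (g x) * indicator {x. \<bar>g x\<bar> \<le> real m} x) v"
  have w: "AE x in lebesgue. rep w x = of_real (g x) * rep (rotate_l2 (- \<i>) u) x"
   using rep_mul[OF lim(1)[of m], of v] rep_mul[OF bounded_measurable_sublevel[OF g, of m], of v]
   unfolding u_def w_def rotate_inverse by eventually_elim simp
  have "(rep u, rep (T u)) \<in> product_op f g"
   unfolding product_op_def fourier_multiplier_def
  proof (intro relcompI)
   show "(rep u, rep (rotate_l2 (- \<i>) u)) \<in> fourier_op" by (simp add: fourier_op_iff)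
   show "(rep (rotate_l2 (- \<i>) u), rep w) \<in> mult_op (\<lambda>\<xi>. of_real (g \<xi>))" using w by (simp add: mult_op_def ae_eq_def)
   show "(rep w, rep (rotate_l2 \<i> w)) \<in> fourier_op\<inverse>" by (simp add: fourier_op_iff rotate_inverse)
   show "(rep (rotate_l2 \<i> w), rep (T u)) \<in> mult_op f" using prod[OF w] by (simp add: mult_op_def ae_eq_def)
  qed
  moreover have "L2norm (\<lambda>x. \<phi> x - rep u x) < ennreal e"
  proof -
   have "L2norm (\<lambda>x. \<phi> x - rep u x) = ennreal (norm (cls \<phi> - u))"
    using \<phi> by (simp add: L2norm_cls L2_diff flip: cls_diff)
   also have "cls \<phi> - u = rotate_l2 \<i> (v - mul (indicator {x. \<bar>g x\<bar> \<le> real m}) v)"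
    by (simp add: u_def v_def rotate_inverse linear_diff[OF bounded_linear.linear[OF bounded_linear_rotate]])
   finally show ?thesis using m e by (simp add: norm_rotate norm_minus_commute ennreal_less_iff)
  qed
  ultimately show "\<exists>\<psi>\<in>Domain (product_op f g). L2norm (\<lambda>x. \<phi> x - \<psi> x) < ennreal e" by blast
 qed
qed

section \<open>Assembly of the windows\<close>

lemma ky_fan_bound_scale:
 assumes "ky_fan_bound T K" "0 \<le> c"
 shows "ky_fan_bound (\<lambda>x. c *\<^sub>R T x) (c * K)"
 unfolding ky_fan_bound_def
proof (intro allI impI)
 fix N and u e :: "nat \<Rightarrow> 'a"
 assume o: "orthonormal N u" "orthonormal N e"
 show "(\<Sum>i<N. \<bar>u i \<bullet> (c *\<^sub>R T (e i))\<bar>) \<le> c * K * sqrt (real N)"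
  using mult_left_mono[OF ky_fan_boundD[OF assms(1) o] assms(2)] assms(2)
  by (simp add: abs_mult sum_distrib_left mult.assoc)
qed

lemma ky_fan_bound_rotate:
 assumes "ky_fan_bound T K" and z: "cmod z = 1"
 shows "ky_fan_bound (\<lambda>u. T (rotate_l2 z u)) K"
 unfolding ky_fan_bound_def
proof (intro allI impI)
 fix N and u e :: "nat \<Rightarrow> 'a l2"
 assume o: "orthonormal N u" "orthonormal N e"
 have "cnj z * z = 1" using complex_norm_square[of z] z by (simp add: mult.commute)
 then have "rotate_l2 z x \<bullet> rotate_l2 z y = x \<bullet> y" for x y :: "'a l2"
  using z by (simp add: inner_eq_Re_cin cin_rotate_left rotate_rotate rotate_1)
 then have "orthonormal N (\<lambda>i. rotate_l2 z (e i))" using o(2) by (simp add: orthonormal_def)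
 from ky_fan_boundD[OF assms(1) o(1) this] show "(\<Sum>i<N. \<bar>u i \<bullet> T (rotate_l2 z (e i))\<bar>) \<le> K * sqrt (real N)" .
qed

text \<open>The estimate for normalized symbols is rescaled by \<theta> > \<gamma>, as \<gamma> may
  be 0 and the infimum need not be attained; then \<theta> tends to \<gamma>. The bounded function
  \<open>k\<close> stands for truncations of g.\<close>

lemma window_ky_fan_norm:
 fixes \<delta> :: real
 assumes \<delta>: "0 < \<delta>"
 shows "\<exists>C\<ge>0. \<forall>n (v :: 'n l2) (g :: real ^ 'n::finite \<Rightarrow> real) \<gamma> (k :: 'n fn). factorization_norm \<delta> g = ennreal \<gamma> \<longrightarrow> 0 \<le> \<gamma> \<longrightarrow>
  bounded_measurable k \<longrightarrow> (\<forall>x. cmod (k x) \<le> \<bar>g x\<bar>) \<longrightarrow>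
  ky_fan_bound (\<lambda>u. mul (window_fun n v) (rotate_l2 \<i> (mul k u))) (C * \<gamma> * (norm (block osc_window n v) * sqrt (2 ^ n)))"
proof -
 \<comment> \<open>The exponents 2 + \<eta> / 2^n must not exceed 2 + \<delta>, where factorizations
   are given, nor 3, where the core estimate holds.\<close>
 define \<eta> where "\<eta> = min \<delta> 1"
 have \<eta>: "0 < \<eta>" "\<eta> \<le> 1" "\<eta> \<le> \<delta>" using \<delta> by (auto simp: \<eta>_def)
 obtain C where C: "0 \<le> C" "\<And>n v (g :: 'n fn). bounded_measurable g \<Longrightarrow> weak_factorable g (2 + \<eta> / 2 ^ n) \<Longrightarrow>
  ky_fan_bound (\<lambda>u. mul (window_fun n v) (rotate_l2 \<i> (mul g u))) (C * (norm (block osc_window n v) * sqrt (2 ^ n)))"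
  using window_ky_fan[OF \<eta>(1,2), where 'n='n] by blast
 show ?thesis
 proof (intro exI conjI allI impI)
  show "0 \<le> C" by (rule C(1))
  fix n and v :: "'n l2" and g :: "real ^ 'n \<Rightarrow> real" and \<gamma> and k :: "'n fn"
  assume G: "factorization_norm \<delta> g = ennreal \<gamma>" "0 \<le> \<gamma>" and k: "bounded_measurable k" "\<forall>x. cmod (k x) \<le> \<bar>g x\<bar>"
  define B where "B = norm (block osc_window n v) * sqrt (2 ^ n)"
  have bound: "ky_fan_bound (\<lambda>u. mul (window_fun n v) (rotate_l2 \<i> (mul k u))) (\<theta> * (C * B))" if \<theta>: "\<gamma> < \<theta>" for \<theta>
  proof -
   have \<theta>0: "0 < \<theta>" using G \<theta> by simp
   define k' where "k' x = complex_of_real (1 / \<theta>) * k x" for x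
   have k': "bounded_measurable k'"
    unfolding k'_def by (rule bounded_measurable_mult[OF _ k(1)]) (auto simp: bounded_measurable_def)
   have p: "2 < 2 + \<eta> / 2 ^ n" "2 + \<eta> / 2 ^ n \<le> 2 + \<delta>"
   proof -
    have "\<eta> / 2 ^ n \<le> \<eta> / 1" using \<eta> by (intro divide_left_mono) auto
    then show "2 + \<eta> / 2 ^ n \<le> 2 + \<delta>" using \<eta> by simp
   qed (use \<eta> in simp)
   have "weak_factorable k' (2 + \<eta> / 2 ^ n)"
   proof (rule weak_factorable_mono[OF factorization_norm_weak_factorable[OF _ p]])
    show "factorization_norm \<delta> g < ennreal \<theta>" using G \<theta> \<theta>0 by (simp add: ennreal_less_iff)
    show "cmod (k' x) \<le> cmod (complex_of_real (g x / \<theta>))" for x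
     using k(2) \<theta>0 by (simp add: k'_def norm_mult norm_divide divide_right_mono)
   qed
   from ky_fan_bound_scale[OF C(2)[OF k' this, of v], of \<theta>] \<theta>0
   have *: "ky_fan_bound (\<lambda>u. \<theta> *\<^sub>R mul (window_fun n v) (rotate_l2 \<i> (mul k' u))) (\<theta> * (C * B))"
    by (simp add: B_def)
   have bw: "bounded_measurable (window_fun n v)" by (rule window_fun)
   have "mul k u = \<theta> *\<^sub>R mul k' u" for u
   proof -
    have "mul k u = mul (\<lambda>x. complex_of_real \<theta> * k' x) u" using \<theta>0 by (simp add: k'_def)
    also have "\<dots> = cs (of_real \<theta>) (mul k' u)"
     by (simp add: mul_def cs_cls bounded_measurable_L2[OF k'] mult.assoc)
    finally show ?thesis by (simp add: cs_scaleR)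
   qed
   then show ?thesis using * by (simp add: rotate_scaleR mul_scaleR[OF bw])
  qed
  have "ky_fan_bound (\<lambda>u. mul (window_fun n v) (rotate_l2 \<i> (mul k u))) (\<gamma> * (C * B))"
  proof (rule ky_fan_bound_limit[OF tendsto_const bound])
   have "(\<lambda>j. (\<gamma> + inverse (real (Suc j))) * (C * B)) \<longlonglongrightarrow> (\<gamma> + 0) * (C * B)"
    by (intro tendsto_intros LIMSEQ_inverse_real_of_nat)
   then show "(\<lambda>j. (\<gamma> + inverse (real (Suc j))) * (C * B)) \<longlonglongrightarrow> \<gamma> * (C * B)" by simp
  qed simp
  then show "ky_fan_bound (\<lambda>u. mul (window_fun n v) (rotate_l2 \<i> (mul k u))) (C * \<gamma> * (norm (block osc_window n v) * sqrt (2 ^ n)))"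
   by (simp add: B_def mult_ac)
 qed
qed

text \<open>Neither factor is bounded. Both are truncated with the same index m: the first to its
  windows below m, g to its values up to m. The Ky Fan bounds are summable over the windows and
  uniform in the truncation of g, which makes \<open>S m u\<close> a Cauchy sequence for each u. The
  limit inherits the bound, and \<open>ae_product_limit\<close> identifies it.\<close>

lemma window_limit_operator:
 fixes v :: "'n::finite l2" and g :: "real ^ 'n \<Rightarrow> real"
 assumes g: "g \<in> borel_measurable lebesgue"
  and k: "\<And>n h. bounded_measurable h \<Longrightarrow> (\<And>x. cmod (h x) \<le> \<bar>g x\<bar>) \<Longrightarrow>
   ky_fan_bound (\<lambda>u. mul (window_fun n v) (rotate_l2 \<i> (mul h u))) (k n)"
  and k0: "\<And>n. 0 \<le> k n" and ks: "summable k"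
 obtains T where "bounded_linear T" "\<And>c u. T (cs c u) = cs c (T u)" "ky_fan_bound T (suminf k)"
  "\<And>u w. AE x in lebesgue. rep w x = of_real (g x) * rep (rotate_l2 (- \<i>) u) x \<Longrightarrow>
    AE x in lebesgue. rep (T u) x = rep v x * rep (rotate_l2 \<i> w) x"
proof -
 define I :: "nat \<Rightarrow> 'n fn" where "I m = indicator {x. \<bar>g x\<bar> \<le> real m}" for m
 define h :: "nat \<Rightarrow> 'n fn" where "h m x = of_real (g x) * indicator {x. \<bar>g x\<bar> \<le> real m} x" for m x
 define P where "P n l u = mul (window_fun n v) (rotate_l2 \<i> (mul l u))" for n l u
 define R where "R u = rotate_l2 (- \<i>) u" for u :: "'n l2"
 define S where "S m u = (\<Sum>n<m. P n (h m) (R u))" for m u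
 define K where "K = suminf k"
 have bI: "bounded_measurable (I m)" and limI: "(\<lambda>m. mul (I m) w) \<longlonglongrightarrow> w" for m w
  unfolding I_def by (rule tendsto_mul_sublevel[OF g])+
 have bh: "bounded_measurable (h m)" for m unfolding h_def[abs_def] by (rule bounded_measurable_sublevel[OF g])
 have hg: "cmod (h m x) \<le> \<bar>g x\<bar>" for m x by (simp add: h_def norm_mult indicator_def)
 have bw: "bounded_measurable (window_fun n v)" for n by (rule window_fun)
 have Pl: "bounded_linear (P n (h m))" for n m
  unfolding P_def[abs_def]
  by (intro bounded_linear_compose[OF bounded_linear_mul[OF bw] bounded_linear_compose[OF bounded_linear_rotate bounded_linear_mul[OF bh]]]) simp
 have Rl: "bounded_linear R" unfolding R_def[abs_def] by (rule bounded_linear_rotate) simp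
 have Rn: "norm (R u) = norm u" for u by (simp add: R_def norm_rotate)
 have Pk: "ky_fan_bound (P n (h m)) (k n)" for n m unfolding P_def by (rule k[OF bh hg])
 have Pn: "norm (P n (h m) u) \<le> k n * norm u" for n m u
  by (rule ky_fan_bound_norm[OF Pk bounded_linear.linear[OF Pl]])
 have ksum: "(\<Sum>n<m. k n) \<le> K" for m unfolding K_def by (rule sum_le_suminf[OF ks]) (auto simp: k0)
 have K0: "0 \<le> K" unfolding K_def by (rule suminf_nonneg[OF ks k0])
 have Sk: "ky_fan_bound (S m) K" for m
  unfolding S_def R_def
  by (rule ky_fan_bound_rotate[OF ky_fan_bound_mono[OF ky_fan_bound_sum[OF _ Pk] ksum]]) simp_all
 have Sl: "bounded_linear (S m)" for m
  unfolding S_def[abs_def] by (intro bounded_linear_sum bounded_linear_compose[OF Pl Rl])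
 have Sc: "S m (cs c u) = cs c (S m u)" for m c u
  by (simp add: S_def P_def R_def cs_sum_right mul_cs bw bh rotate_cs)
 have "Cauchy (\<lambda>m. S m u)" for u
 proof -
  \<comment> \<open>The error from enlarging the truncation of g plus the error from the remaining
    windows.\<close>
  define b where "b m = K * norm (R u - mul (I m) (R u)) + (K - (\<Sum>n<m. k n)) * norm u" for m
  have "b \<longlonglongrightarrow> K * norm (R u - R u) + (K - K) * norm u"
   unfolding b_def[abs_def] K_def by (intro tendsto_intros limI summable_LIMSEQ ks)
  then have b0: "b \<longlonglongrightarrow> 0" by simp
  have diff: "norm (S m' u - S m u) \<le> b m" if mm: "m \<le> m'" for m m'
  proof -
   \<comment> \<open>The smaller truncation of g is the larger one after a cutoff, so the difference
     can be charged to \<open>R u\<close>.\<close>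
   have "mul (h m) (R u) = mul (h m') (mul (I m) (R u))"
    using mm by (subst mul_mul[OF bh bI]) (auto simp: h_def I_def indicator_def intro!: arg_cong[of _ _ "\<lambda>l. mul l (R u)"])
   then have "P n (h m) (R u) = P n (h m') (mul (I m) (R u))" for n by (simp add: P_def)
   then have "S m' u - S m u = (\<Sum>n<m'. P n (h m') (R u)) - (\<Sum>n<m. P n (h m') (mul (I m) (R u)))"
    by (simp add: S_def)
   also have "{..<m'} = {..<m} \<union> {m..<m'}" using mm by auto
   also have "(\<Sum>n\<in>{..<m} \<union> {m..<m'}. P n (h m') (R u)) = (\<Sum>n<m. P n (h m') (R u)) + (\<Sum>n=m..<m'. P n (h m') (R u))"
    by (rule sum.union_disjoint) auto
   also have "\<dots> - (\<Sum>n<m. P n (h m') (mul (I m) (R u)))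
     = (\<Sum>n<m. P n (h m') (R u - mul (I m) (R u))) + (\<Sum>n=m..<m'. P n (h m') (R u))"
    by (simp add: linear_diff[OF bounded_linear.linear[OF Pl]] sum_subtractf)
   finally have "norm (S m' u - S m u) \<le> (\<Sum>n<m. k n * norm (R u - mul (I m) (R u))) + (\<Sum>n=m..<m'. k n * norm (R u))"
    by (simp only:) (intro norm_triangle_le add_mono sum_norm_le Pn)
   also have "\<dots> \<le> b m"
   proof -
    have "(\<Sum>n=m..<m'. k n) = (\<Sum>n<m'. k n) - (\<Sum>n<m. k n)"
     using sum_diff_nat_ivl[of 0 m m' k] mm by (simp add: atLeast0LessThan)
    then have "(\<Sum>n=m..<m'. k n) \<le> K - (\<Sum>n<m. k n)" using ksum[of m'] by simp
    then show ?thesis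
     unfolding b_def sum_distrib_right[symmetric] Rn by (intro add_mono mult_right_mono ksum) auto
   qed
   finally show ?thesis .
  qed
  show ?thesis
  proof (rule CauchyI')
   fix e :: real assume "0 < e"
   from LIMSEQ_D[OF b0 this] obtain M where M: "\<And>m. M \<le> m \<Longrightarrow> norm (b m) < e" by auto
   have "dist (S m u) (S m' u) < e" if "M \<le> m" "m < m'" for m m'
    using diff[of m m'] M[of m] that by (simp add: dist_norm norm_minus_commute[of "S m u"])
   then show "\<exists>M. \<forall>m\<ge>M. \<forall>m'>m. dist (S m u) (S m' u) < e" by blast
  qed
 qed
 then have "convergent (\<lambda>m. S m u)" for u by (simp add: Cauchy_convergent_iff)
 then obtain T where T: "\<And>u. (\<lambda>m. S m u) \<longlonglongrightarrow> T u" unfolding convergent_def by metis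
 show ?thesis
 proof (rule that)
  show "ky_fan_bound T (suminf k)"
   using ky_fan_bound_limit[OF T Sk tendsto_const] by (simp add: K_def)
  note lin = bounded_linear.linear[OF Sl]
  show "bounded_linear T"
  proof (rule bounded_linear_intro[where K = K])
   show "T (x + y) = T x + T y" for x y
    by (rule LIMSEQ_unique[OF T]) (simp add: linear_add[OF lin] tendsto_add T)
   show "T (r *\<^sub>R x) = r *\<^sub>R T x" for r x
    by (rule LIMSEQ_unique[OF T]) (simp add: linear_scale[OF lin] tendsto_scaleR T)
   show "norm (T x) \<le> norm x * K" for x
    by (rule LIMSEQ_le_const2[OF tendsto_norm[OF T]])
     (use ky_fan_bound_norm[OF Sk lin] in \<open>auto simp: mult.commute\<close>)
  qed
  show "T (cs c u) = cs c (T u)" for c u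
   by (rule LIMSEQ_unique[OF T]) (simp add: Sc tendsto_cs T)
  fix u w assume w: "AE x in lebesgue. rep w x = of_real (g x) * rep (rotate_l2 (- \<i>) u) x"
  \<comment> \<open>On the domain of the product the truncated symbol yields a cutoff of w, and
    these cutoffs converge to w in the norm.\<close>
  have hw: "mul (h m) (R u) = mul (I m) w" for m
  proof (rule l2_eqI)
   show "AE x in lebesgue. rep (mul (h m) (R u)) x = rep (mul (I m) w) x"
    using w rep_mul[OF bh[of m], of "R u"] rep_mul[OF bI[of m], of w]
    by eventually_elim (simp add: h_def I_def R_def)
  qed
  show "AE x in lebesgue. rep (T u) x = rep v x * rep (rotate_l2 \<i> w) x"
  proof (rule ae_product_limit)
   show "(\<lambda>m. \<Sum>n<m. block osc_window n v) \<longlonglongrightarrow> v"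
    using block_sums[OF finite_osc_window, of v] by (simp add: sums_def)
   show "(\<lambda>m. rotate_l2 \<i> (mul (I m) w)) \<longlonglongrightarrow> rotate_l2 \<i> w"
    by (rule bounded_linear.tendsto[OF bounded_linear_rotate limI]) simp
   show "(\<lambda>m. S m u) \<longlonglongrightarrow> T u" by (rule T)
   fix m
   have "AE x in lebesgue. \<forall>n\<in>{..<m}. rep (mul (window_fun n v) (rotate_l2 \<i> (mul (I m) w))) x
     = rep (block osc_window n v) x * rep (rotate_l2 \<i> (mul (I m) w)) x"
   proof (intro AE_finite_allI)
    show "AE x in lebesgue. rep (mul (window_fun n v) (rotate_l2 \<i> (mul (I m) w))) x
      = rep (block osc_window n v) x * rep (rotate_l2 \<i> (mul (I m) w)) x" for n
     using rep_mul[OF bw, of n] window_fun(2)[of n v] by eventually_elim simp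
   qed simp
   then show "AE x in lebesgue. rep (S m u) x = rep (\<Sum>n<m. block osc_window n v) x * rep (rotate_l2 \<i> (mul (I m) w)) x"
    using rep_sum[of "{..<m}" "\<lambda>n. P n (h m) (R u)", OF finite_lessThan] rep_sum[of "{..<m}" "\<lambda>n. block osc_window n v", OF finite_lessThan]
    unfolding S_def by eventually_elim (simp add: P_def hw sum_distrib_right)
  qed
 qed
qed

section \<open>Logarithmic weights and summation over the windows\<close>

definition log_weight :: "real \<Rightarrow> real \<Rightarrow> real" where
 "log_weight \<epsilon> t = ln t powr (1/2) * ln (ln t) powr (1/2 + \<epsilon>)"

lemma log_weight_measurable: "log_weight \<epsilon> \<in> borel_measurable borel"
 unfolding log_weight_def[abs_def] by measurable

lemma log_weight_window:
 assumes "0 < \<epsilon>"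
 shows "sqrt (2 ^ osc_window \<alpha>) * (real (osc_window \<alpha>) * ln 2) powr (1/2 + \<epsilon>) \<le> log_weight \<epsilon> (osc_eigenvalue \<alpha>)"
  and "0 < log_weight \<epsilon> (osc_eigenvalue \<alpha>)"
proof -
 define n where "n = osc_window \<alpha>"
 define L where "L = ln (osc_eigenvalue \<alpha>)"
 have n: "1 \<le> n" "2 ^ n \<le> L" using osc_window[of \<alpha>] by (auto simp: n_def L_def)
 have L: "0 < L" using n(2) less_le_trans[of 0 "2 ^ n" L] by simp
 have l: "real n * ln 2 \<le> ln L" using n(2) L by (simp add: ln_realpow[symmetric])
 have p: "0 < real n * ln 2" using n by simp
 have "sqrt (2 ^ n) * (real n * ln 2) powr (1/2 + \<epsilon>) \<le> L powr (1/2) * ln L powr (1/2 + \<epsilon>)"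
  using n(2) l p L assms by (intro mult_mono powr_mono2) (auto simp: powr_half_sqrt)
 then show le: "sqrt (2 ^ osc_window \<alpha>) * (real (osc_window \<alpha>) * ln 2) powr (1/2 + \<epsilon>) \<le> log_weight \<epsilon> (osc_eigenvalue \<alpha>)"
  by (simp add: log_weight_def L_def n_def)
 have "0 < sqrt (2 ^ n) * (real n * ln 2) powr (1/2 + \<epsilon>)" using n(1) by (intro mult_pos_pos) simp_all
 then show "0 < log_weight \<epsilon> (osc_eigenvalue \<alpha>)" using le by (simp add: n_def)
qed

text \<open>Cauchy-Schwarz over the windows: the excess \<open>\<epsilon>\<close> of the exponent over \<open>1/2\<close> makes the
 sum of \<open>n powr (- 1 - 2 * \<epsilon>)\<close> converge.\<close>

lemma window_sum:
 assumes \<epsilon>: "0 < \<epsilon>"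
 shows "\<exists>C\<ge>0. \<forall>v w :: 'n::finite l2. (\<forall>\<alpha>. cin (hv \<alpha>) w = of_real (log_weight \<epsilon> (osc_eigenvalue \<alpha>)) * cin (hv \<alpha>) v) \<longrightarrow>
  summable (\<lambda>n. norm (block osc_window n v) * sqrt (2 ^ n)) \<and>
  (\<Sum>n. norm (block osc_window n v) * sqrt (2 ^ n)) \<le> C * norm w"
proof -
 define r where "r n = (real n * ln 2) powr (- (1/2 + \<epsilon>))" for n
 have r0: "0 \<le> r n" for n by (simp add: r_def)
 have "(r n)^2 = ln 2 powr (- (1 + 2 * \<epsilon>)) * real n powr (- (1 + 2 * \<epsilon>))" for n
  by (simp add: r_def power2_eq_square powr_mult mult_ac flip: powr_add)
 moreover have "summable (\<lambda>n. real n powr (- (1 + 2 * \<epsilon>)))" using \<epsilon> by (subst summable_real_powr_iff) simp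
 ultimately have rs: "summable (\<lambda>n. (r n)^2)" by simp
 define C where "C = sqrt (\<Sum>n. (r n)^2)"
 have "summable (\<lambda>n. norm (block osc_window n v) * sqrt (2 ^ n)) \<and>
   (\<Sum>n. norm (block osc_window n v) * sqrt (2 ^ n)) \<le> C * norm w"
  if w: "\<forall>\<alpha>. cin (hv \<alpha>) w = of_real (log_weight \<epsilon> (osc_eigenvalue \<alpha>)) * cin (hv \<alpha>) v" for v w :: "'n l2"
 proof -
  have step: "norm (block osc_window n v) * sqrt (2 ^ n) \<le> r n * norm (block osc_window n w)" for n
  proof (cases "n = 0")
   case True
   then have "{\<alpha> :: 'n \<Rightarrow> nat. osc_window \<alpha> = n} = {}" using less_le_trans[OF zero_less_one osc_window(1)] by auto
   then have "block osc_window n v = 0" by (simp add: block_def)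
   then show ?thesis by (simp add: r0)
  next
   case False
   define q where "q = sqrt (2 ^ n) * (real n * ln 2) powr (1/2 + \<epsilon>)"
   have q0: "0 \<le> q" by (simp add: q_def)
   have "(q * norm (block osc_window n v))^2 = (\<Sum>\<alpha> | osc_window \<alpha> = n. (q * cmod (cin (hv \<alpha>) v))^2)"
    by (simp add: power_mult_distrib norm_block[OF finite_osc_window] sum_distrib_left)
   also have "\<dots> \<le> (\<Sum>\<alpha> | osc_window \<alpha> = n. (cmod (cin (hv \<alpha>) w))^2)"
   proof (intro sum_mono power_mono)
    fix \<alpha> :: "'n \<Rightarrow> nat" assume "\<alpha> \<in> {\<alpha>. osc_window \<alpha> = n}"
    then have "q \<le> \<bar>log_weight \<epsilon> (osc_eigenvalue \<alpha>)\<bar>" using log_weight_window(1)[OF \<epsilon>, of \<alpha>] by (simp add: q_def)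
    then show "q * cmod (cin (hv \<alpha>) v) \<le> cmod (cin (hv \<alpha>) w)"
     using w by (simp add: norm_mult mult_right_mono)
   qed (use q0 in simp)
   also have "\<dots> = (norm (block osc_window n w))^2" by (rule norm_block[OF finite_osc_window, symmetric])
   finally have "q * norm (block osc_window n v) \<le> norm (block osc_window n w)" by (rule power2_le_imp_le) simp
   then have "r n * (q * norm (block osc_window n v)) \<le> r n * norm (block osc_window n w)" by (rule mult_left_mono[OF _ r0])
   moreover have "r n * q = sqrt (2 ^ n)" using False by (simp add: r_def q_def powr_minus field_simps)
   ultimately show ?thesis by (simp add: mult.commute flip: mult.assoc)
  qed
  have part: "(\<Sum>n<m. norm (block osc_window n v) * sqrt (2 ^ n)) \<le> C * norm w" for m
  proof -
   have "(\<Sum>n<m. norm (block osc_window n v) * sqrt (2 ^ n)) \<le> (\<Sum>n<m. \<bar>r n\<bar> * \<bar>norm (block osc_window n w)\<bar>)"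
    using step r0 by (intro sum_mono) simp
   also have "\<dots> \<le> L2_set r {..<m} * L2_set (\<lambda>n. norm (block osc_window n w)) {..<m}" by (rule L2_set_mult_ineq)
   also have "\<dots> \<le> C * norm w"
   proof (rule mult_mono)
    show "L2_set r {..<m} \<le> C"
     unfolding L2_set_def C_def by (intro real_sqrt_le_mono sum_le_suminf rs) auto
    show "L2_set (\<lambda>n. norm (block osc_window n w)) {..<m} \<le> norm w"
     unfolding L2_set_def by (intro real_le_lsqrt sum_norm_block[OF finite_osc_window] sum_nonneg) auto
   qed (auto simp: C_def suminf_nonneg rs)
   finally show ?thesis .
  qed
  have s: "summable (\<lambda>n. norm (block osc_window n v) * sqrt (2 ^ n))"
   by (rule bounded_imp_summable[where B = "C * norm w"]) (use part[of "Suc _"] in \<open>auto simp: lessThan_Suc_atMost\<close>)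
  with part show ?thesis by (auto intro: suminf_le_const)
 qed
 moreover have "0 \<le> C" by (simp add: C_def suminf_nonneg rs)
 ultimately show ?thesis by blast
qed

text \<open>The infimum in \<open>applied_norm\<close> runs over all values at f. Their Hermite
  coefficients agree, so it is taken over a single number.\<close>

lemma oscillator_log_norm_finite:
 fixes f :: "'n::finite fn"
 assumes "oscillator_log_norm \<epsilon> f < top"
 obtains w where "f \<in> L2" "oscillator_log_norm \<epsilon> f = ennreal (norm w)"
  "\<And>\<alpha>. cin (hv \<alpha>) w = of_real (log_weight \<epsilon> (osc_eigenvalue \<alpha>)) * cin (hv \<alpha>) (cls f)"
proof -
 define T :: "'n op" where "T = functional_calculus (log_weight \<epsilon>) oscillator"
 note fc = functional_calculus_oscillator[OF log_weight_measurable[of \<epsilon>], of f, folded T_def]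
 have N: "oscillator_log_norm \<epsilon> f = (INF \<psi>\<in>T `` {f}. L2norm \<psi>)"
  by (simp add: oscillator_log_norm_def applied_norm_def T_def log_weight_def[abs_def])
 then obtain \<psi> where \<psi>: "(f, \<psi>) \<in> T" using assms by (auto simp: INF_less_iff)
 have "L2norm \<psi>' = ennreal (norm (cls \<psi>))" if "(f, \<psi>') \<in> T" for \<psi>'
 proof -
  have "cls \<psi>' = cls \<psi>" by (rule hv_eqI) (simp add: fc(3)[OF that] fc(3)[OF \<psi>])
  then show ?thesis using fc(2)[OF that] by (simp add: L2norm_cls)
 qed
 then have "L2norm ` (T `` {f}) = {ennreal (norm (cls \<psi>))}" using \<psi> by auto
 then have "oscillator_log_norm \<epsilon> f = ennreal (norm (cls \<psi>))" by (simp add: N)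
 then show ?thesis using that[of "cls \<psi>"] fc[OF \<psi>] by simp
qed

text \<open>Covers the product of an infinite norm of f with a vanishing norm of g. The window bound
  with \<gamma> = 0, for the Gaussian ground state in place of f, makes the operator vanish. The
  Gaussian has no zeros and the Fourier transform is injective, so both can be cancelled, first on
  the left and then after applying to the Gaussian itself.\<close>

lemma factorization_norm_zero:
 fixes g :: "real ^ 'n::finite \<Rightarrow> real"
 assumes \<delta>: "0 < \<delta>" and g: "g \<in> borel_measurable lebesgue" and G: "factorization_norm \<delta> g = 0"
 shows "AE x in lebesgue. g x = 0"
proof -
 define v :: "'n l2" where "v = hv (\<lambda>_. 0)"
 define n where "n = osc_window (\<lambda>_::'n. 0)"
 define h :: "nat \<Rightarrow> 'n fn" where "h m x = of_real (g x) * indicator {x. \<bar>g x\<bar> \<le> real m} x" for m x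
 have bh: "bounded_measurable (h m)" for m unfolding h_def[abs_def] by (rule bounded_measurable_sublevel[OF g])
 have hg: "cmod (h m x) \<le> \<bar>g x\<bar>" for m x by (simp add: h_def norm_mult indicator_def)
 have pos: "herm_vec (\<lambda>_. 0) x \<noteq> 0" for x :: "real ^ 'n"
  using hermite_norm2_pos[of 0] by (simp add: herm_vec_def herm_def)
 have wf: "window_fun n v x \<noteq> 0" for x
 proof -
  have "window_fun n v x = (\<Sum>\<alpha> | osc_window \<alpha> = n. if \<alpha> = (\<lambda>_. 0) then of_real (herm_vec \<alpha> x) else 0)"
   unfolding window_fun_def by (intro sum.cong) (auto simp: v_def hv_orthonormal)
  also have "\<dots> = of_real (herm_vec (\<lambda>_. 0) x)"
   using finite_osc_window[where 'n='n, of n] by (simp add: n_def)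
  finally show ?thesis using pos by simp
 qed
 have "AE x in lebesgue. h m x = 0" for m
 proof -
  obtain C :: real where C: "\<And>\<gamma>. factorization_norm \<delta> g = ennreal \<gamma> \<Longrightarrow> 0 \<le> \<gamma> \<Longrightarrow>
   ky_fan_bound (\<lambda>u. mul (window_fun n v) (rotate_l2 \<i> (mul (h m) u))) (C * \<gamma> * (norm (block osc_window n v) * sqrt (2 ^ n)))"
   using window_ky_fan_norm[OF \<delta>, where 'n='n] bh hg by blast
  have "ky_fan_bound (\<lambda>u. mul (window_fun n v) (rotate_l2 \<i> (mul (h m) u))) 0" using C[of 0] G by simp
  moreover have "linear (\<lambda>u. mul (window_fun n v) (rotate_l2 \<i> (mul (h m) u)))"
   by (intro bounded_linear.linear bounded_linear_compose[OF bounded_linear_mul[OF window_fun(1)]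
    bounded_linear_compose[OF bounded_linear_rotate bounded_linear_mul[OF bh]]]) simp
  ultimately have "norm (mul (window_fun n v) (rotate_l2 \<i> (mul (h m) v))) \<le> 0 * norm v" by (rule ky_fan_bound_norm)
  then have z: "mul (window_fun n v) (rotate_l2 \<i> (mul (h m) v)) = 0" by simp
  from rep_mul[OF window_fun(1)[of n v], of "rotate_l2 \<i> (mul (h m) v)", unfolded z] rep_zero
  have "AE x in lebesgue. rep (rotate_l2 \<i> (mul (h m) v)) x = rep 0 x" by eventually_elim (use wf in auto)
  then have "rotate_l2 \<i> (mul (h m) v) = 0" by (rule l2_eqI)
  then have z: "mul (h m) v = 0" using norm_rotate[of \<i> "mul (h m) v"] by simp
  from rep_mul[OF bh[of m], of v, unfolded z] rep_zero rep_cls[OF herm_vec_L2[of "\<lambda>_::'n. 0"]]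
  show ?thesis unfolding v_def hv_def by eventually_elim (use pos in auto)
 qed
 then have "AE x in lebesgue. \<forall>m. h m x = 0" by (simp add: AE_all_countable)
 then show ?thesis
 proof eventually_elim
  case (elim x)
  obtain m :: nat where "\<bar>g x\<bar> \<le> real m" by (rule real_arch_simple[THEN exE])
  then show ?case using elim[rule_format, of m] by (simp add: h_def)
 qed
qed

theorem theorem1p8:
  fixes \<delta> \<epsilon> :: real
  assumes "\<delta> > 0" and "\<epsilon> > 0"
  shows "\<exists>C::real. C > 0 \<and>
    (\<forall>(f :: real ^ 'n::finite \<Rightarrow> complex) (g :: real ^ 'n \<Rightarrow> real).
       f \<in> borel_measurable lebesgue \<longrightarrow> g \<in> borel_measurable lebesgue \<longrightarrow>
       oscillator_log_norm \<epsilon> f * factorization_norm \<delta> g < top \<longrightarrow>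
       (\<exists>A. compact_operator A \<and> extends_densely_defined A (product_op f g) \<and>
          weak_schatten2_norm A \<le>
            ennreal C * (oscillator_log_norm \<epsilon> f * factorization_norm \<delta> g)))"
proof -
 obtain C where C: "0 \<le> C" "\<And>n (v :: 'n l2) (g :: real ^ 'n \<Rightarrow> real) \<gamma> (k :: 'n fn). factorization_norm \<delta> g = ennreal \<gamma> \<Longrightarrow> 0 \<le> \<gamma> \<Longrightarrow>
  bounded_measurable k \<Longrightarrow> (\<And>x. cmod (k x) \<le> \<bar>g x\<bar>) \<Longrightarrow>
  ky_fan_bound (\<lambda>u. mul (window_fun n v) (rotate_l2 \<i> (mul k u))) (C * \<gamma> * (norm (block osc_window n v) * sqrt (2 ^ n)))"
  using window_ky_fan_norm[OF assms(1), where 'n='n] by blast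
 obtain D where D: "0 \<le> D" "\<And>v w :: 'n l2. (\<And>\<alpha>. cin (hv \<alpha>) w = of_real (log_weight \<epsilon> (osc_eigenvalue \<alpha>)) * cin (hv \<alpha>) v) \<Longrightarrow>
  summable (\<lambda>n. norm (block osc_window n v) * sqrt (2 ^ n)) \<and>
  (\<Sum>n. norm (block osc_window n v) * sqrt (2 ^ n)) \<le> D * norm w"
  using window_sum[OF assms(2), where 'n='n] by blast
 show ?thesis
 \<comment> \<open>The summand 1 makes the constant positive, as C and D may be 0.\<close>
 proof (intro exI[of _ "C * D + 1"] conjI allI impI)
  show "0 < C * D + 1" using C(1) D(1) by (simp add: add_nonneg_pos)
  fix f :: "'n fn" and g :: "real ^ 'n \<Rightarrow> real"
  assume g: "g \<in> borel_measurable lebesgue" and fin: "oscillator_log_norm \<epsilon> f * factorization_norm \<delta> g < top"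
  define B where "B = ennreal (C * D + 1) * (oscillator_log_norm \<epsilon> f * factorization_norm \<delta> g)"
  \<comment> \<open>In \<open>ennreal\<close>, 0 times infinity is 0, so the right-hand side can be
    finite with one infinite factor. In these cases f or g vanishes almost everywhere, and the
    extension is the zero operator.\<close>
  have zero: "\<exists>A. compact_operator A \<and> extends_densely_defined A (product_op f g) \<and> weak_schatten2_norm A \<le> B"
   if "(AE x in lebesgue. f x = 0) \<or> (AE x in lebesgue. g x = 0)"
  proof -
   have "\<exists>A. compact_operator A \<and> extends_densely_defined A (product_op f g) \<and> weak_schatten2_norm A \<le> ennreal 0"
   proof (rule product_op_extension[OF bounded_linear_zero cs_zero[symmetric] ky_fan_bound_zero g])
    fix u w :: "'n l2"
    assume w: "AE x in lebesgue. rep w x = of_real (g x) * rep (rotate_l2 (- \<i>) u) x"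
    from that show "AE x in lebesgue. rep 0 x = f x * rep (rotate_l2 \<i> w) x"
    proof
     assume "AE x in lebesgue. f x = 0"
     then show ?thesis using rep_zero by eventually_elim simp
    next
     assume "AE x in lebesgue. g x = 0"
     with w rep_zero have "AE x in lebesgue. rep w x = rep 0 x" by eventually_elim simp
     then have "w = 0" by (rule l2_eqI)
     then have "rotate_l2 \<i> w = 0" using norm_rotate[of \<i> w] by simp
     with rep_zero show ?thesis by (auto elim: eventually_mono)
    qed
   qed
   then show ?thesis by (auto intro: order_trans)
  qed
  have "\<exists>A. compact_operator A \<and> extends_densely_defined A (product_op f g) \<and> weak_schatten2_norm A \<le> B"
  proof (cases "oscillator_log_norm \<epsilon> f < top")
   case False
   then have "factorization_norm \<delta> g = 0" using fin by (auto simp: less_top[symmetric] ennreal_mult_eq_top_iff)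
   then show ?thesis by (intro zero disjI2 factorization_norm_zero[OF assms(1) g])
  next
   case True
   then obtain w where f: "f \<in> L2" and N: "oscillator_log_norm \<epsilon> f = ennreal (norm w)"
    and w: "\<And>\<alpha>. cin (hv \<alpha>) w = of_real (log_weight \<epsilon> (osc_eigenvalue \<alpha>)) * cin (hv \<alpha>) (cls f)"
    by (rule oscillator_log_norm_finite) (rule that)
   show ?thesis
   proof (cases "factorization_norm \<delta> g")
    case top
    then have "w = 0" using fin by (auto simp: N less_top[symmetric] ennreal_mult_eq_top_iff)
    \<comment> \<open>The weight is positive at every eigenvalue, so the coefficients of f vanish
      together with those of w.\<close>
    have "cls f = 0"
    proof (rule hv_eqI)
     fix \<alpha> :: "'n \<Rightarrow> nat"
     show "cin (hv \<alpha>) (cls f) = cin (hv \<alpha>) 0"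
      using w[of \<alpha>] log_weight_window(2)[OF assms(2), of \<alpha>] by (simp add: \<open>w = 0\<close>)
    qed
    with rep_cls[OF f] rep_zero have "AE x in lebesgue. f x = 0" by (auto elim: eventually_elim2)
    then show ?thesis by (intro zero disjI1)
   next
    case (real \<gamma>)
    define k where "k n = C * \<gamma> * (norm (block osc_window n (cls f)) * sqrt (2 ^ n))" for n
    note sums = D(2)[OF w]
    have k: "0 \<le> k n" "summable k" for n using C(1) real(1) sums by (auto simp: k_def[abs_def])
    have "suminf k = C * \<gamma> * (\<Sum>n. norm (block osc_window n (cls f)) * sqrt (2 ^ n))"
     unfolding k_def using sums by (intro suminf_mult) simp
    also have "\<dots> \<le> C * \<gamma> * (D * norm w)" using sums C(1) real(1) by (intro mult_left_mono) auto
    also have "\<dots> \<le> (C * D + 1) * (norm w * \<gamma>)" using real(1) by (simp add: algebra_simps)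
    finally have "ennreal (suminf k) \<le> ennreal ((C * D + 1) * (norm w * \<gamma>))" by (rule ennreal_leI)
    also have "\<dots> = B" using C(1) D(1) real by (simp add: B_def N ennreal_mult)
    finally have kB: "ennreal (suminf k) \<le> B" .
    obtain T where T: "bounded_linear T" "\<And>c u. T (cs c u) = cs c (T u)" "ky_fan_bound T (suminf k)"
     "\<And>u w. AE x in lebesgue. rep w x = of_real (g x) * rep (rotate_l2 (- \<i>) u) x \<Longrightarrow>
      AE x in lebesgue. rep (T u) x = rep (cls f) x * rep (rotate_l2 \<i> w) x"
    proof (rule window_limit_operator[OF g _ k(1,2)])
     show "ky_fan_bound (\<lambda>u. mul (window_fun n (cls f)) (rotate_l2 \<i> (mul h u))) (k n)"
      if "bounded_measurable h" "\<And>x. cmod (h x) \<le> \<bar>g x\<bar>" for n h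
      unfolding k_def by (rule C(2)[OF real(2,1) that])
    qed (rule that)
    have "\<exists>A. compact_operator A \<and> extends_densely_defined A (product_op f g) \<and> weak_schatten2_norm A \<le> ennreal (suminf k)"
    proof (rule product_op_extension[OF T(1,2,3) g])
     fix u w :: "'n l2"
     assume "AE x in lebesgue. rep w x = of_real (g x) * rep (rotate_l2 (- \<i>) u) x"
     from T(4)[OF this] rep_cls[OF f] show "AE x in lebesgue. rep (T u) x = f x * rep (rotate_l2 \<i> w) x"
      by eventually_elim simp
    qed
    then show ?thesis using kB by (auto intro: order_trans)
   qed
  qed
  then show "\<exists>A. compact_operator A \<and> extends_densely_defined A (product_op f g) \<and>
   weak_schatten2_norm A \<le> ennreal (C * D + 1) * (oscillator_log_norm \<epsilon> f * factorization_norm \<delta> g)"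
   unfolding B_def .
 qed
qed

end
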